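(* Let $A$ be a brace algebra, $M$ a left brace $A$-module and $N$ a right brace $A$-module. Then the derived tensor product (derived intersection) $N\otimes^{\mathbb{L}}_A M$, given by the two-sided bar complex, carries a natural dg algebra structure such that the projection $N^{\mathrm{op}}\otimes M\to N\otimes^{\mathbb{L}}_A M$ is a morphism of dg algebras, where $N^{\mathrm{op}}$ denotes the algebra $N$ with the opposite multiplication.
   Context: Conventions: $k$ is a field of characteristic zero, cohomological grading, dga = differential graded associative $k$-algebra. **Brace algebras.** A brace algebra is a dga $A$ with operations $A\otimes A^{\otimes n}\to A[-n]$, $n>0$, written $x\{y_1,\dots,y_n\}$ (with $x\{\}=x$), such that: (associativity) $x\{y_1,\dots,y_n\}\{z_1,\dots,z_m\}=\sum(-1)^\epsilon x\{z_1,\dots,z_{i_1},y_1\{z_{i_1+1},\dots\},\dots,y_n\{z_{i_n+1},\dots\},\dots,z_m\}$, sum over positions of the $y_i$ and lengths of their braces, $\epsilon=\sum_{p=1}^n(|y_p|+1)\sum_{q=1}^{i_p}(|z_q|+1)$; (higher homotopies) $\mathrm d(x\{y_1,\dots,y_n\})=(\mathrm dx)\{y_1,\dots,y_n\}+\sum_i(-1)^{|x|+\sum_{q<i}|y_q|+i}x\{y_1,\dots,\mathrm dy_i,\dots,y_n\}+\sum_{i<n}(-1)^{|x|+\sum_{q\le i}|y_q|+i+1}x\{y_1,\dots,y_iy_{i+1},\dots,y_n\}-(-1)^{(|y_1|+1)|x|}y_1\cdot x\{y_2,\dots,y_n\}-(-1)^{|x|+\sum_{q=1}^{n-1}|y_q|+n}x\{y_1,\dots,y_{n-1}\}\cdot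 y_n$; (distributivity) $(x_1x_2)\{y_1,\dots,y_n\}=\sum_{k=0}^n(-1)^{|x_2|(\sum_{q=1}^k|y_q|+k)}x_1\{y_1,\dots,y_k\}\,x_2\{y_{k+1},\dots,y_n\}$. The opposite brace algebra $A^{\mathrm{op}}$ has product $a\cdot^{\mathrm{op}}b=(-1)^{|a||b|}ba$ and braces $x\{y_1,\dots,y_n\}^{\mathrm{op}}=(-1)^{\sum_{i<j}(|y_i|+1)(|y_j|+1)+n}x\{y_n,\dots,y_1\}$. **Brace modules.** A left brace $A$-module is a dga $M$ with a dga homomorphism $A\to M$ (written $x\mapsto x\cdot1$; $A$ acts on $M$ by multiplication through it) and operations $M\otimes A^{\otimes n}\to M[-n]$, written $m\{x_1,\dots,x_n\}$ (with $m\{\}=m$), such that for all $m,m'\in M$ and $x,x_i,y_i\in A$: (compatibility) $(x\cdot1)\{y_1,\dots,y_n\}=x\{y_1,\dots,y_n\}\cdot1$; (associativity) $m\{x_1,\dots,x_n\}\{y_1,\dots,y_r\}=\sum(-1)^\epsilon m\{y_1,\dots,y_{i_1},x_1\{y_{i_1+1},\dots\},\dots,x_n\{y_{i_n+1},\dots\},\dots,y_r\}$, $\epsilon=\sum_{p=1}^n(|x_p|+1)\sum_{q=1}^{i_p}(|y_q|+1)$; (higher homotopies) $\mathrm d(m\{x_1,\dots,x_n\})=(\mathrm dm)\{x_1,\dots,x_n\}+\sum_i(-1)^{|m|+\sum_{q<i}|x_q|+i}m\{x_1,\dots,\mathrm dx_i,\dots,x_n\}+\sum_{i<n}(-1)^{|m|+\sum_{q\le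 i}|x_q|+i+1}m\{x_1,\dots,x_ix_{i+1},\dots,x_n\}-(-1)^{(|x_1|+1)|m|}x_1\cdot m\{x_2,\dots,x_n\}-(-1)^{|m|+\sum_{q=1}^{n-1}|x_q|+n}m\{x_1,\dots,x_{n-1}\}\cdot x_n$; (distributivity) $(mm')\{x_1,\dots,x_n\}=\sum_{k=0}^n(-1)^{|m'|(\sum_{q=1}^k|x_q|+k)}m\{x_1,\dots,x_k\}\,m'\{x_{k+1},\dots,x_n\}$. A right brace $A$-module is a left brace $A^{\mathrm{op}}$-module. If $L$ is a left brace $A$-module, then $L^{\mathrm{op}}$ (opposite multiplication, brace operations mirror reversed) is naturally a right brace $A$-module. **Two-sided bar complex.** $\mathrm T_\bullet(A[1])=\bigoplus_{k\ge0}A^{\otimes k}[k]$, with elements $[a_1|\dots|a_k]$ and deconcatenation coproduct $\Delta$. $N\otimes^{\mathbb L}_AM$ is $N\otimes\mathrm T_\bullet(A[1])\otimes M$ with the usual two-sided bar differential (internal differentials plus multiplication of adjacent entries, with the usual signs), where $N$ is a right dg $A$-module through $A^{\mathrm{op}}\to N$ and $M$ a left dg $A$-module through $A\to M$. The projection sends $x\otimes m$ to $[x|m]$, the part with no $A$-entries. **The natural structure.** $\mathrm T_\bullet(A[1])$, with the bar differential and $\Delta$, is a dg bialgebra for the product $[x_1|\dots|x_n]\cdot[y_1|\dots|y_m]=\sum(-1)^\epsilon[y_1|\dots|y_{i_1}|x_1\{y_{i_1+1},\dots,y_{i_1+l_1}\}|\dots|x_n\{y_{i_n+1},\dots,y_{i_n+l_n}\}|\dots|y_m]$,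 $\epsilon=\sum_p(|x_p|+1)\sum_{q\le i_p}(|y_q|+1)$. The one-sided bar complex $\tilde M=\mathrm T_\bullet(A[1])\otimes M$ is a dga, compatibly with the left $\mathrm T_\bullet(A[1])$-coaction, with subalgebras $\mathrm T_\bullet(A[1])$ and $M$ and $[m]\cdot[x_1|\dots|x_n|1]=\sum_{i=0}^n(-1)^{|m|(\sum_{q\le i}|x_q|+i)}[x_1|\dots|x_i|m\{x_{i+1},\dots,x_n\}]$. The one-sided bar complex $\tilde N=N\otimes\mathrm T_\bullet(A[1])$ is likewise a dga compatible with the right coaction, by the same construction applied with $A$ replaced by $A^{\mathrm{op}}$. The map $\mathrm{id}_N\otimes\Delta\otimes\mathrm{id}_M$ identifies $N\otimes^{\mathbb L}_AM$ with the cotensor product of $\tilde N$ and $\tilde M$ over $\mathrm T_\bullet(A[1])$ (the equalizer of the two coaction maps $\tilde N\otimes\tilde M\rightrightarrows\tilde N\otimes\mathrm T_\bullet(A[1])\otimes\tilde M$), which is a sub-dga of $\tilde N\otimes\tilde M$; this gives the dga structure.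
   Formalization: A right brace A-module N is taken to mean that N^op (not N) is a left brace A^op-module; with N itself a left brace A^op-module, the natural product makes the projection multiplicative on N⊗M, not N^op⊗M (e.g. A=M=k, N=2x2 matrices, zero braces). *)

theory Defs
  imports Complex_Main "HOL-Library.Function_Algebras" "HOL-Library.Product_Plus"
begin

section \<open>Dg vector spaces and dg algebras\<close>

text \<open>
  A graded vector space is a family of linearly independent subspaces \<open>gr V i\<close> of an ambient
  \<open>'k\<close>-vector space \<open>(+, scal V)\<close>. Only homogeneous elements matter: all operations
  are specified, and all axioms are imposed, on the pieces \<open>gr V i\<close>. The values of the
  operations elsewhere in the ambient type carry no meaning.
\<close>

record ('k, 'v) dgv =
  scal :: "'k \<Rightarrow> 'v \<Rightarrow> 'v"
  gr :: "int \<Rightarrow> 'v set"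
  diff :: "'v \<Rightarrow> 'v"

record ('k, 'v) dga = "('k, 'v) dgv" +
  mul :: "'v \<Rightarrow> 'v \<Rightarrow> 'v"
  unt :: "'v"

definition ksign :: "int \<Rightarrow> 'k::field" where
  "ksign n = (if even n then 1 else - 1)"

definition homog :: "('k, 'v, 'r) dgv_scheme \<Rightarrow> 'v set" where
  "homog V = (\<Union>i. gr V i)"

text \<open>The zero vector lies in every piece; its degree is irrelevant and set to \<open>0\<close>.\<close>

definition deg :: "('k, 'v::zero, 'r) dgv_scheme \<Rightarrow> 'v \<Rightarrow> int" where
  "deg V x = (if x = 0 then 0 else (THE i. x \<in> gr V i))"

definition lin_on :: "('k \<Rightarrow> 'v::plus \<Rightarrow> 'v) \<Rightarrow> ('k \<Rightarrow> 'w::plus \<Rightarrow> 'w) \<Rightarrow> 'v set \<Rightarrow> ('v \<Rightarrow> 'w) \<Rightarrow> bool"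
  where
  "lin_on s t S f \<longleftrightarrow>
     (\<forall>x\<in>S. \<forall>y\<in>S. f (x + y) = f x + f y) \<and> (\<forall>c. \<forall>x\<in>S. f (s c x) = t c (f x))"

definition graded_map ::
  "('k, 'v::plus, 'r) dgv_scheme \<Rightarrow> ('k, 'w::plus, 's) dgv_scheme \<Rightarrow> int \<Rightarrow> ('v \<Rightarrow> 'w) \<Rightarrow> bool" where
  "graded_map V W n f \<longleftrightarrow>
     (\<forall>i. f ` gr V i \<subseteq> gr W (i + n) \<and> lin_on (scal V) (scal W) (gr V i) f)"

definition dg_space :: "('k::field, 'v::ab_group_add, 'r) dgv_scheme \<Rightarrow> bool" where
  "dg_space V \<longleftrightarrow>
     vector_space (scal V) \<and>
     (\<forall>i. module.subspace (scal V) (gr V i)) \<and>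
     (\<forall>I x. finite I \<longrightarrow> (\<forall>i\<in>I. x i \<in> gr V i) \<longrightarrow> (\<Sum>i\<in>I. x i) = 0 \<longrightarrow> (\<forall>i\<in>I. x i = 0)) \<and>
     graded_map V V 1 (diff V) \<and>
     (\<forall>x\<in>homog V. diff V (diff V x) = 0)"

definition dga :: "('k::field, 'v::ab_group_add, 'r) dga_scheme \<Rightarrow> bool" where
  "dga A \<longleftrightarrow>
     dg_space A \<and>
     (\<forall>j. \<forall>y\<in>gr A j. graded_map A A j (\<lambda>x. mul A x y)) \<and>
     (\<forall>i. \<forall>x\<in>gr A i. graded_map A A i (mul A x)) \<and>
     (\<forall>x\<in>homog A. \<forall>y\<in>homog A. \<forall>z\<in>homog A. mul A (mul A x y) z = mul A x (mul A y z)) \<and>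
     unt A \<in> gr A 0 \<and>
     (\<forall>x\<in>homog A. mul A (unt A) x = x \<and> mul A x (unt A) = x) \<and>
     (\<forall>x\<in>homog A. \<forall>y\<in>homog A.
        diff A (mul A x y) = mul A (diff A x) y + scal A (ksign (deg A x)) (mul A x (diff A y)))"

definition dga_hom ::
  "('k::field, 'v::ab_group_add, 'r) dga_scheme \<Rightarrow> ('k, 'w::ab_group_add, 's) dga_scheme \<Rightarrow>
   ('v \<Rightarrow> 'w) \<Rightarrow> bool" where
  "dga_hom A B f \<longleftrightarrow>
     dga A \<and> dga B \<and>
     graded_map A B 0 f \<and>
     (\<forall>x\<in>homog A. f (diff A x) = diff B (f x)) \<and>
     (\<forall>x\<in>homog A. \<forall>y\<in>homog A. f (mul A x y) = mul B (f x) (f y)) \<and>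
     f (unt A) = unt B"

definition op_mul :: "('k::field, 'v::ab_group_add, 'r) dga_scheme \<Rightarrow> 'v \<Rightarrow> 'v \<Rightarrow> 'v" where
  "op_mul A x y = scal A (ksign (deg A x * deg A y)) (mul A y x)"

definition dga_op :: "('k::field, 'v::ab_group_add, 'r) dga_scheme \<Rightarrow> ('k, 'v, 'r) dga_scheme" where
  "dga_op A = A\<lparr>mul := op_mul A\<rparr>"


section \<open>Brace algebras and brace modules\<close>

record ('k, 'a) brace_alg = "('k, 'a) dga" +
  brc :: "'a \<Rightarrow> 'a list \<Rightarrow> 'a"

record ('k, 'a, 'm) brace_mod = "('k, 'm) dga" +
  act :: "'a \<Rightarrow> 'm"
  mbr :: "'m \<Rightarrow> 'a list \<Rightarrow> 'm"

definition dsum :: "('k, 'v::zero, 'r) dgv_scheme \<Rightarrow> 'v list \<Rightarrow> int" where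
  "dsum A xs = (\<Sum>x\<leftarrow>xs. deg A x)"

text \<open>
  Total degree of a word in \<open>A[1]\<close>. Modulo 2 this is the sum of the \<open>|x| + 1\<close>, and it is used
  for the Koszul signs as well.
\<close>

definition bdeg :: "('k, 'v::zero, 'r) dgv_scheme \<Rightarrow> 'v list \<Rightarrow> int" where
  "bdeg A xs = (\<Sum>x\<leftarrow>xs. deg A x - 1)"

text \<open>
  Positions for the associativity sum: \<open>ks ! p = (i, l)\<close> says that exactly \<open>i\<close> of the \<open>m\<close> inner
  arguments precede the \<open>p\<close>-th outer argument, and that the next \<open>l\<close> of them are put into its brace.
\<close>

definition insertions :: "nat \<Rightarrow> nat \<Rightarrow> (nat \<times> nat) list set" where
  "insertions n m = {ks. length ks = n \<and>
     (\<forall>p<n. fst (ks ! p) + snd (ks ! p) \<le> (if Suc p < n then fst (ks ! Suc p) else m))}"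

text \<open>
  \<open>weave br 0 xs ks ys\<close> is
  \<open>y\<^sub>1, \<dots>, y\<^bsub>i\<^sub>1\<^esub>, x\<^sub>1{y\<^bsub>i\<^sub>1+1\<^esub>, \<dots>, y\<^bsub>i\<^sub>1+l\<^sub>1\<^esub>}, \<dots>, x\<^sub>n{\<dots>}, \<dots>, y\<^sub>m\<close>; the number argument counts the \<open>ys\<close> already used.
\<close>

fun weave :: "('a \<Rightarrow> 'a list \<Rightarrow> 'a) \<Rightarrow> nat \<Rightarrow> 'a list \<Rightarrow> (nat \<times> nat) list \<Rightarrow> 'a list \<Rightarrow> 'a list" where
  "weave br s (x # xs) ((i, l) # ks) ys =
     take (i - s) (drop s ys) @ br x (take l (drop i ys)) # weave br (i + l) xs ks ys"
| "weave br s _ _ ys = drop s ys"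

definition weave_exp ::
  "('k, 'a::zero, 'r) dgv_scheme \<Rightarrow> 'a list \<Rightarrow> (nat \<times> nat) list \<Rightarrow> 'a list \<Rightarrow> int" where
  "weave_exp A xs ks ys =
     (\<Sum>p<length xs. (deg A (xs ! p) + 1) * (\<Sum>q<fst (ks ! p). deg A (ys ! q) + 1))"

text \<open>
  The axioms on the operations \<open>br m [x\<^sub>1, \<dots>, x\<^sub>n] = m{x\<^sub>1, \<dots>, x\<^sub>n}\<close> for a dga \<open>M\<close> and a map
  \<open>h : A \<rightarrow> M\<close>. Those of a brace algebra are the case \<open>M = A\<close>, \<open>h = id\<close>, \<open>br = brc A\<close>. Lists are
  indexed from \<open>0\<close>, so the summation index \<open>i\<close> here is the usual one minus \<open>1\<close>.
\<close>

definition brace_multilinear ::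
  "('k::field, 'a::ab_group_add, 'r) brace_alg_scheme \<Rightarrow> ('k, 'm::ab_group_add, 's) dga_scheme \<Rightarrow>
   ('m \<Rightarrow> 'a list \<Rightarrow> 'm) \<Rightarrow> bool" where
  "brace_multilinear A M br \<longleftrightarrow>
     (\<forall>m\<in>homog M. \<forall>xs\<in>lists (homog A). br m xs \<in> gr M (deg M m + bdeg A xs)) \<and>
     (\<forall>i. \<forall>xs\<in>lists (homog A). lin_on (scal M) (scal M) (gr M i) (\<lambda>m. br m xs)) \<and>
     (\<forall>m\<in>homog M. \<forall>xs\<in>lists (homog A). \<forall>ys\<in>lists (homog A). \<forall>i.
        lin_on (scal A) (scal M) (gr A i) (\<lambda>x. br m (xs @ x # ys)))"

definition brace_associative ::
  "('k::field, 'a::ab_group_add, 'r) brace_alg_scheme \<Rightarrow> ('k, 'm::ab_group_add, 's) dga_scheme \<Rightarrow>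
   ('m \<Rightarrow> 'a list \<Rightarrow> 'm) \<Rightarrow> bool" where
  "brace_associative A M br \<longleftrightarrow>
     (\<forall>m\<in>homog M. \<forall>xs\<in>lists (homog A). \<forall>ys\<in>lists (homog A).
        br (br m xs) ys =
          (\<Sum>ks\<in>insertions (length xs) (length ys).
             scal M (ksign (weave_exp A xs ks ys)) (br m (weave (brc A) 0 xs ks ys))))"

definition brace_homotopies ::
  "('k::field, 'a::ab_group_add, 'r) brace_alg_scheme \<Rightarrow> ('k, 'm::ab_group_add, 's) dga_scheme \<Rightarrow>
   ('a \<Rightarrow> 'm) \<Rightarrow> ('m \<Rightarrow> 'a list \<Rightarrow> 'm) \<Rightarrow> bool" where
  "brace_homotopies A M h br \<longleftrightarrow>
     (\<forall>m\<in>homog M. \<forall>xs\<in>lists (homog A). xs \<noteq> [] \<longrightarrow>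
        diff M (br m xs) =
          br (diff M m) xs
          + (\<Sum>i<length xs. scal M (ksign (deg M m + dsum A (take i xs) + int (i + 1)))
               (br m (xs[i := diff A (xs ! i)])))
          + (\<Sum>i<length xs - 1. scal M (ksign (deg M m + dsum A (take (i + 1) xs) + int (i + 1) + 1))
               (br m (take i xs @ mul A (xs ! i) (xs ! (i + 1)) # drop (i + 2) xs)))
          - scal M (ksign ((deg A (hd xs) + 1) * deg M m)) (mul M (h (hd xs)) (br m (tl xs)))
          - scal M (ksign (deg M m + dsum A (butlast xs) + int (length xs)))
               (mul M (br m (butlast xs)) (h (last xs))))"

definition brace_distributive ::
  "('k::field, 'a::ab_group_add, 'r) brace_alg_scheme \<Rightarrow> ('k, 'm::ab_group_add, 's) dga_scheme \<Rightarrow>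
   ('m \<Rightarrow> 'a list \<Rightarrow> 'm) \<Rightarrow> bool" where
  "brace_distributive A M br \<longleftrightarrow>
     (\<forall>m\<in>homog M. \<forall>m'\<in>homog M. \<forall>xs\<in>lists (homog A).
        br (mul M m m') xs =
          (\<Sum>k\<le>length xs. scal M (ksign (deg M m' * (dsum A (take k xs) + int k)))
             (mul M (br m (take k xs)) (br m' (drop k xs)))))"

definition brace_action ::
  "('k::field, 'a::ab_group_add, 'r) brace_alg_scheme \<Rightarrow> ('k, 'm::ab_group_add, 's) dga_scheme \<Rightarrow>
   ('a \<Rightarrow> 'm) \<Rightarrow> ('m \<Rightarrow> 'a list \<Rightarrow> 'm) \<Rightarrow> bool" where
  "brace_action A M h br \<longleftrightarrow>
     (\<forall>m\<in>homog M. br m [] = m) \<and>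
     brace_multilinear A M br \<and>
     brace_associative A M br \<and>
     brace_homotopies A M h br \<and>
     brace_distributive A M br"

definition brace_algebra :: "('k::field, 'a::ab_group_add, 'r) brace_alg_scheme \<Rightarrow> bool" where
  "brace_algebra A \<longleftrightarrow> dga A \<and> brace_action A A id (brc A)"

definition left_brace_module ::
  "('k::field, 'a::ab_group_add, 'r) brace_alg_scheme \<Rightarrow> ('k, 'a, 'm::ab_group_add, 's) brace_mod_scheme \<Rightarrow>
   bool" where
  "left_brace_module A M \<longleftrightarrow>
     dga_hom A M (act M) \<and>
     (\<forall>x\<in>homog A. \<forall>ys\<in>lists (homog A). mbr M (act M x) ys = act M (brc A x ys)) \<and>
     brace_action A M (act M) (mbr M)"

definition rev_exp :: "('k, 'a::zero, 'r) dgv_scheme \<Rightarrow> 'a list \<Rightarrow> int" where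
  "rev_exp A xs =
     (\<Sum>j<length xs. \<Sum>i<j. (deg A (xs ! i) + 1) * (deg A (xs ! j) + 1)) + int (length xs)"

definition brace_op ::
  "('k::field, 'a::ab_group_add, 'r) brace_alg_scheme \<Rightarrow> ('k, 'a, 'r) brace_alg_scheme" where
  "brace_op A =
     A\<lparr>mul := op_mul A, brc := \<lambda>x ys. scal A (ksign (rev_exp A ys)) (brc A x (rev ys))\<rparr>"

text \<open>
  A right brace \<open>A\<close>-module is a left brace \<open>A\<^sup>o\<^sup>p\<close>-module. Convention: the multiplication of \<open>N\<close> is
  the one for which \<open>act N : A \<rightarrow> N\<close> is multiplicative and the right action of \<open>A\<close> is right
  multiplication, so the dga carrying the left \<open>A\<^sup>o\<^sup>p\<close>-structure \<open>A\<^sup>o\<^sup>p \<rightarrow> N\<^sup>o\<^sup>p\<close> is \<open>N\<^sup>o\<^sup>p\<close>. If one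
  calls that dga \<open>N\<close> instead, \<open>N\<close> and \<open>N\<^sup>o\<^sup>p\<close> have to be exchanged throughout. \<open>mbr N\<close> holds the
  \<open>A\<^sup>o\<^sup>p\<close>-braces.
\<close>

definition right_brace_module ::
  "('k::field, 'a::ab_group_add, 'r) brace_alg_scheme \<Rightarrow> ('k, 'a, 'n::ab_group_add, 's) brace_mod_scheme \<Rightarrow>
   bool" where
  "right_brace_module A N \<longleftrightarrow> left_brace_module (brace_op A) (dga_op N)"


section \<open>Tensor products\<close>

text \<open>
  \<open>lin_ext s t S\<close> is the linear map taking the values \<open>S\<close> prescribed on generators: its graph is the
  subspace spanned by \<open>S\<close>. It is meaningful on the span of the first components, provided that the
  values respect all linear relations. \<open>bilin_ext\<close> is the analogue for bilinear maps and triples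
  \<open>(x, y, z)\<close> with \<open>z\<close> the value at \<open>(x, y)\<close>.
\<close>

definition lin_ext ::
  "('k::field \<Rightarrow> 'u \<Rightarrow> 'u) \<Rightarrow> ('k \<Rightarrow> 'v \<Rightarrow> 'v) \<Rightarrow> ('u::ab_group_add \<times> 'v::ab_group_add) set \<Rightarrow> 'u \<Rightarrow> 'v" where
  "lin_ext s t S u = (THE v. (u, v) \<in> module.span (\<lambda>c (x, y). (s c x, t c y)) S)"

definition bilin_ext ::
  "('k::field \<Rightarrow> 'u \<Rightarrow> 'u) \<Rightarrow> ('k \<Rightarrow> 'v \<Rightarrow> 'v) \<Rightarrow> ('k \<Rightarrow> 'w \<Rightarrow> 'w) \<Rightarrow>
   ('u::ab_group_add \<times> 'v::ab_group_add \<times> 'w::ab_group_add) set \<Rightarrow> 'u \<Rightarrow> 'v \<Rightarrow> 'w" where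
  "bilin_ext s t r S u v =
     lin_ext s r {(x, lin_ext t r {(y, z). (x, y, z) \<in> S} v) | x. x \<in> fst ` S} u"

definition fscal :: "'k::field \<Rightarrow> ('x \<Rightarrow> 'k) \<Rightarrow> ('x \<Rightarrow> 'k)" where
  "fscal c f = (\<lambda>x. c * f x)"

text \<open>
  \<open>V \<otimes> W\<close> is realised inside the dual of the space of bilinear forms on \<open>V \<times> W\<close>, as the span of the
  evaluations \<open>v \<otimes> w = (b \<mapsto> b(v, w))\<close>. The tensor algebra is obtained in the same way from
  forms on words that are multilinear on the words of each length.
\<close>

type_synonym ('v, 'w, 'k) tensor = "('v \<Rightarrow> 'w \<Rightarrow> 'k) \<Rightarrow> 'k"
type_synonym ('a, 'k) words = "('a list \<Rightarrow> 'k) \<Rightarrow> 'k"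

definition bilinear_form ::
  "('k::field \<Rightarrow> 'v::ab_group_add \<Rightarrow> 'v) \<Rightarrow> ('k \<Rightarrow> 'w::ab_group_add \<Rightarrow> 'w) \<Rightarrow> ('v \<Rightarrow> 'w \<Rightarrow> 'k) \<Rightarrow> bool" where
  "bilinear_form s t b \<longleftrightarrow>
     (\<forall>w. Vector_Spaces.linear s (*) (\<lambda>v. b v w)) \<and> (\<forall>v. Vector_Spaces.linear t (*) (\<lambda>w. b v w))"

definition tns ::
  "('k::field, 'v::ab_group_add, 'r) dgv_scheme \<Rightarrow> ('k, 'w::ab_group_add, 's) dgv_scheme \<Rightarrow>
   'v \<Rightarrow> 'w \<Rightarrow> ('v, 'w, 'k) tensor" where
  "tns V W v w = (\<lambda>b. if bilinear_form (scal V) (scal W) b then b v w else 0)"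

definition multilinear_form ::
  "('k::field \<Rightarrow> 'a::ab_group_add \<Rightarrow> 'a) \<Rightarrow> ('a list \<Rightarrow> 'k) \<Rightarrow> bool" where
  "multilinear_form s b \<longleftrightarrow> (\<forall>xs ys. Vector_Spaces.linear s (*) (\<lambda>x. b (xs @ x # ys)))"

definition word :: "('k::field, 'a::ab_group_add, 'r) dgv_scheme \<Rightarrow> 'a list \<Rightarrow> ('a, 'k) words" where
  "word A xs = (\<lambda>b. if multilinear_form (scal A) b then b xs else 0)"

definition tensor_cplx ::
  "('k::field, 'v::ab_group_add, 'r) dgv_scheme \<Rightarrow> ('k, 'w::ab_group_add, 's) dgv_scheme \<Rightarrow>
   ('k, ('v, 'w, 'k) tensor) dgv" where
  "tensor_cplx V W =
     \<lparr>scal = fscal,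
      gr = (\<lambda>n. module.span fscal {tns V W v w | v w i j. v \<in> gr V i \<and> w \<in> gr W j \<and> i + j = n}),
      diff = lin_ext fscal fscal
        {(tns V W v w, tns V W (diff V v) w + fscal (ksign (deg V v)) (tns V W v (diff W w))) | v w.
           v \<in> homog V \<and> w \<in> homog W}\<rparr>"

definition tensor_dga ::
  "('k::field, 'v::ab_group_add, 'r) dga_scheme \<Rightarrow> ('k, 'w::ab_group_add, 's) dga_scheme \<Rightarrow>
   ('k, ('v, 'w, 'k) tensor) dga" where
  "tensor_dga A B = dgv.extend (tensor_cplx A B) (dga.fields
     (bilin_ext fscal fscal fscal
        {(tns A B a b, tns A B a' b',
          fscal (ksign (deg B b * deg A a')) (tns A B (mul A a a') (mul B b b'))) | a b a' b'.
           a \<in> homog A \<and> b \<in> homog B \<and> a' \<in> homog A \<and> b' \<in> homog B})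
     (tns A B (unt A) (unt B)))"


section \<open>Bar complexes\<close>

definition bar_diff_word ::
  "('k::field, 'a::ab_group_add, 'r) dga_scheme \<Rightarrow> 'a list \<Rightarrow> ('a, 'k) words" where
  "bar_diff_word A xs =
     (\<Sum>i<length xs. fscal (ksign (dsum A (take i xs) + int (i + 1)))
        (word A (xs[i := diff A (xs ! i)])))
     + (\<Sum>i<length xs - 1. fscal (ksign (dsum A (take (i + 1) xs) + int (i + 1) + 1))
        (word A (take i xs @ mul A (xs ! i) (xs ! (i + 1)) # drop (i + 2) xs)))"

definition bar_dga ::
  "('k::field, 'a::ab_group_add, 'r) brace_alg_scheme \<Rightarrow> ('k, ('a, 'k) words) dga" where
  "bar_dga A =
     \<lparr>scal = fscal,
      gr = (\<lambda>n. module.span fscal {word A xs | xs. xs \<in> lists (homog A) \<and> bdeg A xs = n}),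
      diff = lin_ext fscal fscal {(word A xs, bar_diff_word A xs) | xs. xs \<in> lists (homog A)},
      mul = bilin_ext fscal fscal fscal
        {(word A xs, word A ys,
          \<Sum>ks\<in>insertions (length xs) (length ys).
            fscal (ksign (weave_exp A xs ks ys)) (word A (weave (brc A) 0 xs ks ys))) | xs ys.
           xs \<in> lists (homog A) \<and> ys \<in> lists (homog A)},
      unt = word A []\<rparr>"

text \<open>
  The one-sided bar complex \<open>T(A[1]) \<otimes> M\<close>. The product is the one determined by the subalgebras
  \<open>T(A[1])\<close> and \<open>M\<close>, by \<open>[x\<^sub>1|\<dots>|x\<^sub>n|m] = [x\<^sub>1|\<dots>|x\<^sub>n|1] \<cdot> [m]\<close>, and by the formula for \<open>[m] \<cdot> [y\<^sub>1|\<dots>|y\<^sub>r|1]\<close>.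
\<close>

definition left_bar_dga ::
  "('k::field, 'a::ab_group_add, 'r) brace_alg_scheme \<Rightarrow> ('k, 'a, 'm::ab_group_add, 's) brace_mod_scheme \<Rightarrow>
   ('k, (('a, 'k) words, 'm, 'k) tensor) dga" where
  "left_bar_dga A M =
     \<lparr>scal = fscal,
      gr = gr (tensor_cplx (bar_dga A) M),
      diff = lin_ext fscal fscal
        {(tns (bar_dga A) M (word A xs) m,
          tns (bar_dga A) M (bar_diff_word A xs) m
          + fscal (ksign (bdeg A xs)) (tns (bar_dga A) M (word A xs) (diff M m))
          + (if xs = [] then 0 else fscal (ksign (bdeg A (butlast xs)))
               (tns (bar_dga A) M (word A (butlast xs)) (mul M (act M (last xs)) m)))) | xs m.
           xs \<in> lists (homog A) \<and> m \<in> homog M},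
      mul = bilin_ext fscal fscal fscal
        {(tns (bar_dga A) M (word A xs) m, tns (bar_dga A) M (word A ys) m',
          \<Sum>i\<le>length ys. fscal (ksign (deg M m * (dsum A (take i ys) + int i)))
            (tns (bar_dga A) M (mul (bar_dga A) (word A xs) (word A (take i ys)))
               (mul M (mbr M m (drop i ys)) m'))) | xs m ys m'.
           xs \<in> lists (homog A) \<and> m \<in> homog M \<and> ys \<in> lists (homog A) \<and> m' \<in> homog M},
      unt = tns (bar_dga A) M (word A []) (unt M)\<rparr>"

text \<open>
  The one-sided bar complex \<open>N \<otimes> T(A[1])\<close> is \<open>T(A\<^sup>o\<^sup>p[1]) \<otimes> N\<^sup>o\<^sup>p\<close>, read backwards. The signs of the
  identification are the Koszul signs of the reversal together with \<open>(-1)\<^sup>n\<close> on words of length \<open>n\<close>;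
  \<open>(-1)\<^sup>n\<close> matches the one in the braces of \<open>A\<^sup>o\<^sup>p\<close> and makes word reversal an algebra isomorphism
  \<open>T(A\<^sup>o\<^sup>p[1]) \<rightarrow> T(A[1])\<close>.
\<close>

definition flip_graph ::
  "('k::field, 'a::ab_group_add, 'r) brace_alg_scheme \<Rightarrow> ('k, 'a, 'n::ab_group_add, 's) brace_mod_scheme \<Rightarrow>
   ((('a, 'k) words, 'n, 'k) tensor \<times> ('n, ('a, 'k) words, 'k) tensor) set" where
  "flip_graph A N =
     {(tns (bar_dga (brace_op A)) (dga_op N) (word (brace_op A) xs) n,
       fscal (ksign (deg N n * bdeg A xs + rev_exp A xs)) (tns N (bar_dga A) n (word A (rev xs)))) | xs n.
        xs \<in> lists (homog A) \<and> n \<in> homog N}"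

definition right_bar_dga ::
  "('k::field, 'a::ab_group_add, 'r) brace_alg_scheme \<Rightarrow> ('k, 'a, 'n::ab_group_add, 's) brace_mod_scheme \<Rightarrow>
   ('k, ('n, ('a, 'k) words, 'k) tensor) dga" where
  "right_bar_dga A N =
     (let L = left_bar_dga (brace_op A) (dga_op N);
          F = lin_ext fscal fscal (flip_graph A N);
          G = lin_ext fscal fscal ((flip_graph A N)\<inverse>)
      in \<lparr>scal = fscal,
          gr = gr (tensor_cplx N (bar_dga A)),
          diff = (\<lambda>u. F (diff L (G u))),
          mul = (\<lambda>u v. F (mul L (G u) (G v))),
          unt = F (unt L)\<rparr>)"

text \<open>\<open>bar_elem A N M n xs m\<close> is the element \<open>[n|x\<^sub>1|\<dots>|x\<^sub>k|m]\<close> of \<open>N \<otimes> T(A[1]) \<otimes> M\<close>.\<close>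

type_synonym ('n, 'a, 'm, 'k) bar = "('n, (('a, 'k) words, 'm, 'k) tensor, 'k) tensor"

definition bar_elem ::
  "('k::field, 'a::ab_group_add, 'r) brace_alg_scheme \<Rightarrow> ('k, 'a, 'n::ab_group_add, 's) brace_mod_scheme \<Rightarrow>
   ('k, 'a, 'm::ab_group_add, 't) brace_mod_scheme \<Rightarrow> 'n \<Rightarrow> ('a, 'k) words \<Rightarrow> 'm \<Rightarrow> ('n, 'a, 'm, 'k) bar" where
  "bar_elem A N M n w m = tns N (tensor_cplx (bar_dga A) M) n (tns (bar_dga A) M w m)"

text \<open>The right action \<open>n \<cdot> x\<close> is \<open>mul N n (act N x)\<close>, that is \<open>(-1)\<^bsup>|n||x|\<^esup> x \<cdot> n\<close> for the
  left \<open>A\<^sup>o\<^sup>p\<close>-action on \<open>N\<^sup>o\<^sup>p\<close>.\<close>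

definition bar_cplx ::
  "('k::field, 'a::ab_group_add, 'r) brace_alg_scheme \<Rightarrow> ('k, 'a, 'n::ab_group_add, 's) brace_mod_scheme \<Rightarrow>
   ('k, 'a, 'm::ab_group_add, 't) brace_mod_scheme \<Rightarrow> ('k, ('n, 'a, 'm, 'k) bar) dgv" where
  "bar_cplx A N M =
     \<lparr>scal = fscal,
      gr = gr (tensor_cplx N (tensor_cplx (bar_dga A) M)),
      diff = lin_ext fscal fscal
        {(bar_elem A N M n (word A xs) m,
          bar_elem A N M (diff N n) (word A xs) m
          + fscal (ksign (deg N n)) (bar_elem A N M n (bar_diff_word A xs) m)
          + fscal (ksign (deg N n + bdeg A xs)) (bar_elem A N M n (word A xs) (diff M m))
          + (if xs = [] then 0 else
               fscal (ksign (deg N n + 1))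
                 (bar_elem A N M (mul N n (act N (hd xs))) (word A (tl xs)) m)
               + fscal (ksign (deg N n + bdeg A (butlast xs)))
                 (bar_elem A N M n (word A (butlast xs)) (mul M (act M (last xs)) m)))) | n xs m.
           n \<in> homog N \<and> xs \<in> lists (homog A) \<and> m \<in> homog M}\<rparr>"

text \<open>\<open>id\<^sub>N \<otimes> \<Delta> \<otimes> id\<^sub>M\<close>, with values in the tensor product of the two one-sided bar complexes.\<close>

definition bar_split ::
  "('k::field, 'a::ab_group_add, 'r) brace_alg_scheme \<Rightarrow> ('k, 'a, 'n::ab_group_add, 's) brace_mod_scheme \<Rightarrow>
   ('k, 'a, 'm::ab_group_add, 't) brace_mod_scheme \<Rightarrow> ('n, 'a, 'm, 'k) bar \<Rightarrow>
   (('n, ('a, 'k) words, 'k) tensor, (('a, 'k) words, 'm, 'k) tensor, 'k) tensor" where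
  "bar_split A N M = lin_ext fscal fscal
     {(bar_elem A N M n (word A xs) m,
       \<Sum>i\<le>length xs. tns (right_bar_dga A N) (left_bar_dga A M)
         (tns N (bar_dga A) n (word A (take i xs))) (tns (bar_dga A) M (word A (drop i xs)) m)) | n xs m.
        n \<in> homog N \<and> xs \<in> lists (homog A) \<and> m \<in> homog M}"

text \<open>The maps induced by the right coaction on \<open>N \<otimes> T(A[1])\<close> and the left coaction on
  \<open>T(A[1]) \<otimes> M\<close>; the cotensor product is their equalizer.\<close>

definition right_coact ::
  "('k::field, 'a::ab_group_add, 'r) brace_alg_scheme \<Rightarrow> ('k, 'a, 'n::ab_group_add, 's) brace_mod_scheme \<Rightarrow>
   ('k, 'a, 'm::ab_group_add, 't) brace_mod_scheme \<Rightarrow>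
   (('n, ('a, 'k) words, 'k) tensor, (('a, 'k) words, 'm, 'k) tensor, 'k) tensor \<Rightarrow>
   (('n, ('a, 'k) words, 'k) tensor,
    (('a, 'k) words, (('a, 'k) words, 'm, 'k) tensor, 'k) tensor, 'k) tensor" where
  "right_coact A N M =
     (let R = right_bar_dga A N; T = bar_dga A; L = left_bar_dga A M
      in lin_ext fscal fscal
        {(tns R L (tns N T n (word A xs)) v,
          \<Sum>i\<le>length xs. tns R (tensor_cplx T L)
            (tns N T n (word A (take i xs))) (tns T L (word A (drop i xs)) v)) | n xs v.
           n \<in> homog N \<and> xs \<in> lists (homog A) \<and> v \<in> homog L})"

definition left_coact ::
  "('k::field, 'a::ab_group_add, 'r) brace_alg_scheme \<Rightarrow> ('k, 'a, 'n::ab_group_add, 's) brace_mod_scheme \<Rightarrow>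
   ('k, 'a, 'm::ab_group_add, 't) brace_mod_scheme \<Rightarrow>
   (('n, ('a, 'k) words, 'k) tensor, (('a, 'k) words, 'm, 'k) tensor, 'k) tensor \<Rightarrow>
   (('n, ('a, 'k) words, 'k) tensor,
    (('a, 'k) words, (('a, 'k) words, 'm, 'k) tensor, 'k) tensor, 'k) tensor" where
  "left_coact A N M =
     (let R = right_bar_dga A N; T = bar_dga A; L = left_bar_dga A M
      in lin_ext fscal fscal
        {(tns R L u (tns T M (word A xs) m),
          \<Sum>i\<le>length xs. tns R (tensor_cplx T L)
            u (tns T L (word A (take i xs)) (tns T M (word A (drop i xs)) m))) | u xs m.
           u \<in> homog R \<and> xs \<in> lists (homog A) \<and> m \<in> homog M})"

definition cotensor ::
  "('k::field, 'a::ab_group_add, 'r) brace_alg_scheme \<Rightarrow> ('k, 'a, 'n::ab_group_add, 's) brace_mod_scheme \<Rightarrow>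
   ('k, 'a, 'm::ab_group_add, 't) brace_mod_scheme \<Rightarrow> int \<Rightarrow>
   (('n, ('a, 'k) words, 'k) tensor, (('a, 'k) words, 'm, 'k) tensor, 'k) tensor set" where
  "cotensor A N M i =
     {u \<in> gr (tensor_dga (right_bar_dga A N) (left_bar_dga A M)) i.
        right_coact A N M u = left_coact A N M u}"

text \<open>The two-sided bar complex with the product pulled back along \<open>bar_split\<close>.\<close>

definition bar_tensor ::
  "('k::field, 'a::ab_group_add, 'r) brace_alg_scheme \<Rightarrow> ('k, 'a, 'n::ab_group_add, 's) brace_mod_scheme \<Rightarrow>
   ('k, 'a, 'm::ab_group_add, 't) brace_mod_scheme \<Rightarrow> ('k, ('n, 'a, 'm, 'k) bar) dga" where
  "bar_tensor A N M = dgv.extend (bar_cplx A N M) (dga.fields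
     (\<lambda>u v. the_inv_into (homog (bar_cplx A N M)) (bar_split A N M)
        (mul (tensor_dga (right_bar_dga A N) (left_bar_dga A M)) (bar_split A N M u) (bar_split A N M v)))
     (bar_elem A N M (unt N) (word A []) (unt M)))"

definition bar_proj ::
  "('k::field, 'a::ab_group_add, 'r) brace_alg_scheme \<Rightarrow> ('k, 'a, 'n::ab_group_add, 's) brace_mod_scheme \<Rightarrow>
   ('k, 'a, 'm::ab_group_add, 't) brace_mod_scheme \<Rightarrow> ('n, 'm, 'k) tensor \<Rightarrow> ('n, 'a, 'm, 'k) bar" where
  "bar_proj A N M = lin_ext fscal fscal
     {(tns N M n m, bar_elem A N M n (word A []) m) | n m. n \<in> homog N \<and> m \<in> homog M}"

end

theory Submission imports Defs begin

text \<open>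
 The two-sided bar complex embeds by \<open>bar_split\<close>, the deconcatenation of its words, into the tensor
 product of the one-sided complexes \<open>R = N \<otimes> T(A[1])\<close> and \<open>L = T(A[1]) \<otimes> M\<close>. Once \<open>R\<close> and \<open>L\<close>
 are dg algebras, so is \<open>R \<otimes> L\<close>, and the theorem says that the image of the embedding is the
 equalizer of the two coactions and closed under the product. The axioms of a dg algebra then hold
 on the bar complex because they hold after the injective map (\<open>dga_reflect\<close>).

 The image is the equalizer because words can be forgotten: the map \<open>\<kappa>\<close> that keeps the terms of
 \<open>R \<otimes> L\<close> whose left word is empty is a retraction of the splitting, and the same map on
 \<open>R \<otimes> T(A[1]) \<otimes> L\<close> turns the right coaction into the identity and the left coaction into
 splitting after \<open>\<kappa>\<close> (\<open>split_cotensor\<close>). The image is closed under products because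
 deconcatenation is multiplicative: cutting both factors and multiplying the pieces is the same as
 multiplying the words and cutting the result (\<open>weave_sum_cut\<close>, \<open>cut_product\<close>). On elements
 without \<open>A\<close>-entries that product is the one of the opposite algebra of \<open>N\<close> tensored with \<open>M\<close>.

 That \<open>L\<close> is a dg algebra contains the brace axioms: its product is associative because braces of
 braces are sums over insertions (\<open>ws_assoc\<close>, \<open>lbar_mul_assoc\<close>), and the differential is a
 derivation because of the higher homotopies and distributivity (\<open>ws_diff_sum\<close>, \<open>lbar_leibniz\<close>).
 \<open>R\<close> is the complex \<open>L\<close> of the opposite structures read backwards, so one needs that reversal
 of words carries the product and the differential of \<open>A\<close> to those of its opposite
 (\<open>ws_op\<close>, \<open>diff_sum_op\<close>), which also yields that the opposite is a brace algebra.

 Two devices keep this manageable. A letter is a pair of a degree and an element of that degree, so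
 that signs are computed from data and the degree of \<open>0\<close> never matters; a function linear in each
 letter takes the same value for every label of \<open>0\<close>. And a linear combination of words is
 represented by the values \<open>weave_sum b X Y \<phi>\<close>, \<open>diff_sum A X \<phi>\<close>, \<dots> which a function \<open>\<phi>\<close> of
 words takes on it. An identity of such sums for all multilinear \<open>\<phi>\<close> needs no tensor product, and it
 specialises to tensors of any shape because multilinear functions extend to them
 (\<open>extends_word\<close>, \<open>extends_tns\<close>).
\<close>

section \<open>Prescribing linear maps on generators\<close>

abbreviation "lin \<equiv> Vector_Spaces.linear"
abbreviation "flin \<equiv> Vector_Spaces.linear fscal fscal"

definition extends ::
 "('k::field => 'u::ab_group_add => 'u) => ('k => 'z::ab_group_add => 'z) => 'g set =>
  ('g => 'u) => ('g => 'z) => bool" where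
 "extends s t G e \<phi> \<longleftrightarrow> (\<exists>F. lin s t F \<and> (\<forall>g\<in>G. F (e g) = \<phi> g))"

lemma vector_space_field: "vector_space ((*) :: 'k::field => 'k => 'k)"
 by unfold_locales (auto simp: algebra_simps)

lemma vector_space_fscal: "vector_space (fscal :: 'k::field => ('x => 'k) => _)"
 by unfold_locales (auto simp: algebra_simps fscal_def fun_eq_iff)

lemma linear_imp_vs:
 assumes "lin s t F"
 shows "vector_space s" "vector_space t"
 using assms unfolding Vector_Spaces.linear_iff by auto

lemmas linear_plus = Vector_Spaces.linear_iff[THEN iffD1, THEN conjunct2, THEN conjunct2, THEN conjunct1, rule_format]
lemmas linear_scal = Vector_Spaces.linear_iff[THEN iffD1, THEN conjunct2, THEN conjunct2, THEN conjunct2, rule_format]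

lemma linear_eval: "lin fscal (*) (%u. u b)"
 unfolding Vector_Spaces.linear_iff
 by (auto simp: vector_space_fscal vector_space_field fscal_def)

lemma functional_separates:
 assumes "vector_space t" "z \<noteq> 0"
 obtains l where "lin t (*) l" "l z \<noteq> 0"
proof -
 interpret vector_space_pair t "(*)" using assms vector_space_field by (simp add: vector_space_pair_def)
 have "vs1.independent {z}" using assms by simp
 then obtain l where "lin t (*) l" "\<forall>x\<in>{z}. l x = 1"
  using linear_independent_extend[of "{z}" "%_. 1"] by blast
 then show ?thesis using that by force
qed

lemma linear_agree:
 assumes "lin s t F" "lin s t F'"
  and "!!g. g \<in> G ==> F (e g) = F' (e g)" "u \<in> module.span s (e ` G)"
 shows "F u = F' u"
proof -
 interpret vector_space_pair s t using linear_imp_vs[OF assms(1)] by (simp add: vector_space_pair_def)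
 show ?thesis by (rule linear_eq_on[OF assms(1,2,4)]) (use assms(3) in auto)
qed

lemma basis_from_generators:
 assumes "vector_space s"
 obtains B where "B \<subseteq> e ` G" "\<not> module.dependent s B" "e ` G \<subseteq> module.span s B"
proof -
 interpret vector_space s by fact
 show ?thesis using maximal_independent_subset[of "e ` G"] that by blast
qed

text \<open>
 Values prescribed on generators extend linearly as soon as linear functionals cannot tell the
 difference. This reduces statements about tensors to evaluation at suitable forms.
\<close>

lemma extends_by_functionals:
 assumes s: "vector_space s" and t: "vector_space t"
  and sep: "!!l. lin t (*) l ==>
   \<exists>m. lin s (*) m \<and> (\<forall>g\<in>G. m (e g) = l (\<phi> g))"
 shows "extends s t G e \<phi>"
proof -
 interpret vector_space_pair s t using s t by (simp add: vector_space_pair_def)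
 obtain B where B: "B \<subseteq> e ` G" "vs1.independent B" "e ` G \<subseteq> vs1.span B"
  using basis_from_generators[OF s] by blast
 define r where "r b = (SOME g. g \<in> G \<and> e g = b)" for b
 have r: "r b \<in> G \<and> e (r b) = b" if "b \<in> B" for b
  unfolding r_def by (rule someI_ex) (use that B in auto)
 obtain F where F: "lin s t F" "\<forall>b\<in>B. F b = \<phi> (r b)"
  using linear_independent_extend[OF B(2), of "%b. \<phi> (r b)"] by blast
 have "F (e g) = \<phi> g" if g: "g \<in> G" for g
 proof (rule ccontr)
  assume "F (e g) \<noteq> \<phi> g"
  then have "F (e g) - \<phi> g \<noteq> 0" by simp
  then obtain l where l: "lin t (*) l" "l (F (e g) - \<phi> g) \<noteq> 0"
   using functional_separates[OF t] by blast
  obtain m where m: "lin s (*) m" "\<forall>g\<in>G. m (e g) = l (\<phi> g)" using sep[OF l(1)] by blast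
  have lF: "lin s (*) (%u. l (F u))"
   using l(1) F(1) unfolding Vector_Spaces.linear_iff by auto
  have "m (e g) = l (F (e g))"
  proof (rule linear_agree[OF m(1) lF, where G = B and e = "%x. x"])
   show "m b = l (F b)" if "b \<in> B" for b
    using r[OF that] m(2) F(2) that by metis
   show "e g \<in> vs1.span ((%x. x) ` B)" using B(3) g by auto
  qed
  then have "l (F (e g)) - l (\<phi> g) = 0" using m(2) g by simp
  moreover have "l (F (e g) - \<phi> g) = l (F (e g)) - l (\<phi> g)"
  proof -
   interpret L: vector_space_pair t "(*)" using t vector_space_field by (simp add: vector_space_pair_def)
   show ?thesis by (rule L.linear_diff[OF l(1)])
  qed
  ultimately show False using l(2) by simp
 qed
 with F(1) show ?thesis unfolding extends_def by blast
qed

lemma extends_bilinear: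
 assumes s: "vector_space s" and s': "vector_space s'" and t: "vector_space t"
  and 1: "!!h. h \<in> H ==> extends s t G e (%g. \<phi> g h)"
  and 2: "!!g. g \<in> G ==> extends s' t H e' (\<phi> g)"
 obtains \<Phi> where "!!v. lin s' t (\<Phi> v)" "!!w. lin s t (%v. \<Phi> v w)"
  "!!g h. g \<in> G ==> h \<in> H ==> \<Phi> (e g) (e' h) = \<phi> g h"
proof -
 interpret V: vector_space_pair s t using s t by (simp add: vector_space_pair_def)
 interpret W: vector_space_pair s' t using s' t by (simp add: vector_space_pair_def)
 obtain B where B: "B \<subseteq> e ` G" "V.vs1.independent B" "e ` G \<subseteq> V.vs1.span B"
  using basis_from_generators[OF s] by blast
 obtain C where C: "C \<subseteq> e' ` H" "W.vs1.independent C" "e' ` H \<subseteq> W.vs1.span C"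
  using basis_from_generators[OF s'] by blast
 define r where "r b = (SOME g. g \<in> G \<and> e g = b)" for b
 have r: "r b \<in> G \<and> e (r b) = b" if "b \<in> B" for b
  unfolding r_def by (rule someI_ex) (use that B in auto)
 define q where "q c = (SOME h. h \<in> H \<and> e' h = c)" for c
 have q: "q c \<in> H \<and> e' (q c) = c" if "c \<in> C" for c
  unfolding q_def by (rule someI_ex) (use that C in auto)
 define \<Phi> where "\<Phi> v w = V.construct B (%b. W.construct C (%c. \<phi> (r b) (q c)) w) v" for v w
 have lC: "lin s' t (W.construct C f)" for f by (rule W.linear_construct[OF C(2)])
 have lB: "lin s t (V.construct B f)" for f by (rule V.linear_construct[OF B(2)])
 have inner: "W.construct C (%c. \<phi> g (q c)) (e' h) = \<phi> g h" if g: "g \<in> G" and h: "h \<in> H" for g h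
 proof -
  obtain F where F: "lin s' t F" "\<forall>h\<in>H. F (e' h) = \<phi> g h"
   using 2[OF g] unfolding extends_def by blast
  have "W.construct C (%c. \<phi> g (q c)) (e' h) = F (e' h)"
  proof (rule linear_agree[OF lC F(1), where G = C and e = "%x. x"])
   show "W.construct C (%c. \<phi> g (q c)) c = F c" if "c \<in> C" for c
    using q[OF that] F(2) that by (metis W.construct_basis[OF C(2)])
   show "e' h \<in> W.vs1.span ((%x. x) ` C)" using C(3) h by auto
  qed
  then show ?thesis using F h by simp
 qed
 show ?thesis
 proof
  show "lin s' t (\<Phi> v)" for v
   unfolding \<Phi>_def Vector_Spaces.linear_iff
   by (simp add: s' t linear_plus[OF lC] linear_scal[OF lC] V.construct_add[OF B(2)] V.construct_scale[OF B(2)])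
  show "lin s t (%v. \<Phi> v w)" for w
   unfolding \<Phi>_def by (rule lB)
  show "\<Phi> (e g) (e' h) = \<phi> g h" if g: "g \<in> G" and h: "h \<in> H" for g h
  proof -
   obtain F where F: "lin s t F" "\<forall>g\<in>G. F (e g) = \<phi> g h"
    using 1[OF h] unfolding extends_def by blast
   have "\<Phi> (e g) (e' h) = F (e g)" unfolding \<Phi>_def
   proof (rule linear_agree[OF lB F(1), where G = B and e = "%x. x"])
    show "V.construct B (%b. W.construct C (%c. \<phi> (r b) (q c)) (e' h)) b = F b" if "b \<in> B" for b
     using r[OF that] F(2) that inner[of "r b" h] h by (metis V.construct_basis[OF B(2)])
    show "e g \<in> V.vs1.span ((%x. x) ` B)" using B(3) g by auto
   qed
   then show ?thesis using F g by simp
  qed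
 qed
qed

lemma extends_tns:
 assumes V: "vector_space (scal V)" and W: "vector_space (scal W)" and t: "vector_space t"
  and 1: "!!h. h \<in> H ==> extends (scal V) t G e (%g. \<phi> g h)"
  and 2: "!!g. g \<in> G ==> extends (scal W) t H e' (\<phi> g)"
 shows "extends fscal t (G \<times> H) (%(g, h). tns V W (e g) (e' h)) (%(g, h). \<phi> g h)"
proof -
 obtain \<Phi> where \<Phi>: "!!v. lin (scal W) t (\<Phi> v)"
  "!!w. lin (scal V) t (%v. \<Phi> v w)"
  "!!g h. g \<in> G ==> h \<in> H ==> \<Phi> (e g) (e' h) = \<phi> g h"
  using extends_bilinear[OF V W t 1 2] by blast
 show ?thesis
 proof (rule extends_by_functionals[OF vector_space_fscal t])
  fix l assume l: "lin t (*) l"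
  let ?b = "%v w. l (\<Phi> v w)"
  have "bilinear_form (scal V) (scal W) ?b"
   using \<Phi>(1,2) l unfolding bilinear_form_def Vector_Spaces.linear_iff by auto
  then show "\<exists>m. lin fscal (*) m \<and>
    (\<forall>g\<in>G \<times> H. m (case g of (g, h) => tns V W (e g) (e' h)) = l (case g of (g, h) => \<phi> g h))"
   by (intro exI[of _ "%u. u ?b"]) (auto simp: linear_eval tns_def \<Phi>(3))
 qed
qed

lemma span_graph:
 assumes F: "lin s t F" and S: "S = (%g. (e g, F (e g))) ` G"
 shows "(u, z) \<in> module.span (%c (x, y). (s c x, t c y)) S \<longleftrightarrow> u \<in> module.span s (e ` G) \<and> z = F u"
proof -
 let ?p = "%c (x, y). (s c x, t c y)"
 interpret s: vector_space s using linear_imp_vs(1)[OF F] .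
 interpret t: vector_space t using linear_imp_vs(2)[OF F] .
 interpret p: vector_space ?p
  by unfold_locales (auto simp: s.scale_right_distrib t.scale_right_distrib s.scale_left_distrib t.scale_left_distrib)
 interpret vector_space_pair s t by unfold_locales
 have "p.span S \<subseteq> {(u, z). u \<in> s.span (e ` G) \<and> z = F u}"
  by (rule p.span_minimal)
   (auto simp: S s.span_base p.subspace_def s.span_zero linear_0[OF F] s.span_add linear_plus[OF F]
    s.span_scale linear_scal[OF F] zero_prod_def)
 moreover have "(u, F u) \<in> p.span S" if "u \<in> s.span (e ` G)"
  using that
 proof (induction rule: s.span_induct_alt)
  case base then show ?case using p.span_zero by (simp add: linear_0[OF F] zero_prod_def)
 next
  case (step c x y)
  then have "(x, F x) \<in> p.span S" by (auto simp: S intro!: p.span_base)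
  from p.span_add[OF p.span_scale[OF this, of c] step.IH] show ?case
   by (simp add: linear_plus[OF F] linear_scal[OF F])
 qed
 ultimately show ?thesis by auto
qed

lemma lin_ext_linear:
 assumes F: "lin s t F" and S: "S = (%g. (e g, F (e g))) ` G"
  and u: "u \<in> module.span s (e ` G)"
 shows "lin_ext s t S u = F u"
 unfolding lin_ext_def span_graph[OF F S] using u by auto

lemma lin_ext_exists:
 assumes "extends s t G e \<phi>" and S: "S = (%g. (e g, \<phi> g)) ` G"
 obtains F where "lin s t F" "!!g. g \<in> G ==> F (e g) = \<phi> g"
  "!!u. u \<in> module.span s (e ` G) ==> lin_ext s t S u = F u"
proof -
 obtain F where F: "lin s t F" "\<forall>g\<in>G. F (e g) = \<phi> g" using assms unfolding extends_def by blast
 have SF: "S = (%g. (e g, F (e g))) ` G" using F(2) S by simp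
 show ?thesis by (rule that[OF F(1)]) (use F(2) lin_ext_linear[OF F(1) SF] in auto)
qed

lemma bilin_ext_exists:
 assumes s: "vector_space s" and s': "vector_space s'" and t: "vector_space t"
  and 1: "!!h. h \<in> H ==> extends s t G e (%g. \<phi> g h)"
  and 2: "!!g. g \<in> G ==> extends s' t H e' (\<phi> g)"
  and S: "S = (%(g, h). (e g, e' h, \<phi> g h)) ` (G \<times> H)" and H: "H \<noteq> {}"
 obtains \<Phi> where "!!v. lin s' t (\<Phi> v)" "!!w. lin s t (%v. \<Phi> v w)"
  "!!g h. g \<in> G ==> h \<in> H ==> \<Phi> (e g) (e' h) = \<phi> g h"
  "!!u v. u \<in> module.span s (e ` G) ==> v \<in> module.span s' (e' ` H) ==> bilin_ext s s' t S u v = \<Phi> u v"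
proof -
 obtain \<Phi> where \<Phi>: "!!v. lin s' t (\<Phi> v)"
  "!!w. lin s t (%v. \<Phi> v w)"
  "!!g h. g \<in> G ==> h \<in> H ==> \<Phi> (e g) (e' h) = \<phi> g h"
  using extends_bilinear[OF s s' t 1 2] by blast
 have ext: "bilin_ext s s' t S u v = \<Phi> u v"
  if u: "u \<in> module.span s (e ` G)" and v: "v \<in> module.span s' (e' ` H)" for u v
 proof -
  have inner: "lin_ext s' t {(y, z). (x, y, z) \<in> S} v = \<Phi> x v" if "x \<in> e ` G" for x
  proof (rule lin_ext_linear[OF \<Phi>(1) _ v])
   show "{(y, z). (x, y, z) \<in> S} = (%h. (e' h, \<Phi> x (e' h))) ` H"
    using that \<Phi>(3) unfolding S by (auto simp: image_iff \<Phi>(3)) (metis \<Phi>(3))?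
  qed
  have "fst ` S = e ` G" unfolding S using H by force
  then show ?thesis unfolding bilin_ext_def
   by (intro lin_ext_linear[OF \<Phi>(2) _ u]) (auto simp: inner)
 qed
 show ?thesis using that[of \<Phi>] \<Phi> ext by blast
qed

section \<open>Graded spaces and their letters\<close>

definition letters :: "('k, 'v, 'r) dgv_scheme => (int \<times> 'v) set" where
 "letters V = {(i, x). x \<in> gr V i}"

definition lin1 ::
 "('k, 'v::plus, 'r) dgv_scheme => ('k => 'z::plus => 'z) => (int \<times> 'v => 'z) => bool" where
 "lin1 V t g \<longleftrightarrow> (\<forall>i. lin_on (scal V) t (gr V i) (%x. g (i, x)))"

definition mlin ::
 "('k, 'v::plus, 'r) dgv_scheme => ('k => 'z::plus => 'z) => ((int \<times> 'v) list => 'z) => bool" where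
 "mlin V t \<phi> \<longleftrightarrow>
   (\<forall>X\<in>lists (letters V). \<forall>Y\<in>lists (letters V). lin1 V t (%x. \<phi> (X @ x # Y)))"

definition bd :: "(int \<times> 'v) list => int" where
 "bd X = (\<Sum>x\<leftarrow>X. fst x - 1)"

definition wd :: "('k::field, 'a::ab_group_add, 'r) dgv_scheme => (int \<times> 'a) list => ('a, 'k) words" where
 "wd A X = word A (map snd X)"

definition label :: "('k, 'v::zero, 'r) dgv_scheme => 'v => int \<times> 'v" where
 "label V x = (deg V x, x)"

definition graded :: "('k::field, 'v::ab_group_add, 'r) dgv_scheme => bool" where
 "graded V \<longleftrightarrow>
   vector_space (scal V) \<and>
   (\<forall>i. module.subspace (scal V) (gr V i)) \<and>
   (\<forall>I x. finite I \<longrightarrow> (\<forall>i\<in>I. x i \<in> gr V i) \<longrightarrow> (\<Sum>i\<in>I. x i) = 0 \<longrightarrow> (\<forall>i\<in>I. x i = 0))"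

definition gens ::
 "('k::field, 'v::ab_group_add, 'r) dgv_scheme => 'g set => ('g => 'v) => ('g => int) => bool" where
 "gens V G e dg \<longleftrightarrow> (\<forall>n. gr V n = module.span (scal V) {e g | g. g \<in> G \<and> dg g = n})"

lemma dg_space_graded: "dg_space V ==> graded V"
 unfolding dg_space_def graded_def by blast

lemma dg_space_iff:
 "dg_space V \<longleftrightarrow> graded V \<and> graded_map V V 1 (diff V) \<and> (\<forall>x\<in>homog V. diff V (diff V x) = 0)"
 unfolding dg_space_def graded_def by blast

lemma bd_simps [simp]: "bd [] = 0" "bd (x # X) = fst x - 1 + bd X" "bd (X @ Y) = bd X + bd Y"
 "bd (rev X) = bd X"
 by (auto simp: bd_def rev_map[symmetric])

lemma letters_iff [simp]: "(i, x) \<in> letters V \<longleftrightarrow> x \<in> gr V i"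
 by (simp add: letters_def)

lemma snd_letters: "x \<in> letters V ==> snd x \<in> gr V (fst x)"
 by (cases x) simp

lemma homogI: "x \<in> gr V i ==> x \<in> homog V"
 unfolding homog_def by blast

context
 fixes V :: "('k::field, 'v::ab_group_add, 'r) dgv_scheme"
 assumes V: "graded V"
begin

interpretation vector_space "scal V"
 using V unfolding graded_def by blast

lemma graded_vector_space: "vector_space (scal V)"
 using V unfolding graded_def by blast

lemma graded_subspace: "subspace (gr V i)"
 using V unfolding graded_def by blast

lemma graded_zero: "0 \<in> gr V i"
 using graded_subspace subspace_0 by blast

lemma graded_add: "x \<in> gr V i ==> y \<in> gr V i ==> x + y \<in> gr V i"
 using graded_subspace subspace_add by blast

lemma graded_scale: "x \<in> gr V i ==> scal V c x \<in> gr V i"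
 using graded_subspace subspace_scale by blast

lemma graded_independent:
 "finite I ==> (!!i. i \<in> I ==> x i \<in> gr V i) ==> (\<Sum>i\<in>I. x i) = 0 ==> i \<in> I ==> x i = 0"
 using V unfolding graded_def by blast

lemma graded_disjoint:
 assumes "x \<in> gr V i" "x \<in> gr V j" "i \<noteq> j"
 shows "x = 0"
proof -
 have "(if i = i then x else - x) = 0"
  by (rule graded_independent[of "{i, j}" "%k. if k = i then x else - x" i])
   (use assms graded_subspace subspace_neg in auto)
 then show ?thesis by simp
qed

lemma deg_eq:
 assumes "x \<in> gr V i" "x \<noteq> 0"
 shows "deg V x = i"
 using assms graded_disjoint unfolding deg_def by (auto intro!: the_equality)

lemma label_in_letters: "x \<in> homog V ==> label V x \<in> letters V"
 using deg_eq graded_zero by (cases "x = 0") (auto simp: homog_def label_def)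

lemma snd_label [simp]: "snd (label V x) = x"
 by (simp add: label_def)

lemma snd_letters_homog: "snd ` letters V = homog V"
 by (auto simp: letters_def homog_def image_iff)

lemma map_snd_lists: "map snd ` lists (letters V) = lists (homog V)"
 by (simp add: lists_image[symmetric] snd_letters_homog)

lemma labels_in_lists: "xs \<in> lists (homog V) ==> map (label V) xs \<in> lists (letters V)"
 by (induction xs) (auto simp: label_in_letters)

lemma map_snd_label [simp]: "map snd (map (label V) xs) = xs"
 by (simp add: comp_def map_idI)

lemma lin1_zero:
 assumes "lin1 V t g" "vector_space t"
 shows "g (i, 0) = 0"
proof -
 interpret t: vector_space t by fact
 have "g (i, 0 + 0) = g (i, 0) + g (i, 0)"
  using assms(1) graded_zero unfolding lin1_def lin_on_def by blast
 then show ?thesis by simp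
qed

text \<open>The zero vector lies in every degree, but a linear function does not see which one is chosen.\<close>

lemma lin1_label:
 assumes "lin1 V t g" "vector_space t" "x \<in> letters V"
 shows "g (label V (snd x)) = g x"
proof (cases "snd x = 0")
 case True
 then show ?thesis using lin1_zero[OF assms(1,2)] by (cases x) (simp add: label_def)
next
 case False
 then show ?thesis using deg_eq[of "snd x" "fst x"] assms(3) by (cases x) (simp add: label_def)
qed

lemma mlin_label:
 assumes "mlin V t \<phi>" "vector_space t" "X \<in> lists (letters V)"
 shows "\<phi> (map (label V \<circ> snd) X) = \<phi> X"
proof -
 have "\<phi> (Y @ map (label V \<circ> snd) X) = \<phi> (Y @ X)" if "Y \<in> lists (letters V)" for Y
  using assms(3) that
 proof (induction X arbitrary: Y rule: list.induct)
  case (Cons x X)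
  have l: "label V (snd x) \<in> letters V"
   using Cons.prems label_in_letters[OF homogI[OF snd_letters[of x]]] by simp
  have "\<phi> (Y @ label V (snd x) # map (label V \<circ> snd) X) = \<phi> ((Y @ [label V (snd x)]) @ X)"
   using Cons.IH[of "Y @ [label V (snd x)]"] Cons.prems l by (simp add: comp_def)
  also have "... = \<phi> (Y @ x # X)"
   using lin1_label[of t "%x. \<phi> (Y @ x # X)"] assms(1,2) Cons.prems unfolding mlin_def by simp
  finally show ?case by (simp add: comp_def)
 qed simp
 from this[of "[]"] show ?thesis by simp
qed

text \<open>
 Since the grading is direct, bases of the pieces unite to an independent set. Everything
 specified on homogeneous elements only can therefore be continued to the ambient space.
\<close>

lemma homogeneous_basis:
 obtains B where "independent B" "B \<subseteq> homog V" "!!i. gr V i \<subseteq> span (B \<inter> gr V i)"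
proof -
 have "\<exists>B. B \<subseteq> gr V i \<and> independent B \<and> gr V i \<subseteq> span B" for i
  by (rule maximal_independent_subset[of "gr V i"]) blast
 then obtain b where b: "!!i. b i \<subseteq> gr V i" "!!i. independent (b i)" "!!i. gr V i \<subseteq> span (b i)"
  by metis
 have nz: "x \<noteq> 0" if "x \<in> b i" for x i
  using b(2)[of i] that dependent_zero by blast
 have uniq: "i = j" if "x \<in> b i" "x \<in> b j" for x i j
  using graded_disjoint[of x i j] b(1) nz that by blast
 define B where "B = (\<Union>i. b i)"
 have "independent B"
  unfolding independent_explicit_finite_subsets
 proof (intro allI impI ballI)
  fix S u v assume S: "S \<subseteq> B" "finite S" "(\<Sum>v\<in>S. scal V (u v) v) = 0" and v: "v \<in> S"
  define d where "d x = (THE i. x \<in> b i)" for x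
  have d: "d x = i" if "x \<in> b i" for x i
   unfolding d_def using that uniq by blast
  have db: "x \<in> b (d x)" if "x \<in> S" for x
   using S(1) that d unfolding B_def by auto
  let ?y = "%i. \<Sum>v | v \<in> S \<and> d v = i. scal V (u v) v"
  have y0: "?y (d v) = 0"
  proof (rule graded_independent[of "d ` S" ?y])
   show "(\<Sum>v | v \<in> S \<and> d v = i. scal V (u v) v) \<in> gr V i" for i
    by (rule subspace_sum[OF graded_subspace]) (use subsetD[OF b(1) db] graded_scale in auto)
   show "(\<Sum>i\<in>d ` S. ?y i) = 0"
    using S(3) sum.image_gen[OF S(2), of "%v. scal V (u v) v" d] by simp
  qed (use S v in auto)
  have fin: "finite {w. w \<in> S \<and> d w = d v}" using S(2) by simp
  have "\<forall>w\<in>{w. w \<in> S \<and> d w = d v}. u w = 0"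
   using b(2)[of "d v", unfolded independent_explicit_finite_subsets, rule_format, OF _ fin y0] db
   by force
  then show "u v = 0" using v by simp
 qed
 moreover have "B \<subseteq> homog V" using b(1) unfolding B_def homog_def by blast
 moreover have "gr V i \<subseteq> span (B \<inter> gr V i)" for i
  using b(1,3)[of i] span_mono[of "b i" "B \<inter> gr V i"] unfolding B_def by blast
 ultimately show ?thesis using that by blast
qed

context
 fixes t :: "'k => 'z::ab_group_add => 'z" and B
 assumes t: "vector_space t"
  and B: "independent B" "B \<subseteq> homog V" "!!i. gr V i \<subseteq> span (B \<inter> gr V i)"
begin

interpretation P: vector_space_pair "scal V" t
 using t graded_vector_space by (simp add: vector_space_pair_def)

definition lext :: "(int \<times> 'v => 'z) => 'v => 'z" where
 "lext g = P.construct B (%b. g (label V b))"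

lemma linear_lext: "lin (scal V) t (lext g)"
 unfolding lext_def by (rule P.linear_construct[OF B(1)])

lemma lext_plus: "lext (%x. g x + g' x) v = lext g v + lext g' v"
 unfolding lext_def by (rule P.construct_add[OF B(1)])

lemma lext_scale: "lext (%x. t c (g x)) v = t c (lext g v)"
 unfolding lext_def by (rule P.construct_scale[OF B(1)])

lemma lext_cong: "(!!x. x \<in> letters V ==> g x = g' x) ==> lext g = lext g'"
 unfolding lext_def by (rule P.construct_cong) (use B(2) label_in_letters in blast)

lemma lext_letter:
 assumes g: "lin1 V t g" and x: "x \<in> letters V"
 shows "lext g (snd x) = g x"
proof -
 obtain i v where x': "x = (i, v)" "v \<in> gr V i" using x by (cases x) auto
 have "v \<in> gr V i \<and> lext g v = g (i, v)" if "v \<in> span (B \<inter> gr V i)" for v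
  using that
 proof (induction rule: span_induct_alt)
  case base
  then show ?case using graded_zero lin1_zero[OF g t] P.linear_0[OF linear_lext] by simp
 next
  case (step c u w)
  then have u: "u \<in> gr V i" "lext g u = g (i, u)"
   using P.construct_basis[OF B(1), of u "%b. g (label V b)"] lin1_label[OF g t, of "(i, u)"]
   by (auto simp: lext_def)
  then show ?case
   using step.IH g graded_scale[OF u(1)] unfolding lin1_def lin_on_def
   by (simp add: linear_plus[OF linear_lext] linear_scal[OF linear_lext] graded_add)
 qed
 then show ?thesis using x' B(3)[of i] by auto
qed

primrec wext :: "'v list => ((int \<times> 'v) list => 'z) => 'z" where
 "wext [] \<phi> = \<phi> []"
| "wext (x # xs) \<phi> = lext (%b. wext xs (%X. \<phi> (b # X))) x"

lemma linear_wext: "lin (scal V) t (%x. wext (xs @ x # ys) \<phi>)"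
proof (induction xs arbitrary: \<phi>)
 case Nil
 show ?case using linear_lext by simp
next
 case (Cons u us)
 note IH = linear_plus[OF Cons.IH] linear_scal[OF Cons.IH]
 show ?case
  unfolding Vector_Spaces.linear_iff
  by (simp add: graded_vector_space t IH lext_plus lext_scale)
qed

lemma wext_letters:
 assumes "mlin V t \<phi>" "X \<in> lists (letters V)"
 shows "wext (map snd X) \<phi> = \<phi> X"
 using assms
proof (induction X arbitrary: \<phi> rule: list.induct)
 case (Cons x X)
 have "wext (map snd X) (%Y. \<phi> (b # Y)) = \<phi> (b # X)" if "b \<in> letters V" for b
 proof (rule Cons.IH)
  have "lin1 V t (%x. \<phi> ((b # U) @ x # W))" if "U \<in> lists (letters V)" "W \<in> lists (letters V)" for U W
   using Cons.prems(1)[unfolded mlin_def, rule_format, of "b # U" W] \<open>b \<in> letters V\<close> that by simp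
  then show "mlin V t (%Y. \<phi> (b # Y))" by (simp add: mlin_def)
 qed (use Cons.prems in simp)
 then have "lext (%b. wext (map snd X) (%Y. \<phi> (b # Y))) (snd x) = lext (%b. \<phi> (b # X)) (snd x)"
  by (intro fun_cong[OF lext_cong])
 also have "... = \<phi> (x # X)"
 proof (rule lext_letter)
  have "lin1 V t (%b. \<phi> ([] @ b # X))" using Cons.prems(1)[unfolded mlin_def, rule_format, of "[]" X] Cons.prems(2) by simp
  then show "lin1 V t (%b. \<phi> (b # X))" by simp
 qed (use Cons.prems in simp)
 finally show ?case by simp
qed simp

end

lemma extends_letter:
 assumes t: "vector_space t" and g: "lin1 V t g"
 shows "extends (scal V) t (letters V) snd g"
proof -
 obtain B where B: "independent B" "B \<subseteq> homog V" "!!i. gr V i \<subseteq> span (B \<inter> gr V i)"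
  by (rule homogeneous_basis) (rule that)
 show ?thesis unfolding extends_def
  using linear_lext[OF t B] lext_letter[OF t B g] by blast
qed

lemma extends_word:
 assumes t: "vector_space t" and \<phi>: "mlin V t \<phi>"
 shows "extends fscal t (lists (letters V)) (wd V) \<phi>"
proof (rule extends_by_functionals[OF vector_space_fscal t])
 fix l assume l: "lin t (*) l"
 obtain B where B: "independent B" "B \<subseteq> homog V" "!!i. gr V i \<subseteq> span (B \<inter> gr V i)"
  by (rule homogeneous_basis) (rule that)
 let ?b = "%xs. wext (*) B xs (%X. l (\<phi> X))"
 have form: "multilinear_form (scal V) ?b"
  unfolding multilinear_form_def using linear_wext[OF vector_space_field B] by blast
 have "mlin V (*) (%X. l (\<phi> X))"
  using \<phi> unfolding mlin_def lin1_def lin_on_def by (simp add: linear_plus[OF l] linear_scal[OF l])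
 then have "?b (map snd X) = l (\<phi> X)" if "X \<in> lists (letters V)" for X
  using wext_letters[OF vector_space_field B] that by blast
 then show "\<exists>m. lin fscal (*) m \<and> (\<forall>X\<in>lists (letters V). m (wd V X) = l (\<phi> X))"
  by (intro exI[of _ "%u. u ?b"]) (simp add: linear_eval wd_def word_def form)
qed

lemma gens_letters: "gens V (letters V) snd fst"
proof -
 have "{snd g | g. g \<in> letters V \<and> fst g = n} = gr V n" for n
 proof (intro set_eqI iffI)
  fix x assume "x \<in> {snd g | g. g \<in> letters V \<and> fst g = n}"
  then show "x \<in> gr V n" using snd_letters by blast
 next
  fix x assume "x \<in> gr V n"
  then have "x = snd (n, x) \<and> (n, x) \<in> letters V \<and> fst (n, x) = n" by simp
  then show "x \<in> {snd g | g. g \<in> letters V \<and> fst g = n}" by blast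
 qed
 then show ?thesis unfolding gens_def by (simp add: span_eq_iff[THEN iffD2, OF graded_subspace])
qed

end

section \<open>Signs and multilinear functions of letters\<close>

definition sg :: "int => 'z::ab_group_add => 'z" where
 "sg n v = (if even n then v else - v)"

lemma sg_simps [simp]:
 "sg 0 v = v" "sg n 0 = 0" "sg m (sg n v) = sg (m + n) v"
 "sg n (u + v) = sg n u + sg n v" "sg n (- v) = - sg n v" "sg n (u - v) = sg n u - sg n v"
 by (auto simp: sg_def)

lemma sg_cong: "even m = even n ==> sg m v = sg n v"
 by (simp add: sg_def)

lemma sg_eq_0_iff [simp]: "sg n v = 0 \<longleftrightarrow> v = 0"
 by (simp add: sg_def)

lemma sg_sum: "sg n (\<Sum>i\<in>I. f i) = (\<Sum>i\<in>I. sg n (f i))"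
 by (simp add: sg_def sum_negf)

lemma ksign_sg: "vector_space s ==> s (ksign n) v = sg n v"
 unfolding vector_space_def ksign_def sg_def
 using module.scale_minus_left[of s 1 v] module_iff_vector_space[of s]
 by (auto simp: vector_space_def)

lemmas fscal_sg [simp] = ksign_sg[OF vector_space_fscal]

lemma linear_0: "lin s t F ==> F 0 = 0"
 using linear_plus[of s t F 0 0] by simp

lemma linear_sg: "lin s t F ==> F (sg n v) = sg n (F v)"
 using linear_plus[of s t F v "- v"] linear_0[of s t F] by (simp add: sg_def eq_neg_iff_add_eq_0 add.commute)

lemma linear_compose: "lin s t F ==> lin t r F' ==> lin s r (%x. F' (F x))"
 by (simp add: Vector_Spaces.linear_iff)

lemma scale_sg: "vector_space s ==> s c (sg n v) = sg n (s c v)"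
proof -
 assume "vector_space s"
 then interpret vector_space s .
 show ?thesis by (simp add: sg_def)
qed

lemma linear_add_sg:
 assumes "lin s t F" "lin s t F'"
 shows "lin s t (%x. F x + sg n (F' x))"
proof -
 interpret t: vector_space t by (rule linear_imp_vs[OF assms(1)])
 show ?thesis
  using assms linear_imp_vs[OF assms(1)] unfolding Vector_Spaces.linear_iff
  by (auto simp: algebra_simps t.scale_right_distrib scale_sg)
qed

lemma linear_maps_span:
 assumes F: "lin s t F" and S: "module.subspace t S" and "!!g. g \<in> G ==> F g \<in> S"
  and u: "u \<in> module.span s G"
 shows "F u \<in> S"
proof -
 interpret vector_space_pair s t using linear_imp_vs[OF F] by (simp add: vector_space_pair_def)
 have "vs1.span G \<subseteq> {x. F x \<in> S}"
  by (rule vs1.span_minimal[OF _ linear_subspace_linear_preimage[OF F S]]) (use assms(3) in auto)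
 then show ?thesis using u by blast
qed

definition letter_map ::
 "('k, 'v::plus, 'r) dgv_scheme => ('k, 'w::plus, 's) dgv_scheme => (int \<times> 'v => int \<times> 'w) => bool" where
 "letter_map V W f \<longleftrightarrow> (\<exists>D r. (\<forall>i x. f (i, x) = (D i, r i x)) \<and>
   (\<forall>i. r i ` gr V i \<subseteq> gr W (D i) \<and> lin_on (scal V) (scal W) (gr V i) (r i)))"

lemma lin1_letter_map: "letter_map V W f ==> lin1 W t g ==> lin1 V t (%x. g (f x))"
 unfolding letter_map_def lin1_def lin_on_def by (fastforce simp: image_subset_iff)

lemma lin1_snd: "lin1 V (scal V) snd"
 by (simp add: lin1_def lin_on_def)

lemma lin1_linear: "lin1 V t g ==> lin t r F ==> lin1 V r (%x. F (g x))"
 unfolding lin1_def lin_on_def by (simp add: linear_plus linear_scal)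

lemma lin1_sg: "vector_space t ==> lin1 V t g ==> lin1 V t (%x. sg (h (fst x)) (g x))"
 unfolding lin1_def lin_on_def by (simp add: scale_sg)

lemma lin1_const_sg: "vector_space t ==> lin1 V t g ==> lin1 V t (%x. sg n (g x))"
 unfolding lin1_def lin_on_def by (simp add: scale_sg)

lemma lin1_0: "vector_space t ==> lin1 V t (%x. 0)"
proof -
 assume "vector_space t"
 then interpret vector_space t .
 show ?thesis unfolding lin1_def lin_on_def by simp
qed

lemma lin1_if: "vector_space t ==> lin1 V t g ==> lin1 V t (%x. if c (fst x) then g x else 0)"
proof -
 assume "vector_space t" "lin1 V t g"
 then interpret vector_space t by blast
 show ?thesis using \<open>lin1 V t g\<close> unfolding lin1_def lin_on_def by simp
qed

lemma lin1_add: "vector_space t ==> lin1 V t g ==> lin1 V t g' ==> lin1 V t (%x. g x + g' x)"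
proof -
 assume "vector_space t" and g: "lin1 V t g" "lin1 V t g'"
 then interpret vector_space t by blast
 show ?thesis using g unfolding lin1_def lin_on_def by (simp add: scale_right_distrib algebra_simps)
qed

lemma lin1_uminus: "vector_space t ==> lin1 V t g ==> lin1 V t (%x. - g x)"
 using lin1_const_sg[of t V g 1] by (simp add: sg_def)

section \<open>Generators of tensor products and of the tensor coalgebra\<close>

lemma vector_space_scal_cplx [simp]:
 "scal (tensor_cplx V W) = fscal" "scal (bar_dga A) = fscal"
 by (simp_all add: tensor_cplx_def bar_dga_def)

context
 fixes V :: "('k::field, 'v::ab_group_add, 'r) dgv_scheme" and W :: "('k, 'w::ab_group_add, 's) dgv_scheme"
 assumes V: "vector_space (scal V)" and W: "vector_space (scal W)"
begin

lemma linear_tns_right: "lin (scal W) fscal (tns V W v)"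
 unfolding Vector_Spaces.linear_iff
 by (auto simp: W vector_space_fscal tns_def bilinear_form_def Vector_Spaces.linear_iff fun_eq_iff fscal_def)

lemma linear_tns_left: "lin (scal V) fscal (%v. tns V W v w)"
 unfolding Vector_Spaces.linear_iff
 by (auto simp: V vector_space_fscal tns_def bilinear_form_def Vector_Spaces.linear_iff fun_eq_iff fscal_def)

lemma tns_simps [simp]:
 "tns V W 0 w = 0" "tns V W v 0 = 0"
 "tns V W (sg n v) w = sg n (tns V W v w)" "tns V W v (sg n w) = sg n (tns V W v w)"
 using linear_0[OF linear_tns_left] linear_0[OF linear_tns_right]
  linear_sg[OF linear_tns_left] linear_sg[OF linear_tns_right] by auto

lemma tns_span:
 assumes v: "v \<in> module.span (scal V) S" and w: "w \<in> module.span (scal W) T"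
  and "!!s t. s \<in> S ==> t \<in> T ==> tns V W s t \<in> R" and R: "module.subspace fscal R"
 shows "tns V W v w \<in> R"
proof -
 have "tns V W s w \<in> R" if "s \<in> S" for s
  using linear_maps_span[OF linear_tns_right R _ w] assms(3) that by blast
 then show ?thesis using linear_maps_span[OF linear_tns_left R _ v] by blast
qed

lemma gens_tensor:
 assumes GV: "gens V G e dg" and GW: "gens W H e' dg'"
 shows "gens (tensor_cplx V W) (G \<times> H) (%(g, h). tns V W (e g) (e' h)) (%(g, h). dg g + dg' h)"
 unfolding gens_def
proof
 fix n
 interpret f: vector_space "fscal :: 'k => (('v, 'w, 'k) tensor) => _" by (rule vector_space_fscal)
 interpret V: vector_space "scal V" by (rule V)
 interpret W: vector_space "scal W" by (rule W)
 let ?R = "f.span {(case g of (g, h) => tns V W (e g) (e' h)) | g. g \<in> G \<times> H \<and> (case g of (g, h) => dg g + dg' h) = n}"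
 let ?L = "f.span {tns V W v w | v w i j. v \<in> gr V i \<and> w \<in> gr W j \<and> i + j = n}"
 have "?R \<subseteq> ?L"
 proof (rule f.span_mono, safe)
  fix g h assume "g \<in> G" "h \<in> H"
  then show "\<exists>v w i j. tns V W (e g) (e' h) = tns V W v w \<and> v \<in> gr V i \<and> w \<in> gr W j \<and> i + j = dg g + dg' h"
   using GV GW unfolding gens_def by (blast intro: V.span_base W.span_base)
 qed
 moreover have "?L \<subseteq> ?R"
 proof (rule f.span_minimal[OF _ f.subspace_span], safe)
  fix v w i j assume vw: "v \<in> gr V i" "w \<in> gr W j" "n = i + j"
  show "tns V W v w \<in> f.span {(case g of (g, h) => tns V W (e g) (e' h)) | g. g \<in> G \<times> H \<and> (case g of (g, h) => dg g + dg' h) = i + j}"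
   by (rule tns_span[OF vw(1,2)[unfolded GV[unfolded gens_def, rule_format] GW[unfolded gens_def, rule_format]] _ f.subspace_span])
    (auto intro!: f.span_base)
 qed
 ultimately show "gr (tensor_cplx V W) n = module.span (scal (tensor_cplx V W))
   {(case g of (g, h) => tns V W (e g) (e' h)) | g. g \<in> G \<times> H \<and> (case g of (g, h) => dg g + dg' h) = n}"
  by (simp add: tensor_cplx_def)
qed

end

lemma gens_homog:
 assumes G: "gens V G e dg" and V: "vector_space (scal V)" and x: "x \<in> homog V"
 shows "x \<in> module.span (scal V) (e ` G)"
proof -
 interpret vector_space "scal V" by fact
 obtain n where "x \<in> gr V n" using x unfolding homog_def by blast
 moreover have "gr V n = span {e g | g. g \<in> G \<and> dg g = n}"
  using G unfolding gens_def by simp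
 moreover have "span {e g | g. g \<in> G \<and> dg g = n} \<subseteq> span (e ` G)"
  by (rule span_mono) auto
 ultimately show ?thesis by auto
qed

lemma gens_base:
 assumes G: "gens V G e dg" and V: "vector_space (scal V)" and g: "g \<in> G"
 shows "e g \<in> gr V (dg g)"
proof -
 interpret vector_space "scal V" by fact
 show ?thesis unfolding G[unfolded gens_def, rule_format]
  by (rule span_base) (use g in auto)
qed

lemma gens_agree:
 assumes G: "gens V G e dg" and F: "lin (scal V) t F" "lin (scal V) t F'"
  and eq: "!!g. g \<in> G ==> dg g = n ==> F (e g) = F' (e g)" and x: "x \<in> gr V n"
 shows "F x = F' x"
proof (rule linear_agree[OF F, where G = "{g \<in> G. dg g = n}" and e = e])
 show "x \<in> module.span (scal V) (e ` {g \<in> G. dg g = n})"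
  using x[unfolded G[unfolded gens_def, rule_format, of n] setcompr_eq_image] .
qed (auto intro: eq)

lemma graded_by_generators:
 assumes vs: "vector_space (scal V)" and G: "gens V G e dg"
  and P: "!!n. extends (scal V) (scal V) G e (%g. if dg g = n then e g else 0)"
 shows "graded V"
 unfolding graded_def
proof (intro conjI allI impI ballI)
 interpret vector_space "scal V" by fact
 show "vector_space (scal V)" by fact
 show "subspace (gr V i)" for i using G unfolding gens_def by simp
 fix I x i assume I: "finite I" "\<forall>i\<in>I. x i \<in> gr V i" "(\<Sum>i\<in>I. x i) = 0" "i \<in> I"
 obtain F where F: "lin (scal V) (scal V) F" "\<forall>g\<in>G. F (e g) = (if dg g = i then e g else 0)"
  using P[of i] unfolding extends_def by blast
 have id: "lin (scal V) (scal V) (%x. if b then x else 0)" for b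
  by (auto simp: Vector_Spaces.linear_iff vs)
 have "F y = (if j = i then y else 0)" if "y \<in> gr V j" for y j
  by (rule gens_agree[OF G F(1) id _ that]) (simp add: F(2))
 then have "(\<Sum>j\<in>I. F (x j)) = (\<Sum>j\<in>I. if j = i then x j else 0)"
  using I(2) by (intro sum.cong) auto
 also have "... = x i" using I(1,4) by simp
 finally have "F (\<Sum>j\<in>I. x j) = x i"
 proof -
  interpret P: vector_space_pair "scal V" "scal V" by unfold_locales
  assume "(\<Sum>j\<in>I. F (x j)) = x i"
  then show ?thesis by (simp add: P.linear_sum[OF F(1)])
 qed
 then show "x i = 0" using I(3) linear_0[OF F(1)] by simp
qed

lemma lin1_tns:
 assumes "vector_space (scal V)" "vector_space (scal W)"
 shows "lin1 V fscal (%v. tns V W (snd v) w)" "lin1 W fscal (%w. tns V W v (snd w))"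
 using lin1_linear[OF lin1_snd linear_tns_left[OF assms]] lin1_linear[OF lin1_snd linear_tns_right[OF assms]] by auto

lemma extends_tensor_letters:
 assumes V: "graded V" and W: "graded W" and t: "vector_space t"
  and 1: "!!w. w \<in> letters W ==> lin1 V t (%v. \<phi> v w)" and 2: "!!v. v \<in> letters V ==> lin1 W t (\<phi> v)"
 shows "extends fscal t (letters V \<times> letters W) (%(v, w). tns V W (snd v) (snd w)) (%(v, w). \<phi> v w)"
 by (rule extends_tns[OF graded_vector_space[OF V] graded_vector_space[OF W] t
    extends_letter[OF V t 1] extends_letter[OF W t 2]])

lemma graded_tensor:
 assumes V: "graded V" and W: "graded W"
 shows "graded (tensor_cplx V W)"
proof (rule graded_by_generators[OF _ gens_tensor[OF _ _ gens_letters[OF V] gens_letters[OF W]]])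
 note vs = graded_vector_space[OF V] graded_vector_space[OF W]
 show "vector_space (scal V)" "vector_space (scal W)" by (rule vs)+
 show "vector_space (scal (tensor_cplx V W))" by (simp add: vector_space_fscal)
 fix n
 have "extends fscal fscal (letters V \<times> letters W) (%(v, w). tns V W (snd v) (snd w))
   (%(v, w). if fst v + fst w = n then tns V W (snd v) (snd w) else 0)"
  by (rule extends_tensor_letters[OF V W vector_space_fscal])
   (intro lin1_if[OF vector_space_fscal] lin1_tns vs
    lin1_if[OF vector_space_fscal, where c = "%i. _ + i = n"] lin1_if[OF vector_space_fscal, where c = "%i. i + _ = n"])+
 then show "extends (scal (tensor_cplx V W)) (scal (tensor_cplx V W)) (letters V \<times> letters W)
   (%(g, h). tns V W (snd g) (snd h))
   (%g. if (case g of (g, h) => fst g + fst h) = n then case g of (g, h) => tns V W (snd g) (snd h) else 0)"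
  unfolding extends_def by simp (erule ex_forward, auto)
qed

lemma linear_word: "vector_space (scal A) ==> lin (scal A) fscal (%x. word A (xs @ x # ys))"
 unfolding Vector_Spaces.linear_iff
 by (auto simp: vector_space_fscal word_def multilinear_form_def Vector_Spaces.linear_iff fun_eq_iff fscal_def)

lemma mlin_wd: "vector_space (scal A) ==> mlin A fscal (wd A)"
 unfolding mlin_def wd_def by (auto intro!: lin1_linear[OF lin1_snd linear_word])

lemma mlin_if:
 assumes "vector_space t" "mlin A t \<phi>" "!!X Y. map fst X = map fst Y ==> c X = c Y"
 shows "mlin A t (%X. if c X then \<phi> X else 0)"
 unfolding mlin_def
proof (intro ballI)
 fix X Y assume "X \<in> lists (letters A)" "Y \<in> lists (letters A)"
 then have "lin1 A t (%x. \<phi> (X @ x # Y))" using assms(2) unfolding mlin_def by blast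
 from lin1_if[OF assms(1) this, of "%i. c (X @ (i, undefined) # Y)"]
 have "lin1 A t (%x. if c (X @ (fst x, undefined) # Y) then \<phi> (X @ x # Y) else 0)" .
 moreover have "c (X @ (fst x, undefined) # Y) = c (X @ x # Y)" for x by (rule assms(3)) simp
 ultimately show "lin1 A t (%x. if c (X @ x # Y) then \<phi> (X @ x # Y) else 0)" by simp
qed

lemma map_fst_bd: "map fst X = map fst Y ==> bd X = bd Y"
proof -
 have "bd Z = sum_list (map (%i. i - 1) (map fst Z))" for Z :: "(int \<times> 'x) list" by (simp add: bd_def comp_def)
 then show "map fst X = map fst Y ==> bd X = bd Y" by metis
qed

lemma mlin_zero:
 assumes A: "graded A" and t: "vector_space t" and m: "mlin A t \<phi>" and X: "X \<in> lists (letters A)" "0 \<in> snd ` set X"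
 shows "\<phi> X = 0"
proof -
 obtain x where "x \<in> set X" "snd x = 0" using X(2) by force
 then obtain U W i where XU: "X = U @ (i, 0) # W" by (metis prod.collapse split_list)
 then show ?thesis using lin1_zero[OF A _ t, of "%x. \<phi> (U @ x # W)"] m X(1) unfolding mlin_def by simp
qed

lemma bdeg_label: "bd (map (label A) xs) = bdeg A xs"
 by (simp add: bd_def bdeg_def label_def comp_def)

lemma gens_word:
 fixes A :: "('k::field, 'a::ab_group_add, 'r) brace_alg_scheme"
 assumes A: "graded A"
 shows "gens (bar_dga A) (lists (letters A)) (wd A) bd"
 unfolding gens_def
proof
 fix n
 interpret f: vector_space "fscal :: 'k => ('a, 'k) words => _" by (rule vector_space_fscal)
 have "{word A xs | xs. xs \<in> lists (homog A) \<and> bdeg A xs = n} \<subseteq> {wd A X | X. X \<in> lists (letters A) \<and> bd X = n}"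
 proof
  fix u assume "u \<in> {word A xs | xs. xs \<in> lists (homog A) \<and> bdeg A xs = n}"
  then obtain xs where "u = word A xs" "xs \<in> lists (homog A)" "bdeg A xs = n" by blast
  then have "u = wd A (map (label A) xs) \<and> map (label A) xs \<in> lists (letters A) \<and> bd (map (label A) xs) = n"
   using labels_in_lists[OF A] by (simp add: wd_def bdeg_label comp_def snd_label[OF A])
  then show "u \<in> {wd A X | X. X \<in> lists (letters A) \<and> bd X = n}" by blast
 qed
 moreover have "wd A X \<in> f.span {word A xs | xs. xs \<in> lists (homog A) \<and> bdeg A xs = bd X}" if X: "X \<in> lists (letters A)" for X
 proof (cases "0 \<in> snd ` set X")
  case True
  then show ?thesis
   using mlin_zero[OF A vector_space_fscal mlin_wd[OF graded_vector_space[OF A]] X] f.span_zero by simp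
 next
  case False
  have "map (label A) (map snd X) = X"
   using X False deg_eq[OF A] by (induction X rule: list.induct) (auto simp: label_def)
  then have "bdeg A (map snd X) = bd X" by (metis bdeg_label)
  moreover have "map snd X \<in> lists (homog A)" using X map_snd_lists[OF A] by blast
  ultimately show ?thesis by (intro f.span_base) (auto simp: wd_def)
 qed
 ultimately show "gr (bar_dga A) n = module.span (scal (bar_dga A)) {wd A X | X. X \<in> lists (letters A) \<and> bd X = n}"
  by (simp add: bar_dga_def, intro subset_antisym f.span_mono f.span_minimal[OF _ f.subspace_span]) auto
qed

lemma graded_bar:
 assumes A: "graded A"
 shows "graded (bar_dga A)"
proof (rule graded_by_generators[OF _ gens_word[OF A]])
 show "extends (scal (bar_dga A)) (scal (bar_dga A)) (lists (letters A)) (wd A) (%X. if bd X = n then wd A X else 0)" for n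
 proof -
  have "mlin A fscal (%X. if bd X = n then wd A X else 0)"
   by (rule mlin_if[OF vector_space_fscal mlin_wd[OF graded_vector_space[OF A]]]) (drule map_fst_bd, simp)
  from extends_word[OF A vector_space_fscal this] show ?thesis by simp
 qed
qed (simp add: vector_space_fscal)

section \<open>Recognising dg algebras\<close>

lemma scal_sg: "graded V ==> scal V (ksign n) x = sg n x"
 by (rule ksign_sg[OF graded_vector_space])

lemma graded_sg: "graded V ==> x \<in> gr V i ==> sg n x \<in> gr V i"
 using graded_scale[of V x i "ksign n"] by (simp add: scal_sg)

lemma gens_maps:
 assumes G: "gens V G e dg" and F: "lin (scal V) (scal W) F" and W: "graded W"
  and m: "!!g. g \<in> G ==> dg g = n ==> F (e g) \<in> gr W k" and x: "x \<in> gr V n"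
 shows "F x \<in> gr W k"
 by (rule linear_maps_span[OF F graded_subspace[OF W] _ x[unfolded G[unfolded gens_def, rule_format]]])
  (use m in auto)

lemma graded_map_linear:
 assumes "lin (scal V) (scal W) F" "!!i x. x \<in> gr V i ==> F x \<in> gr W (i + n)"
  "!!x. x \<in> homog V ==> f x = F x" "graded V"
 shows "graded_map V W n f"
 unfolding graded_map_def lin_on_def
proof (intro conjI allI ballI)
 have eq: "f x = F x" if "x \<in> gr V i" for x i using assms(3) homogI[OF that] .
 show "f ` gr V i \<subseteq> gr W (i + n)" for i using assms(2) eq by auto
 show "f (x + y) = f x + f y" if "x \<in> gr V i" "y \<in> gr V i" for i x y
  using eq[OF that(1)] eq[OF that(2)] eq[OF graded_add[OF assms(4) that]] linear_plus[OF assms(1)] by simp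
 show "f (scal V c x) = scal W c (f x)" if "x \<in> gr V i" for i c x
  using eq[OF that] eq[OF graded_scale[OF assms(4) that]] linear_scal[OF assms(1)] by simp
qed

lemma graded_map_mem: "graded_map V W n f ==> x \<in> gr V i ==> f x \<in> gr W (i + n)"
 unfolding graded_map_def by blast

lemma graded_map_plus: "graded_map V W n f ==> x \<in> gr V i ==> y \<in> gr V i ==> f (x + y) = f x + f y"
 unfolding graded_map_def lin_on_def by blast

lemma graded_map_scal: "graded_map V W n f ==> x \<in> gr V i ==> f (scal V c x) = scal W c (f x)"
 unfolding graded_map_def lin_on_def by blast

lemma graded_map_zero:
 fixes W :: "('k::field, 'w::ab_group_add, 's) dgv_scheme"
 assumes "graded_map V W n f" "graded V"
 shows "f 0 = 0"
 using graded_map_plus[OF assms(1) graded_zero[OF assms(2)] graded_zero[OF assms(2)]] by simp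

lemma graded_map_letter_map:
 assumes "graded_map V W n f"
 shows "letter_map V W (%x. (fst x + n, f (snd x)))"
 using assms unfolding letter_map_def graded_map_def
 by (intro exI[of _ "%i. i + n"] exI[of _ "%i. f"]) simp

text \<open>All axioms of a dg algebra are multilinear, so generators suffice.\<close>

lemma dga_by_generators:
 fixes D :: "('k::field, 'u::ab_group_add, 'r) dga_scheme"
 assumes gr: "graded D" and G: "gens D G e dg"
  and d: "lin (scal D) (scal D) d" "!!x. x \<in> homog D ==> diff D x = d x"
  and m: "!!u. lin (scal D) (scal D) (m u)"
   "!!v. lin (scal D) (scal D) (%u. m u v)"
   "!!x y. x \<in> homog D ==> y \<in> homog D ==> mul D x y = m x y"
  and u: "unt D \<in> gr D 0"
  and dg: "!!g. g \<in> G ==> d (e g) \<in> gr D (dg g + 1)" "!!g. g \<in> G ==> d (d (e g)) = 0"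
  and mg: "!!g h. g \<in> G ==> h \<in> G ==> m (e g) (e h) \<in> gr D (dg g + dg h)"
  and assoc: "!!g h k. g \<in> G ==> h \<in> G ==> k \<in> G ==> m (m (e g) (e h)) (e k) = m (e g) (m (e h) (e k))"
  and unit: "!!g. g \<in> G ==> m (unt D) (e g) = e g" "!!g. g \<in> G ==> m (e g) (unt D) = e g"
  and leib: "!!g h. g \<in> G ==> h \<in> G ==>
   d (m (e g) (e h)) = m (d (e g)) (e h) + sg (dg g) (m (e g) (d (e h)))"
 shows "dga D"
proof -
 note vs = graded_vector_space[OF gr]
 note agree = gens_agree[OF G]
 note maps = gens_maps[OF G _ gr]
 have id: "lin (scal D) (scal D) (%x. x)" by (simp add: Vector_Spaces.linear_iff vs)
 have zero: "lin (scal D) (scal D) (%x. 0)"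
  using linear_add_sg[OF id id, of 1] by (simp add: sg_def)
 have dgr: "d x \<in> gr D (i + 1)" if "x \<in> gr D i" for x i
  by (rule maps[OF d(1) _ that]) (use dg(1) in auto)
 have mgr1: "m x (e h) \<in> gr D (i + dg h)" if "x \<in> gr D i" "h \<in> G" for x h i
  by (rule maps[OF m(2) _ that(1)]) (use mg that(2) in auto)
 have mgr: "m x y \<in> gr D (i + j)" if "x \<in> gr D i" "y \<in> gr D j" for x y i j
  by (rule maps[OF m(1) _ that(2)]) (use mgr1[OF that(1)] in auto)
 have dd: "d (d x) = 0" if "x \<in> gr D i" for x i
  by (rule agree[OF linear_compose[OF d(1) d(1)] zero _ that]) (use dg(2) in auto)
 have as1: "m (m x (e h)) (e k) = m x (m (e h) (e k))" if "x \<in> gr D i" "h \<in> G" "k \<in> G" for x h k i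
  by (rule agree[OF linear_compose[OF m(2) m(2)] m(2) _ that(1)]) (use assoc that in auto)
 have as2: "m (m x y) (e k) = m x (m y (e k))" if "x \<in> gr D i" "y \<in> gr D j" "k \<in> G" for x y k i j
  by (rule agree[OF linear_compose[OF m(1) m(2)] linear_compose[OF m(2) m(1)] _ that(2)]) (use as1 that in auto)
 have as: "m (m x y) z = m x (m y z)" if "x \<in> gr D i" "y \<in> gr D j" "z \<in> gr D l" for x y z i j l
  by (rule agree[OF m(1) linear_compose[OF m(1) m(1)] _ that(3)]) (use as2 that in auto)
 have un: "m (unt D) x = x" "m x (unt D) = x" if "x \<in> gr D i" for x i
  by (rule agree[OF m(1) id _ that], use unit in auto) (rule agree[OF m(2) id _ that], use unit in auto)
 have le1: "d (m x (e h)) = m (d x) (e h) + sg i (m x (d (e h)))" if "x \<in> gr D i" "h \<in> G" for x h i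
  by (rule agree[OF linear_compose[OF m(2) d(1)] linear_add_sg[OF linear_compose[OF d(1) m(2)] m(2)] _ that(1)])
   (use leib that in auto)
 have le: "d (m x y) = m (d x) y + sg i (m x (d y))" if "x \<in> gr D i" "y \<in> gr D j" for x y i j
  by (rule agree[OF linear_compose[OF m(1) d(1)] linear_add_sg[OF m(1) linear_compose[OF d(1) m(1)]] _ that(2)])
   (use le1 that in auto)
 have le': "d (m x y) = m (d x) y + sg (deg D x) (m x (d y))" if "x \<in> gr D i" "y \<in> gr D j" for x y i j
  using le[OF that] deg_eq[OF gr that(1)] linear_0[OF m(2)] by (cases "x = 0") auto
 have mh: "mul D x y \<in> homog D" if xy: "x \<in> homog D" "y \<in> homog D" for x y
 proof -
  obtain i j where "x \<in> gr D i" "y \<in> gr D j" using xy unfolding homog_def by blast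
  then show ?thesis using m(3)[OF xy] homogI[OF mgr] by simp
 qed
 have dh: "diff D x \<in> homog D" if x: "x \<in> homog D" for x
 proof -
  obtain i where "x \<in> gr D i" using x unfolding homog_def by blast
  then show ?thesis using d(2)[OF x] homogI[OF dgr] by simp
 qed
 have 1: "dg_space D"
  unfolding dg_space_iff
 proof (intro conjI ballI)
  show "graded_map D D 1 (diff D)" by (rule graded_map_linear[OF d(1) dgr d(2) gr])
  show "diff D (diff D x) = 0" if "x \<in> homog D" for x
   using d(2)[OF that] d(2)[OF dh[OF that]] that dd unfolding homog_def by auto
 qed (rule gr)
 have 2: "graded_map D D j (%x. mul D x y)" if "y \<in> gr D j" for y j
  by (rule graded_map_linear[OF m(2) _ m(3) gr]) (use that mgr homogI[OF that] in auto)
 have 3: "graded_map D D i (mul D x)" if "x \<in> gr D i" for x i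
 proof (rule graded_map_linear[OF m(1) _ m(3) gr])
  show "m x y \<in> gr D (j + i)" if "y \<in> gr D j" for y j
   using mgr[OF \<open>x \<in> gr D i\<close> that] by (simp add: add.commute)
 qed (use homogI[OF that] in auto)
 have 4: "mul D (mul D x y) z = mul D x (mul D y z)" if "x \<in> homog D" "y \<in> homog D" "z \<in> homog D" for x y z
  using that m(3)[OF that(1,2)] m(3)[OF that(2,3)] m(3)[OF mh[OF that(1,2)] that(3)] m(3)[OF that(1) mh[OF that(2,3)]] as
  by (auto simp: homog_def)
 have 5: "mul D (unt D) x = x \<and> mul D x (unt D) = x" if "x \<in> homog D" for x
  using that m(3)[OF homogI[OF u] that] m(3)[OF that homogI[OF u]] un by (auto simp: homog_def)
 have 6: "diff D (mul D x y) = mul D (diff D x) y + scal D (ksign (deg D x)) (mul D x (diff D y))"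
  if "x \<in> homog D" "y \<in> homog D" for x y
  using that d(2)[OF mh[OF that]] m(3)[OF that] m(3)[OF dh[OF that(1)] that(2)] m(3)[OF that(1) dh[OF that(2)]]
   d(2)[OF that(1)] d(2)[OF that(2)] le'
  by (auto simp: homog_def scal_sg[OF gr])
 show ?thesis unfolding dga_def using 1 2 3 4 5 6 u by blast
qed

context
 fixes A :: "('k::field, 'v::ab_group_add, 'r) dga_scheme"
 assumes A: "dga A"
begin

lemma dga_graded: "graded A"
 using A unfolding dga_def by (simp add: dg_space_graded)

lemma dga_diff_map: "graded_map A A 1 (diff A)"
 using A unfolding dga_def dg_space_def by simp

lemma dga_mul_left: "x \<in> gr A i ==> graded_map A A i (mul A x)"
 using A unfolding dga_def by blast

lemma dga_mul_right: "y \<in> gr A j ==> graded_map A A j (%x. mul A x y)"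
 using A unfolding dga_def by blast

lemma dga_diff_gr: "x \<in> gr A i ==> diff A x \<in> gr A (i + 1)"
 using graded_map_mem[OF dga_diff_map] .

lemma dga_mul_gr: "x \<in> gr A i ==> y \<in> gr A j ==> mul A x y \<in> gr A (i + j)"
 using graded_map_mem[OF dga_mul_right] .

lemma dga_diff_diff: "x \<in> gr A i ==> diff A (diff A x) = 0"
 using A homogI unfolding dga_def dg_space_def by metis

lemma dga_assoc:
 "x \<in> gr A i ==> y \<in> gr A j ==> z \<in> gr A l ==> mul A (mul A x y) z = mul A x (mul A y z)"
 using A homogI unfolding dga_def by metis

lemma dga_unit: "unt A \<in> gr A 0" "x \<in> gr A i ==> mul A (unt A) x = x" "x \<in> gr A i ==> mul A x (unt A) = x"
 using A homogI unfolding dga_def by metis+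

lemma dga_mul_zero: "x \<in> gr A i ==> mul A x 0 = 0" "x \<in> gr A i ==> mul A 0 x = 0"
 using graded_map_zero[OF dga_mul_left dga_graded] graded_map_zero[OF dga_mul_right dga_graded] by auto

lemma dga_leibniz:
 assumes "x \<in> gr A i" "y \<in> gr A j"
 shows "diff A (mul A x y) = mul A (diff A x) y + sg i (mul A x (diff A y))"
proof (cases "x = 0")
 case True
 then show ?thesis
  using graded_map_zero[OF dga_diff_map dga_graded] dga_mul_zero[OF assms(2)] dga_mul_zero[OF dga_diff_gr[OF assms(2)]] by simp
next
 case False
 have "diff A (mul A x y) = mul A (diff A x) y + scal A (ksign (deg A x)) (mul A x (diff A y))"
  using A homogI[OF assms(1)] homogI[OF assms(2)] unfolding dga_def by blast
 then show ?thesis using deg_eq[OF dga_graded assms(1) False] scal_sg[OF dga_graded] by simp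
qed

lemma lin1_mul:
 "y \<in> gr A j ==> letter_map A A (%x. (fst x + j, mul A (snd x) y))"
 "x \<in> gr A i ==> letter_map A A (%y. (fst y + i, mul A x (snd y)))"
 using graded_map_letter_map[OF dga_mul_right] graded_map_letter_map[OF dga_mul_left] by auto

lemma op_mul_letters:
 assumes "x \<in> gr A i" "y \<in> gr A j"
 shows "op_mul A x y = sg (i * j) (mul A y x)"
 using deg_eq[OF dga_graded assms(1)] deg_eq[OF dga_graded assms(2)] dga_mul_zero[OF assms(1)] dga_mul_zero[OF assms(2)]
 unfolding op_mul_def by (cases "x = 0 \<or> y = 0") (auto simp: scal_sg[OF dga_graded])

end

text \<open>Elements of \<open>V\<close> are determined by their images, so every axiom can be checked in \<open>B\<close>.\<close>

lemma dga_reflect: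
 assumes B: "dga B" and V: "graded V" and f: "graded_map V B 0 f"
  and inj: "!!x i. x \<in> gr V i ==> f x = 0 ==> x = 0"
  and d: "!!x i. x \<in> gr V i ==> diff V x \<in> gr V (i + 1)" "!!x i. x \<in> gr V i ==> f (diff V x) = diff B (f x)"
  and m: "!!x y i j. x \<in> gr V i ==> y \<in> gr V j ==> mul V x y \<in> gr V (i + j)"
   "!!x y i j. x \<in> gr V i ==> y \<in> gr V j ==> f (mul V x y) = mul B (f x) (f y)"
  and u: "unt V \<in> gr V 0" "f (unt V) = unt B"
 shows "dga V" "dga_hom V B f"
proof -
 note fgr = graded_map_mem[OF f, simplified]
 note fp = graded_map_plus[OF f] and fs = graded_map_scal[OF f]
 have fsg: "f (sg n x) = sg n (f x)" if "x \<in> gr V i" for x i n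
  using fs[OF that, of "ksign n"] scal_sg[OF V] scal_sg[OF dga_graded[OF B]] by simp
 have eq: "x = y" if "x \<in> gr V i" "y \<in> gr V i" "f x = f y" for x y i
 proof -
  have "f (x + sg 1 y) = f x + sg 1 (f y)"
   by (simp only: fp[OF that(1) graded_sg[OF V that(2)]] fsg[OF that(2)])
  then have "f (x + sg 1 y) = 0" using that(3) by (simp add: sg_def)
  then have "x + sg 1 y = 0" using inj graded_add[OF V that(1) graded_sg[OF V that(2)]] by blast
  then show ?thesis by (simp add: sg_def)
 qed
 note dgr = dga_diff_gr[OF B] and mgr = dga_mul_gr[OF B]
 have 1: "dg_space V"
  unfolding dg_space_iff
 proof (intro conjI ballI)
  show "graded_map V V 1 (diff V)"
   unfolding graded_map_def lin_on_def
  proof (intro conjI allI ballI)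
   fix i x y assume x: "x \<in> gr V i" and y: "y \<in> gr V i"
   show "diff V (x + y) = diff V x + diff V y"
   proof (rule eq[of _ "i + 1"])
    show "f (diff V (x + y)) = f (diff V x + diff V y)"
     using d(2)[OF graded_add[OF V x y]] fp[OF d(1)[OF x] d(1)[OF y]] fp[OF x y]
      graded_map_plus[OF dga_diff_map[OF B] fgr[OF x] fgr[OF y]] d(2)[OF x] d(2)[OF y] by simp
   qed (use x y d(1) graded_add[OF V] in auto)
  next
   fix i x c assume x: "x \<in> gr V i"
   show "diff V (scal V c x) = scal V c (diff V x)"
   proof (rule eq[of _ "i + 1"])
    show "f (diff V (scal V c x)) = f (scal V c (diff V x))"
     using d(2)[OF graded_scale[OF V x, of c]] fs[OF d(1)[OF x], of c] fs[OF x, of c]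
      graded_map_scal[OF dga_diff_map[OF B] fgr[OF x], of c] d(2)[OF x] by simp
   qed (use x d(1) graded_scale[OF V] in auto)
  qed (use d in auto)
  show "diff V (diff V x) = 0" if "x \<in> homog V" for x
  proof -
   obtain i where x: "x \<in> gr V i" using \<open>x \<in> homog V\<close> unfolding homog_def by blast
   show ?thesis
    by (rule inj[OF d(1)[OF d(1)[OF x]]])
     (use d(2)[OF d(1)[OF x]] d(2)[OF x] dga_diff_diff[OF B fgr[OF x]] in simp)
  qed
 qed (rule V)
 have 2: "graded_map V V j (%x. mul V x y)" if y: "y \<in> gr V j" for y j
  unfolding graded_map_def lin_on_def
 proof (intro conjI allI ballI)
  fix i x x' assume x: "x \<in> gr V i" "x' \<in> gr V i"
  show "mul V (x + x') y = mul V x y + mul V x' y"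
  proof (rule eq[OF m(1)[OF graded_add[OF V x] y]])
   show "f (mul V (x + x') y) = f (mul V x y + mul V x' y)"
    using graded_map_plus[OF dga_mul_right[OF B fgr[OF y]] fgr[OF x(1)] fgr[OF x(2)]]
    by (simp add: m(2)[OF graded_add[OF V x] y] m(2)[OF x(1) y] m(2)[OF x(2) y] fp[OF x] fp[OF m(1)[OF x(1) y] m(1)[OF x(2) y]])
  qed (rule graded_add[OF V m(1)[OF x(1) y] m(1)[OF x(2) y]])
 next
  fix i x c assume x: "x \<in> gr V i"
  show "mul V (scal V c x) y = scal V c (mul V x y)"
  proof (rule eq[OF m(1)[OF graded_scale[OF V x] y]])
   show "f (mul V (scal V c x) y) = f (scal V c (mul V x y))"
    using graded_map_scal[OF dga_mul_right[OF B fgr[OF y]] fgr[OF x], of c]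
    by (simp add: m(2)[OF graded_scale[OF V x] y] m(2)[OF x y] fs[OF x] fs[OF m(1)[OF x y]])
  qed (rule graded_scale[OF V m(1)[OF x y]])
 qed (use m y in auto)
 have 3: "graded_map V V i (mul V x)" if x: "x \<in> gr V i" for x i
  unfolding graded_map_def lin_on_def
 proof (intro conjI allI ballI)
  fix j y y' assume y: "y \<in> gr V j" "y' \<in> gr V j"
  show "mul V x (y + y') = mul V x y + mul V x y'"
  proof (rule eq[OF m(1)[OF x graded_add[OF V y]]])
   show "f (mul V x (y + y')) = f (mul V x y + mul V x y')"
    using graded_map_plus[OF dga_mul_left[OF B fgr[OF x]] fgr[OF y(1)] fgr[OF y(2)]]
    by (simp add: m(2)[OF x graded_add[OF V y]] m(2)[OF x y(1)] m(2)[OF x y(2)] fp[OF y] fp[OF m(1)[OF x y(1)] m(1)[OF x y(2)]])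
  qed (rule graded_add[OF V m(1)[OF x y(1)] m(1)[OF x y(2)]])
 next
  fix j y c assume y: "y \<in> gr V j"
  show "mul V x (scal V c y) = scal V c (mul V x y)"
  proof (rule eq[OF m(1)[OF x graded_scale[OF V y]]])
   show "f (mul V x (scal V c y)) = f (scal V c (mul V x y))"
    using graded_map_scal[OF dga_mul_left[OF B fgr[OF x]] fgr[OF y], of c]
    by (simp add: m(2)[OF x graded_scale[OF V y]] m(2)[OF x y] fs[OF y] fs[OF m(1)[OF x y]])
  qed (rule graded_scale[OF V m(1)[OF x y]])
 next
  show "mul V x ` gr V j \<subseteq> gr V (j + i)" for j
   using m(1)[OF x, of _ j] by (auto simp: add.commute)
 qed
 have 4: "mul V (mul V x y) z = mul V x (mul V y z)" if h: "x \<in> homog V" "y \<in> homog V" "z \<in> homog V" for x y z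
 proof -
  obtain i j k where x: "x \<in> gr V i" "y \<in> gr V j" "z \<in> gr V k" using h unfolding homog_def by blast
  show ?thesis
  proof (rule eq[OF m(1)[OF m(1)[OF x(1,2)] x(3)]])
   show "f (mul V (mul V x y) z) = f (mul V x (mul V y z))"
    by (simp add: m(2)[OF m(1)[OF x(1,2)] x(3)] m(2)[OF x(1) m(1)[OF x(2,3)]] m(2)[OF x(1,2)] m(2)[OF x(2,3)]
     dga_assoc[OF B fgr[OF x(1)] fgr[OF x(2)] fgr[OF x(3)]])
   show "mul V x (mul V y z) \<in> gr V (i + j + k)" using m(1)[OF x(1) m(1)[OF x(2,3)]] by (simp add: add.assoc)
  qed
 qed
 have 5: "mul V (unt V) x = x \<and> mul V x (unt V) = x" if h: "x \<in> homog V" for x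
 proof -
  obtain i where x: "x \<in> gr V i" using h unfolding homog_def by blast
  have "mul V (unt V) x \<in> gr V i" "mul V x (unt V) \<in> gr V i" using m(1)[OF u(1) x] m(1)[OF x u(1)] by auto
  then show ?thesis using x eq by (auto simp: m(2)[OF u(1) x] m(2)[OF x u(1)] u dga_unit(2,3)[OF B fgr])
 qed
 have 6: "diff V (mul V x y) = mul V (diff V x) y + scal V (ksign (deg V x)) (mul V x (diff V y))"
  if h: "x \<in> homog V" "y \<in> homog V" for x y
 proof -
  obtain i j where x: "x \<in> gr V i" "y \<in> gr V j" using h unfolding homog_def by blast
  have m2: "mul V (diff V x) y \<in> gr V (i + j + 1)" "mul V x (diff V y) \<in> gr V (i + j + 1)"
   using m(1)[OF d(1)[OF x(1)] x(2)] m(1)[OF x(1) d(1)[OF x(2)]] by (auto simp: algebra_simps)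
  have "diff V (mul V x y) = mul V (diff V x) y + sg i (mul V x (diff V y))"
  proof (rule eq[of _ "i + j + 1"])
   show "f (diff V (mul V x y)) = f (mul V (diff V x) y + sg i (mul V x (diff V y)))"
    by (simp add: d(2)[OF m(1)[OF x]] m(2)[OF x] fp[OF m2(1) graded_sg[OF V m2(2)]] fsg[OF m2(2)]
     m(2)[OF d(1)[OF x(1)] x(2)] m(2)[OF x(1) d(1)[OF x(2)]] d(2)[OF x(1)] d(2)[OF x(2)]
     dga_leibniz[OF B fgr[OF x(1)] fgr[OF x(2)]])
  qed (use x m2 d(1)[OF m(1)[OF x]] graded_add[OF V] graded_sg[OF V] in auto)
  moreover have "mul V 0 (diff V y) = 0"
   using graded_map_zero[OF 2[OF d(1)[OF x(2)]] V] by simp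
  ultimately show ?thesis using deg_eq[OF V x(1)] by (cases "x = 0") (auto simp: scal_sg[OF V])
 qed
 show "dga V" unfolding dga_def using 1 2 3 4 5 6 u by blast
 then show "dga_hom V B f"
  unfolding dga_hom_def using B f d(2) m(2) u(2) by (auto simp: homog_def)
qed

section \<open>The tensor product of dg algebras\<close>

lemma letters_cases:
 assumes "v \<in> letters V" "graded V"
 obtains "label V (snd v) = v" | "snd v = 0"
 using assms deg_eq[OF assms(2), of "snd v" "fst v"] by (cases v) (auto simp: label_def)

lemma tensor_diff:
 assumes V: "dg_space V" and W: "dg_space W"
 obtains F where "flin F"
  "!!v w. v \<in> letters V ==> w \<in> letters W ==>
   F (tns V W (snd v) (snd w)) = tns V W (diff V (snd v)) (snd w) + sg (fst v) (tns V W (snd v) (diff W (snd w)))"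
  "!!u. u \<in> homog (tensor_cplx V W) ==> diff (tensor_cplx V W) u = F u"
proof -
 note gV = dg_space_graded[OF V] and gW = dg_space_graded[OF W]
 note vs = graded_vector_space[OF gV] graded_vector_space[OF gW]
 note f = vector_space_fscal
 have dV: "graded_map V V 1 (diff V)" and dW: "graded_map W W 1 (diff W)"
  using V W unfolding dg_space_iff by auto
 let ?\<phi> = "%v w. tns V W (diff V (snd v)) (snd w) + sg (fst v) (tns V W (snd v) (diff W (snd w)))"
 have ext: "extends fscal fscal (letters V \<times> letters W) (%(v, w). tns V W (snd v) (snd w)) (%(v, w). ?\<phi> v w)"
 proof (rule extends_tensor_letters[OF gV gW f])
  show "lin1 V fscal (%v. ?\<phi> v w)" for w
   using lin1_letter_map[OF graded_map_letter_map[OF dV] lin1_tns(1)[OF vs]]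
   by (intro lin1_add[OF f] lin1_sg[OF f] lin1_tns[OF vs]) simp
  show "lin1 W fscal (?\<phi> v)" for v
   using lin1_letter_map[OF graded_map_letter_map[OF dW] lin1_tns(2)[OF vs]]
   by (intro lin1_add[OF f] lin1_const_sg[OF f] lin1_tns[OF vs]) simp
 qed
 let ?S = "{(tns V W v w, tns V W (diff V v) w + fscal (ksign (deg V v)) (tns V W v (diff W w))) | v w.
      v \<in> homog V \<and> w \<in> homog W}"
 have "?S = (%g. (case g of (v, w) => tns V W (snd v) (snd w), case g of (v, w) => ?\<phi> v w)) ` (letters V \<times> letters W)"
  (is "_ = ?T")
 proof
  show "?S \<subseteq> ?T"
  proof
   fix p assume "p \<in> ?S"
   then obtain v w where p: "p = (tns V W v w, tns V W (diff V v) w + sg (deg V v) (tns V W v (diff W w)))"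
    "v \<in> homog V" "w \<in> homog W" by auto
   then show "p \<in> ?T"
    using label_in_letters[OF gV] label_in_letters[OF gW]
    by (intro image_eqI[of _ _ "(label V v, label W w)"]) (auto simp: label_def)
  qed
  show "?T \<subseteq> ?S"
  proof
   fix p assume "p \<in> ?T"
   then obtain v w where vw: "v \<in> letters V" "w \<in> letters W" "p = (tns V W (snd v) (snd w), ?\<phi> v w)" by auto
   have "sg (deg V (snd v)) (tns V W (snd v) (diff W (snd w))) = sg (fst v) (tns V W (snd v) (diff W (snd w)))"
    using letters_cases[OF vw(1) gV] by (metis fst_conv label_def sg_simps(2) tns_simps(1)[OF vs])
   then have "p = (tns V W (snd v) (snd w), tns V W (diff V (snd v)) (snd w) + fscal (ksign (deg V (snd v))) (tns V W (snd v) (diff W (snd w))))"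
    using vw(3) by simp
   then show "p \<in> ?S" using homogI[OF snd_letters[OF vw(1)]] homogI[OF snd_letters[OF vw(2)]] by blast
  qed
 qed
 from lin_ext_exists[OF ext this] obtain F where F: "flin F"
  "!!g. g \<in> letters V \<times> letters W ==> F (case g of (v, w) => tns V W (snd v) (snd w)) = (case g of (v, w) => ?\<phi> v w)"
  "!!u. u \<in> module.span fscal ((%(v, w). tns V W (snd v) (snd w)) ` (letters V \<times> letters W)) ==> lin_ext fscal fscal ?S u = F u"
  by blast
 show ?thesis
 proof (rule that[OF F(1)])
  show "F (tns V W (snd v) (snd w)) = ?\<phi> v w" if "v \<in> letters V" "w \<in> letters W" for v w
   using F(2)[of "(v, w)"] that by simp
  show "diff (tensor_cplx V W) u = F u" if "u \<in> homog (tensor_cplx V W)" for u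
   using F(3)[OF gens_homog[OF gens_tensor[OF vs gens_letters[OF gV] gens_letters[OF gW]] _ that, simplified, OF f]]
   by (simp add: tensor_cplx_def)
 qed
qed

lemma tensor_dga_simps [simp]:
 "scal (tensor_dga A B) = fscal" "gr (tensor_dga A B) = gr (tensor_cplx A B)"
 "diff (tensor_dga A B) = diff (tensor_cplx A B)" "unt (tensor_dga A B) = tns A B (unt A) (unt B)"
 by (simp_all add: tensor_dga_def dgv.defs dga.defs tensor_cplx_def)

lemma homog_tensor_dga [simp]: "homog (tensor_dga A B) = homog (tensor_cplx A B)"
 by (simp add: homog_def)

lemma tensor_mul:
 assumes A: "dga A" and B: "dga B"
 obtains m where "!!v. flin (m v)" "!!w. flin (%v. m v w)"
  "!!a b a' b'. a \<in> letters A ==> b \<in> letters B ==> a' \<in> letters A ==> b' \<in> letters B ==>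
   m (tns A B (snd a) (snd b)) (tns A B (snd a') (snd b'))
   = sg (fst b * fst a') (tns A B (mul A (snd a) (snd a')) (mul B (snd b) (snd b')))"
  "!!u v. u \<in> homog (tensor_cplx A B) ==> v \<in> homog (tensor_cplx A B) ==> mul (tensor_dga A B) u v = m u v"
proof -
 note gA = dga_graded[OF A] and gB = dga_graded[OF B]
 note vs = graded_vector_space[OF gA] graded_vector_space[OF gB]
 note f = vector_space_fscal
 let ?G = "letters A \<times> letters B"
 let ?e = "%(a, b). tns A B (snd a) (snd b)"
 let ?\<phi> = "%(a, b) (a', b'). sg (fst b * fst a') (tns A B (mul A (snd a) (snd a')) (mul B (snd b) (snd b')))"
 have mA: "lin1 A fscal (%a. tns A B (mul A (snd a) (snd a')) w)" "lin1 A fscal (%a. tns A B (mul A (snd a') (snd a)) w)"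
  if "a' \<in> letters A" for a' w
  using lin1_letter_map[OF lin1_mul(1)[OF A snd_letters[OF that]] lin1_tns(1)[OF vs]]
   lin1_letter_map[OF lin1_mul(2)[OF A snd_letters[OF that]] lin1_tns(1)[OF vs]] by auto
 have mB: "lin1 B fscal (%b. tns A B w (mul B (snd b) (snd b')))" "lin1 B fscal (%b. tns A B w (mul B (snd b') (snd b)))"
  if "b' \<in> letters B" for b' w
  using lin1_letter_map[OF lin1_mul(1)[OF B snd_letters[OF that]] lin1_tns(2)[OF vs]]
   lin1_letter_map[OF lin1_mul(2)[OF B snd_letters[OF that]] lin1_tns(2)[OF vs]] by auto
 have 1: "extends fscal fscal ?G ?e (%g. ?\<phi> g h)" if "h \<in> ?G" for h
 proof -
  obtain a' b' where h: "h = (a', b')" "a' \<in> letters A" "b' \<in> letters B" using \<open>h \<in> ?G\<close> by blast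
  have "extends fscal fscal ?G ?e (%(a, b). sg (fst b * fst a') (tns A B (mul A (snd a) (snd a')) (mul B (snd b) (snd b'))))"
   by (rule extends_tensor_letters[OF gA gB f],
     rule lin1_const_sg[OF f mA(1)[OF h(2)]], rule lin1_sg[OF f mB(1)[OF h(3)], where h = "%i. i * fst a'"])
  then show ?thesis unfolding h(1) by (simp add: case_prod_unfold)
 qed
 have 2: "extends fscal fscal ?G ?e (?\<phi> g)" if "g \<in> ?G" for g
 proof -
  obtain a b where g: "g = (a, b)" "a \<in> letters A" "b \<in> letters B" using \<open>g \<in> ?G\<close> by blast
  have "extends fscal fscal ?G ?e (%(a', b'). sg (fst b * fst a') (tns A B (mul A (snd a) (snd a')) (mul B (snd b) (snd b'))))"
   by (rule extends_tensor_letters[OF gA gB f],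
     rule lin1_sg[OF f mA(2)[OF g(2)], where h = "%i. fst b * i"], rule lin1_const_sg[OF f mB(2)[OF g(3)]])
  then show ?thesis unfolding g(1) by (simp add: case_prod_unfold)
 qed
 let ?S = "{(tns A B a b, tns A B a' b',
     fscal (ksign (deg B b * deg A a')) (tns A B (mul A a a') (mul B b b'))) | a b a' b'.
      a \<in> homog A \<and> b \<in> homog B \<and> a' \<in> homog A \<and> b' \<in> homog B}"
 have S: "?S = (%(g, h). (?e g, ?e h, ?\<phi> g h)) ` (?G \<times> ?G)" (is "_ = ?T")
 proof
  show "?S \<subseteq> ?T"
  proof
   fix p assume "p \<in> ?S"
   then obtain a b a' b' where p: "p = (tns A B a b, tns A B a' b', sg (deg B b * deg A a') (tns A B (mul A a a') (mul B b b')))"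
    "a \<in> homog A" "b \<in> homog B" "a' \<in> homog A" "b' \<in> homog B" by auto
   then show "p \<in> ?T"
    using label_in_letters[OF gA] label_in_letters[OF gB]
    by (intro image_eqI[of _ _ "((label A a, label B b), (label A a', label B b'))"]) (auto simp: label_def)
  qed
  show "?T \<subseteq> ?S"
  proof
   fix p assume "p \<in> ?T"
   then obtain a b a' b' where l: "a \<in> letters A" "b \<in> letters B" "a' \<in> letters A" "b' \<in> letters B"
    and p: "p = (?e (a, b), ?e (a', b'), ?\<phi> (a, b) (a', b'))" by auto
   have "sg (deg B (snd b) * deg A (snd a')) (tns A B (mul A (snd a) (snd a')) (mul B (snd b) (snd b')))
     = ?\<phi> (a, b) (a', b')"
   proof (cases "snd b = 0 \<or> snd a' = 0")
    case True
    then have "tns A B (mul A (snd a) (snd a')) (mul B (snd b) (snd b')) = 0"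
     using dga_mul_zero[OF A snd_letters[OF l(1)]] dga_mul_zero[OF B snd_letters[OF l(4)]] by (auto simp: tns_simps[OF vs])
    then show ?thesis by simp
   next
    case False
    then show ?thesis using letters_cases[OF l(2) gB] letters_cases[OF l(3) gA] by (metis (no_types, lifting) case_prod_conv fst_conv label_def)
   qed
   then have "p = (tns A B (snd a) (snd b), tns A B (snd a') (snd b'),
     fscal (ksign (deg B (snd b) * deg A (snd a'))) (tns A B (mul A (snd a) (snd a')) (mul B (snd b) (snd b'))))"
    using p by simp
   then show "p \<in> ?S" using l[THEN snd_letters, THEN homogI] by blast
  qed
 qed
 have ne: "?G \<noteq> {}" using graded_zero[OF gA] graded_zero[OF gB] by (auto simp: letters_def)
 obtain m where m: "!!v. flin (m v)" "!!w. flin (%v. m v w)"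
  "!!g h. g \<in> ?G ==> h \<in> ?G ==> m (?e g) (?e h) = ?\<phi> g h"
  "!!u v. u \<in> module.span fscal (?e ` ?G) ==> v \<in> module.span fscal (?e ` ?G) ==> bilin_ext fscal fscal fscal ?S u v = m u v"
  using bilin_ext_exists[OF f f f 1 2 S ne] by blast
 show ?thesis
 proof (rule that[OF m(1,2)])
  fix a b a' b' assume "a \<in> letters A" "b \<in> letters B" "a' \<in> letters A" "b' \<in> letters B"
  then show "m (tns A B (snd a) (snd b)) (tns A B (snd a') (snd b'))
    = sg (fst b * fst a') (tns A B (mul A (snd a) (snd a')) (mul B (snd b) (snd b')))"
   using m(3)[of "(a, b)" "(a', b')"] by simp
 next
  fix u v assume "u \<in> homog (tensor_cplx A B)" "v \<in> homog (tensor_cplx A B)"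
  then show "mul (tensor_dga A B) u v = m u v"
   using m(4) gens_homog[OF gens_tensor[OF vs gens_letters[OF gA] gens_letters[OF gB]], simplified, OF f]
   by (simp add: tensor_dga_def dgv.defs dga.defs tensor_cplx_def)
 qed
qed

lemma graded_cong: "graded V ==> scal W = scal V ==> gr W = gr V ==> graded W"
 unfolding graded_def by simp

lemma gens_cong: "gens V G e dg ==> scal W = scal V ==> gr W = gr V ==> gens W G e dg"
 unfolding gens_def by simp

lemma graded_tensor_dga: "graded A ==> graded B ==> graded (tensor_dga A B)"
 by (rule graded_cong[OF graded_tensor]) auto

lemma gens_tensor_dga:
 assumes "graded A" "graded B"
 shows "gens (tensor_dga A B) (letters A \<times> letters B) (%(a, b). tns A B (snd a) (snd b)) (%(a, b). fst a + fst b)"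
 by (rule gens_cong[OF gens_tensor]) (use assms in \<open>auto intro: graded_vector_space gens_letters\<close>)

lemma tns_gr:
 assumes "graded V" "graded W" "v \<in> gr V i" "w \<in> gr W j"
 shows "tns V W v w \<in> gr (tensor_cplx V W) (i + j)"
 using gens_base[OF gens_tensor[OF _ _ gens_letters[OF assms(1)] gens_letters[OF assms(2)]], of "((i, v), (j, w))"]
  assms(3,4) by (simp add: graded_vector_space[OF assms(1)] graded_vector_space[OF assms(2)] vector_space_fscal)

text \<open>
 The Koszul sign in the product is what makes the sign of the differential consistent; both
 sides of each axiom are compared on pure tensors of letters.
\<close>

lemma dga_tensor:
 assumes A: "dga A" and B: "dga B"
 shows "dga (tensor_dga A B)"
proof -
 note gA = dga_graded[OF A] and gB = dga_graded[OF B]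
 note vs = graded_vector_space[OF gA] graded_vector_space[OF gB]
 have dA: "dg_space A" and dB: "dg_space B" using A B unfolding dga_def by auto
 obtain d where d: "flin d"
  "!!v w. v \<in> letters A ==> w \<in> letters B ==>
   d (tns A B (snd v) (snd w)) = tns A B (diff A (snd v)) (snd w) + sg (fst v) (tns A B (snd v) (diff B (snd w)))"
  "!!u. u \<in> homog (tensor_cplx A B) ==> diff (tensor_cplx A B) u = d u"
  using tensor_diff[OF dA dB] by blast
 obtain m where m: "!!v. flin (m v)" "!!w. flin (%v. m v w)"
  "!!a b a' b'. a \<in> letters A ==> b \<in> letters B ==> a' \<in> letters A ==> b' \<in> letters B ==>
   m (tns A B (snd a) (snd b)) (tns A B (snd a') (snd b'))
   = sg (fst b * fst a') (tns A B (mul A (snd a) (snd a')) (mul B (snd b) (snd b')))"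
  "!!u v. u \<in> homog (tensor_cplx A B) ==> v \<in> homog (tensor_cplx A B) ==> mul (tensor_dga A B) u v = m u v"
  using tensor_mul[OF A B] by blast
 \<comment> \<open>The same formulas with degrees as separate data.\<close>
 have d': "d (tns A B a b) = tns A B (diff A a) b + sg i (tns A B a (diff B b))"
  if "a \<in> gr A i" "b \<in> gr B j" for a b i j
  using d(2)[of "(i, a)" "(j, b)"] that by simp
 have m': "m (tns A B a b) (tns A B a' b') = sg (j * k) (tns A B (mul A a a') (mul B b b'))"
  if "a \<in> gr A i" "b \<in> gr B j" "a' \<in> gr A k" "b' \<in> gr B l" for a b a' b' i j k l
  using m(3)[of "(i, a)" "(j, b)" "(k, a')" "(l, b')"] that by simp
 note gi = dga_diff_gr[OF A] dga_diff_gr[OF B] dga_mul_gr[OF A] dga_mul_gr[OF B]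
 note lin = linear_plus[OF d(1)] linear_plus[OF m(1)] linear_plus[OF m(2)] linear_sg[OF d(1)] linear_sg[OF m(1)] linear_sg[OF m(2)]
  linear_plus[OF linear_tns_left[OF vs]] linear_plus[OF linear_tns_right[OF vs]] tns_simps[OF vs]
 note tg = tns_gr[OF gA gB] graded_tensor[OF gA gB]
 show ?thesis
 proof (rule dga_by_generators[OF graded_tensor_dga[OF gA gB] gens_tensor_dga[OF gA gB], where d = d and m = m];
   (elim SigmaE)?; simp only: tensor_dga_simps homog_tensor_dga case_prod_conv)
  show "tns A B (unt A) (unt B) \<in> gr (tensor_cplx A B) 0"
   using tns_gr[OF gA gB dga_unit(1)[OF A] dga_unit(1)[OF B]] by simp
 next
  fix x y assume xy: "x \<in> letters A" "y \<in> letters B"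
  obtain i a j b where g: "x = (i, a)" "y = (j, b)" "a \<in> gr A i" "b \<in> gr B j"
   using xy by (cases x, cases y) auto
  show "d (tns A B (snd x) (snd y)) \<in> gr (tensor_cplx A B) (fst x + fst y + 1)"
   using g tns_gr[OF gA gB gi(1)[OF g(3)] g(4)] tns_gr[OF gA gB g(3) gi(2)[OF g(4)]]
   by (auto simp: d'[OF g(3,4)] algebra_simps intro!: graded_add[OF tg(2)] graded_sg[OF tg(2)])
  show "d (d (tns A B (snd x) (snd y))) = 0"
   using g by (simp add: d'[OF g(3,4)] lin d'[OF gi(1) g(4), OF g(3)] d'[OF g(3) gi(2), OF g(4)]
    dga_diff_diff[OF A g(3)] dga_diff_diff[OF B g(4)]) (simp add: sg_def)
  show "m (tns A B (unt A) (unt B)) (tns A B (snd x) (snd y)) = tns A B (snd x) (snd y)"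
   "m (tns A B (snd x) (snd y)) (tns A B (unt A) (unt B)) = tns A B (snd x) (snd y)"
   using g m'[OF dga_unit(1)[OF A] dga_unit(1)[OF B] g(3,4)] m'[OF g(3,4) dga_unit(1)[OF A] dga_unit(1)[OF B]]
   by (simp_all add: dga_unit[OF A] dga_unit[OF B])
  fix x' y' assume xy': "x' \<in> letters A" "y' \<in> letters B"
  obtain i' a' j' b' where g': "x' = (i', a')" "y' = (j', b')" "a' \<in> gr A i'" "b' \<in> gr B j'"
   using xy' by (cases x', cases y') auto
  show "m (tns A B (snd x) (snd y)) (tns A B (snd x') (snd y')) \<in> gr (tensor_cplx A B) (fst x + fst y + (fst x' + fst y'))"
   using g g' tns_gr[OF gA gB gi(3)[OF g(3) g'(3)] gi(4)[OF g(4) g'(4)]]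
   by (auto simp: m'[OF g(3,4) g'(3,4)] algebra_simps intro!: graded_sg[OF tg(2)])
  show "d (m (tns A B (snd x) (snd y)) (tns A B (snd x') (snd y')))
    = m (d (tns A B (snd x) (snd y))) (tns A B (snd x') (snd y'))
     + sg (fst x + fst y) (m (tns A B (snd x) (snd y)) (d (tns A B (snd x') (snd y'))))"
   using g g'
   by (simp add: m'[OF g(3,4) g'(3,4)] d'[OF g(3,4)] d'[OF g'(3,4)] lin d'[OF gi(3)[OF g(3) g'(3)] gi(4)[OF g(4) g'(4)]]
     m'[OF gi(1)[OF g(3)] g(4) g'(3,4)] m'[OF g(3) gi(2)[OF g(4)] g'(3,4)]
     m'[OF g(3,4) gi(1)[OF g'(3)] g'(4)] m'[OF g(3,4) g'(3) gi(2)[OF g'(4)]]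
     dga_leibniz[OF A g(3) g'(3)] dga_leibniz[OF B g(4) g'(4)] algebra_simps)
    (auto simp: sg_def)
  fix x'' y'' assume xy'': "x'' \<in> letters A" "y'' \<in> letters B"
  obtain i'' a'' j'' b'' where g'': "x'' = (i'', a'')" "y'' = (j'', b'')" "a'' \<in> gr A i''" "b'' \<in> gr B j''"
   using xy'' by (cases x'', cases y'') auto
  show "m (m (tns A B (snd x) (snd y)) (tns A B (snd x') (snd y'))) (tns A B (snd x'') (snd y''))
    = m (tns A B (snd x) (snd y)) (m (tns A B (snd x') (snd y')) (tns A B (snd x'') (snd y'')))"
   using g g' g''
   by (simp add: m'[OF g(3,4) g'(3,4)] m'[OF g'(3,4) g''(3,4)] lin
     m'[OF gi(3)[OF g(3) g'(3)] gi(4)[OF g(4) g'(4)] g''(3,4)]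
     m'[OF g(3,4) gi(3)[OF g'(3) g''(3)] gi(4)[OF g'(4) g''(4)]]
     dga_assoc[OF A g(3) g'(3) g''(3)] dga_assoc[OF B g(4) g'(4) g''(4)] algebra_simps)
 qed (use d m in auto)
qed

section \<open>Signed sums over words\<close>

definition ssum :: "(int \<times> 'w) list => ('w => 'z::ab_group_add) => 'z" where
 "ssum T \<phi> = (\<Sum>(n, w)\<leftarrow>T. sg n (\<phi> w))"

definition sbind :: "(int \<times> 'w) list => ('w => (int \<times> 'v) list) => (int \<times> 'v) list" where
 "sbind T f = concat (map (%(n, w). map (%(m, v). (n + m, v)) (f w)) T)"

lemma ssum_simps [simp]:
 "ssum [] \<phi> = 0" "ssum ((n, w) # T) \<phi> = sg n (\<phi> w) + ssum T \<phi>"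
 "ssum (T @ T') \<phi> = ssum T \<phi> + ssum T' \<phi>"
 by (auto simp: ssum_def)

lemma ssum_sg: "ssum T (%w. sg n (\<phi> w)) = sg n (ssum T \<phi>)"
 by (induction T) (auto simp: add.commute)

lemma ssum_map: "ssum (map (%(n, w). (n + k, f w)) T) \<phi> = sg k (ssum T (%w. \<phi> (f w)))"
 by (induction T) (auto simp: add.commute)

lemma ssum_sbind: "ssum (sbind T f) \<phi> = ssum T (%w. ssum (f w) \<phi>)"
proof (induction T)
 case (Cons a T)
 obtain n w where a: "a = (n, w)" by (cases a)
 have "ssum (map (%(m, v). (n + m, v)) (f w)) \<phi> = sg n (ssum (f w) \<phi>)"
  using ssum_map[of n "%v. v" "f w" \<phi>] by (simp add: add.commute)
 then show ?case using Cons a by (simp add: sbind_def)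
qed (simp add: sbind_def)

lemma ssum_cong: "(!!n w. (n, w) \<in> set T ==> \<phi> w = \<psi> w) ==> ssum T \<phi> = ssum T \<psi>"
 unfolding ssum_def by (intro arg_cong[where f = sum_list] map_cong) auto

lemma ssum_add: "ssum T (%w. \<phi> w + \<psi> w) = ssum T \<phi> + ssum T \<psi>"
 by (induction T) (auto simp: algebra_simps)

lemma ssum_zero: "ssum T (%w. 0) = 0"
 by (induction T) auto

lemma ssum_uminus: "ssum T (%w. - \<phi> w) = - ssum T \<phi>"
 by (induction T) auto

lemma ssum_diff: "ssum T (%w. \<phi> w - \<psi> w) = ssum T \<phi> - ssum T \<psi>"
 by (induction T) (auto simp: algebra_simps)

lemma ssum_swap: "ssum T (%w. ssum T' (\<phi> w)) = ssum T' (%w'. ssum T (%w. \<phi> w w'))"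
 by (induction T) (auto simp: ssum_add ssum_sg ssum_zero)

lemma ssum_linear: "lin s t F ==> F (ssum T \<phi>) = ssum T (%w. F (\<phi> w))"
 by (induction T) (auto simp: linear_0 linear_plus linear_sg)

lemma graded_ssum:
 assumes "graded V" "!!n w. (n, w) \<in> set T ==> \<phi> w \<in> gr V i"
 shows "ssum T \<phi> \<in> gr V i"
 using assms(2)
proof (induction T)
 case (Cons a T)
 obtain n w where a: "a = (n, w)" by (cases a)
 have "\<phi> w \<in> gr V i" by (rule Cons.prems[of n]) (simp add: a)
 moreover have "\<phi> w' \<in> gr V i" if "(n', w') \<in> set T" for n' w' using Cons.prems[of n' w'] that by simp
 then have "ssum T \<phi> \<in> gr V i" by (rule Cons.IH)
 ultimately show ?case by (simp add: a graded_add[OF assms(1)] graded_sg[OF assms(1)])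
qed (simp add: graded_zero[OF assms(1)])

lemma lin1_sg_arg:
 assumes "graded V" "vector_space t" "lin1 V t g" "x \<in> gr V i"
 shows "g (i, sg n x) = sg n (g (i, x))"
proof -
 have "g (i, scal V (ksign n) x) = t (ksign n) (g (i, x))"
  using assms(3,4) unfolding lin1_def lin_on_def by blast
 then show ?thesis by (simp add: scal_sg[OF assms(1)] ksign_sg[OF assms(2)])
qed

lemma lin1_add_arg: "lin1 V t g ==> x \<in> gr V i ==> y \<in> gr V i ==> g (i, x + y) = g (i, x) + g (i, y)"
 unfolding lin1_def lin_on_def by blast

lemma lin1_ssum_arg:
 assumes "graded V" "vector_space t" "lin1 V t g" "!!n w. (n, w) \<in> set T ==> \<phi> w \<in> gr V i"
 shows "g (i, ssum T \<phi>) = ssum T (%w. g (i, \<phi> w))"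
 using assms(4)
proof (induction T)
 case Nil
 then show ?case using lin1_zero[OF assms(1,3,2)] by simp
next
 case (Cons a T)
 obtain n w where a: "a = (n, w)" by (cases a)
 have T: "\<phi> w' \<in> gr V i" if "(n', w') \<in> set T" for n' w' using Cons.prems[of n' w'] that by simp
 have 1: "\<phi> w \<in> gr V i" using Cons.prems[of n w] a by simp
 note 1 = 1 graded_sg[OF assms(1) 1, of n] graded_ssum[OF assms(1) T]
 have "ssum T (%w. g (i, \<phi> w)) = g (i, ssum T \<phi>)" using Cons.IH T by simp
 then show ?case
  using lin1_add_arg[OF assms(3) 1(2,3)] lin1_sg_arg[OF assms(1-3) 1(1)] by (simp add: a)
qed

lemma lin1_ssum:
 assumes "vector_space t" "!!n w. (n, w) \<in> set T ==> lin1 V t (g w)"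
 shows "lin1 V t (%x. ssum T (%w. g w x))"
 using assms(2)
proof (induction T)
 case Nil
 show ?case using lin1_0[OF assms(1)] by simp
next
 case (Cons a T)
 obtain n w where a: "a = (n, w)" by (cases a)
 show ?case unfolding a ssum_simps
  by (intro lin1_add[OF assms(1)] lin1_const_sg[OF assms(1)]) (use Cons a in auto)
qed

subsection \<open>Deconcatenation\<close>

text \<open>All cuts carry the sign exponent \<open>0\<close>, which makes them a list of signed summands.\<close>

primrec cuts :: "'l list => (int \<times> 'l list \<times> 'l list) list" where
 "cuts [] = [(0, [], [])]"
| "cuts (y # Y) = (0, [], y # Y) # map (%(n, U, V). (n + 0, y # U, V)) (cuts Y)"

definition cut_sum :: "'l list => ('l list => 'l list => 'z::ab_group_add) => 'z" where
 "cut_sum Y g = ssum (cuts Y) (%(U, V). g U V)"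

lemma cut_sum_simps [simp]:
 "cut_sum [] g = g [] []"
 "cut_sum (y # Y) g = g [] (y # Y) + cut_sum Y (%U V. g (y # U) V)"
 using ssum_map[of 0 "%(U, V). (y # U, V)" "cuts Y" "%(U, V). g U V"]
 by (auto simp: cut_sum_def case_prod_unfold)

lemma cuts_append: "(n, U, V) \<in> set (cuts Y) ==> Y = U @ V"
 by (induction Y arbitrary: U V n) auto

lemma cut_sum_cong: "(!!U V. Y = U @ V ==> g U V = g' U V) ==> cut_sum Y g = cut_sum Y g'"
 unfolding cut_sum_def by (rule ssum_cong) (auto dest: cuts_append)

lemma cut_sum_sg: "cut_sum Y (%U V. sg n (g U V)) = sg n (cut_sum Y g)"
 and cut_sum_add: "cut_sum Y (%U V. g U V + g' U V) = cut_sum Y g + cut_sum Y g'"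
 and cut_sum_zero: "cut_sum Y (%U V. 0) = 0"
 and cut_sum_uminus: "cut_sum Y (%U V. - g U V) = - cut_sum Y g"
 unfolding cut_sum_def
 by (simp_all add: ssum_sg[symmetric] ssum_add[symmetric] ssum_zero ssum_uminus[symmetric] ssum_diff[symmetric] case_prod_unfold)

lemma cut_sum_swap: "cut_sum X (%U V. cut_sum Y (h U V)) = cut_sum Y (%U' V'. cut_sum X (%U V. h U V U' V'))"
 unfolding cut_sum_def using ssum_swap[of "cuts X" "cuts Y" "%(U, V) (U', V'). h U V U' V'"]
 by (simp add: case_prod_unfold)

lemma cut_sum_ssum: "cut_sum X (%U V. ssum T (h U V)) = ssum T (%w. cut_sum X (%U V. h U V w))"
 unfolding cut_sum_def using ssum_swap[of "cuts X" T "%(U, V) w. h U V w"]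
 by (simp add: case_prod_unfold)

lemma cut_sum_linear: "lin s t F ==> F (cut_sum Y g) = cut_sum Y (%U V. F (g U V))"
 unfolding cut_sum_def by (simp add: ssum_linear case_prod_unfold)

lemma graded_cut_sum: "graded V ==> (!!U W. Y = U @ W ==> g U W \<in> gr V i) ==> cut_sum Y g \<in> gr V i"
 unfolding cut_sum_def by (rule graded_ssum) (auto dest: cuts_append)

lemma lin1_cut_sum_arg:
 assumes "graded V" "vector_space t" "lin1 V t f" "!!U W. Y = U @ W ==> g U W \<in> gr V i"
 shows "f (i, cut_sum Y g) = cut_sum Y (%U W. f (i, g U W))"
 unfolding cut_sum_def
 by (subst lin1_ssum_arg[OF assms(1-3)]) (auto dest: cuts_append simp: assms(4) case_prod_unfold)

lemma lin1_cut_sum: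
 assumes "vector_space t" "!!U W. Y = U @ W ==> lin1 V t (g U W)"
 shows "lin1 V t (%x. cut_sum Y (%U W. g U W x))"
proof -
 have "lin1 V t (%x. ssum (cuts Y) (%w. (%(U, W). g U W) w x))"
  by (rule lin1_ssum[OF assms(1)]) (auto dest: cuts_append simp: assms(2))
 then show ?thesis by (simp add: cut_sum_def case_prod_unfold)
qed

lemma cut_sum_append_Cons:
 "cut_sum (X @ y # Y) g = cut_sum X (%U V. g U (V @ y # Y)) + cut_sum Y (%U V. g (X @ y # U) V)"
 by (induction X arbitrary: g) (auto simp: add.assoc)

lemma cut_sum_coassoc:
 "cut_sum Y (%U V. cut_sum U (%a b. f a b V)) = cut_sum Y (%a V. cut_sum V (%b c. f a b c))"
 by (induction Y arbitrary: f) (auto simp: cut_sum_add add.assoc)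

lemma cut_sum_rev: "cut_sum (rev Y) g = cut_sum Y (%U V. g (rev V) (rev U))"
proof (induction Y arbitrary: g)
 case (Cons y Y)
 have "cut_sum (rev Y @ [y]) g = cut_sum (rev Y) (%U V. g U (V @ [y])) + g (rev Y @ [y]) []"
  by (simp add: cut_sum_append_Cons)
 then show ?case using Cons.IH by (simp add: add.commute)
qed simp

lemma cut_sum_take_drop: "(\<Sum>i\<le>length Y. g (take i Y) (drop i Y)) = cut_sum Y g"
 by (induction Y arbitrary: g) (auto simp: sum.atMost_Suc_shift simp del: sum.atMost_Suc)

lemma cut_sum_first: "(!!U V. Y = U @ V ==> U \<noteq> [] ==> g U V = 0) ==> cut_sum Y g = g [] Y"
proof (cases Y)
 case (Cons y Y')
 assume *: "!!U V. Y = U @ V ==> U \<noteq> [] ==> g U V = 0"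
 have "cut_sum Y' (%U V. g (y # U) V) = cut_sum Y' (%U V. 0)"
  by (rule cut_sum_cong) (simp add: * Cons)
 then show ?thesis by (simp add: Cons cut_sum_zero)
qed simp

lemma cut_sum_last: "(!!U V. Y = U @ V ==> V \<noteq> [] ==> g U V = 0) ==> cut_sum Y g = g Y []"
 using cut_sum_first[of "rev Y" "%U V. g (rev V) (rev U)"] cut_sum_rev[of Y "%U V. g (rev V) (rev U)"]
 by (simp add: rev_swap)

lemma mlin_lists: "mlin V t \<phi> ==> X \<in> lists (letters V) ==> Y \<in> lists (letters V) ==> lin1 V t (%x. \<phi> (X @ x # Y))"
 unfolding mlin_def by blast

lemma mlin_cut_sum:
 assumes t: "vector_space t"
  and 1: "!!U. U \<in> lists (letters V) ==> mlin V t (g U)"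
  and 2: "!!W. W \<in> lists (letters V) ==> mlin V t (%U. g U W)"
 shows "mlin V t (%Y. cut_sum Y g)"
 unfolding mlin_def cut_sum_append_Cons
proof (intro ballI lin1_add[OF t] lin1_cut_sum[OF t])
 fix X Y U W assume XY: "X \<in> lists (letters V)" "Y \<in> lists (letters V)"
 show "lin1 V t (%x. g U (W @ x # Y))" if "X = U @ W"
  using mlin_lists[OF 1, of U W Y] XY that by simp
 show "lin1 V t (%x. g (X @ x # U) W)" if "Y = U @ W"
  using mlin_lists[OF 2, of W X U] XY that by simp
qed

lemma mlin_sg:
 assumes "vector_space t" "mlin V t \<phi>" "!!X Y. map fst X = map fst Y ==> k X = k Y"
 shows "mlin V t (%X. sg (k X) (\<phi> X))"
 unfolding mlin_def
proof (intro ballI)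
 fix X Y assume "X \<in> lists (letters V)" "Y \<in> lists (letters V)"
 from lin1_sg[OF assms(1) mlin_lists[OF assms(2) this], of "%i. k (X @ (i, undefined) # Y)"]
 have "lin1 V t (%x. sg (k (X @ (fst x, undefined) # Y)) (\<phi> (X @ x # Y)))" .
 moreover have "k (X @ (fst x, undefined) # Y) = k (X @ x # Y)" for x by (rule assms(3)) simp
 ultimately show "lin1 V t (%x. sg (k (X @ x # Y)) (\<phi> (X @ x # Y)))" by simp
qed

lemma mlin_const_sg: "vector_space t ==> mlin V t \<phi> ==> mlin V t (%X. sg n (\<phi> X))"
 by (rule mlin_sg) auto

lemma mlin_bd_sg: "vector_space t ==> mlin V t \<phi> ==> mlin V t (%X. sg (k (bd X)) (\<phi> X))"
 by (rule mlin_sg) (auto dest: map_fst_bd)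

lemma mlin_add: "vector_space t ==> mlin V t \<phi> ==> mlin V t \<psi> ==> mlin V t (%X. \<phi> X + \<psi> X)"
 by (simp add: mlin_def lin1_add)

lemma mlin_append:
 assumes "mlin V t \<phi>" "P \<in> lists (letters V)" "Q \<in> lists (letters V)"
 shows "mlin V t (%X. \<phi> (P @ X @ Q))"
 unfolding mlin_def using mlin_lists[OF assms(1), of "P @ _" "_ @ Q"] assms(2,3) by auto

lemma mlin_Cons: "mlin V t \<phi> ==> x \<in> letters V ==> mlin V t (%X. \<phi> (x # X))"
 using mlin_append[of V t \<phi> "[x]" "[]"] by simp

lemma mlin_ssum:
 "vector_space t ==> (!!n w. (n, w) \<in> set T ==> mlin V t (g w)) ==> mlin V t (%X. ssum T (%w. g w X))"
 unfolding mlin_def by (auto intro!: lin1_ssum)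

lemma mlin_linear: "mlin V t \<phi> ==> lin t r F ==> mlin V r (%X. F (\<phi> X))"
 unfolding mlin_def by (intro ballI) (rule lin1_linear[of V t], blast+)

section \<open>The product of words\<close>

definition lbr :: "('m => 'a list => 'm) => int \<times> 'm => (int \<times> 'a) list => int \<times> 'm" where
 "lbr b m X = (fst m + bd X, b (snd m) (map snd X))"

lemma fst_lbr [simp]: "fst (lbr b m X) = fst m + bd X"
 by (simp add: lbr_def)

text \<open>
 The first letter of the left factor takes a segment of the right factor into its brace. The sign
 moves it, and later the remaining left letters, across what precedes them.
\<close>

primrec weaves :: "('a => 'a list => 'a) => (int \<times> 'a) list => (int \<times> 'a) list => (int \<times> (int \<times> 'a) list) list" where
 "weaves b [] Y = [(0, Y)]"
| "weaves b (x # X) Y = sbind (cuts Y) (%(U, V). sbind (cuts V) (%(U', V').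
   map (%(n, W). (n + ((fst x - 1) * bd U + bd X * (bd U + bd U')), U @ lbr b x U' # W)) (weaves b X V')))"

definition weave_sum ::
 "('a => 'a list => 'a) => (int \<times> 'a) list => (int \<times> 'a) list => ((int \<times> 'a) list => 'z::ab_group_add) => 'z" where
 "weave_sum b X Y \<phi> = ssum (weaves b X Y) \<phi>"

lemma weave_sum_Nil [simp]: "weave_sum b [] Y \<phi> = \<phi> Y"
 by (simp add: weave_sum_def)

lemma weave_sum_Cons:
 "weave_sum b (x # X) Y \<phi> = cut_sum Y (%U V. cut_sum V (%U' V'.
   sg ((fst x - 1) * bd U + bd X * (bd U + bd U')) (weave_sum b X V' (%W. \<phi> (U @ lbr b x U' # W)))))"
 by (simp add: weave_sum_def cut_sum_def ssum_sbind case_prod_unfold)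
  (simp add: ssum_map[of _ "%W. _ @ _ # W", simplified case_prod_unfold])

lemma weave_sum_sg: "weave_sum b X Y (%W. sg n (\<phi> W)) = sg n (weave_sum b X Y \<phi>)"
 and weave_sum_add: "weave_sum b X Y (%W. \<phi> W + \<psi> W) = weave_sum b X Y \<phi> + weave_sum b X Y \<psi>"
 and weave_sum_zero: "weave_sum b X Y (%W. 0) = 0"
 by (simp_all add: weave_sum_def ssum_sg ssum_add ssum_zero ssum_uminus ssum_diff)

lemma weave_sum_cut_sum: "weave_sum b X Y (%W. cut_sum Z (h W)) = cut_sum Z (%U V. weave_sum b X Y (%W. h W U V))"
 unfolding weave_sum_def by (simp add: cut_sum_ssum)

lemma weave_sum_swap:
 "weave_sum b X Y (%W. weave_sum b' X' Y' (h W)) = weave_sum b' X' Y' (%W'. weave_sum b X Y (%W. h W W'))"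
 unfolding weave_sum_def by (rule ssum_swap)

lemma weave_sum_linear: "lin s t F ==> F (weave_sum b X Y \<phi>) = weave_sum b X Y (%W. F (\<phi> W))"
 unfolding weave_sum_def by (rule ssum_linear)

text \<open>
 A sign with an exponent that is even or odd by bilinear bookkeeping of degrees; all comparisons
 of signs reduce to propositional logic about parities.
\<close>

lemmas parity = even_add even_mult_iff even_diff even_minus

lemma cut_sum_swap3:
 "cut_sum U (%a b. cut_sum b (%c d. cut_sum V (h a c d)))
  = cut_sum V (%e f. cut_sum U (%a b. cut_sum b (%c d. h a c d e f)))"
 by (simp only: cut_sum_swap[where Y = V])

text \<open>
 The recursion may be started at any letter of the left factor; this makes the product linear in
 each letter and symmetric under reversal.
\<close>

lemma weave_sum_append_Cons:
 "weave_sum b (X @ x # X') Y \<phi> = cut_sum Y (%U V. cut_sum V (%U' V'.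
   sg ((fst x - 1) * bd U + bd X' * (bd U + bd U'))
    (weave_sum b X U (%W. weave_sum b X' V' (%W'. \<phi> (W @ lbr b x U' # W'))))))"
proof (induction X arbitrary: Y \<phi>)
 case Nil
 show ?case by (simp add: weave_sum_Cons)
next
 case (Cons z X)
 let ?f = "%U0 U1 U U' V'. sg ((fst x - 1) * (bd U0 + bd U1 + bd U) + bd X' * (bd U0 + bd U1 + bd U + bd U')
  + ((fst z - 1) * bd U0 + bd X * (bd U0 + bd U1)))
  (weave_sum b X U (%W. weave_sum b X' V' (%W'. \<phi> (U0 @ lbr b z U1 # W @ lbr b x U' # W'))))"
 have "weave_sum b ((z # X) @ x # X') Y \<phi> =
  cut_sum Y (%U0 V0. cut_sum V0 (%U1 V1. cut_sum V1 (%U V. cut_sum V (%U' V'. ?f U0 U1 U U' V'))))"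
  unfolding append_Cons weave_sum_Cons Cons.IH
  by (intro cut_sum_cong) (simp add: cut_sum_sg[symmetric], intro cut_sum_cong sg_cong, auto simp: parity)
 also have "... = cut_sum Y (%U0 V0. cut_sum V0 (%U1V1 V. cut_sum U1V1 (%U1 U. cut_sum V (%U' V'. ?f U0 U1 U U' V'))))"
  by (subst cut_sum_coassoc) simp
 also have "... = cut_sum Y (%U V. cut_sum U (%U0 V0. cut_sum V0 (%U1 U. cut_sum V (%U' V'. ?f U0 U1 U U' V'))))"
  by (subst cut_sum_coassoc) simp
 also have "... = cut_sum Y (%U V. cut_sum V (%U' V'. cut_sum U (%U0 V0. cut_sum V0 (%U1 U. ?f U0 U1 U U' V'))))"
  by (intro cut_sum_cong) (simp only: cut_sum_swap3)
 also have "... = cut_sum Y (%U V. cut_sum V (%U' V'.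
   sg ((fst x - 1) * bd U + bd X' * (bd U + bd U'))
    (weave_sum b (z # X) U (%W. weave_sum b X' V' (%W'. \<phi> (W @ lbr b x U' # W'))))))"
  unfolding weave_sum_Cons
  by (intro cut_sum_cong) (simp add: cut_sum_sg[symmetric], intro cut_sum_cong, simp add: add.assoc)
 finally show ?case .
qed

text \<open>Deconcatenation is multiplicative: a cut of a product of words cuts both factors.\<close>

lemma weave_sum_cut:
 "weave_sum b X Y (%W. cut_sum W g) = cut_sum X (%X1 X2. cut_sum Y (%Y1 Y2.
   sg (bd X2 * bd Y1) (weave_sum b X1 Y1 (%W1. weave_sum b X2 Y2 (g W1)))))"
proof (induction X arbitrary: Y g)
 case Nil
 show ?case by simp
next
 case (Cons x X)
 let ?s = "%U U'. (fst x - 1) * bd U + bd X * (bd U + bd U')"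
 let ?l = "lbr b x"
 have 0: "weave_sum b (x # X) Y (%W. cut_sum W g) =
   cut_sum Y (%U V. cut_sum V (%U' V'. sg (?s U U') (cut_sum U (%U1 U2. weave_sum b X V' (%W. g U1 (U2 @ ?l U' # W))))))
  + cut_sum Y (%U V. cut_sum V (%U' V'. sg (?s U U') (weave_sum b X V' (%W. cut_sum W (%W1 W2. g (U @ ?l U' # W1) W2)))))"
  unfolding weave_sum_Cons cut_sum_append_Cons by (simp add: weave_sum_add cut_sum_add weave_sum_cut_sum)
 have "cut_sum Y (%U V. cut_sum V (%U' V'. sg (?s U U') (cut_sum U (%U1 U2. weave_sum b X V' (%W. g U1 (U2 @ ?l U' # W))))))
  = cut_sum Y (%U V. cut_sum U (%U1 U2. cut_sum V (%U' V'. sg (?s U1 U' + ((fst x - 1) * bd U2 + bd X * bd U2))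
     (weave_sum b X V' (%W. g U1 (U2 @ ?l U' # W))))))"
  by (intro cut_sum_cong, unfold cut_sum_sg[symmetric], subst cut_sum_swap, intro cut_sum_cong sg_cong)
   (auto simp: parity)
 also have "... = cut_sum Y (%Y1 Y2. sg (bd (x # X) * bd Y1) (weave_sum b (x # X) Y2 (g Y1)))"
  unfolding cut_sum_coassoc weave_sum_Cons
  by (intro cut_sum_cong) (simp add: cut_sum_sg[symmetric], intro cut_sum_cong sg_cong, auto simp: parity)
 finally have 1: "cut_sum Y (%U V. cut_sum V (%U' V'. sg (?s U U') (cut_sum U (%U1 U2. weave_sum b X V' (%W. g U1 (U2 @ ?l U' # W))))))
  = cut_sum Y (%Y1 Y2. sg (bd (x # X) * bd Y1) (weave_sum b (x # X) Y2 (g Y1)))" .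
 have "cut_sum Y (%U V. cut_sum V (%U' V'. sg (?s U U') (weave_sum b X V' (%W. cut_sum W (%W1 W2. g (U @ ?l U' # W1) W2)))))
  = cut_sum X (%X1 X2. cut_sum Y (%U V. cut_sum V (%U' V'. cut_sum V' (%Y1 Y2. sg (?s U U' + bd X2 * bd Y1)
    (weave_sum b X1 Y1 (%W1. weave_sum b X2 Y2 (g (U @ ?l U' # W1))))))))"
  unfolding Cons.IH by (simp add: cut_sum_sg[symmetric] cut_sum_swap[where Y = X])
 also have "... = cut_sum X (%X1 X2. cut_sum Y (%Y1 Y2. sg (bd X2 * bd Y1)
   (weave_sum b (x # X1) Y1 (%W1. weave_sum b X2 Y2 (g W1)))))"
 proof (rule cut_sum_cong)
  fix X1 X2 assume X: "X = X1 @ X2"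
  let ?h = "%U U' Y1 Y2. sg (?s U U' + bd X2 * bd Y1) (weave_sum b X1 Y1 (%W1. weave_sum b X2 Y2 (g (U @ ?l U' # W1))))"
  have "cut_sum Y (%U V. cut_sum V (%U' V'. cut_sum V' (?h U U')))
   = cut_sum Y (%U V. cut_sum U (%U U'. cut_sum U' (%U' Y1. ?h U U' Y1 V)))"
   by (simp only: cut_sum_coassoc)
  also have "... = cut_sum Y (%Y1 Y2. sg (bd X2 * bd Y1) (weave_sum b (x # X1) Y1 (%W1. weave_sum b X2 Y2 (g W1))))"
   unfolding weave_sum_Cons
   by (intro cut_sum_cong) (simp add: cut_sum_sg[symmetric], intro cut_sum_cong sg_cong, auto simp: X parity)
  finally show "cut_sum Y (%U V. cut_sum V (%U' V'. cut_sum V' (?h U U')))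
   = cut_sum Y (%Y1 Y2. sg (bd X2 * bd Y1) (weave_sum b (x # X1) Y1 (%W1. weave_sum b X2 Y2 (g W1))))" .
 qed
 finally show ?case using 0 1 by simp
qed

section \<open>Braces as operations on letters\<close>

lemma lists_letters_simps [simp]:
 "[] \<in> lists (letters A)"
 "x # X \<in> lists (letters A) \<longleftrightarrow> x \<in> letters A \<and> X \<in> lists (letters A)"
 "X @ Y \<in> lists (letters A) \<longleftrightarrow> X \<in> lists (letters A) \<and> Y \<in> lists (letters A)"
 by auto

context
 fixes A :: "('k::field, 'a::ab_group_add, 'r) brace_alg_scheme" and M :: "('k, 'm::ab_group_add, 's) dga_scheme"
  and b :: "'m => 'a list => 'm"
 assumes A: "graded A" and M: "graded M" and mult: "brace_multilinear A M b"
begin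

lemma brace_lin_left: "X \<in> lists (letters A) ==> lin_on (scal M) (scal M) (gr M i) (%m. b m (map snd X))"
 using mult map_snd_lists[OF A] unfolding brace_multilinear_def by blast

lemma brace_lin_right:
 assumes "m \<in> gr M j" "X \<in> lists (letters A)" "Y \<in> lists (letters A)"
 shows "lin_on (scal A) (scal M) (gr A i) (%x. b m (map snd X @ x # map snd Y))"
proof -
 have "map snd X \<in> lists (homog A)" "map snd Y \<in> lists (homog A)" using assms map_snd_lists[OF A] by blast+
 then show ?thesis using mult homogI[OF assms(1)] unfolding brace_multilinear_def by blast
qed

lemma brace_zero_left: "X \<in> lists (letters A) ==> b 0 (map snd X) = 0"
 using brace_lin_left[of X 0] graded_zero[OF M, of 0] unfolding lin_on_def by (metis add_cancel_left_left)

lemma brace_zero_right: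
 assumes "m \<in> gr M j" "X \<in> lists (letters A)" "0 \<in> snd ` set X"
 shows "b m (map snd X) = 0"
proof -
 obtain x where "x \<in> set X" "snd x = 0" using assms(3) by force
 then obtain U W i where XU: "X = U @ (i, 0) # W" by (metis prod.collapse split_list)
 then have "lin_on (scal A) (scal M) (gr A i) (%x. b m (map snd U @ x # map snd W))"
  by (intro brace_lin_right[OF assms(1)]) (use assms(2) in auto)
 then have "b m (map snd U @ (0 + 0) # map snd W) = b m (map snd U @ 0 # map snd W) + b m (map snd U @ 0 # map snd W)"
  using graded_zero[OF A, of i] unfolding lin_on_def by blast
 then show ?thesis using XU by simp
qed

lemma lbr_letters:
 assumes "m \<in> letters M" "X \<in> lists (letters A)"
 shows "lbr b m X \<in> letters M"
proof -
 obtain i u where m: "m = (i, u)" "u \<in> gr M i" using assms(1) by (cases m) auto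
 have "b u (map snd X) \<in> gr M (i + bd X)"
 proof (cases "u = 0 \<or> 0 \<in> snd ` set X")
  case True
  then have "b u (map snd X) = 0" using brace_zero_left[OF assms(2)] brace_zero_right[OF m(2) assms(2)] by blast
  then show ?thesis using graded_zero[OF M] by simp
 next
  case False
  have "map (label A) (map snd X) = X"
   using assms(2) False deg_eq[OF A] by (induction X rule: list.induct) (auto simp: label_def)
  then have "bdeg A (map snd X) = bd X" by (metis bdeg_label)
  moreover have "map snd X \<in> lists (homog A)" using assms(2) map_snd_lists[OF A] by blast
  then have "b u (map snd X) \<in> gr M (deg M u + bdeg A (map snd X))"
   using mult homogI[OF m(2)] unfolding brace_multilinear_def by blast
  ultimately show ?thesis using deg_eq[OF M m(2)] False by simp
 qed
 then show ?thesis using m by (simp add: lbr_def)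
qed

lemma letter_map_lbr_left: "X \<in> lists (letters A) ==> letter_map M M (%m. lbr b m X)"
 unfolding letter_map_def
 using lbr_letters[of "(_, _)" X] brace_lin_left[of X]
 by (intro exI[of _ "%i. i + bd X"] exI[of _ "%i m. b m (map snd X)"]) (auto simp: lbr_def)

lemma letter_map_lbr_right:
 assumes "m \<in> letters M" "X \<in> lists (letters A)" "Y \<in> lists (letters A)"
 shows "letter_map A M (%x. lbr b m (X @ x # Y))"
 unfolding letter_map_def
 using lbr_letters[OF assms(1), of "X @ (_, _) # Y"] brace_lin_right[OF snd_letters[OF assms(1)] assms(2,3)] assms(2,3)
 by (intro exI[of _ "%i. fst m + (bd X + (i - 1 + bd Y))"] exI[of _ "%i x. b (snd m) (map snd X @ x # map snd Y)"])
  (auto simp: lbr_def)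

lemma mlin_lbr: "lin1 M t g ==> m \<in> letters M ==> mlin A t (%X. g (lbr b m X))"
 unfolding mlin_def by (auto intro: lin1_letter_map[OF letter_map_lbr_right])

end

definition ldiff :: "('k, 'v, 'r) dgv_scheme => int \<times> 'v => int \<times> 'v" where
 "ldiff V x = (fst x + 1, diff V (snd x))"

definition lmul :: "('k, 'v, 'r) dga_scheme => int \<times> 'v => int \<times> 'v => int \<times> 'v" where
 "lmul A x y = (fst x + fst y, mul A (snd x) (snd y))"

lemma fst_ldiff_lmul [simp]: "fst (ldiff V x) = fst x + 1" "fst (lmul A x y) = fst x + fst y"
 by (simp_all add: ldiff_def lmul_def)

text \<open>The differential of the tensor coalgebra; each summand creates exactly one new letter.\<close>

primrec diffs :: "('k, 'v, 'r) dga_scheme => (int \<times> 'v) list => (int \<times> (int \<times> 'v) list) list" where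
 "diffs A [] = []"
| "diffs A (x # X) = (1, ldiff A x # X) # map (%(n, W). (n + (fst x - 1), x # W)) (diffs A X)
   @ (case X of [] => [] | y # X' => [(fst x, lmul A x y # X')])"

definition diff_sum ::
 "('k, 'v, 'r) dga_scheme => (int \<times> 'v) list => ((int \<times> 'v) list => 'z::ab_group_add) => 'z" where
 "diff_sum A X \<phi> = ssum (diffs A X) \<phi>"

lemma diff_sum_simps [simp]:
 "diff_sum A [] \<phi> = 0"
 "diff_sum A (x # X) \<phi> = - \<phi> (ldiff A x # X) + sg (fst x - 1) (diff_sum A X (%W. \<phi> (x # W)))
   + (case X of [] => 0 | y # X' => sg (fst x) (\<phi> (lmul A x y # X')))"
proof -
 show "diff_sum A [] \<phi> = 0" by (simp add: diff_sum_def)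
 show "diff_sum A (x # X) \<phi> = - \<phi> (ldiff A x # X) + sg (fst x - 1) (diff_sum A X (%W. \<phi> (x # W)))
   + (case X of [] => 0 | y # X' => sg (fst x) (\<phi> (lmul A x y # X')))"
  unfolding diff_sum_def diffs.simps ssum_simps ssum_map
  by (cases X) (simp_all add: sg_def)
qed

lemma diff_sum_sg: "diff_sum A X (%W. sg n (\<phi> W)) = sg n (diff_sum A X \<phi>)"
 and diff_sum_add: "diff_sum A X (%W. \<phi> W + \<psi> W) = diff_sum A X \<phi> + diff_sum A X \<psi>"
 and diff_sum_zero: "diff_sum A X (%W. 0) = 0"
 and diff_sum_uminus: "diff_sum A X (%W. - \<phi> W) = - diff_sum A X \<phi>"
 by (simp_all add: diff_sum_def ssum_sg ssum_add ssum_zero ssum_uminus ssum_diff)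

lemma diff_sum_linear: "lin s t F ==> F (diff_sum A X \<phi>) = diff_sum A X (%W. F (\<phi> W))"
 unfolding diff_sum_def by (rule ssum_linear)

definition bar_term :: "('k, 'v, 'r) dga_scheme => (int \<times> 'v) list => (int \<times> 'v => 'z::ab_group_add) => 'z" where
 "bar_term A B \<psi> = (case B of [x] => - \<psi> (ldiff A x) | [x, y] => sg (fst x) (\<psi> (lmul A x y)) | _ => 0)"

lemma bar_term_simps [simp]:
 "bar_term A [] \<psi> = 0" "bar_term A [x] \<psi> = - \<psi> (ldiff A x)"
 "bar_term A [x, y] \<psi> = sg (fst x) (\<psi> (lmul A x y))" "bar_term A (x # y # z # B) \<psi> = 0"
 by (simp_all add: bar_term_def)

lemma bar_term_long: "length B \<ge> 3 ==> bar_term A B \<psi> = 0"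
 by (auto simp: numeral_3_eq_3 Suc_le_length_iff)

text \<open>The bar differential is the coderivation with corestriction \<open>bar_term\<close>.\<close>

lemma diff_sum_cut:
 "diff_sum A X \<phi> = cut_sum X (%U V. cut_sum V (%B V'. sg (bd U) (bar_term A B (%z. \<phi> (U @ z # V')))))"
proof (induction X arbitrary: \<phi>)
 case (Cons x X)
 have first: "cut_sum X (%B V'. bar_term A (x # B) (%z. \<phi> (z # V')))
   = - \<phi> (ldiff A x # X) + (case X of [] => 0 | y # X' => sg (fst x) (\<phi> (lmul A x y # X')))"
 proof (cases X)
  case (Cons y X')
  have "cut_sum X' (%B V'. bar_term A (x # y # B) (%z. \<phi> (z # V'))) = bar_term A [x, y] (%z. \<phi> (z # X'))"
   by (rule cut_sum_first) (auto simp: neq_Nil_conv)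
  then show ?thesis using Cons by simp
 qed simp
 have rest: "cut_sum X (%U V. cut_sum V (%B V'. sg (bd (x # U)) (bar_term A B (%z. \<phi> ((x # U) @ z # V')))))
   = sg (fst x - 1) (diff_sum A X (%W. \<phi> (x # W)))"
  unfolding Cons.IH by (simp add: cut_sum_sg[symmetric])
 show ?case using first rest by (simp add: algebra_simps)
qed simp

primrec mid_sum :: "'l list => ('l list => 'l => 'l list => 'z::ab_group_add) => 'z" where
 "mid_sum [] g = 0"
| "mid_sum (x # X) g = g [] x X + mid_sum X (%U. g (x # U))"

lemma mid_sum_cong: "(!!U x V. X = U @ x # V ==> g U x V = g' U x V) ==> mid_sum X g = mid_sum X g'"
proof (induction X arbitrary: g g')
 case (Cons x X)
 have "mid_sum X (%U. g (x # U)) = mid_sum X (%U. g' (x # U))" by (rule Cons.IH) (simp add: Cons.prems)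
 then show ?case using Cons.prems[of "[]" x X] by simp
qed simp

lemma mid_sum_sg: "mid_sum X (%U x V. sg n (g U x V)) = sg n (mid_sum X g)"
 by (induction X arbitrary: g) auto

lemma mid_sum_cut_sum: "mid_sum X (%U x V. cut_sum Y (h U x V)) = cut_sum Y (%P Q. mid_sum X (%U x V. h U x V P Q))"
 by (induction X arbitrary: h) (auto simp: cut_sum_add cut_sum_zero)

lemma cut_sum_single:
 "cut_sum X (%U V. cut_sum V (%B V'. case B of [x] => g U x V' | _ => 0)) = mid_sum X g"
proof (induction X arbitrary: g)
 case (Cons x X)
 have "cut_sum X (%B V'. case x # B of [x] => g [] x V' | _ => 0) = (case [x] of [x] => g [] x X | _ => 0)"
  by (rule cut_sum_first) (auto simp: neq_Nil_conv)
 then show ?case using Cons.IH[of "%U. g (x # U)"] by simp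
qed simp

text \<open>
 A marked letter \<open>z\<close> of the right factor either stands alone in the product, or it lies in the
 brace of exactly one letter of the left factor.
\<close>

lemma weave_sum_insert:
 "weave_sum b X (U @ z # V) \<phi> =
   cut_sum X (%X1 X2. sg (bd X2 * (bd U + (fst z - 1)))
    (weave_sum b X1 U (%W. weave_sum b X2 V (%W'. \<phi> (W @ z # W')))))
  + mid_sum X (%X1 x X2. cut_sum U (%U1 U2. cut_sum V (%V1 V2.
    sg ((fst x - 1) * bd U1 + bd X2 * (bd U + (fst z - 1) + bd V1))
    (weave_sum b X1 U1 (%W. weave_sum b X2 V2 (%W'. \<phi> (W @ lbr b x (U2 @ z # V1) # W')))))))"
proof (induction X arbitrary: U V \<phi>)
 case (Cons x X)
 let ?s = "fst x - 1" and ?z = "fst z - 1"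
 let ?e = "%P P'. ?s * bd P + bd X * (bd P + bd P')"
 have 0: "weave_sum b (x # X) (U @ z # V) \<phi> =
   cut_sum U (%U1 U2. cut_sum U2 (%P R. sg (?s * bd U1 + bd X * (bd U1 + bd P))
     (weave_sum b X (R @ z # V) (%W. \<phi> (U1 @ lbr b x P # W)))))
  + cut_sum U (%U1 U2. cut_sum V (%V1 V2. sg (?s * bd U1 + bd X * (bd U1 + bd (U2 @ z # V1)))
     (weave_sum b X V2 (%W. \<phi> (U1 @ lbr b x (U2 @ z # V1) # W)))))
  + cut_sum V (%V1 V2. cut_sum V2 (%P R. sg (?s * bd (U @ z # V1) + bd X * (bd (U @ z # V1) + bd P))
     (weave_sum b X R (%W. \<phi> ((U @ z # V1) @ lbr b x P # W)))))"
  unfolding weave_sum_Cons cut_sum_append_Cons cut_sum_add by (simp add: add.assoc)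
 have 1: "cut_sum V (%V1 V2. cut_sum V2 (%P R. sg (?s * bd (U @ z # V1) + bd X * (bd (U @ z # V1) + bd P))
     (weave_sum b X R (%W. \<phi> ((U @ z # V1) @ lbr b x P # W)))))
   = sg (bd (x # X) * (bd U + ?z)) (weave_sum b (x # X) V (%W'. \<phi> (U @ z # W')))"
  unfolding weave_sum_Cons cut_sum_sg[symmetric]
  by (intro cut_sum_cong) (simp, intro sg_cong, auto simp: parity)
 have 2: "cut_sum U (%U1 U2. cut_sum V (%V1 V2. sg (?s * bd U1 + bd X * (bd U1 + bd (U2 @ z # V1)))
     (weave_sum b X V2 (%W. \<phi> (U1 @ lbr b x (U2 @ z # V1) # W)))))
   = cut_sum U (%U1 U2. cut_sum V (%V1 V2. sg (?s * bd U1 + bd X * (bd U + ?z + bd V1))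
     (weave_sum b X V2 (%W. \<phi> (U1 @ lbr b x (U2 @ z # V1) # W)))))"
  by (intro cut_sum_cong sg_cong) (auto simp: parity)
 let ?\<phi> = "%U1 P W. \<phi> (U1 @ lbr b x P # W)"
 have 3: "cut_sum U (%U1 U2. cut_sum U2 (%P R. sg (?s * bd U1 + bd X * (bd U1 + bd P))
     (weave_sum b X (R @ z # V) (?\<phi> U1 P))))
  = cut_sum U (%U1 U2. cut_sum U2 (%P R. sg (?s * bd U1 + bd X * (bd U1 + bd P))
    (cut_sum X (%X1 X2. sg (bd X2 * (bd R + ?z)) (weave_sum b X1 R (%W. weave_sum b X2 V (%W'. ?\<phi> U1 P (W @ z # W'))))))))
  + cut_sum U (%U1 U2. cut_sum U2 (%P R. sg (?s * bd U1 + bd X * (bd U1 + bd P))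
    (mid_sum X (%X1 y X2. cut_sum R (%R1 R2. cut_sum V (%V1 V2. sg ((fst y - 1) * bd R1 + bd X2 * (bd R + ?z + bd V1))
     (weave_sum b X1 R1 (%W. weave_sum b X2 V2 (%W'. ?\<phi> U1 P (W @ lbr b y (R2 @ z # V1) # W'))))))))))"
  unfolding Cons.IH by (simp add: cut_sum_add)
 have 4: "cut_sum U (%U1 U2. cut_sum U2 (%P R. sg (?s * bd U1 + bd X * (bd U1 + bd P))
    (cut_sum X (%X1 X2. sg (bd X2 * (bd R + ?z)) (weave_sum b X1 R (%W. weave_sum b X2 V (%W'. ?\<phi> U1 P (W @ z # W'))))))))
  = cut_sum X (%X1 X2. sg (bd X2 * (bd U + ?z)) (weave_sum b (x # X1) U (%W. weave_sum b X2 V (%W'. \<phi> (W @ z # W')))))"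
  unfolding weave_sum_Cons cut_sum_sg[symmetric] cut_sum_swap[where Y = X]
  by (intro cut_sum_cong) (simp, intro sg_cong, auto simp: parity)
 have 5: "cut_sum U (%U1 U2. cut_sum U2 (%P R. sg (?s * bd U1 + bd X * (bd U1 + bd P))
    (mid_sum X (%X1 y X2. cut_sum R (%R1 R2. cut_sum V (%V1 V2. sg ((fst y - 1) * bd R1 + bd X2 * (bd R + ?z + bd V1))
     (weave_sum b X1 R1 (%W. weave_sum b X2 V2 (%W'. ?\<phi> U1 P (W @ lbr b y (R2 @ z # V1) # W'))))))))))
  = mid_sum X (%X1 y X2. cut_sum U (%U1 U2. cut_sum U2 (%P R. cut_sum R (%R1 R2. cut_sum V (%V1 V2.
    sg (?s * bd U1 + bd X * (bd U1 + bd P) + ((fst y - 1) * bd R1 + bd X2 * (bd R + ?z + bd V1)))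
     (weave_sum b X1 R1 (%W. weave_sum b X2 V2 (%W'. ?\<phi> U1 P (W @ lbr b y (R2 @ z # V1) # W')))))))))"
  by (simp add: mid_sum_sg[symmetric] cut_sum_sg[symmetric] mid_sum_cut_sum)
 have 6: "... = mid_sum X (%X1 y X2. cut_sum U (%U1 U2. cut_sum V (%V1 V2.
    sg ((fst y - 1) * bd U1 + bd X2 * (bd U + ?z + bd V1))
    (weave_sum b (x # X1) U1 (%W. weave_sum b X2 V2 (%W'. \<phi> (W @ lbr b y (U2 @ z # V1) # W')))))))"
 proof (rule mid_sum_cong)
  fix X1 y X2 assume X: "X = X1 @ y # X2"
  let ?h = "%U1 P R1 R2 V1 V2. sg (?s * bd U1 + bd X * (bd U1 + bd P) + ((fst y - 1) * bd R1 + bd X2 * (bd R1 + bd R2 + ?z + bd V1)))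
     (weave_sum b X1 R1 (%W. weave_sum b X2 V2 (%W'. ?\<phi> U1 P (W @ lbr b y (R2 @ z # V1) # W'))))"
  have "cut_sum U (%U1 U2. cut_sum U2 (%P R. cut_sum R (%R1 R2. cut_sum V (%V1 V2.
    sg (?s * bd U1 + bd X * (bd U1 + bd P) + ((fst y - 1) * bd R1 + bd X2 * (bd R + ?z + bd V1)))
     (weave_sum b X1 R1 (%W. weave_sum b X2 V2 (%W'. ?\<phi> U1 P (W @ lbr b y (R2 @ z # V1) # W'))))))))
   = cut_sum U (%U1 U2. cut_sum U2 (%P R. cut_sum R (%R1 R2. cut_sum V (?h U1 P R1 R2))))"
   by (intro cut_sum_cong) (simp add: add.assoc)
  also have "... = cut_sum U (%U1 R2. cut_sum U1 (%U1 U2. cut_sum U2 (%P R1. cut_sum V (?h U1 P R1 R2))))"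
   by (simp only: cut_sum_coassoc)
  also have "... = cut_sum U (%U1 U2. cut_sum V (%V1 V2.
    sg ((fst y - 1) * bd U1 + bd X2 * (bd U + ?z + bd V1))
    (weave_sum b (x # X1) U1 (%W. weave_sum b X2 V2 (%W'. \<phi> (W @ lbr b y (U2 @ z # V1) # W'))))))"
   unfolding weave_sum_Cons cut_sum_sg[symmetric] cut_sum_swap[where Y = V]
   by (intro cut_sum_cong) (simp, intro sg_cong, auto simp: parity X)
  finally show "cut_sum U (%U1 U2. cut_sum U2 (%P R. cut_sum R (%R1 R2. cut_sum V (%V1 V2.
    sg (?s * bd U1 + bd X * (bd U1 + bd P) + ((fst y - 1) * bd R1 + bd X2 * (bd R + ?z + bd V1)))
     (weave_sum b X1 R1 (%W. weave_sum b X2 V2 (%W'. ?\<phi> U1 P (W @ lbr b y (R2 @ z # V1) # W'))))))))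
   = cut_sum U (%U1 U2. cut_sum V (%V1 V2.
    sg ((fst y - 1) * bd U1 + bd X2 * (bd U + ?z + bd V1))
    (weave_sum b (x # X1) U1 (%W. weave_sum b X2 V2 (%W'. \<phi> (W @ lbr b y (U2 @ z # V1) # W'))))))" .
 qed
 show ?case unfolding 0 1 2 3 4 5 6 by (simp add: algebra_simps)
qed simp

primrec bterms :: "('k, 'v, 'r) dga_scheme => (int \<times> 'v) list => (int \<times> int \<times> 'v) list" where
 "bterms A [] = []"
| "bterms A (x # B) = (case B of [] => [(1, ldiff A x)] | y # B' => if B' = [] then [(fst x, lmul A x y)] else [])"

lemma bar_term_ssum: "bar_term A B \<psi> = ssum (bterms A B) \<psi>"
 by (auto simp: bar_term_def sg_def split: list.splits)

lemma bar_term_sg: "bar_term A B (%z. sg n (\<psi> z)) = sg n (bar_term A B \<psi>)"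
 and bar_term_add: "bar_term A B (%z. \<phi> z + \<psi> z) = bar_term A B \<phi> + bar_term A B \<psi>"
 and bar_term_cut_sum: "bar_term A B (%z. cut_sum X (h z)) = cut_sum X (%U V. bar_term A B (%z. h z U V))"
 and bar_term_weave_sum: "bar_term A B (%z. weave_sum b X Y (k z)) = weave_sum b X Y (%W. bar_term A B (%z. k z W))"
 by (simp_all add: bar_term_ssum ssum_sg ssum_add cut_sum_ssum weave_sum_def ssum_swap[of "bterms A B"])

lemma bar_term_mid_sum: "bar_term A B (%z. mid_sum X (h z)) = mid_sum X (%U x V. bar_term A B (%z. h z U x V))"
 by (induction X arbitrary: h) (auto simp: bar_term_add bar_term_ssum ssum_zero)

lemma weave_sum_diff_sum: "weave_sum b X Y (%W. diff_sum A Z (h W)) = diff_sum A Z (%w. weave_sum b X Y (%W. h W w))"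
 unfolding weave_sum_def diff_sum_def by (rule ssum_swap)

lemma sbind_mem: "(k, v) \<in> set (sbind T f) ==> \<exists>n w m. (n, w) \<in> set T \<and> (m, v) \<in> set (f w)"
 by (fastforce simp: sbind_def)

lemma mlin_cut_sum_const:
 assumes "vector_space t" "!!U W. Y = U @ W ==> mlin V t (%X. g X U W)"
 shows "mlin V t (%X. cut_sum Y (g X))"
proof -
 have "mlin V t (%X. ssum (cuts Y) (%w. (%(U, W). g X U W) w))"
  by (rule mlin_ssum[OF assms(1)]) (auto dest: cuts_append simp: assms(2))
 then show ?thesis by (simp add: cut_sum_def)
qed

lemma lin1_weave_sum:
 "vector_space t ==> (!!n W. (n, W) \<in> set (weaves b X Y) ==> lin1 V t (g W)) ==> lin1 V t (%x. weave_sum b X Y (%W. g W x))"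
 unfolding weave_sum_def by (rule lin1_ssum)

lemma mlin_weave_sum:
 "vector_space t ==> (!!n W. (n, W) \<in> set (weaves b X Y) ==> mlin V t (g W)) ==> mlin V t (%Z. weave_sum b X Y (%W. g W Z))"
 unfolding weave_sum_def by (rule mlin_ssum)

locale brace_ops =
 fixes A :: "('k::field, 'a::ab_group_add, 'r) brace_alg_scheme"
 assumes dgaA: "dga A" and multi: "brace_multilinear A A (brc A)"
  and brc_Nil: "!!x. x \<in> homog A ==> brc A x [] = x"
begin

abbreviation "L \<equiv> lists (letters A)"
abbreviation "bl \<equiv> lbr (brc A)"
abbreviation "ws \<equiv> weave_sum (brc A)"

lemmas gA = dga_graded[OF dgaA]

lemma bl_Nil: "x \<in> letters A ==> bl x [] = x"
 using brc_Nil[OF homogI[OF snd_letters[of x]]] by (simp add: lbr_def)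

lemma bl_letters: "x \<in> letters A ==> X \<in> L ==> bl x X \<in> letters A"
 by (rule lbr_letters[OF gA gA multi])

lemma ldiff_letters: "x \<in> letters A ==> ldiff A x \<in> letters A"
 using dga_diff_gr[OF dgaA snd_letters] by (simp add: ldiff_def)

lemma lmul_letters: "x \<in> letters A ==> y \<in> letters A ==> lmul A x y \<in> letters A"
 using dga_mul_gr[OF dgaA snd_letters snd_letters] by (simp add: lmul_def)

lemma weaves_mem:
 "(n, W) \<in> set (weaves (brc A) X Y) ==> X \<in> L ==> Y \<in> L ==>
   W \<in> L \<and> bd W = bd X + bd Y \<and> length X \<le> length W"
proof (induction X arbitrary: n W Y)
 case (Cons x X)
 obtain U V U' V' n' W' where W: "W = U @ bl x U' # W'" "Y = U @ V" "V = U' @ V'" "(n', W') \<in> set (weaves (brc A) X V')"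
  using Cons.prems(1) by (auto dest!: sbind_mem cuts_append)
 then have "W' \<in> L \<and> bd W' = bd X + bd V' \<and> length X \<le> length W'"
  using Cons.IH[OF W(4)] Cons.prems(2,3) by simp
 then show ?case using W Cons.prems(2,3) bl_letters by simp
qed simp

lemma ws_cong:
 "X \<in> L ==> Y \<in> L ==> (!!W. W \<in> L ==> bd W = bd X + bd Y ==> length X \<le> length W ==> \<phi> W = \<psi> W) ==> ws X Y \<phi> = ws X Y \<psi>"
 unfolding weave_sum_def by (rule ssum_cong) (auto dest!: weaves_mem)

lemma ws_Nil_right: "X \<in> L ==> ws X [] \<phi> = \<phi> X"
 by (induction X arbitrary: \<phi> rule: list.induct) (auto simp: weave_sum_Cons bl_Nil)

lemma lin1_bl: "lin1 A t g ==> Y \<in> L ==> lin1 A t (%x. g (bl x Y))"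
 by (rule lin1_letter_map[OF letter_map_lbr_left[OF gA gA multi]])

lemma mlin_bl: "lin1 A t g ==> x \<in> letters A ==> mlin A t (%X. g (bl x X))"
 by (rule mlin_lbr[OF gA gA multi])

lemma mlin_append_left: "mlin A t \<phi> ==> P \<in> L ==> mlin A t (%X. \<phi> (P @ X))"
 using mlin_append[of A t \<phi> P "[]"] by simp

lemma mlin_append_right: "mlin A t \<phi> ==> Q \<in> L ==> mlin A t (%X. \<phi> (X @ Q))"
 using mlin_append[of A t \<phi> "[]" Q] by simp

lemma mlin_ws_right:
 assumes t: "vector_space t"
 shows "mlin A t \<phi> ==> X \<in> L ==> mlin A t (%Y. ws X Y \<phi>)"
proof (induction X arbitrary: \<phi>)
 case (Cons x X)
 note W = weaves_mem[THEN conjunct1]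
 have 1: "mlin A t (%V'. sg n (ws X V' (%W. \<phi> (U @ bl x U' # W))))" if "U \<in> L" "U' \<in> L" for U U' n
  using Cons.IH[of "%W. \<phi> ((U @ [bl x U']) @ W)"] mlin_append_left[OF Cons.prems(1), of "U @ [bl x U']"] that Cons.prems(2)
  by (intro mlin_const_sg[OF t]) (simp add: bl_letters)
 have 2: "mlin A t (%U'. sg ((fst x - 1) * bd U + bd X * (bd U + bd U')) (ws X V' (%W. \<phi> (U @ bl x U' # W))))"
  if "U \<in> L" "V' \<in> L" for U V'
  by (rule mlin_bd_sg[OF t, where k = "%i. (fst x - 1) * bd U + bd X * (bd U + i)"], rule mlin_weave_sum[OF t], rule mlin_bl)
   (use W[of _ _ X V'] that Cons.prems in \<open>auto intro: mlin_lists\<close>)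
 have 3: "mlin A t (%U. sg ((fst x - 1) * bd U + bd X * (bd U + bd U')) (ws X V' (%W. \<phi> (U @ bl x U' # W))))"
  if "U' \<in> L" "V' \<in> L" for U' V'
  by (rule mlin_bd_sg[OF t, where k = "%i. (fst x - 1) * i + bd X * (i + bd U')"], rule mlin_weave_sum[OF t], rule mlin_append_right)
   (use W[of _ _ X V'] that Cons.prems bl_letters in auto)
 show ?case unfolding weave_sum_Cons
 proof (rule mlin_cut_sum[OF t])
  show "mlin A t (%V. cut_sum V (%U' V'. sg ((fst x - 1) * bd U + bd X * (bd U + bd U')) (ws X V' (%W. \<phi> (U @ bl x U' # W)))))"
   if "U \<in> L" for U
   by (rule mlin_cut_sum[OF t 1[OF that] 2[OF that]])
  show "mlin A t (%U. cut_sum V (%U' V'. sg ((fst x - 1) * bd U + bd X * (bd U + bd U')) (ws X V' (%W. \<phi> (U @ bl x U' # W)))))"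
   if "V \<in> L" for V
   by (rule mlin_cut_sum_const[OF t 3]) (use that in auto)
 qed
qed simp

lemma mlin_ws_left:
 assumes t: "vector_space t" and \<phi>: "mlin A t \<phi>" and Y: "Y \<in> L"
 shows "mlin A t (%X. ws X Y \<phi>)"
 unfolding mlin_def weave_sum_append_Cons
proof (intro ballI lin1_cut_sum[OF t])
 fix P Q U V U' V' assume *: "P \<in> L" "Q \<in> L" "Y = U @ V" "V = U' @ V'"
 have "lin1 A t (%x. ws P U (%W. ws Q V' (%W'. \<phi> (W @ bl x U' # W'))))"
  by (intro lin1_weave_sum[OF t] lin1_bl mlin_lists[OF \<phi>])
   (use * Y weaves_mem[of _ _ P U] weaves_mem[of _ _ Q V'] in auto)
 from lin1_sg[OF t this, of "%i. (i - 1) * bd U + bd Q * (bd U + bd U')"]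
 show "lin1 A t (%x. sg ((fst x - 1) * bd U + bd Q * (bd U + bd U')) (ws P U (%W. ws Q V' (%W'. \<phi> (W @ bl x U' # W')))))" .
qed

lemma bar_term_cong:
 assumes "B \<in> L" "!!z. z \<in> letters A ==> fst z = bd B + 2 ==> \<phi> z = \<psi> z"
 shows "bar_term A B \<phi> = bar_term A B \<psi>"
proof -
 consider "B = []" | x where "B = [x]" | x y where "B = [x, y]" | "length B \<ge> 3"
  by (cases B; cases "tl B"; cases "tl (tl B)") auto
 then show ?thesis
 proof cases
  case (2 x)
  then have "\<phi> (ldiff A x) = \<psi> (ldiff A x)" using assms(1) by (intro assms(2) ldiff_letters) auto
  then show ?thesis using 2 by simp
 next
  case (3 x y)
  then have "\<phi> (lmul A x y) = \<psi> (lmul A x y)" using assms(1) by (intro assms(2) lmul_letters) auto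
  then show ?thesis using 3 by simp
 qed (simp_all add: bar_term_long)
qed

lemma diffs_mem: "(n, W) \<in> set (diffs A X) ==> X \<in> L ==> W \<in> L \<and> bd W = bd X + 1"
proof (induction X arbitrary: n W)
 case (Cons x X)
 from Cons.prems(1) consider "W = ldiff A x # X" | n' W' where "W = x # W'" "(n', W') \<in> set (diffs A X)"
  | y X' where "X = y # X'" "W = lmul A x y # X'"
  by (auto split: list.splits)
 then show ?case
  by cases (use Cons.prems(2) Cons.IH ldiff_letters lmul_letters in \<open>auto simp del: letters_iff\<close>)
qed simp

lemma diff_sum_cong:
 "X \<in> L ==> (!!W. W \<in> L ==> bd W = bd X + 1 ==> \<phi> W = \<psi> W) ==> diff_sum A X \<phi> = diff_sum A X \<psi>"
 unfolding diff_sum_def by (rule ssum_cong) (auto dest!: diffs_mem)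

lemma lin1_ldiff: "lin1 A t g ==> lin1 A t (%x. g (ldiff A x))"
 unfolding ldiff_def by (rule lin1_letter_map[OF graded_map_letter_map[OF dga_diff_map[OF dgaA]]])

lemma lin1_lmul_left: "lin1 A t g ==> y \<in> letters A ==> lin1 A t (%x. g (lmul A x y))"
 unfolding lmul_def by (rule lin1_letter_map[OF lin1_mul(1)[OF dgaA snd_letters]])

lemma lin1_lmul_right: "lin1 A t g ==> y \<in> letters A ==> lin1 A t (%x. g (lmul A y x))"
 unfolding lmul_def using lin1_letter_map[OF lin1_mul(2)[OF dgaA snd_letters], of y t g] by (simp add: add.commute)

lemma mlin_diff_sum:
 assumes t: "vector_space t"
 shows "mlin A t \<phi> ==> mlin A t (%X. diff_sum A X \<phi>)"
 unfolding mlin_def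
proof (intro ballI)
 fix P Q :: "(int \<times> 'a) list" assume "P \<in> L" "Q \<in> L"
 moreover assume "\<forall>X\<in>L. \<forall>Y\<in>L. lin1 A t (%x. \<phi> (X @ x # Y))"
 then have "mlin A t \<phi>" by (simp add: mlin_def)
 ultimately show "lin1 A t (%x. diff_sum A (P @ x # Q) \<phi>)"
 proof (induction P arbitrary: \<phi> rule: list.induct)
  case Nil
  have 0: "lin1 A t (%x. \<phi> (x # W))" if "W \<in> L" for W
   using mlin_lists[OF Nil(3), of "[]" W] that by simp
  have 1: "lin1 A t (%x. diff_sum A Q (%W. \<phi> (x # W)))"
   unfolding diff_sum_def
  proof (rule lin1_ssum[OF t])
   show "lin1 A t (%x. \<phi> (x # W))" if "(n, W) \<in> set (diffs A Q)" for n W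
    using 0 diffs_mem[OF that Nil(2)] by blast
  qed
  have 2: "lin1 A t (%x. case Q of [] => 0 | y # X' => sg (fst x) (\<phi> (lmul A x y # X')))"
  proof (cases Q)
   case (Cons y X')
   then show ?thesis
    using lin1_sg[OF t lin1_lmul_left[OF 0, of X' y], of "%i. i"] Nil(2) by simp
  qed (simp add: lin1_0[OF t])
  show ?case unfolding append_Nil diff_sum_simps
   by (intro lin1_add[OF t] lin1_uminus[OF t] lin1_sg[OF t, where h = "%i. i - 1"] 1 2 lin1_ldiff 0 Nil(2))
 next
  case (Cons p P)
  have IH: "lin1 A t (%x. diff_sum A (P @ x # Q) (%W. \<phi> (p # W)))"
   using Cons.IH Cons.prems mlin_Cons[OF Cons.prems(3), of p] by simp
  have 1: "lin1 A t (%x. \<phi> (ldiff A p # P @ x # Q))"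
   using mlin_lists[OF Cons.prems(3), of "ldiff A p # P" Q] Cons.prems ldiff_letters by simp
  have 2: "lin1 A t (%x. case P @ x # Q of [] => 0 | y # X' => sg (fst p) (\<phi> (lmul A p y # X')))"
  proof (cases P)
   case Nil
   then show ?thesis
    using lin1_lmul_right[of t "%x. \<phi> (x # Q)" p] mlin_lists[OF Cons.prems(3), of "[]" Q] Cons.prems
    by (auto intro!: lin1_const_sg[OF t])
  next
   case (Cons y P')
   then show ?thesis
    using mlin_lists[OF \<open>mlin A t \<phi>\<close>, of "lmul A p y # P'" Q] \<open>p # P \<in> L\<close> \<open>Q \<in> L\<close> lmul_letters
    by (auto intro!: lin1_const_sg[OF t])
  qed
  show ?case unfolding append_Cons diff_sum_simps
   by (intro lin1_add[OF t] lin1_uminus[OF t] lin1_const_sg[OF t] IH 1 2)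
 qed
qed

end

section \<open>Brace algebras and modules in terms of letters\<close>

definition lhom :: "('a => 'm) => int \<times> 'a => int \<times> 'm" where
 "lhom h x = (fst x, h (snd x))"

lemma fst_lhom [simp]: "fst (lhom h x) = fst x"
 by (simp add: lhom_def)

lemma lhom_id [simp]: "lhom id x = x"
 by (simp add: lhom_def)

text \<open>
 The axioms shared by brace algebras and brace modules, for letters. The tail is the element \<open>m\<close>
 whose braces are taken.
\<close>

locale brace_tail = brace_ops A
 for A :: "('k::field, 'a::ab_group_add, 'r) brace_alg_scheme" +
 fixes M :: "('k, 'm::ab_group_add, 's) dga_scheme" and h :: "'a => 'm" and b :: "'m => 'a list => 'm"
 assumes dgaM: "dga M" and multiM: "brace_multilinear A M b" and h: "graded_map A M 0 h"
  and b_Nil: "!!m. m \<in> homog M ==> b m [] = m"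
  and tail_assoc: "!!m X Y. m \<in> letters M ==> X \<in> lists (letters A) ==> Y \<in> lists (letters A) ==>
   b (b (snd m) (map snd X)) (map snd Y) = weave_sum (brc A) X Y (%W. b (snd m) (map snd W))"
  and tail_dist: "!!m m' Y. m \<in> letters M ==> m' \<in> letters M ==> Y \<in> lists (letters A) ==>
   b (mul M (snd m) (snd m')) (map snd Y)
    = cut_sum Y (%U V. sg (fst m' * bd U) (mul M (b (snd m) (map snd U)) (b (snd m') (map snd V))))"
  and tail_homot: "!!m Y. m \<in> letters M ==> Y \<in> lists (letters A) ==> Y \<noteq> [] ==>
   diff M (b (snd m) (map snd Y)) = b (diff M (snd m)) (map snd Y)
    + sg (fst m) (diff_sum A Y (%W. b (snd m) (map snd W)))
    - sg ((fst (hd Y) - 1) * fst m) (mul M (h (snd (hd Y))) (b (snd m) (map snd (tl Y))))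
    + sg (fst m + bd (butlast Y)) (mul M (b (snd m) (map snd (butlast Y))) (h (snd (last Y))))"
begin

abbreviation "bm \<equiv> lbr b"
abbreviation "lh \<equiv> lhom h"

lemmas gM = dga_graded[OF dgaM]

lemma bm_letters: "m \<in> letters M ==> X \<in> L ==> bm m X \<in> letters M"
 by (rule lbr_letters[OF gA gM multiM])

lemma bm_Nil: "m \<in> letters M ==> bm m [] = m"
 using b_Nil[OF homogI[OF snd_letters[of m]]] by (simp add: lbr_def)

lemma lin1_bm: "lin1 M t g ==> Y \<in> L ==> lin1 M t (%x. g (bm x Y))"
 by (rule lin1_letter_map[OF letter_map_lbr_left[OF gA gM multiM]])

lemma mlin_bm: "lin1 M t g ==> m \<in> letters M ==> mlin A t (%X. g (bm m X))"
 by (rule mlin_lbr[OF gA gM multiM])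

lemma ldiffM_letters: "x \<in> letters M ==> ldiff M x \<in> letters M"
 using dga_diff_gr[OF dgaM snd_letters] by (simp add: ldiff_def)

lemma lmulM_letters: "x \<in> letters M ==> y \<in> letters M ==> lmul M x y \<in> letters M"
 using dga_mul_gr[OF dgaM snd_letters snd_letters] by (simp add: lmul_def)

lemma lh_letters: "x \<in> letters A ==> lh x \<in> letters M"
 using graded_map_mem[OF h snd_letters] by (simp add: lhom_def)

lemma lin1_ldiffM: "lin1 M t g ==> lin1 M t (%x. g (ldiff M x))"
 unfolding ldiff_def by (rule lin1_letter_map[OF graded_map_letter_map[OF dga_diff_map[OF dgaM]]])

lemma lin1_lmulM_left: "lin1 M t g ==> y \<in> letters M ==> lin1 M t (%x. g (lmul M x y))"
 unfolding lmul_def by (rule lin1_letter_map[OF lin1_mul(1)[OF dgaM snd_letters]])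

lemma lin1_lmulM_right: "lin1 M t g ==> y \<in> letters M ==> lin1 M t (%x. g (lmul M y x))"
 unfolding lmul_def using lin1_letter_map[OF lin1_mul(2)[OF dgaM snd_letters], of y t g] by (simp add: add.commute)

lemma lin1_lh: "lin1 M t g ==> lin1 A t (%x. g (lh x))"
 unfolding lhom_def using lin1_letter_map[OF graded_map_letter_map[OF h], of t g] by simp

text \<open>The axioms, tested on a linear function \<open>g\<close>.\<close>

lemma bm_bm:
 assumes t: "vector_space t" and g: "lin1 M t g" and m: "m \<in> letters M" and XY: "X \<in> L" "Y \<in> L"
 shows "g (bm (bm m X) Y) = ws X Y (%W. g (bm m W))"
proof -
 have "g (bm (bm m X) Y) = g (fst m + (bd X + bd Y), ssum (weaves (brc A) X Y) (%W. b (snd m) (map snd W)))"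
  using tail_assoc[OF m XY] by (simp add: lbr_def weave_sum_def add.assoc)
 also have "... = ssum (weaves (brc A) X Y) (%W. g (fst m + (bd X + bd Y), b (snd m) (map snd W)))"
 proof (rule lin1_ssum_arg[OF gM t g])
  fix n W assume "(n, W) \<in> set (weaves (brc A) X Y)"
  from weaves_mem[OF this XY] show "b (snd m) (map snd W) \<in> gr M (fst m + (bd X + bd Y))"
   using snd_letters[OF bm_letters[OF m, of W]] by (simp add: lbr_def)
 qed
 also have "... = ws X Y (%W. g (bm m W))"
  unfolding weave_sum_def by (rule ssum_cong) (use weaves_mem[OF _ XY] in \<open>auto simp: lbr_def\<close>)
 finally show ?thesis .
qed

lemma bm_lmul:
 assumes t: "vector_space t" and g: "lin1 M t g" and m: "m \<in> letters M" "m' \<in> letters M" and Y: "Y \<in> L"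
 shows "g (bm (lmul M m m') Y) = cut_sum Y (%U V. sg (fst m' * bd U) (g (lmul M (bm m U) (bm m' V))))"
proof -
 have *: "mul M (b (snd m) (map snd U)) (b (snd m') (map snd V)) \<in> gr M (fst m + fst m' + bd Y)" if "Y = U @ V" for U V
  using snd_letters[OF lmulM_letters[OF bm_letters bm_letters], OF m(1) _ m(2), of U V] that Y
  by (simp add: lmul_def lbr_def algebra_simps)
 have "g (bm (lmul M m m') Y)
  = g (fst m + fst m' + bd Y, cut_sum Y (%U V. sg (fst m' * bd U) (mul M (b (snd m) (map snd U)) (b (snd m') (map snd V)))))"
  using tail_dist[OF m Y] by (simp add: lbr_def lmul_def)
 also have "... = cut_sum Y (%U V. g (fst m + fst m' + bd Y, sg (fst m' * bd U) (mul M (b (snd m) (map snd U)) (b (snd m') (map snd V)))))"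
  by (rule lin1_cut_sum_arg[OF gM t g]) (rule graded_sg[OF gM *])
 also have "... = cut_sum Y (%U V. sg (fst m' * bd U) (g (lmul M (bm m U) (bm m' V))))"
  by (intro cut_sum_cong, subst lin1_sg_arg[OF gM t g *]) (auto simp: lmul_def lbr_def algebra_simps)
 finally show ?thesis .
qed

lemma ldiff_bm:
 assumes t: "vector_space t" and g: "lin1 M t g" and m: "m \<in> letters M" and Y: "Y \<in> L" "Y \<noteq> []"
 shows "g (ldiff M (bm m Y)) = g (bm (ldiff M m) Y) + sg (fst m) (diff_sum A Y (%W. g (bm m W)))
  - sg ((fst (hd Y) - 1) * fst m) (g (lmul M (lh (hd Y)) (bm m (tl Y))))
  + sg (fst m + bd (butlast Y)) (g (lmul M (bm m (butlast Y)) (lh (last Y))))"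
proof -
 let ?n = "fst m + bd Y + 1"
 have ht: "hd Y \<in> letters A" "tl Y \<in> L" "last Y \<in> letters A" "butlast Y \<in> L"
  using Y by (auto simp: in_lists_conv_set dest: in_set_butlastD list.set_sel(2) simp del: letters_iff)
 have bdh: "bd Y = fst (hd Y) - 1 + bd (tl Y)" using Y(2) by (cases Y) auto
 have bdl: "bd Y = bd (butlast Y) + (fst (last Y) - 1)"
  using Y(2) bd_simps(3)[of "butlast Y" "[last Y]"] by simp
 have 1: "b (diff M (snd m)) (map snd Y) \<in> gr M ?n"
  using snd_letters[OF bm_letters[OF ldiffM_letters[OF m] Y(1)]] by (simp add: lbr_def ldiff_def algebra_simps)
 have 2: "b (snd m) (map snd W) \<in> gr M ?n" if "(n, W) \<in> set (diffs A Y)" for n W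
  using snd_letters[OF bm_letters[OF m, of W]] diffs_mem[OF that Y(1)] by (simp add: lbr_def algebra_simps)
 have 3: "mul M (h (snd (hd Y))) (b (snd m) (map snd (tl Y))) \<in> gr M ?n"
  using snd_letters[OF lmulM_letters[OF lh_letters[OF ht(1)] bm_letters[OF m ht(2)]]]
  unfolding bdh by (simp add: lmul_def lbr_def lhom_def algebra_simps)
 have 4: "mul M (b (snd m) (map snd (butlast Y))) (h (snd (last Y))) \<in> gr M ?n"
  using snd_letters[OF lmulM_letters[OF bm_letters[OF m ht(4)] lh_letters[OF ht(3)]]]
  unfolding bdl by (simp add: lmul_def lbr_def lhom_def algebra_simps)
 note S = graded_sg[OF gM] and add = lin1_add_arg[OF g]
 let ?D = "ssum (diffs A Y) (%W. b (snd m) (map snd W))"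
 have D: "?D \<in> gr M ?n" by (rule graded_ssum[OF gM 2])
 have gD: "g (?n, ?D) = diff_sum A Y (%W. g (bm m W))"
 proof -
  have "g (?n, ?D) = ssum (diffs A Y) (%W. g (?n, b (snd m) (map snd W)))"
   by (rule lin1_ssum_arg[OF gM t g]) (rule 2)
  also have "... = diff_sum A Y (%W. g (bm m W))"
   unfolding diff_sum_def
   by (rule ssum_cong) (use diffs_mem[OF _ Y(1)] in \<open>auto simp: lbr_def algebra_simps\<close>)
  finally show ?thesis .
 qed
 have eq: "diff M (b (snd m) (map snd Y)) = b (diff M (snd m)) (map snd Y) + sg (fst m) ?D
    + sg ((fst (hd Y) - 1) * fst m + 1) (mul M (h (snd (hd Y))) (b (snd m) (map snd (tl Y))))
    + sg (fst m + bd (butlast Y)) (mul M (b (snd m) (map snd (butlast Y))) (h (snd (last Y))))"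
  unfolding tail_homot[OF m Y] diff_sum_def by (simp add: sg_def)
 have "g (ldiff M (bm m Y)) = g (?n, diff M (b (snd m) (map snd Y)))"
  by (simp add: ldiff_def lbr_def)
 also have "... = g (?n, b (diff M (snd m)) (map snd Y)) + sg (fst m) (g (?n, ?D))
    + sg ((fst (hd Y) - 1) * fst m + 1) (g (?n, mul M (h (snd (hd Y))) (b (snd m) (map snd (tl Y)))))
    + sg (fst m + bd (butlast Y)) (g (?n, mul M (b (snd m) (map snd (butlast Y))) (h (snd (last Y)))))"
  unfolding eq using 1 D 3 4
  by (simp add: add S graded_add[OF gM] lin1_sg_arg[OF gM t g])
 also have "(?n, b (diff M (snd m)) (map snd Y)) = bm (ldiff M m) Y" by (simp add: lbr_def ldiff_def)
 also have "(?n, mul M (h (snd (hd Y))) (b (snd m) (map snd (tl Y)))) = lmul M (lh (hd Y)) (bm m (tl Y))"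
  by (simp add: lbr_def lmul_def lhom_def bdh)
 also have "(?n, mul M (b (snd m) (map snd (butlast Y))) (h (snd (last Y)))) = lmul M (bm m (butlast Y)) (lh (last Y))"
  by (simp add: lbr_def lmul_def lhom_def bdl)
 finally show ?thesis unfolding gD by (simp add: sg_def)
qed

end

section \<open>The bialgebra of words\<close>

locale brace_alg = brace_tail A A id "brc A"
 for A :: "('k::field, 'a::ab_group_add, 'r) brace_alg_scheme"
begin

text \<open>
 Induction on the left word. The first letter collects a brace of braces, which \<open>bm_bm\<close> expands
 into a product, so that the induction hypothesis applies to the other letters.
\<close>

lemma ws_assoc:
 assumes t: "vector_space t"
 shows "mlin A t \<phi> ==> X \<in> L ==> Y \<in> L ==> Z \<in> L ==> ws X Y (%W. ws W Z \<phi>) = ws Y Z (%W. ws X W \<phi>)"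
proof (induction X arbitrary: Y Z \<phi> rule: list.induct)
 case (Cons x X)
 note XYZ = Cons.prems(2-4)
 let ?s = "fst x - 1"
 let ?K = "%U U' V' Z1 Z2 Z3. sg (?s * (bd U + bd Z1) + bd X * (bd U + bd U' + bd Z1 + bd Z2) + bd U' * bd Z1 + bd V' * (bd Z1 + bd Z2))
   (ws U Z1 (%P. ws U' Z2 (%C. ws V' Z3 (%B. ws X B (%B'. \<phi> (P @ bl x C # B'))))))"
 have "ws (x # X) Y (%W. ws W Z \<phi>) = cut_sum Y (%U V. cut_sum V (%U' V'.
   cut_sum Z (%Z1 R. cut_sum R (%Z2 Z3. ?K U U' V' Z1 Z2 Z3))))"
  unfolding weave_sum_Cons
 proof (intro cut_sum_cong)
  fix U V U' V' assume Y: "Y = U @ V" "V = U' @ V'"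
  have L: "U \<in> L" "U' \<in> L" "V' \<in> L" "x \<in> letters A" "X \<in> L" using XYZ Y by auto
  have 1: "ws (U @ bl x U' # W) Z \<phi> = cut_sum Z (%Z1 R. cut_sum R (%Z2 Z3.
    sg ((?s + bd U') * bd Z1 + (bd X + bd V') * (bd Z1 + bd Z2))
     (ws U Z1 (%P. ws W Z3 (%B. ws U' Z2 (%C. \<phi> (P @ bl x C # B)))))))"
   if W: "W \<in> L" "bd W = bd X + bd V'" for W
   unfolding weave_sum_append_Cons
  proof (intro cut_sum_cong)
   fix Z1 R Z2 Z3 assume Z: "Z = Z1 @ R" "R = Z2 @ Z3"
   have L': "Z1 \<in> L" "Z2 \<in> L" "Z3 \<in> L" using XYZ Z by auto
   have "ws U Z1 (%P. ws W Z3 (%B. \<phi> (P @ bl (bl x U') Z2 # B)))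
     = ws U Z1 (%P. ws W Z3 (%B. ws U' Z2 (%C. \<phi> (P @ bl x C # B))))"
    by (intro ws_cong bm_bm[OF t, where g = "%z. \<phi> (_ @ z # _)"] mlin_lists[OF Cons.prems(1)] L L' W)
   then show "sg ((fst (bl x U') - 1) * bd Z1 + bd W * (bd Z1 + bd Z2)) (ws U Z1 (%P. ws W Z3 (%B. \<phi> (P @ bl (bl x U') Z2 # B))))
    = sg ((?s + bd U') * bd Z1 + (bd X + bd V') * (bd Z1 + bd Z2))
     (ws U Z1 (%P. ws W Z3 (%B. ws U' Z2 (%C. \<phi> (P @ bl x C # B)))))"
    using W by (simp add: algebra_simps)
  qed
  have 2: "ws X V' (%W. ws U Z1 (%P. ws W Z3 (%B. ws U' Z2 (%C. \<phi> (P @ bl x C # B)))))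
    = ws U Z1 (%P. ws U' Z2 (%C. ws V' Z3 (%B. ws X B (%B'. \<phi> (P @ bl x C # B')))))"
   if Z: "Z1 \<in> L" "Z2 \<in> L" "Z3 \<in> L" for Z1 Z2 Z3
  proof -
   have "ws X V' (%W. ws U Z1 (%P. ws W Z3 (%B. ws U' Z2 (%C. \<phi> (P @ bl x C # B)))))
     = ws U Z1 (%P. ws U' Z2 (%C. ws X V' (%W. ws W Z3 (%B. \<phi> (P @ bl x C # B)))))"
    by (subst weave_sum_swap, subst (2) weave_sum_swap, subst (3) weave_sum_swap) (rule refl)
   also have "... = ws U Z1 (%P. ws U' Z2 (%C. ws V' Z3 (%B. ws X B (%B'. \<phi> (P @ bl x C # B')))))"
   proof (intro ws_cong L Z Cons.IH)
    fix P C assume "P \<in> L" "C \<in> L"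
    then show "mlin A t (%B. \<phi> (P @ bl x C # B))"
     using mlin_append_left[OF Cons.prems(1), of "P @ [bl x C]"] bl_letters L by simp
   qed
   finally show ?thesis .
  qed
  have "ws X V' (%W. ws (U @ bl x U' # W) Z \<phi>) = ws X V' (%W. cut_sum Z (%Z1 R. cut_sum R (%Z2 Z3.
    sg ((?s + bd U') * bd Z1 + (bd X + bd V') * (bd Z1 + bd Z2))
     (ws U Z1 (%P. ws W Z3 (%B. ws U' Z2 (%C. \<phi> (P @ bl x C # B))))))))"
   by (intro ws_cong L 1)
  also have "... = cut_sum Z (%Z1 R. cut_sum R (%Z2 Z3. sg ((?s + bd U') * bd Z1 + (bd X + bd V') * (bd Z1 + bd Z2))
     (ws U Z1 (%P. ws U' Z2 (%C. ws V' Z3 (%B. ws X B (%B'. \<phi> (P @ bl x C # B'))))))))"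
   unfolding weave_sum_cut_sum weave_sum_sg
   by (intro cut_sum_cong arg_cong[where f = "sg _"] 2) (use XYZ in auto)
  finally show "sg (?s * bd U + bd X * (bd U + bd U')) (ws X V' (%W. ws (U @ bl x U' # W) Z \<phi>))
    = cut_sum Z (%Z1 R. cut_sum R (%Z2 Z3. ?K U U' V' Z1 Z2 Z3))"
   by (simp add: cut_sum_sg[symmetric]) (intro cut_sum_cong sg_cong, auto simp: parity)
 qed
 also have "... = cut_sum Y (%U V. cut_sum Z (%Z1 R. cut_sum V (%U' V'. cut_sum R (%Z2 Z3. ?K U U' V' Z1 Z2 Z3))))"
  by (intro cut_sum_cong) (rule cut_sum_swap)
 also have "... = ws Y Z (%W. ws (x # X) W \<phi>)"
  unfolding weave_sum_Cons weave_sum_cut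
 proof (intro cut_sum_cong)
  fix U V Z1 R assume YZ: "Y = U @ V" "Z = Z1 @ R"
  have "ws U Z1 (%P. cut_sum V (%U' V'. cut_sum R (%Z2 Z3. sg (bd V' * bd Z2)
    (ws U' Z2 (%C. ws V' Z3 (%B. sg (?s * bd P + bd X * (bd P + bd C)) (ws X B (%B'. \<phi> (P @ bl x C # B')))))))))
   = cut_sum V (%U' V'. cut_sum R (%Z2 Z3. sg (bd V' * bd Z2 + (?s * (bd U + bd Z1) + bd X * (bd U + bd Z1 + (bd U' + bd Z2))))
    (ws U Z1 (%P. ws U' Z2 (%C. ws V' Z3 (%B. ws X B (%B'. \<phi> (P @ bl x C # B'))))))))"
   unfolding weave_sum_cut_sum weave_sum_sg
  proof (intro cut_sum_cong)
   fix U' V' Z2 Z3 assume "V = U' @ V'" "R = Z2 @ Z3"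
   then have L: "U \<in> L" "Z1 \<in> L" "U' \<in> L" "Z2 \<in> L" using XYZ YZ by auto
   have "ws U Z1 (%P. ws U' Z2 (%C. sg (?s * bd P + bd X * (bd P + bd C)) (ws V' Z3 (%B. ws X B (%B'. \<phi> (P @ bl x C # B'))))))
    = ws U Z1 (%P. ws U' Z2 (%C. sg (?s * (bd U + bd Z1) + bd X * (bd U + bd Z1 + (bd U' + bd Z2))) (ws V' Z3 (%B. ws X B (%B'. \<phi> (P @ bl x C # B'))))))"
    by (intro ws_cong L) simp
   then show "sg (bd V' * bd Z2) (ws U Z1 (%P. ws U' Z2 (%C. sg (?s * bd P + bd X * (bd P + bd C)) (ws V' Z3 (%B. ws X B (%B'. \<phi> (P @ bl x C # B')))))))
    = sg (bd V' * bd Z2 + (?s * (bd U + bd Z1) + bd X * (bd U + bd Z1 + (bd U' + bd Z2))))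
     (ws U Z1 (%P. ws U' Z2 (%C. ws V' Z3 (%B. ws X B (%B'. \<phi> (P @ bl x C # B'))))))"
    by (simp add: weave_sum_sg)
  qed
  then show "cut_sum V (%U' V'. cut_sum R (%Z2 Z3. ?K U U' V' Z1 Z2 Z3))
   = sg (bd V * bd Z1) (ws U Z1 (%P. cut_sum V (%U' V'. cut_sum R (%Z2 Z3. sg (bd V' * bd Z2)
    (ws U' Z2 (%C. ws V' Z3 (%B. sg (?s * bd P + bd X * (bd P + bd C)) (ws X B (%B'. \<phi> (P @ bl x C # B'))))))))))"
   by (simp add: cut_sum_sg[symmetric]) (intro cut_sum_cong sg_cong, auto simp: parity)
 qed
 finally show ?case .
qed simp

end

lemma cut_sum_middle_Nil:
 "cut_sum X (%U V. cut_sum V (%B V'. if B = [] then g U V' else 0)) = cut_sum X g"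
proof (rule cut_sum_cong)
 fix U V
 show "cut_sum V (%B V'. if B = [] then g U V' else 0) = g U V"
  using cut_sum_first[of V "%B V'. if B = [] then g U V' else 0"] by simp
qed

context brace_alg
begin

text \<open>
 The part of the bar differential of a product that ends in a single letter. All three kinds of
 axioms of a brace algebra that involve the differential or the product are collected here.
\<close>

lemma ws_bar_term:
 assumes t: "vector_space t" and \<psi>: "lin1 A t \<psi>" and X: "X \<in> L" and Y: "Y \<in> L"
 shows "ws X Y (%B. bar_term A B \<psi>) = (if X = [] then bar_term A Y \<psi> else 0) + bar_term A X (%z. \<psi> (bl z Y))
   + (case X of [x] => sg (fst x - 1) (diff_sum A Y (%W. \<psi> (bl x W))) | _ => 0)"
proof -
 consider "X = []" | x where "X = [x]" | x y where "X = [x, y]" | "length X \<ge> 3"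
  by (cases X; cases "tl X"; cases "tl (tl X)") auto
 then show ?thesis
 proof cases
  case (2 x)
  then have x: "x \<in> letters A" using X by simp
  have ws1: "ws [x] Y (%B. bar_term A B \<psi>)
   = cut_sum Y (%U V. cut_sum V (%U' V'. sg ((fst x - 1) * bd U) (bar_term A (U @ bl x U' # V') \<psi>)))"
   by (simp add: weave_sum_Cons)
  show ?thesis
  proof (cases Y rule: rev_cases)
   case Nil
   then show ?thesis by (simp add: 2 weave_sum_Cons bl_Nil x ldiff_letters[OF x])
  next
   case (snoc Y0 v)
   have "Y \<noteq> []" using snoc by simp
   then obtain y Y' where Y': "Y = y # Y'" by (meson neq_Nil_conv)
   have a: "cut_sum Y (%U' V'. bar_term A (bl x U' # V') \<psi>)
     = sg (fst x + bd Y0) (\<psi> (lmul A (bl x Y0) v)) - \<psi> (ldiff A (bl x Y))"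
   proof -
    have "cut_sum Y0 (%U V. bar_term A (bl x U # V @ [v]) \<psi>) = bar_term A (bl x Y0 # [] @ [v]) \<psi>"
     by (rule cut_sum_last) (auto simp: neq_Nil_conv, metis append_is_Nil_conv bar_term_simps(4) list.exhaust not_Cons_self2)
    then show ?thesis by (simp add: snoc cut_sum_append_Cons)
   qed
   have b: "cut_sum Y' (%U V. cut_sum V (%U' V'. sg ((fst x - 1) * bd (y # U)) (bar_term A (y # U @ bl x U' # V') \<psi>)))
     = sg ((fst x - 1) * (fst y - 1) + fst y) (\<psi> (lmul A y (bl x Y')))"
   proof -
    have long: "bar_term A (y # U @ z # V') \<psi> = 0" if "U \<noteq> []" for U V' z
     by (rule bar_term_long) (use that in \<open>cases U, auto\<close>)
    have "cut_sum Y' (%U V. cut_sum V (%U' V'. sg ((fst x - 1) * bd (y # U)) (bar_term A (y # U @ bl x U' # V') \<psi>)))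
     = cut_sum Y' (%U' V'. sg ((fst x - 1) * bd (y # [])) (bar_term A (y # [] @ bl x U' # V') \<psi>))"
     by (rule cut_sum_first) (simp add: long cut_sum_zero)
    also have "... = sg ((fst x - 1) * bd (y # [])) (bar_term A (y # [] @ bl x Y' # []) \<psi>)"
     by (rule cut_sum_last) (auto simp: neq_Nil_conv)
    finally show ?thesis by (simp add: add.commute)
   qed
   have c: "ws [x] Y (%B. bar_term A B \<psi>) = sg (fst x + bd Y0) (\<psi> (lmul A (bl x Y0) v)) - \<psi> (ldiff A (bl x Y))
     + sg ((fst x - 1) * (fst y - 1) + fst y) (\<psi> (lmul A y (bl x Y')))"
    unfolding ws1 using a b by (simp add: Y')
   have d: "\<psi> (ldiff A (bl x Y)) = \<psi> (bl (ldiff A x) Y) + sg (fst x) (diff_sum A Y (%W. \<psi> (bl x W)))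
    - sg ((fst y - 1) * fst x) (\<psi> (lmul A y (bl x Y'))) + sg (fst x + bd Y0) (\<psi> (lmul A (bl x Y0) v))"
    using ldiff_bm[OF t \<psi> x Y] Y' snoc by (metis butlast_snoc last_snoc lhom_id list.distinct(1) list.sel(1,3))
   have e: "sg ((fst x - 1) * (fst y - 1) + fst y) z = - sg ((fst y - 1) * fst x) z"
    "sg (fst x - 1) z = - sg (fst x) z" for z :: 'b
    by (auto simp: sg_def parity)
   show ?thesis unfolding 2 c d by (simp add: e)
  qed
 next
  case (3 x1 x2)
  then have x: "x1 \<in> letters A" "x2 \<in> letters A" using X by auto
  have "ws X Y (%B. bar_term A B \<psi>)
   = cut_sum Y (%U V. cut_sum V (%U' V'. sg ((fst x1 - 1) * bd U + (fst x2 - 1) * (bd U + bd U'))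
     (ws [x2] V' (%W. bar_term A (U @ bl x1 U' # W) \<psi>))))"
   by (simp add: 3 weave_sum_Cons)
  also have "... = cut_sum Y (%U' V'. sg ((fst x1 - 1) * bd ([] :: (int \<times> 'a) list) + (fst x2 - 1) * (bd ([] :: (int \<times> 'a) list) + bd U'))
     (ws [x2] V' (%W. bar_term A ([] @ bl x1 U' # W) \<psi>)))"
  proof (rule cut_sum_first)
   fix U V assume UV: "Y = U @ V" "U \<noteq> []"
   have "ws [x2] V' (%W. bar_term A (U @ bl x1 U' # W) \<psi>) = ws [x2] V' (%W. 0)" if "V = U' @ V'" for U' V'
    by (intro ws_cong bar_term_long) (use UV Y x that in \<open>cases U; auto simp: Suc_le_length_iff\<close>)+
   then have "cut_sum V (%U' V'. sg ((fst x1 - 1) * bd U + (fst x2 - 1) * (bd U + bd U'))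
     (ws [x2] V' (%W. bar_term A (U @ bl x1 U' # W) \<psi>))) = cut_sum V (%U' V'. 0)"
    by (intro cut_sum_cong) (simp add: weave_sum_zero)
   then show "cut_sum V (%U' V'. sg ((fst x1 - 1) * bd U + (fst x2 - 1) * (bd U + bd U'))
     (ws [x2] V' (%W. bar_term A (U @ bl x1 U' # W) \<psi>))) = 0" by (simp add: cut_sum_zero)
  qed
  also have "... = cut_sum Y (%U' V'. sg ((fst x2 - 1) * bd U') (sg (fst x1 + bd U') (\<psi> (lmul A (bl x1 U') (bl x2 V')))))"
  proof (rule cut_sum_cong)
   fix U' V' assume UV: "Y = U' @ V'"
   have "ws [x2] V' (%W. bar_term A (bl x1 U' # W) \<psi>)
    = cut_sum V' (%P Q. cut_sum Q (%P' Q'. sg ((fst x2 - 1) * bd P) (bar_term A (bl x1 U' # P @ bl x2 P' # Q') \<psi>)))"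
    by (simp add: weave_sum_Cons)
   also have "... = cut_sum V' (%P' Q'. sg ((fst x2 - 1) * bd ([] :: (int \<times> 'a) list)) (bar_term A (bl x1 U' # [] @ bl x2 P' # Q') \<psi>))"
    by (rule cut_sum_first) (auto simp: neq_Nil_conv cut_sum_zero bar_term_long)
   also have "... = sg ((fst x2 - 1) * bd ([] :: (int \<times> 'a) list)) (bar_term A (bl x1 U' # [] @ bl x2 V' # []) \<psi>)"
    by (rule cut_sum_last) (auto simp: neq_Nil_conv)
   finally show "sg ((fst x1 - 1) * bd ([] :: (int \<times> 'a) list) + (fst x2 - 1) * (bd ([] :: (int \<times> 'a) list) + bd U')) (ws [x2] V' (%W. bar_term A ([] @ bl x1 U' # W) \<psi>))
    = sg ((fst x2 - 1) * bd U') (sg (fst x1 + bd U') (\<psi> (lmul A (bl x1 U') (bl x2 V'))))"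
    by simp
  qed
  also have "... = sg (fst x1) (\<psi> (bl (lmul A x1 x2) Y))"
   unfolding bm_lmul[OF t \<psi> x Y] cut_sum_sg[symmetric]
   by (intro cut_sum_cong) (simp, intro sg_cong, auto simp: parity)
  finally show ?thesis using 3 by simp
 next
  case 4
  have "ws X Y (%B. bar_term A B \<psi>) = ws X Y (%B. 0)"
   by (intro ws_cong X Y bar_term_long) (use 4 in simp)
  then show ?thesis using 4 bar_term_long[OF 4]
   by (auto simp: weave_sum_zero split: list.splits)
 qed simp
qed

text \<open>
 Both sides are coderivations along the product, so it suffices to compare the letters which they
 create, and this is \<open>ws_bar_term\<close>.
\<close>

lemma ws_diff_sum:
 assumes t: "vector_space t" and \<phi>: "mlin A t \<phi>" and X: "X \<in> L" and Y: "Y \<in> L"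
 shows "ws X Y (%W. diff_sum A W \<phi>)
  = diff_sum A X (%X'. ws X' Y \<phi>) + sg (bd X) (diff_sum A Y (%Y'. ws X Y' \<phi>))"
proof -
 let ?e = "%(X1 :: (int \<times> 'a) list) (X2 :: (int \<times> 'a) list) (X3 :: (int \<times> 'a) list) (Y1 :: (int \<times> 'a) list) (Y2 :: (int \<times> 'a) list). (bd X2 + bd X3) * bd Y1 + bd X3 * bd Y2 + bd X1 + bd Y1"
 let ?w = "%X1 X3 Y1 Y3 F. ws X1 Y1 (%P. ws X3 Y3 (%C. F P C))"
 let ?I = "%X1 (X2 :: (int \<times> 'a) list) X3 Y1 Y2 Y3. if X2 = [] then
   sg (?e X1 [] X3 Y1 Y2) (?w X1 X3 Y1 Y3 (%P C. bar_term A Y2 (%z. \<phi> (P @ z # C)))) else 0"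
 let ?II = "%X1 X2 X3 Y1 Y2 Y3. sg (?e X1 X2 X3 Y1 Y2) (?w X1 X3 Y1 Y3 (%P C. bar_term A X2 (%z. \<phi> (P @ bl z Y2 # C))))"
 let ?III = "%X1 X2 X3 Y1 Y2 Y3. case X2 of [x] =>
   sg (?e X1 [x] X3 Y1 Y2 + (fst x - 1)) (?w X1 X3 Y1 Y3 (%P C. diff_sum A Y2 (%W. \<phi> (P @ bl x W # C)))) | _ => 0"
 have "ws X Y (%W. diff_sum A W \<phi>) = cut_sum X (%X1 X'. cut_sum Y (%Y1 Y'. cut_sum X' (%X2 X3. cut_sum Y' (%Y2 Y3.
   ?I X1 X2 X3 Y1 Y2 Y3 + ?II X1 X2 X3 Y1 Y2 Y3 + ?III X1 X2 X3 Y1 Y2 Y3))))"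
  unfolding diff_sum_cut[of A _ \<phi>] weave_sum_cut
 proof (intro cut_sum_cong)
  fix X1 X' Y1 Y' assume XY: "X = X1 @ X'" "Y = Y1 @ Y'"
  have a: "ws X1 Y1 (%P. cut_sum X' (%X2 X3. cut_sum Y' (%Y2 Y3. sg (bd X3 * bd Y2)
    (ws X2 Y2 (%B. ws X3 Y3 (%C. sg (bd P) (bar_term A B (%z. \<phi> (P @ z # C)))))))))
   = cut_sum X' (%X2 X3. cut_sum Y' (%Y2 Y3. sg (bd X3 * bd Y2 + (bd X1 + bd Y1))
    (ws X1 Y1 (%P. ws X3 Y3 (%C. ws X2 Y2 (%B. bar_term A B (%z. \<phi> (P @ z # C))))))))"
   unfolding weave_sum_cut_sum weave_sum_sg
  proof (intro cut_sum_cong)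
   fix X2 X3 Y2 Y3
   have "ws X1 Y1 (%P. sg (bd P) (ws X2 Y2 (%B. ws X3 Y3 (%C. bar_term A B (%z. \<phi> (P @ z # C))))))
    = ws X1 Y1 (%P. sg (bd X1 + bd Y1) (ws X3 Y3 (%C. ws X2 Y2 (%B. bar_term A B (%z. \<phi> (P @ z # C))))))"
    by (intro ws_cong) (use X Y XY in \<open>auto simp: weave_sum_swap[of _ X2]\<close>)
   then show "sg (bd X3 * bd Y2) (ws X1 Y1 (%P. sg (bd P) (ws X2 Y2 (%B. ws X3 Y3 (%C. bar_term A B (%z. \<phi> (P @ z # C)))))))
    = sg (bd X3 * bd Y2 + (bd X1 + bd Y1)) (ws X1 Y1 (%P. ws X3 Y3 (%C. ws X2 Y2 (%B. bar_term A B (%z. \<phi> (P @ z # C))))))"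
    by (simp add: weave_sum_sg)
  qed
  have b: "sg (bd X' * bd Y1) (sg (bd X3 * bd Y2 + (bd X1 + bd Y1))
    (ws X1 Y1 (%P. ws X3 Y3 (%C. ws X2 Y2 (%B. bar_term A B (%z. \<phi> (P @ z # C)))))))
   = ?I X1 X2 X3 Y1 Y2 Y3 + ?II X1 X2 X3 Y1 Y2 Y3 + ?III X1 X2 X3 Y1 Y2 Y3"
   if XY': "X' = X2 @ X3" "Y' = Y2 @ Y3" for X2 X3 Y2 Y3
  proof -
   have "ws X1 Y1 (%P. ws X3 Y3 (%C. ws X2 Y2 (%B. bar_term A B (%z. \<phi> (P @ z # C)))))
    = ws X1 Y1 (%P. ws X3 Y3 (%C. (if X2 = [] then bar_term A Y2 (%z. \<phi> (P @ z # C)) else 0)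
      + bar_term A X2 (%z. \<phi> (P @ bl z Y2 # C))
      + (case X2 of [x] => sg (fst x - 1) (diff_sum A Y2 (%W. \<phi> (P @ bl x W # C))) | _ => 0)))"
    by (intro ws_cong ws_bar_term[OF t, where \<psi> = "%z. \<phi> (_ @ z # _)"] mlin_lists[OF \<phi>])
     (use X Y XY XY' in auto)
   then show ?thesis
    by (simp add: weave_sum_add weave_sum_zero XY' algebra_simps weave_sum_sg split: list.split)
  qed
  show "sg (bd X' * bd Y1) (ws X1 Y1 (%P. cut_sum X' (%X2 X3. cut_sum Y' (%Y2 Y3. sg (bd X3 * bd Y2)
    (ws X2 Y2 (%B. ws X3 Y3 (%C. sg (bd P) (bar_term A B (%z. \<phi> (P @ z # C))))))))))
   = cut_sum X' (%X2 X3. cut_sum Y' (%Y2 Y3. ?I X1 X2 X3 Y1 Y2 Y3 + ?II X1 X2 X3 Y1 Y2 Y3 + ?III X1 X2 X3 Y1 Y2 Y3))"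
   unfolding a cut_sum_sg[symmetric] by (intro cut_sum_cong) (rule b)
 qed
 also have "... = cut_sum X (%X1 X'. cut_sum X' (%X2 X3. cut_sum Y (%Y1 Y'. cut_sum Y' (%Y2 Y3.
   ?I X1 X2 X3 Y1 Y2 Y3 + ?II X1 X2 X3 Y1 Y2 Y3 + ?III X1 X2 X3 Y1 Y2 Y3))))"
  by (rule cut_sum_cong) (rule cut_sum_swap)
 also have "... = cut_sum X (%X1 X'. cut_sum X' (%X2 X3. cut_sum Y (%Y1 Y'. cut_sum Y' (?I X1 X2 X3 Y1))))
   + cut_sum X (%X1 X'. cut_sum X' (%X2 X3. cut_sum Y (%Y1 Y'. cut_sum Y' (?II X1 X2 X3 Y1))))
   + cut_sum X (%X1 X'. cut_sum X' (%X2 X3. cut_sum Y (%Y1 Y'. cut_sum Y' (?III X1 X2 X3 Y1))))"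
  unfolding cut_sum_add by simp
 finally have 0: "ws X Y (%W. diff_sum A W \<phi>) = cut_sum X (%X1 X'. cut_sum X' (%X2 X3. cut_sum Y (%Y1 Y'. cut_sum Y' (?I X1 X2 X3 Y1))))
   + cut_sum X (%X1 X'. cut_sum X' (%X2 X3. cut_sum Y (%Y1 Y'. cut_sum Y' (?II X1 X2 X3 Y1))))
   + cut_sum X (%X1 X'. cut_sum X' (%X2 X3. cut_sum Y (%Y1 Y'. cut_sum Y' (?III X1 X2 X3 Y1))))" .
 have I: "cut_sum X (%X1 X'. cut_sum X' (%X2 X3. cut_sum Y (%Y1 Y'. cut_sum Y' (?I X1 X2 X3 Y1))))
  = cut_sum X (%X1 X3. cut_sum Y (%Y1 Y'. cut_sum Y' (%Y2 Y3. sg (?e X1 [] X3 Y1 Y2)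
    (?w X1 X3 Y1 Y3 (%P C. bar_term A Y2 (%z. \<phi> (P @ z # C)))))))"
 proof -
  have "cut_sum Y (%Y1 Y'. cut_sum Y' (?I X1 X2 X3 Y1))
   = (if X2 = [] then cut_sum Y (%Y1 Y'. cut_sum Y' (%Y2 Y3. sg (?e X1 [] X3 Y1 Y2)
    (?w X1 X3 Y1 Y3 (%P C. bar_term A Y2 (%z. \<phi> (P @ z # C)))))) else 0)" for X1 X2 X3
   by (simp add: cut_sum_zero)
  then show ?thesis by (simp only: cut_sum_middle_Nil)
 qed
 have III: "cut_sum X (%X1 X'. cut_sum X' (%X2 X3. cut_sum Y (%Y1 Y'. cut_sum Y' (?III X1 X2 X3 Y1))))
  = mid_sum X (%X1 x X3. cut_sum Y (%Y1 Y'. cut_sum Y' (%Y2 Y3. sg (?e X1 [x] X3 Y1 Y2 + (fst x - 1))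
    (?w X1 X3 Y1 Y3 (%P C. diff_sum A Y2 (%W. \<phi> (P @ bl x W # C)))))))"
 proof -
  have "cut_sum Y (%Y1 Y'. cut_sum Y' (?III X1 X2 X3 Y1))
   = (case X2 of [x] => cut_sum Y (%Y1 Y'. cut_sum Y' (%Y2 Y3. sg (?e X1 [x] X3 Y1 Y2 + (fst x - 1))
    (?w X1 X3 Y1 Y3 (%P C. diff_sum A Y2 (%W. \<phi> (P @ bl x W # C)))))) | _ => 0)" for X1 X2 X3
   by (simp add: cut_sum_zero split: list.split)
  then show ?thesis by (simp only: cut_sum_single)
 qed
 have R1: "diff_sum A X (%X'. ws X' Y \<phi>) = cut_sum X (%X1 X'. cut_sum X' (%X2 X3. cut_sum Y (%Y1 Y'. cut_sum Y' (?II X1 X2 X3 Y1))))"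
  unfolding diff_sum_cut
 proof (intro cut_sum_cong)
  fix X1 X' X2 X3 assume X': "X = X1 @ X'" "X' = X2 @ X3"
  have "bar_term A X2 (%z. ws (X1 @ z # X3) Y \<phi>)
   = bar_term A X2 (%z. cut_sum Y (%Y1 Y'. cut_sum Y' (%Y2 Y3. sg ((bd X2 + 1) * bd Y1 + bd X3 * (bd Y1 + bd Y2))
     (?w X1 X3 Y1 Y3 (%P C. \<phi> (P @ bl z Y2 # C))))))"
   unfolding weave_sum_append_Cons
  proof (rule bar_term_cong)
   show "X2 \<in> L" using X X' by simp
   fix z :: "int \<times> 'a" assume "fst z = bd X2 + 2"
   then have "fst z - 1 = bd X2 + 1" by simp
   then show "cut_sum Y (%U V. cut_sum V (%U' V'. sg ((fst z - 1) * bd U + bd X3 * (bd U + bd U'))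
      (?w X1 X3 U V' (%W W'. \<phi> (W @ bl z U' # W')))))
     = cut_sum Y (%Y1 Y'. cut_sum Y' (%Y2 Y3. sg ((bd X2 + 1) * bd Y1 + bd X3 * (bd Y1 + bd Y2))
      (?w X1 X3 Y1 Y3 (%P C. \<phi> (P @ bl z Y2 # C)))))"
    by (simp only:)
  qed
  then show "sg (bd X1) (bar_term A X2 (%z. ws (X1 @ z # X3) Y \<phi>)) = cut_sum Y (%Y1 Y'. cut_sum Y' (?II X1 X2 X3 Y1))"
   unfolding bar_term_cut_sum bar_term_sg bar_term_weave_sum
   by (simp add: cut_sum_sg[symmetric]) (intro cut_sum_cong sg_cong, auto simp: parity)
 qed
 have R2: "sg (bd X) (diff_sum A Y (%Y'. ws X Y' \<phi>))
  = cut_sum X (%X1 X3. cut_sum Y (%Y1 Y'. cut_sum Y' (%Y2 Y3. sg (?e X1 [] X3 Y1 Y2)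
    (?w X1 X3 Y1 Y3 (%P C. bar_term A Y2 (%z. \<phi> (P @ z # C)))))))
  + mid_sum X (%X1 x X3. cut_sum Y (%Y1 Y'. cut_sum Y' (%B Y3. cut_sum Y1 (%P1 P2. cut_sum Y3 (%Q1 Q2.
    sg (bd X1 + bd X3 + (fst x - 1) * (1 + bd P1) + bd P1 + bd P2 + bd X3 * (bd P1 + bd P2 + bd B + 1 + bd Q1))
     (?w X1 X3 P1 Q2 (%P C. bar_term A B (%z. \<phi> (P @ bl x (P2 @ z # Q1) # C)))))))))"
  (is "_ = ?R2a + ?R2b")
 proof -
  have "sg (bd X) (diff_sum A Y (%Y'. ws X Y' \<phi>)) = cut_sum Y (%Y1 Y'. cut_sum Y' (%B Y3.
    cut_sum X (%X1 X3. sg (?e X1 [] X3 Y1 B) (?w X1 X3 Y1 Y3 (%P C. bar_term A B (%z. \<phi> (P @ z # C)))))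
   + mid_sum X (%X1 x X3. cut_sum Y1 (%P1 P2. cut_sum Y3 (%Q1 Q2.
    sg (bd X1 + bd X3 + (fst x - 1) * (1 + bd P1) + bd P1 + bd P2 + bd X3 * (bd P1 + bd P2 + bd B + 1 + bd Q1))
     (?w X1 X3 P1 Q2 (%P C. bar_term A B (%z. \<phi> (P @ bl x (P2 @ z # Q1) # C)))))))))"
   unfolding diff_sum_cut cut_sum_sg[symmetric]
  proof (intro cut_sum_cong)
   fix Y1 Y' B Y3 assume Y': "Y = Y1 @ Y'" "Y' = B @ Y3"
   have "bar_term A B (%z. ws X (Y1 @ z # Y3) \<phi>) = bar_term A B (%z.
     cut_sum X (%X1 X3. sg (bd X3 * (bd Y1 + (bd B + 1))) (?w X1 X3 Y1 Y3 (%P C. \<phi> (P @ z # C))))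
    + mid_sum X (%X1 x X3. cut_sum Y1 (%P1 P2. cut_sum Y3 (%Q1 Q2.
      sg ((fst x - 1) * bd P1 + bd X3 * (bd Y1 + (bd B + 1) + bd Q1))
       (?w X1 X3 P1 Q2 (%P C. \<phi> (P @ bl x (P2 @ z # Q1) # C)))))))"
    unfolding weave_sum_insert
   proof (rule bar_term_cong)
    show "B \<in> L" using Y Y' by simp
    fix z :: "int \<times> 'a" assume "fst z = bd B + 2"
    then have "fst z - 1 = bd B + 1" by simp
    then show "cut_sum X (%X1 X2. sg (bd X2 * (bd Y1 + (fst z - 1))) (?w X1 X2 Y1 Y3 (%W W'. \<phi> (W @ z # W'))))
     + mid_sum X (%X1 x X2. cut_sum Y1 (%U1 U2. cut_sum Y3 (%V1 V2.
       sg ((fst x - 1) * bd U1 + bd X2 * (bd Y1 + (fst z - 1) + bd V1))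
        (?w X1 X2 U1 V2 (%W W'. \<phi> (W @ bl x (U2 @ z # V1) # W'))))))
     = cut_sum X (%X1 X3. sg (bd X3 * (bd Y1 + (bd B + 1))) (?w X1 X3 Y1 Y3 (%P C. \<phi> (P @ z # C))))
     + mid_sum X (%X1 x X3. cut_sum Y1 (%P1 P2. cut_sum Y3 (%Q1 Q2.
       sg ((fst x - 1) * bd P1 + bd X3 * (bd Y1 + (bd B + 1) + bd Q1))
        (?w X1 X3 P1 Q2 (%P C. \<phi> (P @ bl x (P2 @ z # Q1) # C))))))"
     by (simp only:)
   qed
   also have "... = cut_sum X (%X1 X3. sg (bd X3 * (bd Y1 + (bd B + 1))) (?w X1 X3 Y1 Y3 (%P C. bar_term A B (%z. \<phi> (P @ z # C)))))
    + mid_sum X (%X1 x X3. cut_sum Y1 (%P1 P2. cut_sum Y3 (%Q1 Q2.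
      sg ((fst x - 1) * bd P1 + bd X3 * (bd Y1 + (bd B + 1) + bd Q1))
       (?w X1 X3 P1 Q2 (%P C. bar_term A B (%z. \<phi> (P @ bl x (P2 @ z # Q1) # C)))))))"
    by (simp only: bar_term_add bar_term_cut_sum bar_term_mid_sum bar_term_sg bar_term_weave_sum)
   finally have "sg (bd X) (sg (bd Y1) (bar_term A B (%z. ws X (Y1 @ z # Y3) \<phi>))) = sg (bd X) (sg (bd Y1) ...)"
    by (rule arg_cong[where f = "%u. sg (bd X) (sg (bd Y1) u)"])
   then show "sg (bd X) (sg (bd Y1) (bar_term A B (%z. ws X (Y1 @ z # Y3) \<phi>))) = cut_sum X (%X1 X3. sg (?e X1 [] X3 Y1 B) (?w X1 X3 Y1 Y3 (%P C. bar_term A B (%z. \<phi> (P @ z # C)))))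
    + mid_sum X (%X1 x X3. cut_sum Y1 (%P1 P2. cut_sum Y3 (%Q1 Q2.
      sg (bd X1 + bd X3 + (fst x - 1) * (1 + bd P1) + bd P1 + bd P2 + bd X3 * (bd P1 + bd P2 + bd B + 1 + bd Q1))
       (?w X1 X3 P1 Q2 (%P C. bar_term A B (%z. \<phi> (P @ bl x (P2 @ z # Q1) # C)))))))"
    by (rule trans) (unfold sg_simps cut_sum_sg[symmetric] mid_sum_sg[symmetric],
      intro arg_cong2[where f = "(+)"] cut_sum_cong mid_sum_cong sg_cong, auto simp: parity)
  qed
  then show ?thesis by (simp add: cut_sum_add cut_sum_swap[where Y = X] mid_sum_cut_sum)
 qed
 have "?R2b = mid_sum X (%X1 x X3. cut_sum Y (%Y1 Y'. cut_sum Y' (%Y2 Y3. sg (?e X1 [x] X3 Y1 Y2 + (fst x - 1))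
    (?w X1 X3 Y1 Y3 (%P C. diff_sum A Y2 (%W. \<phi> (P @ bl x W # C)))))))"
 proof (rule mid_sum_cong)
  fix X1 x X3
  let ?f = "%P1 P2 B Q1 Q2. sg (bd X1 + bd X3 + (fst x - 1) * (1 + bd P1) + bd P1 + bd P2 + bd X3 * (bd P1 + bd P2 + bd B + 1 + bd Q1))
     (?w X1 X3 P1 Q2 (%P C. bar_term A B (%z. \<phi> (P @ bl x (P2 @ z # Q1) # C))))"
  have "cut_sum Y (%Y1 Y'. cut_sum Y' (%B Y3. cut_sum Y1 (%P1 P2. cut_sum Y3 (?f P1 P2 B))))
   = cut_sum Y (%Y1 Y'. cut_sum Y1 (%P1 P2. cut_sum Y' (%B Y3. cut_sum Y3 (?f P1 P2 B))))"
   by (rule cut_sum_cong) (rule cut_sum_swap)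
  also have "... = cut_sum Y (%P1 Y'. cut_sum Y' (%P2 Y'. cut_sum Y' (%B Y3. cut_sum Y3 (?f P1 P2 B))))"
   by (rule cut_sum_coassoc)
  also have "... = cut_sum Y (%P1 Y'. cut_sum Y' (%Y2 Q2. cut_sum Y2 (%P2 R. cut_sum R (%B Q1. ?f P1 P2 B Q1 Q2))))"
   by (simp only: cut_sum_coassoc)
  also have "... = cut_sum Y (%Y1 Y'. cut_sum Y' (%Y2 Y3. sg (?e X1 [x] X3 Y1 Y2 + (fst x - 1))
    (?w X1 X3 Y1 Y3 (%P C. diff_sum A Y2 (%W. \<phi> (P @ bl x W # C))))))"
   unfolding diff_sum_cut weave_sum_cut_sum weave_sum_sg cut_sum_sg[symmetric]
   by (intro cut_sum_cong) (simp, intro sg_cong, auto simp: parity)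
  finally show "cut_sum Y (%Y1 Y'. cut_sum Y' (%B Y3. cut_sum Y1 (%P1 P2. cut_sum Y3 (?f P1 P2 B)))) = ..." .
 qed
 then show ?thesis unfolding 0 I III R1 R2 by simp
qed

end

section \<open>Words with a module element at the end\<close>

lemma cut_sum_last_two:
 "cut_sum X (%U V. (if V = [] then f U else 0) + (case V of [x] => g U x | _ => 0))
   = f X + (if X = [] then 0 else g (butlast X) (last X))"
proof (cases X rule: rev_cases)
 case (snoc X0 v)
 have "cut_sum X0 (%U V. case V @ [v] of [x] => g U x | _ => 0) = (case [] @ [v] of [x] => g X0 x | _ => 0)"
  by (rule cut_sum_last) (auto simp: neq_Nil_conv split: list.splits)
 then show ?thesis by (simp add: snoc cut_sum_append_Cons add.commute)
qed simp

lemma cut_sum_first_two: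
 assumes "!!x y U V. X = x # y # U @ V ==> g (x # y # U) V = 0"
 shows "cut_sum X g = g [] X + (case X of [] => 0 | x # X' => g [x] X')"
proof (cases X)
 case (Cons x X')
 have "cut_sum X' (%U V. g (x # U) V) = g [x] X'"
  by (rule cut_sum_first[where g = "%U V. g (x # U) V"]) (use assms Cons in \<open>auto simp: neq_Nil_conv\<close>)
 then show ?thesis by (simp add: Cons)
qed simp

lemma cut_sum_butlast:
 "cut_sum Y (%U V. if V = [] then 0 else g U (butlast V) (last V))
   = (if Y = [] then 0 else cut_sum (butlast Y) (%U V. g U V (last Y)))"
 by (cases Y rule: rev_cases) (simp_all add: cut_sum_append_Cons)

lemma diff_sum_cut_sum:
 "diff_sum A Y (%W. cut_sum W g)
   = cut_sum Y (%U V. diff_sum A U (%U'. g U' V) + sg (bd U) (diff_sum A V (%V'. g U V')))"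
proof (induction Y arbitrary: g)
 case (Cons y Y)
 let ?s = "fst y - 1"
 have c: "(case Y of [] => 0 | z # Y' => sg (fst y) (cut_sum (lmul A y z # Y') g))
   = (case Y of [] => 0 | z # Y' => sg (fst y) (g [] (lmul A y z # Y')))
   + cut_sum Y (%U V. case U of [] => 0 | z # U' => sg (fst y) (g (lmul A y z # U') V))"
  by (cases Y) (simp_all add: cut_sum_sg)
 have IH: "sg ?s (diff_sum A Y (%W. cut_sum W (%U. g (y # U))))
   = cut_sum Y (%U V. sg ?s (diff_sum A U (%U'. g (y # U') V)))
   + cut_sum Y (%U V. sg (?s + bd U) (diff_sum A V (g (y # U))))"
  unfolding Cons.IH by (simp add: cut_sum_add cut_sum_sg[symmetric])
 have "diff_sum A (y # Y) (%W. cut_sum W g) = - (g [] (ldiff A y # Y)) - cut_sum Y (%U. g (ldiff A y # U))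
   + sg ?s (diff_sum A Y (%W. g [] (y # W))) + sg ?s (diff_sum A Y (%W. cut_sum W (%U. g (y # U))))
   + (case Y of [] => 0 | z # Y' => sg (fst y) (cut_sum (lmul A y z # Y') g))"
  by (simp add: diff_sum_add del: sg_simps(6) cong: list.case_cong)
 also have "... = diff_sum A (y # Y) (g []) + (cut_sum Y (%U V. - g (ldiff A y # U) V)
   + cut_sum Y (%U V. sg ?s (diff_sum A U (%U'. g (y # U') V)))
   + cut_sum Y (%U V. case U of [] => 0 | z # U' => sg (fst y) (g (lmul A y z # U') V))
   + cut_sum Y (%U V. sg (?s + bd U) (diff_sum A V (g (y # U)))))"
  unfolding c IH cut_sum_uminus by simp
 also have "... = cut_sum (y # Y) (%U V. diff_sum A U (%U'. g U' V) + sg (bd U) (diff_sum A V (%V'. g U V')))"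
  unfolding cut_sum_add[symmetric] by simp
 finally show ?case .
qed simp

locale brace_module = brace_alg A + T: brace_tail A M h b
 for A :: "('k::field, 'a::ab_group_add, 'r) brace_alg_scheme" and M :: "('k, 'm::ab_group_add, 's) dga_scheme"
  and h b +
 assumes hom: "dga_hom A M h"
  and compat: "!!x Y. x \<in> letters A ==> Y \<in> lists (letters A) ==> b (h (snd x)) (map snd Y) = h (brc A (snd x) (map snd Y))"
begin

abbreviation "bM \<equiv> lbr b"
abbreviation "lH \<equiv> lhom h"

lemma bm_lh: "x \<in> letters A ==> Y \<in> L ==> bM (lH x) Y = lH (bl x Y)"
 using compat by (simp add: lbr_def lhom_def)

lemma lmulM_assoc:
 "u \<in> letters M ==> v \<in> letters M ==> w \<in> letters M ==> lmul M (lmul M u v) w = lmul M u (lmul M v w)"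
 using dga_assoc[OF T.dgaM snd_letters snd_letters snd_letters] by (simp add: lmul_def add.assoc)

lemma lmulM_leibniz:
 assumes t: "vector_space t" and \<chi>: "lin1 M t \<chi>" and u: "u \<in> letters M" and v: "v \<in> letters M"
 shows "\<chi> (ldiff M (lmul M u v)) = \<chi> (lmul M (ldiff M u) v) + sg (fst u) (\<chi> (lmul M u (ldiff M v)))"
proof -
 let ?n = "fst u + fst v + 1"
 have 1: "mul M (diff M (snd u)) (snd v) \<in> gr M ?n" "mul M (snd u) (diff M (snd v)) \<in> gr M ?n"
  using snd_letters[OF T.lmulM_letters[OF T.ldiffM_letters[OF u] v]] snd_letters[OF T.lmulM_letters[OF u T.ldiffM_letters[OF v]]]
  by (simp_all add: lmul_def ldiff_def algebra_simps)
 have "\<chi> (ldiff M (lmul M u v)) = \<chi> (?n, mul M (diff M (snd u)) (snd v) + sg (fst u) (mul M (snd u) (diff M (snd v))))"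
  using dga_leibniz[OF T.dgaM snd_letters[OF u] snd_letters[OF v]] by (simp add: ldiff_def lmul_def)
 also have "... = \<chi> (?n, mul M (diff M (snd u)) (snd v)) + sg (fst u) (\<chi> (?n, mul M (snd u) (diff M (snd v))))"
  using lin1_add_arg[OF \<chi> 1(1) graded_sg[OF T.gM 1(2)]] lin1_sg_arg[OF T.gM t \<chi> 1(2)] by simp
 finally show ?thesis by (simp add: lmul_def ldiff_def algebra_simps)
qed

lemma ldiff_ldiffM: "lin1 M t \<chi> ==> vector_space t ==> m \<in> letters M ==> \<chi> (ldiff M (ldiff M m)) = 0"
 using dga_diff_diff[OF T.dgaM snd_letters[of m M]] lin1_zero[OF T.gM] by (simp add: ldiff_def)

lemma lh_lmul: "x \<in> letters A ==> y \<in> letters A ==> lH (lmul A x y) = lmul M (lH x) (lH y)"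
 using hom homogI[OF snd_letters[of x A]] homogI[OF snd_letters[of y A]] unfolding dga_hom_def by (simp add: lhom_def lmul_def)

lemma lh_ldiff: "x \<in> letters A ==> lH (ldiff A x) = ldiff M (lH x)"
 using hom homogI[OF snd_letters[of x A]] unfolding dga_hom_def by (simp add: lhom_def ldiff_def)

lemma brace_unit:
 "V \<in> L ==> V \<noteq> [] ==> b (unt M) (map snd V) = 0"
proof (induction V rule: length_induct)
 case (1 V)
 let ?u = "(0, unt M) :: int \<times> 'm"
 have u: "?u \<in> letters M" using dga_unit(1)[OF T.dgaM] by simp
 have bV: "b (unt M) (map snd V) \<in> gr M (bd V)"
  using snd_letters[OF T.bm_letters[OF u 1(2)]] by (simp add: lbr_def)
 obtain x V' where V: "V = x # V'" using 1(3) by (cases V) auto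
 have "b (unt M) (map snd V) = b (mul M (unt M) (unt M)) (map snd V)"
  using dga_unit(2)[OF T.dgaM dga_unit(1)[OF T.dgaM]] by simp
 also have "... = cut_sum V (%U W. mul M (b (unt M) (map snd U)) (b (unt M) (map snd W)))"
  using T.tail_dist[OF u u 1(2)] by simp
 also have "... = mul M (b (unt M) []) (b (unt M) (map snd V))
   + cut_sum V' (%U W. mul M (b (unt M) (map snd (x # U))) (b (unt M) (map snd W)))"
  by (simp add: V)
 also have "cut_sum V' (%U W. mul M (b (unt M) (map snd (x # U))) (b (unt M) (map snd W)))
   = mul M (b (unt M) (map snd V)) (b (unt M) [])"
 proof -
  have "cut_sum V' (%U W. mul M (b (unt M) (map snd (x # U))) (b (unt M) (map snd W)))
   = mul M (b (unt M) (map snd (x # V'))) (b (unt M) (map snd ([] :: (int \<times> 'a) list)))"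
  proof (rule cut_sum_last)
   fix U W assume UW: "V' = U @ W" "W \<noteq> []"
   then have xU: "x # U \<in> L" "x # U \<noteq> []" "length (x # U) < length V" and W: "W \<in> L" using 1(2) V by auto
   have "b (unt M) (map snd (x # U)) = 0" using 1(1) xU by blast
   then show "mul M (b (unt M) (map snd (x # U))) (b (unt M) (map snd W)) = 0"
    using dga_mul_zero(2)[OF T.dgaM, of "b (unt M) (map snd W)"] snd_letters[OF T.bm_letters[OF u W]] by (simp add: lbr_def)
  qed
  then show ?thesis by (simp add: V)
 qed
 also have "b (unt M) [] = unt M" using T.b_Nil[OF homogI[OF dga_unit(1)[OF T.dgaM]]] .
 finally show ?case by (simp add: dga_unit(2,3)[OF T.dgaM bV])
qed

text \<open>The module element \<open>m\<close> absorbs the final part of \<open>Y\<close> before it meets \<open>m'\<close>.\<close>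

definition lbar_mul ::
 "(int \<times> 'a) list => int \<times> 'm => (int \<times> 'a) list => int \<times> 'm =>
  ((int \<times> 'a) list => int \<times> 'm => 'z::ab_group_add) => 'z" where
 "lbar_mul X m Y m' \<phi> = cut_sum Y (%U V. sg (fst m * bd U) (ws X U (%W. \<phi> W (lmul M (bM m V) m'))))"

definition lbar_diff ::
 "(int \<times> 'a) list => int \<times> 'm => ((int \<times> 'a) list => int \<times> 'm => 'z::ab_group_add) => 'z" where
 "lbar_diff X m \<phi> = diff_sum A X (%W. \<phi> W m) + sg (bd X) (\<phi> X (ldiff M m))
   + (if X = [] then 0 else sg (bd (butlast X)) (\<phi> (butlast X) (lmul M (lH (last X)) m)))"

definition bilin :: "('k => 'z => 'z) => ((int \<times> 'a) list => int \<times> 'm => 'z::ab_group_add) => bool" where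
 "bilin t \<phi> \<longleftrightarrow> (\<forall>m\<in>letters M. mlin A t (%X. \<phi> X m)) \<and> (\<forall>X\<in>L. lin1 M t (\<phi> X))"

lemma bilinD: "bilin t \<phi> ==> m \<in> letters M ==> mlin A t (%X. \<phi> X m)" "bilin t \<phi> ==> X \<in> L ==> lin1 M t (\<phi> X)"
 by (auto simp: bilin_def simp del: letters_iff)

text \<open>
 Cutting \<open>Z\<close> for the product and for the braces of \<open>m\<close> and \<open>m'\<close> gives three parts on both sides;
 distributivity and associativity for \<open>m\<close> then match the summands.
\<close>

lemma lbar_mul_assoc:
 assumes t: "vector_space t" and \<phi>: "bilin t \<phi>"
  and XYZ: "X \<in> L" "Y \<in> L" "Z \<in> L" and m: "m \<in> letters M" "m' \<in> letters M" "m'' \<in> letters M"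
 shows "lbar_mul X m Y m' (%W w. lbar_mul W w Z m'' \<phi>) = lbar_mul Y m' Z m'' (%W w. lbar_mul X m W w \<phi>)"
proof -
 let ?K = "%Y1 Y2 Z1 Z2 Z3. sg (fst m * (bd Y1 + bd Z1) + bd Y2 * bd Z1 + fst m' * (bd Z1 + bd Z2))
   (ws Y1 Z1 (%P. ws X P (%V. ws Y2 Z2 (%B. \<phi> V (lmul M (bM m B) (lmul M (bM m' Z3) m''))))))"
 have "lbar_mul X m Y m' (%W w. lbar_mul W w Z m'' \<phi>)
  = cut_sum Y (%Y1 Y2. cut_sum Z (%Z1 Z'. cut_sum Z' (?K Y1 Y2 Z1)))"
  unfolding lbar_mul_def
 proof (rule cut_sum_cong)
  fix Y1 Y2 assume Y: "Y = Y1 @ Y2"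
  have L: "Y1 \<in> L" "Y2 \<in> L" using XYZ Y by auto
  have inner: "ws X Y1 (%W. ws W Z1 (%V. \<phi> V (lmul M (bM (lmul M (bM m Y2) m') Z') m'')))
    = cut_sum Z' (%Z2 Z3. sg (fst m' * bd Z2)
      (ws Y1 Z1 (%P. ws X P (%V. ws Y2 Z2 (%B. \<phi> V (lmul M (bM m B) (lmul M (bM m' Z3) m'')))))))"
   if Z: "Z = Z1 @ Z'" for Z1 Z'
  proof -
   have LZ: "Z1 \<in> L" "Z' \<in> L" using XYZ Z by auto
   have 1: "mlin A t (%V. \<phi> V (lmul M (bM (lmul M (bM m Y2) m') Z') m''))"
    using m L LZ by (intro bilinD[OF \<phi>] T.lmulM_letters T.bm_letters)
   have 2: "\<phi> V (lmul M (bM (lmul M (bM m Y2) m') Z') m'')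
     = cut_sum Z' (%Z2 Z3. sg (fst m' * bd Z2) (ws Y2 Z2 (%B. \<phi> V (lmul M (bM m B) (lmul M (bM m' Z3) m'')))))"
    if V: "V \<in> L" for V
   proof -
    have g: "lin1 M t (%z. \<phi> V (lmul M z m''))" by (intro T.lin1_lmulM_left bilinD[OF \<phi>] V m)
    have "\<phi> V (lmul M (bM (lmul M (bM m Y2) m') Z') m'')
     = cut_sum Z' (%Z2 Z3. sg (fst m' * bd Z2) (\<phi> V (lmul M (lmul M (bM (bM m Y2) Z2) (bM m' Z3)) m'')))"
     by (rule T.bm_lmul[OF t g]) (use m L LZ T.bm_letters in auto)
    also have "... = cut_sum Z' (%Z2 Z3. sg (fst m' * bd Z2) (ws Y2 Z2 (%B. \<phi> V (lmul M (bM m B) (lmul M (bM m' Z3) m'')))))"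
    proof (intro cut_sum_cong arg_cong[where f = "sg _"])
     fix Z2 Z3 assume "Z' = Z2 @ Z3"
     then have L': "Z2 \<in> L" "Z3 \<in> L" using LZ by auto
     have l: "bM m' Z3 \<in> letters M" using T.bm_letters m L' by blast
     have "\<phi> V (lmul M (lmul M (bM (bM m Y2) Z2) (bM m' Z3)) m'') = ws Y2 Z2 (%B. \<phi> V (lmul M (lmul M (bM m B) (bM m' Z3)) m''))"
      by (rule T.bm_bm[OF t]) (intro T.lin1_lmulM_left[OF g] l m L L')+
     also have "... = ws Y2 Z2 (%B. \<phi> V (lmul M (bM m B) (lmul M (bM m' Z3) m'')))"
      by (intro ws_cong L L') (simp add: lmulM_assoc[OF T.bm_letters[OF m(1)] l m(3)])
     finally show "\<phi> V (lmul M (lmul M (bM (bM m Y2) Z2) (bM m' Z3)) m'')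
      = ws Y2 Z2 (%B. \<phi> V (lmul M (bM m B) (lmul M (bM m' Z3) m'')))" .
    qed
    finally show ?thesis .
   qed
   have "ws X Y1 (%W. ws W Z1 (%V. \<phi> V (lmul M (bM (lmul M (bM m Y2) m') Z') m'')))
    = ws Y1 Z1 (%P. ws X P (%V. \<phi> V (lmul M (bM (lmul M (bM m Y2) m') Z') m'')))"
    by (rule ws_assoc[OF t 1 XYZ(1) L(1) LZ(1)])
   also have "... = ws Y1 Z1 (%P. ws X P (%V. cut_sum Z' (%Z2 Z3. sg (fst m' * bd Z2)
     (ws Y2 Z2 (%B. \<phi> V (lmul M (bM m B) (lmul M (bM m' Z3) m'')))))))"
    by (intro ws_cong L LZ XYZ(1) 2)
   finally show ?thesis by (simp only: weave_sum_cut_sum weave_sum_sg)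
  qed
  have "ws X Y1 (%W. cut_sum Z (%Z1 Z'. sg (fst (lmul M (bM m Y2) m') * bd Z1)
    (ws W Z1 (%V. \<phi> V (lmul M (bM (lmul M (bM m Y2) m') Z') m'')))))
   = cut_sum Z (%Z1 Z'. sg ((fst m + bd Y2 + fst m') * bd Z1) (cut_sum Z' (%Z2 Z3. sg (fst m' * bd Z2)
      (ws Y1 Z1 (%P. ws X P (%V. ws Y2 Z2 (%B. \<phi> V (lmul M (bM m B) (lmul M (bM m' Z3) m''))))))))) "
   unfolding weave_sum_cut_sum weave_sum_sg fst_ldiff_lmul fst_lbr by (intro cut_sum_cong arg_cong[where f = "sg _"] inner)
  then show "sg (fst m * bd Y1) (ws X Y1 (%W. cut_sum Z (%Z1 Z'. sg (fst (lmul M (bM m Y2) m') * bd Z1)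
    (ws W Z1 (%V. \<phi> V (lmul M (bM (lmul M (bM m Y2) m') Z') m'')))))) = cut_sum Z (%Z1 Z'. cut_sum Z' (?K Y1 Y2 Z1))"
   by (simp add: cut_sum_sg[symmetric]) (intro cut_sum_cong sg_cong, auto simp: parity)
 qed
 also have "... = cut_sum Z (%Z1 Z'. cut_sum Y (%Y1 Y2. cut_sum Z' (?K Y1 Y2 Z1)))"
  by (rule cut_sum_swap)
 also have "... = cut_sum Z (%Z1 Z'. cut_sum Z' (%Z2 Z3. cut_sum Y (%Y1 Y2. ?K Y1 Y2 Z1 Z2 Z3)))"
  by (rule cut_sum_cong) (rule cut_sum_swap)
 also have "... = cut_sum Z (%Z12 Z3. cut_sum Z12 (%Z1 Z2. cut_sum Y (%Y1 Y2. ?K Y1 Y2 Z1 Z2 Z3)))"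
  by (rule cut_sum_coassoc[symmetric])
 also have "... = lbar_mul Y m' Z m'' (%W w. lbar_mul X m W w \<phi>)"
  unfolding lbar_mul_def weave_sum_cut
 proof (rule cut_sum_cong)
  fix Z12 Z3 assume Z: "Z = Z12 @ Z3"
  have "sg (bd Y2 * bd Z1) (ws Y1 Z1 (%P. ws Y2 Z2 (%B. sg (fst m * bd P) (ws X P (%V. \<phi> V (lmul M (bM m B) (lmul M (bM m' Z3) m'')))))))
    = sg (bd Y2 * bd Z1 + fst m * (bd Y1 + bd Z1))
     (ws Y1 Z1 (%P. ws X P (%V. ws Y2 Z2 (%B. \<phi> V (lmul M (bM m B) (lmul M (bM m' Z3) m''))))))"
   if "Y = Y1 @ Y2" "Z12 = Z1 @ Z2" for Y1 Y2 Z1 Z2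
  proof -
   have "ws Y1 Z1 (%P. ws Y2 Z2 (%B. sg (fst m * bd P) (ws X P (%V. \<phi> V (lmul M (bM m B) (lmul M (bM m' Z3) m''))))))
    = ws Y1 Z1 (%P. sg (fst m * (bd Y1 + bd Z1)) (ws X P (%V. ws Y2 Z2 (%B. \<phi> V (lmul M (bM m B) (lmul M (bM m' Z3) m''))))))"
    by (rule ws_cong) (use that XYZ Z in \<open>auto simp: weave_sum_sg weave_sum_swap[of _ Y2]\<close>)
   then show ?thesis by (simp add: weave_sum_sg)
  qed
  then have "cut_sum Y (%Y1 Y2. cut_sum Z12 (%Z1 Z2. sg (bd Y2 * bd Z1) (ws Y1 Z1 (%P. ws Y2 Z2 (%B.
     sg (fst m * bd P) (ws X P (%V. \<phi> V (lmul M (bM m B) (lmul M (bM m' Z3) m'')))))))))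
   = cut_sum Y (%Y1 Y2. cut_sum Z12 (%Z1 Z2. sg (bd Y2 * bd Z1 + fst m * (bd Y1 + bd Z1))
     (ws Y1 Z1 (%P. ws X P (%V. ws Y2 Z2 (%B. \<phi> V (lmul M (bM m B) (lmul M (bM m' Z3) m''))))))))"
   by (intro cut_sum_cong)
  then show "cut_sum Z12 (%Z1 Z2. cut_sum Y (%Y1 Y2. ?K Y1 Y2 Z1 Z2 Z3)) = sg (fst m' * bd Z12)
    (cut_sum Y (%Y1 Y2. cut_sum Z12 (%Z1 Z2. sg (bd Y2 * bd Z1) (ws Y1 Z1 (%P. ws Y2 Z2 (%B.
     sg (fst m * bd P) (ws X P (%V. \<phi> V (lmul M (bM m B) (lmul M (bM m' Z3) m''))))))))))"
   unfolding cut_sum_swap[of Z12 Y]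
   by (simp add: cut_sum_sg[symmetric]) (intro cut_sum_cong sg_cong, auto simp: parity)
 qed
 finally show ?thesis .
qed

lemma lbar_mul_unit:
 assumes t: "vector_space t" and \<phi>: "bilin t \<phi>" and X: "X \<in> L" and m: "m \<in> letters M"
 shows "lbar_mul X m [] (0, unt M) \<phi> = \<phi> X m" "lbar_mul [] (0, unt M) X m \<phi> = \<phi> X m"
proof -
 let ?u = "(0, unt M) :: int \<times> 'm"
 have u: "?u \<in> letters M" using dga_unit(1)[OF T.dgaM] by simp
 have r: "lmul M m ?u = m" "lmul M ?u m = m"
  using dga_unit(2,3)[OF T.dgaM snd_letters[OF m]] by (simp_all add: lmul_def)
 show "lbar_mul X m [] ?u \<phi> = \<phi> X m"
  by (simp add: lbar_mul_def T.bm_Nil[OF m] r ws_Nil_right[OF X])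
 have "lbar_mul [] ?u X m \<phi> = cut_sum X (%U V. \<phi> U (lmul M (bM ?u V) m))"
  by (simp add: lbar_mul_def)
 also have "... = \<phi> X (lmul M (bM ?u []) m)"
 proof (rule cut_sum_last)
  fix U V assume UV: "X = U @ V" "V \<noteq> []"
  then have "bM ?u V = (bd V, 0)" using brace_unit[of V] X by (simp add: lbr_def)
  then have "lmul M (bM ?u V) m = (bd V + fst m, 0)" using dga_mul_zero(2)[OF T.dgaM snd_letters[OF m]] by (simp add: lmul_def)
  then show "\<phi> U (lmul M (bM ?u V) m) = 0"
   using lin1_zero[OF T.gM bilinD(2)[OF \<phi>] t] UV X by simp
 qed
 finally show "lbar_mul [] ?u X m \<phi> = \<phi> X m" by (simp add: T.bm_Nil[OF u] r)
qed

lemma lbar_diff_simps: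
 "lbar_diff [] m \<phi> = \<phi> [] (ldiff M m)"
 "lbar_diff (x # X) m \<phi> = - \<phi> (ldiff A x # X) m + sg (fst x - 1) (lbar_diff X m (%W. \<phi> (x # W)))
   + (case X of [] => \<phi> [] (lmul M (lH x) m) | y # X' => sg (fst x) (\<phi> (lmul A x y # X') m))"
proof -
 show "lbar_diff [] m \<phi> = \<phi> [] (ldiff M m)" by (simp add: lbar_diff_def)
 show "lbar_diff (x # X) m \<phi> = - \<phi> (ldiff A x # X) m + sg (fst x - 1) (lbar_diff X m (%W. \<phi> (x # W)))
   + (case X of [] => \<phi> [] (lmul M (lH x) m) | y # X' => sg (fst x) (\<phi> (lmul A x y # X') m))"
  by (cases X) (simp_all add: lbar_diff_def algebra_simps)
qed

lemma lbar_diff_sg: "lbar_diff X m (%W w. sg n (\<phi> W w)) = sg n (lbar_diff X m \<phi>)"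
 and lbar_diff_add: "lbar_diff X m (%W w. \<phi> W w + \<psi> W w) = lbar_diff X m \<phi> + lbar_diff X m \<psi>"
 and lbar_diff_uminus: "lbar_diff X m (%W w. - \<phi> W w) = - lbar_diff X m \<phi>"
 by (auto simp: lbar_diff_def diff_sum_sg diff_sum_add diff_sum_zero diff_sum_uminus algebra_simps)

lemma lin1_lmul_ldiff_add:
 assumes t: "vector_space t" and \<psi>: "lin1 A t \<psi>" and x: "x \<in> letters A" and y: "y \<in> letters A"
 shows "\<psi> (ldiff A (lmul A x y)) = \<psi> (lmul A (ldiff A x) y) + sg (fst x) (\<psi> (lmul A x (ldiff A y)))"
proof -
 let ?n = "fst x + fst y + 1"
 have 1: "mul A (diff A (snd x)) (snd y) \<in> gr A ?n" "mul A (snd x) (diff A (snd y)) \<in> gr A ?n"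
  using snd_letters[OF lmul_letters[OF ldiff_letters[OF x] y]] snd_letters[OF lmul_letters[OF x ldiff_letters[OF y]]]
  by (simp_all add: lmul_def ldiff_def algebra_simps)
 have "\<psi> (ldiff A (lmul A x y)) = \<psi> (?n, mul A (diff A (snd x)) (snd y) + sg (fst x) (mul A (snd x) (diff A (snd y))))"
  using dga_leibniz[OF dgaA snd_letters[OF x] snd_letters[OF y]] by (simp add: ldiff_def lmul_def)
 also have "... = \<psi> (?n, mul A (diff A (snd x)) (snd y)) + sg (fst x) (\<psi> (?n, mul A (snd x) (diff A (snd y))))"
  using lin1_add_arg[OF \<psi> 1(1) graded_sg[OF gA 1(2)]] lin1_sg_arg[OF gA t \<psi> 1(2)] by simp
 finally show ?thesis by (simp add: lmul_def ldiff_def algebra_simps)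
qed

lemma lmul_assoc:
 "x \<in> letters A ==> y \<in> letters A ==> z \<in> letters A ==> lmul A (lmul A x y) z = lmul A x (lmul A y z)"
 using dga_assoc[OF dgaA snd_letters snd_letters snd_letters] by (simp add: lmul_def add.assoc)

lemma bilin_Cons: "bilin t \<phi> ==> x \<in> letters A ==> bilin t (%X. \<phi> (x # X))"
 unfolding bilin_def by (auto intro: mlin_Cons simp del: letters_iff)

text \<open>
 Induction on the word: the terms that touch the first letter cancel in pairs, by \<open>d\<^sup>2 = 0\<close>, the
 Leibniz rule and associativity.
\<close>

lemma lbar_diff_lbar_diff:
 assumes t: "vector_space t"
 shows "bilin t \<phi> ==> X \<in> L ==> m \<in> letters M ==> lbar_diff X m (%W w. lbar_diff W w \<phi>) = 0"
proof (induction X arbitrary: \<phi> m rule: list.induct)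
 case Nil
 then show ?case by (simp add: lbar_diff_simps ldiff_ldiffM[OF bilinD(2) t])
next
 case (Cons x X)
 note \<phi> = Cons.prems(1) and m = Cons.prems(3)
 have x: "x \<in> letters A" and X: "X \<in> L" using Cons.prems by auto
 have l1: "lin1 A t (%z. \<phi> (z # W) w)" if "W \<in> L" "w \<in> letters M" for W w
  using mlin_lists[OF bilinD(1)[OF \<phi> that(2)], of "[]" W] that by simp
 have dd: "\<phi> (ldiff A (ldiff A x) # X) m = 0"
  using lin1_zero[OF gA l1[OF X m] t] dga_diff_diff[OF dgaA snd_letters[OF x]] by (simp add: ldiff_def)
 have IH: "lbar_diff X m (%W w. lbar_diff W w (%W. \<phi> (x # W))) = 0"
  using Cons.IH[OF bilin_Cons[OF \<phi> x] X m] by simp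
 let ?c = "%X m. case X of [] => \<phi> [] (lmul M (lH x) m) | y # X' => sg (fst x) (\<phi> (lmul A x y # X') m)"
 have e: "sg (fst x + 1 - 1) z = - sg (fst x - 1) z" "sg (fst x - 1) z = - sg (fst x) z" for z :: 'b
  by (auto simp: sg_def)
 have c: "sg (fst x - 1) (lbar_diff X m ?c)
   + (case X of [] => lbar_diff [] (lmul M (lH x) m) \<phi> | y # X' => sg (fst x) (lbar_diff (lmul A x y # X') m \<phi>))
   = (case X of [] => \<phi> [] (lmul M (lH (ldiff A x)) m) | y # X' => sg (fst x + 1) (\<phi> (lmul A (ldiff A x) y # X') m))"
 proof (cases X)
  case Nil
  have "\<phi> [] (ldiff M (lmul M (lH x) m)) = \<phi> [] (lmul M (ldiff M (lH x)) m) + sg (fst x) (\<phi> [] (lmul M (lH x) (ldiff M m)))"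
   using lmulM_leibniz[OF t bilinD(2)[OF \<phi>] T.lh_letters[OF x] m, of "[]"] by simp
  then show ?thesis by (simp add: Nil lbar_diff_simps lh_ldiff[OF x] e)
 next
  case (Cons y X')
  then have y: "y \<in> letters A" and X': "X' \<in> L" using X by auto
  have lz: "\<phi> (ldiff A (lmul A x y) # X') m = \<phi> (lmul A (ldiff A x) y # X') m + sg (fst x) (\<phi> (lmul A x (ldiff A y) # X') m)"
   using lin1_lmul_ldiff_add[OF t l1[OF X' m] x y] by simp
  show ?thesis
  proof (cases X')
   case Nil
   have as: "lmul M (lH (lmul A x y)) m = lmul M (lH x) (lmul M (lH y) m)"
    using lh_lmul[OF x y] lmulM_assoc[OF T.lh_letters[OF x] T.lh_letters[OF y] m] by simp
   show ?thesis unfolding Cons Nil using lz Nil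
    by (simp add: lbar_diff_simps as) (auto simp: sg_def)
  next
   case (Cons z X'')
   then have as: "lmul A (lmul A x y) z = lmul A x (lmul A y z)" using lmul_assoc[OF x y] X' by simp
   show ?thesis unfolding \<open>X = y # X'\<close> Cons using lz Cons
    by (simp add: lbar_diff_simps as lbar_diff_sg) (auto simp: sg_def)
  qed
 qed
 have "lbar_diff (x # X) m (%W w. lbar_diff W w \<phi>)
  = - lbar_diff (ldiff A x # X) m \<phi> + sg (fst x - 1) (lbar_diff X m (%W w. lbar_diff (x # W) w \<phi>))
   + (case X of [] => lbar_diff [] (lmul M (lH x) m) \<phi> | y # X' => sg (fst x) (lbar_diff (lmul A x y # X') m \<phi>))"
  by (simp only: lbar_diff_simps(2)[of x X])
 also have "lbar_diff X m (%W w. lbar_diff (x # W) w \<phi>)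
  = - lbar_diff X m (%W. \<phi> (ldiff A x # W)) + lbar_diff X m ?c"
  by (simp only: lbar_diff_simps(2) lbar_diff_add lbar_diff_uminus lbar_diff_sg IH sg_simps) simp
 also have "lbar_diff (ldiff A x # X) m \<phi> = sg (fst x + 1 - 1) (lbar_diff X m (%W. \<phi> (ldiff A x # W)))
   + (case X of [] => \<phi> [] (lmul M (lH (ldiff A x)) m) | y # X' => sg (fst x + 1) (\<phi> (lmul A (ldiff A x) y # X') m))"
  by (simp only: lbar_diff_simps(2) dd fst_ldiff_lmul) simp
 finally have "lbar_diff (x # X) m (%W w. lbar_diff W w \<phi>)
  = - (case X of [] => \<phi> [] (lmul M (lH (ldiff A x)) m) | y # X' => sg (fst x + 1) (\<phi> (lmul A (ldiff A x) y # X') m))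
   + (sg (fst x - 1) (lbar_diff X m ?c)
   + (case X of [] => lbar_diff [] (lmul M (lH x) m) \<phi> | y # X' => sg (fst x) (lbar_diff (lmul A x y # X') m \<phi>)))"
  unfolding e(1) by (simp add: algebra_simps)
 also have "... = 0" unfolding c by simp
 finally show ?case .
qed

definition tail_term ::
 "(int \<times> 'a) list => int \<times> 'm => (int \<times> 'm => 'z::ab_group_add) => 'z" where
 "tail_term B m \<chi> = (if B = [] then \<chi> (ldiff M m) else 0) + (case B of [x] => \<chi> (lmul M (lH x) m) | _ => 0)"

lemma lbar_diff_cut:
 "lbar_diff X m \<phi> = diff_sum A X (%W. \<phi> W m) + cut_sum X (%U V. sg (bd U) (tail_term V m (\<phi> U)))"
proof -
 have "cut_sum X (%U V. sg (bd U) (tail_term V m (\<phi> U)))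
  = cut_sum X (%U V. (if V = [] then sg (bd U) (\<phi> U (ldiff M m)) else 0)
    + (case V of [x] => sg (bd U) (\<phi> U (lmul M (lH x) m)) | _ => 0))"
  unfolding tail_term_def by (intro cut_sum_cong) (simp split: list.split)
 then show ?thesis by (simp only: cut_sum_last_two lbar_diff_def add.assoc)
qed

lemma ws_tail_term:
 assumes X: "X \<in> L" and Y: "Y \<in> L"
 shows "ws X Y (%B. tail_term B m \<chi>)
  = (if X = [] then tail_term Y m \<chi> else 0) + (case X of [x] => \<chi> (lmul M (lH (bl x Y)) m) | _ => 0)"
proof -
 consider "X = []" | x where "X = [x]" | "length X \<ge> 2"
  by (cases X; cases "tl X") auto
 then show ?thesis
 proof cases
  case (2 x)
  have "ws X Y (%B. tail_term B m \<chi>)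
   = cut_sum Y (%U V. cut_sum V (%U' V'. sg ((fst x - 1) * bd U) (tail_term (U @ bl x U' # V') m \<chi>)))"
   by (simp add: 2 weave_sum_Cons)
  also have "... = cut_sum Y (%U' V'. sg ((fst x - 1) * bd ([] :: (int \<times> 'a) list)) (tail_term ([] @ bl x U' # V') m \<chi>))"
   by (rule cut_sum_first) (auto simp: neq_Nil_conv tail_term_def cut_sum_zero split: list.splits intro!: trans[OF cut_sum_cong cut_sum_zero])
  also have "... = sg ((fst x - 1) * bd ([] :: (int \<times> 'a) list)) (tail_term ([] @ bl x Y # []) m \<chi>)"
   by (rule cut_sum_last) (auto simp: neq_Nil_conv tail_term_def)
  finally show ?thesis by (simp add: 2 tail_term_def)
 next
  case 3
  have "ws X Y (%B. tail_term B m \<chi>) = ws X Y (%B. 0)"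
  proof (rule ws_cong[OF X Y])
   fix B :: "(int \<times> 'a) list" assume "length X \<le> length B"
   then have "length B \<ge> 2" using 3 by simp
   then show "tail_term B m \<chi> = 0" by (auto simp: tail_term_def split: list.splits)
  qed
  then show ?thesis using 3 by (auto simp: weave_sum_zero split: list.splits)
 qed simp
qed

text \<open>The Leibniz rule for products \<open>[m] \<cdot> [Y|m']\<close>, restricted to what ends up in \<open>M\<close>; this is
 where the higher homotopies of the module enter.\<close>

lemma tail_leibniz:
 assumes t: "vector_space t" and \<chi>: "lin1 M t \<chi>" and V: "V \<in> L" and m: "m \<in> letters M" "m' \<in> letters M"
 shows "cut_sum V (%U W. sg (fst m * bd U) (tail_term U (lmul M (bM m W) m') \<chi>))
  = \<chi> (lmul M (bM (ldiff M m) V) m') + sg (fst m) (diff_sum A V (%W. \<chi> (lmul M (bM m W) m')))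
   + sg (fst m + bd V) (\<chi> (lmul M (bM m V) (ldiff M m')))
   + (if V = [] then 0 else sg (fst m + bd (butlast V)) (\<chi> (lmul M (bM m (butlast V)) (lmul M (lH (last V)) m'))))"
proof -
 have g: "lin1 M t (%z. \<chi> (lmul M z m'))" by (rule T.lin1_lmulM_left[OF \<chi> m(2)])
 have "cut_sum V (%U W. sg (fst m * bd U) (tail_term U (lmul M (bM m W) m') \<chi>))
  = \<chi> (ldiff M (lmul M (bM m V) m'))
   + (case V of [] => 0 | y # V' => sg (fst m * (fst y - 1)) (\<chi> (lmul M (lH y) (lmul M (bM m V') m'))))"
  by (subst cut_sum_first_two) (auto simp: tail_term_def split: list.split)
 also have "\<chi> (ldiff M (lmul M (bM m V) m')) = \<chi> (lmul M (ldiff M (bM m V)) m') + sg (fst m + bd V) (\<chi> (lmul M (bM m V) (ldiff M m')))"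
  using lmulM_leibniz[OF t \<chi> T.bm_letters[OF m(1) V] m(2)] by simp
 finally have 0: "cut_sum V (%U W. sg (fst m * bd U) (tail_term U (lmul M (bM m W) m') \<chi>))
  = \<chi> (lmul M (ldiff M (bM m V)) m') + sg (fst m + bd V) (\<chi> (lmul M (bM m V) (ldiff M m')))
   + (case V of [] => 0 | y # V' => sg (fst m * (fst y - 1)) (\<chi> (lmul M (lH y) (lmul M (bM m V') m'))))" .
 show ?thesis
 proof (cases V)
  case Nil
  then show ?thesis unfolding 0 by (simp add: T.bm_Nil m T.ldiffM_letters)
 next
  case (Cons y V')
  have ne: "V \<noteq> []" and y: "y \<in> letters A" "V' \<in> L" using Cons V by auto
  have bl: "butlast V \<in> L" "last V \<in> letters A"
   using V ne by (auto simp: in_lists_conv_set dest: in_set_butlastD simp del: letters_iff)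
  have 1: "\<chi> (lmul M (ldiff M (bM m V)) m') = \<chi> (lmul M (bM (ldiff M m) V) m') + sg (fst m) (diff_sum A V (%W. \<chi> (lmul M (bM m W) m')))
   - sg ((fst y - 1) * fst m) (\<chi> (lmul M (lmul M (lH y) (bM m V')) m'))
   + sg (fst m + bd (butlast V)) (\<chi> (lmul M (lmul M (bM m (butlast V)) (lH (last V))) m'))"
   using T.ldiff_bm[OF t g m(1) V ne] Cons by simp
  have 2: "lmul M (lmul M (lH y) (bM m V')) m' = lmul M (lH y) (lmul M (bM m V') m')"
   by (intro lmulM_assoc T.lh_letters T.bm_letters y m)
  have 3: "lmul M (lmul M (bM m (butlast V)) (lH (last V))) m' = lmul M (bM m (butlast V)) (lmul M (lH (last V)) m')"
   by (intro lmulM_assoc T.lh_letters T.bm_letters bl m)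
  have "(case V of [] => 0 | y # V' => sg (fst m * (fst y - 1)) (\<chi> (lmul M (lH y) (lmul M (bM m V') m'))))
   = sg ((fst y - 1) * fst m) (\<chi> (lmul M (lH y) (lmul M (bM m V') m')))"
   by (simp add: Cons mult.commute)
  then show ?thesis unfolding 0 1 2 3 using ne by simp
 qed
qed

lemma diff_sum_cut_sum_swap: "diff_sum A X (%W. cut_sum Y (k W)) = cut_sum Y (%U V. diff_sum A X (%W. k W U V))"
 unfolding diff_sum_def by (simp add: cut_sum_ssum)

text \<open>
 The differential has a part inside the word, a derivation by \<open>ws_diff_sum\<close>, and a part at the
 end, treated in \<open>tail_leibniz\<close>.
\<close>

lemma lbar_leibniz:
 assumes t: "vector_space t" and \<phi>: "bilin t \<phi>" and X: "X \<in> L" and Y: "Y \<in> L" and m: "m \<in> letters M" "m' \<in> letters M"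
 shows "lbar_mul X m Y m' (%W w. lbar_diff W w \<phi>)
  = lbar_diff X m (%W w. lbar_mul W w Y m' \<phi>) + sg (bd X + fst m) (lbar_diff Y m' (%W w. lbar_mul X m W w \<phi>))"
proof -
 let ?n = "%V. lmul M (bM m V) m'"
 have n: "?n V \<in> letters M" if "V \<in> L" for V using that by (intro T.lmulM_letters T.bm_letters m)
 let ?A1 = "cut_sum Y (%U V. sg (fst m * bd U) (diff_sum A X (%X'. ws X' U (%W. \<phi> W (?n V)))))"
 let ?A2 = "cut_sum Y (%U V. sg (fst m * bd U + bd X) (diff_sum A U (%U'. ws X U' (%W. \<phi> W (?n V)))))"
 let ?t = "%U V k. sg (bd X + bd U + fst m * bd U) (ws X U (%P. k V (\<phi> P)))"
 let ?b1 = "%V \<chi>. cut_sum V (%U W. sg (fst m * bd U) (tail_term U (?n W) \<chi>))"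
 let ?B2 = "if X = [] then 0 else cut_sum Y (%U V. cut_sum U (%Y1 Y2. sg (fst m * bd U + (fst (last X) - 1) * bd Y1 + bd (butlast X) + bd Y1)
   (ws (butlast X) Y1 (%P. \<phi> P (lmul M (lH (bl (last X) Y2)) (?n V))))))"
 have L: "lbar_mul X m Y m' (%W w. lbar_diff W w \<phi>) = ?A1 + ?A2 + cut_sum Y (%U V. ?t U V ?b1) + ?B2"
 proof -
  have "lbar_mul X m Y m' (%W w. lbar_diff W w \<phi>) = cut_sum Y (%U V. sg (fst m * bd U) (ws X U (%W. diff_sum A W (%W'. \<phi> W' (?n V)))))
   + cut_sum Y (%U V. sg (fst m * bd U) (ws X U (%W. cut_sum W (%P B. sg (bd P) (tail_term B (?n V) (\<phi> P))))))"
   unfolding lbar_mul_def lbar_diff_cut weave_sum_add sg_simps cut_sum_add by (rule refl)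
  also have "cut_sum Y (%U V. sg (fst m * bd U) (ws X U (%W. diff_sum A W (%W'. \<phi> W' (?n V))))) = ?A1 + ?A2"
   unfolding cut_sum_add[symmetric]
  proof (rule cut_sum_cong)
   fix U V assume "Y = U @ V"
   then have "U \<in> L" "V \<in> L" using Y by auto
   then show "sg (fst m * bd U) (ws X U (%W. diff_sum A W (%W'. \<phi> W' (?n V))))
    = sg (fst m * bd U) (diff_sum A X (%X'. ws X' U (%W. \<phi> W (?n V))))
    + sg (fst m * bd U + bd X) (diff_sum A U (%U'. ws X U' (%W. \<phi> W (?n V))))"
    by (subst ws_diff_sum[OF t bilinD(1)[OF \<phi> n] X]) auto
  qed
  also have "cut_sum Y (%U V. sg (fst m * bd U) (ws X U (%W. cut_sum W (%P B. sg (bd P) (tail_term B (?n V) (\<phi> P))))))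
   = cut_sum Y (%U V. ?t U V ?b1) + ?B2"
  proof -
   let ?g = "%U V Y1 Y2 X1 x. sg (fst m * bd U + (fst x - 1) * bd Y1 + bd X1 + bd Y1) (ws X1 Y1 (%P. \<phi> P (lmul M (lH (bl x Y2)) (?n V))))"
   let ?f = "%U V Y1 Y2 X1. sg (fst m * bd U + bd X1 + bd Y1) (ws X1 Y1 (%P. tail_term Y2 (?n V) (\<phi> P)))"
   have "cut_sum Y (%U V. sg (fst m * bd U) (ws X U (%W. cut_sum W (%P B. sg (bd P) (tail_term B (?n V) (\<phi> P))))))
    = cut_sum Y (%U V. cut_sum X (%X1 X2. cut_sum U (%Y1 Y2. (if X2 = [] then ?f U V Y1 Y2 X1 else 0) + (case X2 of [x] => ?g U V Y1 Y2 X1 x | _ => 0))))"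
    unfolding weave_sum_cut cut_sum_sg[symmetric]
   proof (intro cut_sum_cong)
    fix U V X1 X2 Y1 Y2 assume *: "Y = U @ V" "X = X1 @ X2" "U = Y1 @ Y2"
    then have l: "X1 \<in> L" "X2 \<in> L" "Y1 \<in> L" "Y2 \<in> L" using X Y by auto
    have "ws X1 Y1 (%P. ws X2 Y2 (%B. sg (bd P) (tail_term B (?n V) (\<phi> P))))
     = ws X1 Y1 (%P. sg (bd X1 + bd Y1) ((if X2 = [] then tail_term Y2 (?n V) (\<phi> P) else 0)
       + (case X2 of [x] => \<phi> P (lmul M (lH (bl x Y2)) (?n V)) | _ => 0)))"
     by (rule ws_cong) (use l in \<open>simp_all add: weave_sum_sg ws_tail_term\<close>)
    then show "sg (fst m * bd U) (sg (bd X2 * bd Y1) (ws X1 Y1 (%P. ws X2 Y2 (%B. sg (bd P) (tail_term B (?n V) (\<phi> P))))))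
     = (if X2 = [] then ?f U V Y1 Y2 X1 else 0) + (case X2 of [x] => ?g U V Y1 Y2 X1 x | _ => 0)"
     by (auto simp: weave_sum_sg weave_sum_add weave_sum_zero algebra_simps split: list.split)
   qed
   also have "... = cut_sum Y (%U V. cut_sum U (%Y1 Y2. cut_sum X (%X1 X2. (if X2 = [] then ?f U V Y1 Y2 X1 else 0) + (case X2 of [x] => ?g U V Y1 Y2 X1 x | _ => 0))))"
    by (rule cut_sum_cong) (rule cut_sum_swap)
   also have "... = cut_sum Y (%U V. cut_sum U (%Y1 Y2. ?f U V Y1 Y2 X)) + ?B2"
    unfolding cut_sum_last_two by (simp add: cut_sum_add cut_sum_zero)
   also have "cut_sum Y (%U V. cut_sum U (%Y1 Y2. ?f U V Y1 Y2 X))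
    = cut_sum Y (%U V. cut_sum U (%Y1 Y2. sg (fst m * (bd Y1 + bd Y2) + bd X + bd Y1) (ws X Y1 (%P. tail_term Y2 (?n V) (\<phi> P)))))"
    by (intro cut_sum_cong) simp
   also have "... = cut_sum Y (%U V. ?t U V ?b1)"
    unfolding cut_sum_coassoc weave_sum_cut_sum weave_sum_sg cut_sum_sg[symmetric]
    by (intro cut_sum_cong) (simp, intro sg_cong, auto simp: parity)
   finally show ?thesis .
  qed
  finally show ?thesis by (simp add: add.assoc)
 qed
 have b1: "cut_sum Y (%U V. ?t U V ?b1)
  = cut_sum Y (%U V. ?t U V (%V \<chi>. \<chi> (lmul M (bM (ldiff M m) V) m')))
  + cut_sum Y (%U V. ?t U V (%V \<chi>. sg (fst m) (diff_sum A V (%W. \<chi> (?n W)))))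
  + cut_sum Y (%U V. ?t U V (%V \<chi>. sg (fst m + bd V) (\<chi> (lmul M (bM m V) (ldiff M m')))))
  + cut_sum Y (%U V. ?t U V (%V \<chi>. if V = [] then 0 else sg (fst m + bd (butlast V)) (\<chi> (lmul M (bM m (butlast V)) (lmul M (lH (last V)) m')))))"
  unfolding cut_sum_add[symmetric] sg_simps(4)[symmetric] weave_sum_add[symmetric]
 proof (intro cut_sum_cong arg_cong[where f = "sg _"] ws_cong X)
  fix U V P assume "Y = U @ V" "P \<in> L"
  then show "?b1 V (\<phi> P) = \<phi> P (lmul M (bM (ldiff M m) V) m') + sg (fst m) (diff_sum A V (%W. \<phi> P (?n W)))
   + sg (fst m + bd V) (\<phi> P (lmul M (bM m V) (ldiff M m')))
   + (if V = [] then 0 else sg (fst m + bd (butlast V)) (\<phi> P (lmul M (bM m (butlast V)) (lmul M (lH (last V)) m'))))"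
   using Y by (intro tail_leibniz[OF t bilinD(2)[OF \<phi>] _ m]) auto
 qed (use Y in auto)
 have R1: "lbar_diff X m (%W w. lbar_mul W w Y m' \<phi>) = ?A1 + cut_sum Y (%U V. ?t U V (%V \<chi>. \<chi> (lmul M (bM (ldiff M m) V) m'))) + ?B2"
 proof -
  have 1: "diff_sum A X (%W. lbar_mul W m Y m' \<phi>) = ?A1"
   unfolding lbar_mul_def diff_sum_cut_sum_swap diff_sum_sg by (rule refl)
  have 2: "sg (bd X) (lbar_mul X (ldiff M m) Y m' \<phi>) = cut_sum Y (%U V. ?t U V (%V \<chi>. \<chi> (lmul M (bM (ldiff M m) V) m')))"
   unfolding lbar_mul_def cut_sum_sg[symmetric] by (intro cut_sum_cong) (simp, intro sg_cong, auto simp: parity)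
  have 3: "(if X = [] then 0 else sg (bd (butlast X)) (lbar_mul (butlast X) (lmul M (lH (last X)) m) Y m' \<phi>)) = ?B2"
  proof (cases "X = []")
   case False
   let ?x = "last X" and ?X = "butlast X"
   have bx: "?X \<in> L" "?x \<in> letters A"
    using X False by (auto simp: in_lists_conv_set dest: in_set_butlastD simp del: letters_iff)
   have "lbar_mul ?X (lmul M (lH ?x) m) Y m' \<phi> = cut_sum Y (%Y1 V'. cut_sum V' (%Y2 V.
     sg ((fst ?x + fst m) * bd Y1 + fst m * bd Y2) (ws ?X Y1 (%P. \<phi> P (lmul M (lH (bl ?x Y2)) (?n V))))))"
    unfolding lbar_mul_def
   proof (rule cut_sum_cong)
    fix Y1 V' assume "Y = Y1 @ V'"
    then have l: "Y1 \<in> L" "V' \<in> L" using Y by auto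
    have "ws ?X Y1 (%P. \<phi> P (lmul M (bM (lmul M (lH ?x) m) V') m'))
     = ws ?X Y1 (%P. cut_sum V' (%Y2 V. sg (fst m * bd Y2) (\<phi> P (lmul M (lH (bl ?x Y2)) (?n V)))))"
    proof (rule ws_cong[OF bx(1) l(1)])
     fix P assume "P \<in> L"
     then have g: "lin1 M t (%z. \<phi> P (lmul M z m'))" by (intro T.lin1_lmulM_left bilinD[OF \<phi>] m)
     have "\<phi> P (lmul M (bM (lmul M (lH ?x) m) V') m') = cut_sum V' (%Y2 V. sg (fst m * bd Y2) (\<phi> P (lmul M (lmul M (bM (lH ?x) Y2) (bM m V)) m')))"
      by (rule T.bm_lmul[OF t g T.lh_letters[OF bx(2)] m(1) l(2)])
     also have "... = cut_sum V' (%Y2 V. sg (fst m * bd Y2) (\<phi> P (lmul M (lH (bl ?x Y2)) (?n V))))"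
     proof (intro cut_sum_cong arg_cong[where f = "sg _"])
      fix Y2 V assume "V' = Y2 @ V"
      then have l': "Y2 \<in> L" "V \<in> L" using l by auto
      show "\<phi> P (lmul M (lmul M (bM (lH ?x) Y2) (bM m V)) m') = \<phi> P (lmul M (lH (bl ?x Y2)) (?n V))"
       using lmulM_assoc[OF T.lh_letters[OF bl_letters[OF bx(2) l'(1)]] T.bm_letters[OF m(1) l'(2)] m(2)]
       by (simp add: bm_lh[OF bx(2) l'(1)])
     qed
     finally show "\<phi> P (lmul M (bM (lmul M (lH ?x) m) V') m') = cut_sum V' (%Y2 V. sg (fst m * bd Y2) (\<phi> P (lmul M (lH (bl ?x Y2)) (?n V))))" .
    qed
    then show "sg (fst (lmul M (lH ?x) m) * bd Y1) (ws ?X Y1 (%P. \<phi> P (lmul M (bM (lmul M (lH ?x) m) V') m')))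
     = cut_sum V' (%Y2 V. sg ((fst ?x + fst m) * bd Y1 + fst m * bd Y2) (ws ?X Y1 (%P. \<phi> P (lmul M (lH (bl ?x Y2)) (?n V)))))"
     by (simp add: weave_sum_cut_sum weave_sum_sg cut_sum_sg[symmetric])
   qed
   then show ?thesis using False
    by (simp add: cut_sum_coassoc[symmetric] cut_sum_sg[symmetric]) (intro cut_sum_cong, simp, intro sg_cong, auto simp: parity)
  qed simp
  show ?thesis unfolding lbar_diff_def 1 2 3 ..
 qed
 have R2: "sg (bd X + fst m) (lbar_diff Y m' (%W w. lbar_mul X m W w \<phi>))
  = ?A2 + cut_sum Y (%U V. ?t U V (%V \<chi>. sg (fst m) (diff_sum A V (%W. \<chi> (?n W)))))
  + cut_sum Y (%U V. ?t U V (%V \<chi>. sg (fst m + bd V) (\<chi> (lmul M (bM m V) (ldiff M m')))))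
  + cut_sum Y (%U V. ?t U V (%V \<chi>. if V = [] then 0 else sg (fst m + bd (butlast V)) (\<chi> (lmul M (bM m (butlast V)) (lmul M (lH (last V)) m')))))"
 proof -
  have 1: "sg (bd X + fst m) (diff_sum A Y (%W. lbar_mul X m W m' \<phi>))
   = ?A2 + cut_sum Y (%U V. ?t U V (%V \<chi>. sg (fst m) (diff_sum A V (%W. \<chi> (?n W)))))"
   unfolding lbar_mul_def diff_sum_cut_sum cut_sum_sg[symmetric] sg_simps(4) cut_sum_add
  proof (intro arg_cong2[where f = "(+)"] cut_sum_cong)
   fix U V assume "Y = U @ V"
   then have "U \<in> L" using Y by simp
   then have "diff_sum A U (%U'. sg (fst m * bd U') (ws X U' (%W. \<phi> W (?n V))))
    = diff_sum A U (%U'. sg (fst m * (bd U + 1)) (ws X U' (%W. \<phi> W (?n V))))"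
    by (rule diff_sum_cong) simp
   then show "sg (bd X + fst m) (diff_sum A U (%U'. sg (fst m * bd U') (ws X U' (%W. \<phi> W (?n V)))))
    = sg (fst m * bd U + bd X) (diff_sum A U (%U'. ws X U' (%W. \<phi> W (?n V))))"
    by (simp add: diff_sum_sg) (intro sg_cong, auto simp: parity)
  next
   fix U V
   show "sg (bd X + fst m) (sg (bd U) (diff_sum A V (%V'. sg (fst m * bd U) (ws X U (%W. \<phi> W (?n V'))))))
    = ?t U V (%V \<chi>. sg (fst m) (diff_sum A V (%W. \<chi> (?n W))))"
    by (simp add: diff_sum_sg weave_sum_sg weave_sum_diff_sum) (intro sg_cong, auto simp: parity)
  qed
  have 2: "sg (bd X + fst m) (sg (bd Y) (lbar_mul X m Y (ldiff M m') \<phi>))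
   = cut_sum Y (%U V. ?t U V (%V \<chi>. sg (fst m + bd V) (\<chi> (lmul M (bM m V) (ldiff M m')))))"
   unfolding lbar_mul_def cut_sum_sg[symmetric]
   by (intro cut_sum_cong) (simp add: weave_sum_sg, intro sg_cong, auto simp: parity)
  have 3: "sg (bd X + fst m) (if Y = [] then 0 else sg (bd (butlast Y)) (lbar_mul X m (butlast Y) (lmul M (lH (last Y)) m') \<phi>))
   = cut_sum Y (%U V. ?t U V (%V \<chi>. if V = [] then 0 else sg (fst m + bd (butlast V)) (\<chi> (lmul M (bM m (butlast V)) (lmul M (lH (last V)) m')))))"
  proof -
   have "cut_sum Y (%U V. ?t U V (%V \<chi>. if V = [] then 0 else sg (fst m + bd (butlast V)) (\<chi> (lmul M (bM m (butlast V)) (lmul M (lH (last V)) m')))))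
    = cut_sum Y (%U V. if V = [] then 0 else sg (bd X + bd U + fst m * bd U + (fst m + bd (butlast V)))
      (ws X U (%P. \<phi> P (lmul M (bM m (butlast V)) (lmul M (lH (last V)) m')))))"
    by (intro cut_sum_cong) (simp add: weave_sum_sg weave_sum_zero)
   also have "... = (if Y = [] then 0 else cut_sum (butlast Y) (%U V. sg (bd X + bd U + fst m * bd U + (fst m + bd V))
      (ws X U (%P. \<phi> P (lmul M (bM m V) (lmul M (lH (last Y)) m'))))))"
    by (rule cut_sum_butlast)
   also have "... = sg (bd X + fst m) (if Y = [] then 0 else sg (bd (butlast Y)) (lbar_mul X m (butlast Y) (lmul M (lH (last Y)) m') \<phi>))"
    unfolding lbar_mul_def
    by (cases "Y = []") (simp_all add: cut_sum_sg[symmetric], intro cut_sum_cong, simp, intro sg_cong, auto simp: parity)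
   finally show ?thesis by simp
  qed
  show ?thesis unfolding lbar_diff_def sg_simps(4) 1 2 3 ..
 qed
 show ?thesis unfolding L b1 R1 R2 by (simp add: algebra_simps)
qed

end

section \<open>From the axioms to letters\<close>

lemma letters_label_or_zero:
 assumes A: "graded A" and X: "X \<in> lists (letters A)"
 shows "0 \<in> snd ` set X \<or> (\<forall>x\<in>set X. fst x = deg A (snd x))"
proof (cases "0 \<in> snd ` set X")
 case False
 have "fst x = deg A (snd x)" if "x \<in> set X" for x
 proof -
  have "x \<in> letters A" "snd x \<noteq> 0" using X False that by (auto simp: in_lists_conv_set simp del: letters_iff)
  then show ?thesis using deg_eq[OF A snd_letters] by metis
 qed
 then show ?thesis by blast
qed simp

lemma dsum_bd: "\<forall>x\<in>set X. fst x = deg A (snd x) ==> dsum A (map snd X) = bd X + int (length X)"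
 by (induction X) (auto simp: dsum_def)

definition ins_from :: "nat => nat => nat => (nat \<times> nat) list set" where
 "ins_from n s m = {ks \<in> insertions n m. n > 0 \<longrightarrow> s \<le> fst (ks ! 0)}"

lemma insertions_le: "ks \<in> insertions n m ==> n > 0 ==> fst (ks ! 0) \<le> m"
proof (induction n arbitrary: ks)
 case (Suc n)
 then obtain k ks' where ks: "ks = k # ks'" by (cases ks) (auto simp: insertions_def)
 have step: "fst (ks ! p) + snd (ks ! p) \<le> (if Suc p < Suc n then fst (ks ! Suc p) else m)" if "p < Suc n" for p
  using Suc.prems(1) that unfolding insertions_def by blast
 show ?case
 proof (cases n)
  case 0
  then show ?thesis using step[of 0] by simp
 next
  case (Suc n')
  have "fst (ks' ! p) + snd (ks' ! p) \<le> (if Suc p < n then fst (ks' ! Suc p) else m)" if "p < n" for p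
   using step[of "Suc p"] that ks by (simp split: if_splits)
  then have "ks' \<in> insertions n m"
   using Suc.prems(1) ks by (simp add: insertions_def)
  then have "fst (ks' ! 0) \<le> m" using Suc.IH Suc by simp
  then show ?thesis using step[of 0] Suc ks by simp
 qed
qed simp

lemma ins_from_0: "ins_from 0 s m = {[]}"
 by (auto simp: ins_from_def insertions_def)

lemma Cons_in_ins_from:
 "(i, l) # ks \<in> ins_from (Suc n) s m \<longleftrightarrow> s \<le> i \<and> i + l \<le> m \<and> ks \<in> ins_from n (i + l) m"
proof
 assume *: "(i, l) # ks \<in> ins_from (Suc n) s m"
 then have len: "length ks = n" and step: "!!p. p < Suc n ==>
   fst (((i, l) # ks) ! p) + snd (((i, l) # ks) ! p) \<le> (if Suc p < Suc n then fst (((i, l) # ks) ! Suc p) else m)"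
  unfolding ins_from_def insertions_def by auto
 have "fst (ks ! p) + snd (ks ! p) \<le> (if Suc p < n then fst (ks ! Suc p) else m)" if "p < n" for p
  using step[of "Suc p"] that by (simp split: if_splits)
 then have ks: "ks \<in> insertions n m" using len by (simp add: insertions_def)
 have "i + l \<le> (if 0 < n then fst (ks ! 0) else m)" using step[of 0] by (simp split: if_splits)
 then show "s \<le> i \<and> i + l \<le> m \<and> ks \<in> ins_from n (i + l) m"
  using * ks insertions_le[OF ks] unfolding ins_from_def by (auto split: if_splits)
next
 assume *: "s \<le> i \<and> i + l \<le> m \<and> ks \<in> ins_from n (i + l) m"
 then have len: "length ks = n" and step: "!!p. p < n ==>
   fst (ks ! p) + snd (ks ! p) \<le> (if Suc p < n then fst (ks ! Suc p) else m)"
  unfolding ins_from_def insertions_def by auto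
 have "fst (((i, l) # ks) ! p) + snd (((i, l) # ks) ! p) \<le> (if Suc p < Suc n then fst (((i, l) # ks) ! Suc p) else m)"
  if "p < Suc n" for p
  using that step[of "p - 1"] * by (cases p) (auto simp: ins_from_def)
 then show "(i, l) # ks \<in> ins_from (Suc n) s m"
  using len * unfolding ins_from_def insertions_def by auto
qed

lemma ins_from_Suc:
 "ins_from (Suc n) s m = (\<Union>i\<in>{s..m}. \<Union>l\<in>{..m - i}. Cons (i, l) ` ins_from n (i + l) m)"
proof
 show "ins_from (Suc n) s m \<subseteq> (\<Union>i\<in>{s..m}. \<Union>l\<in>{..m - i}. Cons (i, l) ` ins_from n (i + l) m)"
 proof
  fix ks assume ks: "ks \<in> ins_from (Suc n) s m"
  then obtain i l ks' where k: "ks = (i, l) # ks'" by (cases ks) (auto simp: ins_from_def insertions_def)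
  then have "s \<le> i \<and> i + l \<le> m \<and> ks' \<in> ins_from n (i + l) m" using ks Cons_in_ins_from by simp
  then show "ks \<in> (\<Union>i\<in>{s..m}. \<Union>l\<in>{..m - i}. Cons (i, l) ` ins_from n (i + l) m)" unfolding k by (intro UN_I[of i] UN_I[of l] imageI) auto
 qed
 show "(\<Union>i\<in>{s..m}. \<Union>l\<in>{..m - i}. Cons (i, l) ` ins_from n (i + l) m) \<subseteq> ins_from (Suc n) s m"
  using Cons_in_ins_from by auto
qed

lemma finite_ins_from: "finite (ins_from n s m)"
 by (induction n arbitrary: s) (auto simp: ins_from_0 ins_from_Suc)

lemma sum_ins_from_Suc:
 "(\<Sum>ks\<in>ins_from (Suc n) s m. f ks) = (\<Sum>i\<in>{s..m}. \<Sum>l\<le>m - i. \<Sum>ks\<in>ins_from n (i + l) m. f ((i, l) # ks))"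
proof -
 have inner: "(\<Sum>ks\<in>(\<Union>l\<in>{..m - i}. Cons (i, l) ` ins_from n (i + l) m). f ks)
   = (\<Sum>l\<le>m - i. \<Sum>ks\<in>ins_from n (i + l) m. f ((i, l) # ks))" for i
  by (subst sum.UNION_disjoint) (auto simp: finite_ins_from sum.reindex inj_on_def)
 have "(\<Sum>ks\<in>ins_from (Suc n) s m. f ks) = (\<Sum>i\<in>{s..m}. \<Sum>ks\<in>(\<Union>l\<in>{..m - i}. Cons (i, l) ` ins_from n (i + l) m). f ks)"
  unfolding ins_from_Suc by (subst sum.UNION_disjoint) (auto simp: finite_ins_from)
 then show ?thesis by (simp only: inner)
qed

lemma weave_exp_Cons:
 "weave_exp A (x # xs) (k # ks) ys = (deg A x + 1) * (\<Sum>q<fst k. deg A (ys ! q) + 1) + weave_exp A xs ks ys"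
 unfolding weave_exp_def by (simp add: sum.lessThan_Suc_shift del: sum.lessThan_Suc)

lemma even_bd_take:
 assumes "\<forall>y\<in>set Y. fst y = deg A (snd y)" "i \<le> length Y"
 shows "even (\<Sum>q<i. deg A (map snd Y ! q) + 1) = even (bd (take i Y))"
 using assms(2)
proof (induction i)
 case (Suc i)
 then have Y: "fst (Y ! i) = deg A (map snd Y ! i)" using assms(1) by simp
 have "bd (take (Suc i) Y) = bd (take i Y) + (fst (Y ! i) - 1)" using Suc.prems by (simp add: take_Suc_conv_app_nth)
 then show ?case using Suc Y by (simp add: parity)
qed simp

lemma sum_from: "s \<le> m ==> (\<Sum>i\<in>{s..m::nat}. F i) = (\<Sum>k\<le>m - s. F (s + k))"
 by (rule sum.reindex_bij_witness[of _ "%k. s + k" "%i. i - s"]) auto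

text \<open>Positions from \<open>s\<close> on, so that the recursion of \<open>weave\<close> becomes that of \<open>weave_sum\<close>.\<close>

lemma weave_sum_from:
 assumes "\<forall>x\<in>set X. fst x = deg A (snd x)" "\<forall>y\<in>set Y. fst y = deg A (snd y)" "s \<le> length Y"
 shows "(\<Sum>ks\<in>ins_from (length X) s (length Y).
   sg (weave_exp A (map snd X) ks (map snd Y)) (\<phi> (weave b s (map snd X) ks (map snd Y))))
  = sg (bd X * bd (take s Y)) (weave_sum b X (drop s Y) (%W. \<phi> (map snd W)))"
 using assms(1,3)
proof (induction X arbitrary: s \<phi>)
 case Nil
 then show ?case by (simp add: ins_from_0 weave_exp_def drop_map)
next
 case (Cons x X)
 let ?m = "length Y"
 have t: "take l (drop i (map snd Y)) = map snd (take l (drop i Y))" for l i by (simp add: take_map drop_map)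
 have "(\<Sum>ks\<in>ins_from (length (x # X)) s ?m.
   sg (weave_exp A (map snd (x # X)) ks (map snd Y)) (\<phi> (weave b s (map snd (x # X)) ks (map snd Y))))
  = (\<Sum>i\<in>{s..?m}. \<Sum>l\<le>?m - i. \<Sum>ks\<in>ins_from (length X) (i + l) ?m.
    sg ((fst x + 1) * (\<Sum>q<i. deg A (map snd Y ! q) + 1)) (sg (weave_exp A (map snd X) ks (map snd Y))
     (\<phi> (map snd (take (i - s) (drop s Y)) @ b (snd x) (map snd (take l (drop i Y))) # weave b (i + l) (map snd X) ks (map snd Y)))))"
  using Cons.prems by (simp add: sum_ins_from_Suc weave_exp_Cons t)
 also have "... = (\<Sum>i\<in>{s..?m}. \<Sum>l\<le>?m - i. sg ((fst x + 1) * (\<Sum>q<i. deg A (map snd Y ! q) + 1))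
    (sg (bd X * bd (take (i + l) Y)) (weave_sum b X (drop (i + l) Y)
     (%W. \<phi> (map snd (take (i - s) (drop s Y)) @ b (snd x) (map snd (take l (drop i Y))) # map snd W)))))"
 proof (intro sum.cong refl, unfold sg_sum[symmetric])
  fix i l assume "i \<in> {s..?m}" "l \<in> {..?m - i}"
  then have "i + l \<le> ?m" by auto
  from Cons.IH[OF _ this, of "%w. \<phi> (map snd (take (i - s) (drop s Y)) @ b (snd x) (map snd (take l (drop i Y))) # w)"] Cons.prems
  show "sg ((fst x + 1) * (\<Sum>q<i. deg A (map snd Y ! q) + 1)) (\<Sum>ks\<in>ins_from (length X) (i + l) ?m.
    sg (weave_exp A (map snd X) ks (map snd Y)) (\<phi> (map snd (take (i - s) (drop s Y)) @ b (snd x) (map snd (take l (drop i Y))) # weave b (i + l) (map snd X) ks (map snd Y))))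
   = sg ((fst x + 1) * (\<Sum>q<i. deg A (map snd Y ! q) + 1)) (sg (bd X * bd (take (i + l) Y)) (weave_sum b X (drop (i + l) Y)
     (%W. \<phi> (map snd (take (i - s) (drop s Y)) @ b (snd x) (map snd (take l (drop i Y))) # map snd W))))"
   by simp
 qed
 also have "... = (\<Sum>k\<le>?m - s. \<Sum>l\<le>?m - (s + k). sg (bd (x # X) * bd (take s Y))
    (sg ((fst x - 1) * bd (take k (drop s Y)) + bd X * (bd (take k (drop s Y)) + bd (take l (drop k (drop s Y)))))
    (weave_sum b X (drop l (drop k (drop s Y))) (%W. \<phi> (map snd (take k (drop s Y) @ lbr b x (take l (drop k (drop s Y))) # W))))))"
 proof -
  show ?thesis
  proof (unfold sum_from[OF Cons.prems(2)], intro sum.cong refl)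
   fix k l assume kl: "k \<in> {..?m - s}" "l \<in> {..?m - (s + k)}"
   have e1: "drop (s + k) Y = drop k (drop s Y)" and e2: "drop (s + k + l) Y = drop l (drop k (drop s Y))"
    by (simp_all add: ac_simps)
   have b1: "bd (take (s + k) Y) = bd (take s Y) + bd (take k (drop s Y))"
    by (simp add: take_add)
   have b2: "bd (take (s + k + l) Y) = bd (take s Y) + bd (take k (drop s Y)) + bd (take l (drop k (drop s Y)))"
    by (simp add: take_add e1)
   have e: "even (\<Sum>q<s + k. deg A (map snd Y ! q) + 1) = even (bd (take s Y) + bd (take k (drop s Y)))"
    using even_bd_take[OF assms(2), of "s + k"] kl Cons.prems(2) by (simp add: b1)
   show "sg ((fst x + 1) * (\<Sum>q<s + k. deg A (map snd Y ! q) + 1))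
    (sg (bd X * bd (take (s + k + l) Y)) (weave_sum b X (drop (s + k + l) Y)
     (%W. \<phi> (map snd (take (s + k - s) (drop s Y)) @ b (snd x) (map snd (take l (drop (s + k) Y))) # map snd W))))
    = sg (bd (x # X) * bd (take s Y))
    (sg ((fst x - 1) * bd (take k (drop s Y)) + bd X * (bd (take k (drop s Y)) + bd (take l (drop k (drop s Y)))))
    (weave_sum b X (drop l (drop k (drop s Y))) (%W. \<phi> (map snd (take k (drop s Y) @ lbr b x (take l (drop k (drop s Y))) # W)))))"
    unfolding sg_simps b2 e1 e2
    by (simp add: lbr_def) (intro sg_cong, use e in \<open>auto simp: parity\<close>)
  qed
 qed
 also have "... = sg (bd (x # X) * bd (take s Y)) (weave_sum b (x # X) (drop s Y) (%W. \<phi> (map snd W)))"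
  unfolding weave_sum_Cons cut_sum_take_drop[symmetric] sg_sum by (simp add: add.commute)
 finally show ?case .
qed

lemma weave_sum_insertions:
 assumes "\<forall>x\<in>set X. fst x = deg A (snd x)" "\<forall>y\<in>set Y. fst y = deg A (snd y)"
 shows "(\<Sum>ks\<in>insertions (length X) (length Y).
   sg (weave_exp A (map snd X) ks (map snd Y)) (\<phi> (weave b 0 (map snd X) ks (map snd Y))))
  = weave_sum b X Y (%W. \<phi> (map snd W))"
 using weave_sum_from[OF assms, of 0 \<phi> b] by (simp add: ins_from_def)

lemma diff_sum_indexed:
 assumes "\<forall>x\<in>set X. fst x = deg A (snd x)"
 shows "(\<Sum>i<length X. sg (dsum A (take i (map snd X)) + int (i + 1)) (\<phi> ((map snd X)[i := diff A (map snd X ! i)])))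
   + (\<Sum>i<length X - 1. sg (dsum A (take (i + 1) (map snd X)) + int (i + 1) + 1)
     (\<phi> (take i (map snd X) @ mul A (map snd X ! i) (map snd X ! (i + 1)) # drop (i + 2) (map snd X))))
   = diff_sum A X (%W. \<phi> (map snd W))"
 using assms
proof (induction X arbitrary: \<phi>)
 case (Cons x X)
 let ?x = "snd x" and ?X = "map snd X"
 have IH: "(\<Sum>i<length X. sg (dsum A (take i ?X) + int (i + 1)) (\<phi> (?x # ?X[i := diff A (?X ! i)])))
   + (\<Sum>i<length X - 1. sg (dsum A (take (i + 1) ?X) + int (i + 1) + 1)
     (\<phi> (?x # take i ?X @ mul A (?X ! i) (?X ! (i + 1)) # drop (i + 2) ?X)))
   = diff_sum A X (%W. \<phi> (map snd (x # W)))"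
  using Cons.IH[of "%w. \<phi> (?x # w)"] Cons.prems by simp
 have d: "dsum A (?x # w) = fst x + dsum A w" for w using Cons.prems by (simp add: dsum_def)
 have 1: "(\<Sum>i<length (x # X). sg (dsum A (take i (map snd (x # X))) + int (i + 1)) (\<phi> ((map snd (x # X))[i := diff A (map snd (x # X) ! i)])))
  = - \<phi> (map snd (ldiff A x # X)) + sg (fst x - 1) (\<Sum>i<length X. sg (dsum A (take i ?X) + int (i + 1)) (\<phi> (?x # ?X[i := diff A (?X ! i)])))"
 proof -
  let ?f = "%i. sg (dsum A (take i (map snd (x # X))) + int (i + 1)) (\<phi> ((map snd (x # X))[i := diff A (map snd (x # X) ! i)]))"
  have "(\<Sum>i<length (x # X). ?f i) = ?f 0 + (\<Sum>i<length X. ?f (Suc i))"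
   by (simp only: list.size(4) add_0_right add_Suc_right One_nat_def sum.lessThan_Suc_shift)
  also have "?f 0 = - \<phi> (map snd (ldiff A x # X))" by (simp add: dsum_def ldiff_def sg_def)
  also have "(\<Sum>i<length X. ?f (Suc i)) = (\<Sum>i<length X. sg (fst x - 1) (sg (dsum A (take i ?X) + int (i + 1)) (\<phi> (?x # ?X[i := diff A (?X ! i)]))))"
   unfolding sg_simps(3) by (rule sum.cong[OF refl], simp add: d, intro sg_cong, auto simp: parity)
  finally show ?thesis by (simp only: sg_sum)
 qed
 have 2: "(\<Sum>i<length (x # X) - 1. sg (dsum A (take (i + 1) (map snd (x # X))) + int (i + 1) + 1)
     (\<phi> (take i (map snd (x # X)) @ mul A (map snd (x # X) ! i) (map snd (x # X) ! (i + 1)) # drop (i + 2) (map snd (x # X)))))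
   = sg (fst x - 1) (\<Sum>i<length X - 1. sg (dsum A (take (i + 1) ?X) + int (i + 1) + 1)
     (\<phi> (?x # take i ?X @ mul A (?X ! i) (?X ! (i + 1)) # drop (i + 2) ?X)))
   + (case X of [] => 0 | y # X' => sg (fst x) (\<phi> (map snd (lmul A x y # X'))))"
 proof (cases X)
  case (Cons y X')
  have "(\<Sum>i<length X'. sg (dsum A (take (i + 2) (map snd (x # X))) + int (i + 2) + 1)
     (\<phi> (?x # take i ?X @ mul A (?X ! i) (?X ! (i + 1)) # drop (i + 2) ?X)))
   = (\<Sum>i<length X'. sg (fst x - 1) (sg (dsum A (take (i + 1) ?X) + int (i + 1) + 1)
     (\<phi> (?x # take i ?X @ mul A (?X ! i) (?X ! (i + 1)) # drop (i + 2) ?X))))"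
   unfolding sg_simps by (intro sum.cong refl sg_cong) (simp add: d parity)
  then show ?thesis
   by (simp add: Cons sum.lessThan_Suc_shift sg_sum d lmul_def del: sum.lessThan_Suc)
    (simp add: dsum_def sg_def)
 qed simp
 show ?case unfolding 1 2 using IH[symmetric] by (simp add: algebra_simps)
qed simp

context brace_ops
begin

text \<open>
 If some entry is \<open>0\<close>, both sides vanish by multilinearity; otherwise all labels are the actual
 degrees and the signs agree.
\<close>

lemma brace_tail_of_action:
 fixes M :: "('k, 'm::ab_group_add, 's) dga_scheme"
 assumes M: "dga M" and h: "graded_map A M 0 h" and act: "brace_action A M h b"
 shows "brace_tail A M h b"
proof -
 have nil: "!!m. m \<in> homog M ==> b m [] = m" and multM: "brace_multilinear A M b"
  and as: "brace_associative A M b" and ho: "brace_homotopies A M h b" and di: "brace_distributive A M b"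
  using act unfolding brace_action_def by auto
 note gM = dga_graded[OF M] and tM = graded_vector_space[OF dga_graded[OF M]]
 note z = brace_zero_left[OF gA gM multM] brace_zero_right[OF gA gM multM]
 note ml = mlin_lbr[OF gA gM multM]
 have hom: "map snd X \<in> lists (homog A)" if "X \<in> L" for X using that map_snd_lists[OF gA] by blast
 have sL: "lin1 M (scal M) snd" by (rule lin1_snd)
 have bl0: "snd (lbr b m X) = b (snd m) (map snd X)" for m X by (simp add: lbr_def)
 have mX: "mlin A (scal M) (%X. b (snd m) (map snd X))" if "m \<in> letters M" for m
  using ml[OF sL that] by (simp add: bl0)
 have b0: "b 0 (map snd X) = 0" if "X \<in> L" for X using z(1) that .
 have good: "snd m = 0 \<or> fst m = deg M (snd m)" if "m \<in> letters M" for m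
  using deg_eq[OF gM snd_letters[OF that]] by metis
 show ?thesis
 proof
  show "dga M" "brace_multilinear A M b" "graded_map A M 0 h" by fact+
  show "b m [] = m" if "m \<in> homog M" for m using nil that .
 next
  fix m X Y assume m: "m \<in> letters M" and X: "X \<in> L" and Y: "Y \<in> L"
  show "b (b (snd m) (map snd X)) (map snd Y) = ws X Y (%W. b (snd m) (map snd W))"
  proof (cases "snd m = 0 \<or> 0 \<in> snd ` set X \<or> 0 \<in> snd ` set Y")
   case True
   have "b (b (snd m) (map snd X)) (map snd Y) = 0"
    using True b0[OF X] b0[OF Y] z(2)[OF snd_letters[OF m] X] z(2)[OF snd_letters[OF lbr_letters[OF gA gM multM m X]] Y]
    unfolding bl0 by metis
   moreover have "ws X Y (%W. b (snd m) (map snd W)) = 0"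
   proof (cases "snd m = 0")
    case True
    have "ws X Y (%W. b (snd m) (map snd W)) = ws X Y (%W. 0)" by (rule ws_cong[OF X Y]) (simp add: True b0)
    then show ?thesis by (simp add: weave_sum_zero)
   next
    case False
    then show ?thesis
     using True mlin_zero[OF gA tM mlin_ws_left[OF tM mX[OF m] Y] X] mlin_zero[OF gA tM mlin_ws_right[OF tM mX[OF m] X] Y]
     by blast
   qed
   ultimately show ?thesis by simp
  next
   case False
   then have l: "\<forall>x\<in>set X. fst x = deg A (snd x)" "\<forall>x\<in>set Y. fst x = deg A (snd x)"
    using letters_label_or_zero[OF gA X] letters_label_or_zero[OF gA Y] by blast+
   have "b (b (snd m) (map snd X)) (map snd Y) = (\<Sum>ks\<in>insertions (length (map snd X)) (length (map snd Y)).
     scal M (ksign (weave_exp A (map snd X) ks (map snd Y))) (b (snd m) (weave (brc A) 0 (map snd X) ks (map snd Y))))"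
    using as homogI[OF snd_letters[OF m]] hom[OF X] hom[OF Y] unfolding brace_associative_def by blast
   then show ?thesis using weave_sum_insertions[OF l, of "b (snd m)" "brc A"] by (simp add: scal_sg[OF gM])
  qed
 next
  fix m m' Y assume m: "m \<in> letters M" "m' \<in> letters M" and Y: "Y \<in> L"
  have mm: "b (mul M (snd m) (snd m')) (map snd Y) = (\<Sum>k\<le>length (map snd Y).
    scal M (ksign (deg M (snd m') * (dsum A (take k (map snd Y)) + int k)))
     (mul M (b (snd m) (take k (map snd Y))) (b (snd m') (drop k (map snd Y)))))"
   using di homogI[OF snd_letters[OF m(1)]] homogI[OF snd_letters[OF m(2)]] hom[OF Y] unfolding brace_distributive_def by blast
  have gb: "b (snd n) (map snd X) \<in> gr M (fst n + bd X)" if "n \<in> letters M" "X \<in> L" for n X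
   using snd_letters[OF lbr_letters[OF gA gM multM that]] by (simp add: lbr_def)
  show "b (mul M (snd m) (snd m')) (map snd Y)
    = cut_sum Y (%U V. sg (fst m' * bd U) (mul M (b (snd m) (map snd U)) (b (snd m') (map snd V))))"
  proof (cases "snd m' = 0 \<or> 0 \<in> snd ` set Y")
   case True
   have "b (mul M (snd m) (snd m')) (map snd Y) = 0"
    using True b0[OF Y] dga_mul_zero(1)[OF M snd_letters[OF m(1)]] z(2)[OF dga_mul_gr[OF M snd_letters snd_letters, OF m] Y] by auto
   moreover have "cut_sum Y (%U V. sg (fst m' * bd U) (mul M (b (snd m) (map snd U)) (b (snd m') (map snd V)))) = cut_sum Y (%U V. 0)"
   proof (rule cut_sum_cong)
    fix U V assume UV: "Y = U @ V"
    then have l: "U \<in> L" "V \<in> L" using Y by auto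
    have "b (snd m) (map snd U) = 0 \<or> b (snd m') (map snd V) = 0"
     using True UV z(2)[OF snd_letters[OF m(1)] l(1)] z(2)[OF snd_letters[OF m(2)] l(2)] b0[OF l(2)] by auto
    then show "sg (fst m' * bd U) (mul M (b (snd m) (map snd U)) (b (snd m') (map snd V))) = 0"
     using dga_mul_zero(1)[OF M gb[OF m(1) l(1)]] dga_mul_zero(2)[OF M gb[OF m(2) l(2)]] by auto
   qed
   ultimately show ?thesis by (simp add: cut_sum_zero)
  next
   case False
   then have l: "\<forall>x\<in>set Y. fst x = deg A (snd x)" "deg M (snd m') = fst m'"
    using letters_label_or_zero[OF gA Y] good[OF m(2)] by auto
   have d: "even (dsum A (take k (map snd Y)) + int k) = even (bd (take k Y))" if "k \<le> length Y" for k
   proof -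
    have "\<forall>x\<in>set (take k Y). fst x = deg A (snd x)" using l(1) by (auto dest: in_set_takeD)
    then show ?thesis using dsum_bd[of "take k Y" A] that by (auto simp: take_map parity)
   qed
   show ?thesis unfolding mm cut_sum_take_drop[symmetric] length_map
    by (intro sum.cong refl) (simp add: scal_sg[OF gM] take_map drop_map l(2), intro sg_cong, use d in \<open>auto simp: parity take_map\<close>)
  qed
 next
  fix m Y assume m: "m \<in> letters M" and Y: "Y \<in> L" and ne: "Y \<noteq> []"
  have ht: "hd Y \<in> letters A" "tl Y \<in> L" "last Y \<in> letters A" "butlast Y \<in> L"
   using Y ne by (auto simp: in_lists_conv_set dest: in_set_butlastD list.set_sel(2) simp del: letters_iff)
  have gb: "b (snd n) (map snd X) \<in> gr M (fst n + bd X)" if "n \<in> letters M" "X \<in> L" for n X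
   using snd_letters[OF lbr_letters[OF gA gM multM that]] by (simp add: lbr_def)
  have gh: "h (snd x) \<in> gr M (fst x)" if "x \<in> letters A" for x
   using graded_map_mem[OF h snd_letters[OF that]] by simp
  have dm: "diff M (snd m) \<in> gr M (fst m + 1)" by (rule dga_diff_gr[OF M snd_letters[OF m]])
  have h0: "h 0 = 0" and d0: "diff M 0 = 0"
   using graded_map_zero[OF h gA] graded_map_zero[OF dga_diff_map[OF M] gM] by auto
  show "diff M (b (snd m) (map snd Y)) = b (diff M (snd m)) (map snd Y)
    + sg (fst m) (diff_sum A Y (%W. b (snd m) (map snd W)))
    - sg ((fst (hd Y) - 1) * fst m) (mul M (h (snd (hd Y))) (b (snd m) (map snd (tl Y))))
    + sg (fst m + bd (butlast Y)) (mul M (b (snd m) (map snd (butlast Y))) (h (snd (last Y))))"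
  proof (cases "snd m = 0 \<or> 0 \<in> snd ` set Y")
   case True
   have 1: "b (snd m) (map snd Y) = 0" using True b0[OF Y] z(2)[OF snd_letters[OF m] Y] by auto
   have 2: "b (diff M (snd m)) (map snd Y) = 0" using True b0[OF Y] z(2)[OF dm Y] d0 by auto
   have 3: "diff_sum A Y (%W. b (snd m) (map snd W)) = 0"
   proof (cases "snd m = 0")
    case True
    have "diff_sum A Y (%W. b (snd m) (map snd W)) = diff_sum A Y (%W. 0)"
     by (rule diff_sum_cong[OF Y]) (simp add: True b0)
    then show ?thesis by (simp add: diff_sum_zero)
   next
    case False
    then show ?thesis using True mlin_zero[OF gA tM mlin_diff_sum[OF tM mX[OF m]] Y] by blast
   qed
   have 4: "mul M (h (snd (hd Y))) (b (snd m) (map snd (tl Y))) = 0"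
   proof -
    have "snd (hd Y) = 0 \<or> b (snd m) (map snd (tl Y)) = 0"
     using True ne b0[OF ht(2)] z(2)[OF snd_letters[OF m] ht(2)] by (cases Y) auto
    then show ?thesis using dga_mul_zero(1)[OF M gh[OF ht(1)]] dga_mul_zero(2)[OF M gb[OF m ht(2)]] h0 by auto
   qed
   have 5: "mul M (b (snd m) (map snd (butlast Y))) (h (snd (last Y))) = 0"
   proof -
    have "set Y = insert (last Y) (set (butlast Y))" using ne by (metis append_butlast_last_id list.set(2) rotate1.simps(2) set_rotate1)
    then have "snd (last Y) = 0 \<or> b (snd m) (map snd (butlast Y)) = 0"
     using True b0[OF ht(4)] z(2)[OF snd_letters[OF m] ht(4)] by auto
    then show ?thesis using dga_mul_zero(2)[OF M gh[OF ht(3)]] dga_mul_zero(1)[OF M gb[OF m ht(4)]] h0 by auto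
   qed
   show ?thesis unfolding 1 2 3 4 5 by (simp add: d0)
  next
   case False
   then have l: "\<forall>x\<in>set Y. fst x = deg A (snd x)" "deg M (snd m) = fst m"
    using letters_label_or_zero[OF gA Y] good[OF m] by auto
   have ne': "map snd Y \<noteq> []" using ne by simp
   have H: "diff M (b (snd m) (map snd Y)) = b (diff M (snd m)) (map snd Y)
    + (\<Sum>i<length (map snd Y). scal M (ksign (deg M (snd m) + dsum A (take i (map snd Y)) + int (i + 1)))
        (b (snd m) ((map snd Y)[i := diff A (map snd Y ! i)])))
     + (\<Sum>i<length (map snd Y) - 1. scal M (ksign (deg M (snd m) + dsum A (take (i + 1) (map snd Y)) + int (i + 1) + 1))
        (b (snd m) (take i (map snd Y) @ mul A (map snd Y ! i) (map snd Y ! (i + 1)) # drop (i + 2) (map snd Y))))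
     - scal M (ksign ((deg A (hd (map snd Y)) + 1) * deg M (snd m))) (mul M (h (hd (map snd Y))) (b (snd m) (tl (map snd Y))))
     - scal M (ksign (deg M (snd m) + dsum A (butlast (map snd Y)) + int (length (map snd Y))))
        (mul M (b (snd m) (butlast (map snd Y))) (h (last (map snd Y))))"
    using ho[unfolded brace_homotopies_def, rule_format, OF homogI[OF snd_letters[OF m]] hom[OF Y] ne'] .
   have S: "(\<Sum>i<length (map snd Y). scal M (ksign (deg M (snd m) + dsum A (take i (map snd Y)) + int (i + 1)))
        (b (snd m) ((map snd Y)[i := diff A (map snd Y ! i)])))
     + (\<Sum>i<length (map snd Y) - 1. scal M (ksign (deg M (snd m) + dsum A (take (i + 1) (map snd Y)) + int (i + 1) + 1))
        (b (snd m) (take i (map snd Y) @ mul A (map snd Y ! i) (map snd Y ! (i + 1)) # drop (i + 2) (map snd Y))))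
     = sg (fst m) (diff_sum A Y (%W. b (snd m) (map snd W)))"
    unfolding diff_sum_indexed[OF l(1), of "b (snd m)", symmetric] by (simp add: l(2) scal_sg[OF gM] sg_sum add.assoc)
   have h1: "deg A (hd (map snd Y)) = fst (hd Y)" using l(1) ne by (simp add: hd_map)
   have h2: "dsum A (butlast (map snd Y)) = bd (butlast Y) + int (length Y - 1)"
    using dsum_bd[of "butlast Y" A] l(1) by (auto simp: map_butlast[symmetric] dest: in_set_butlastD)
   have len: "even (int (length Y - 1) + int (length Y)) = False" using ne by (cases Y) auto
   have s1: "sg ((fst (hd Y) + 1) * fst m) v = sg ((fst (hd Y) - 1) * fst m) v" for v :: 'm
    by (rule sg_cong) (auto simp: parity)
   have s2: "sg (fst m + (bd (butlast Y) + int (length Y - 1)) + int (length Y)) v = - sg (fst m + bd (butlast Y)) v" for v :: 'm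
    using len by (auto simp: sg_def parity)
   show ?thesis
    unfolding H scal_sg[OF gM] h1 h2 l(2) length_map s1 s2
    using S by (simp add: scal_sg[OF gM] l(2) hd_map[OF ne] last_map[OF ne] map_tl[symmetric] map_butlast[symmetric] algebra_simps)
  qed
 qed
qed

end

lemma brace_algebra_letters:
 assumes "brace_algebra A"
 shows "brace_alg A"
proof -
 have A: "dga A" and act: "brace_action A A id (brc A)" using assms unfolding brace_algebra_def by auto
 interpret brace_ops A
  by unfold_locales (use A act in \<open>auto simp: brace_action_def\<close>)
 have "graded_map A A 0 id" by (auto simp: graded_map_def lin_on_def)
 from brace_tail_of_action[OF A this act] show ?thesis by (simp add: brace_alg_def)
qed

lemma brace_module_letters:
 fixes A :: "('k::field, 'a::ab_group_add, 'r) brace_alg_scheme"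
 assumes A: "brace_alg A" and M: "left_brace_module A M"
 shows "brace_module A M (act M) (mbr M)"
proof -
 interpret brace_alg A by fact
 have hom: "dga_hom A M (act M)" and compat: "!!x ys. x \<in> homog A ==> ys \<in> lists (homog A) ==> mbr M (act M x) ys = act M (brc A x ys)"
  and act: "brace_action A M (act M) (mbr M)" using M unfolding left_brace_module_def by auto
 have "dga M" "graded_map A M 0 (act M)" using hom unfolding dga_hom_def by auto
 then interpret T: brace_tail A M "act M" "mbr M" using brace_tail_of_action act by blast
 show ?thesis
 proof
  show "dga_hom A M (act M)" by fact
  show "mbr M (act M (snd x)) (map snd Y) = act M (brc A (snd x) (map snd Y))" if "x \<in> letters A" "Y \<in> lists (letters A)" for x Y
   using compat homogI[OF snd_letters[OF that(1)]] that(2) map_snd_lists[OF gA] by blast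
 qed
qed

section \<open>The opposite brace algebra\<close>

text \<open>The exponent of the sign by which the reversal of a word of letters is twisted.\<close>

primrec rexp :: "(int \<times> 'a) list => int" where
 "rexp [] = 0"
| "rexp (x # X) = rexp X + (fst x - 1) * bd X + 1"

lemma rexp_append: "even (rexp (X @ Y)) = even (rexp X + rexp Y + bd X * bd Y)"
 by (induction X) (auto simp: parity)

lemma rexp_rev [simp]: "even (rexp (rev X)) = even (rexp X)"
 by (induction X) (auto simp: rexp_append parity)

lemma rexp_cong: "map fst X = map fst Y ==> rexp X = rexp Y"
proof (induction X arbitrary: Y)
 case (Cons x X)
 then obtain y Y' where "Y = y # Y'" by (cases Y) auto
 then show ?case using Cons map_fst_bd[of X Y'] by simp
qed simp

lemma rev_exp_rexp:
 "\<forall>x\<in>set X. fst x = deg A (snd x) ==> even (rev_exp A (map snd X)) = even (rexp X)"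
proof (induction X)
 case (Cons x X)
 let ?f = "%xs i. deg A (xs ! i) + 1"
 have "(\<Sum>j<length (x # X). \<Sum>i<j. ?f (map snd (x # X)) i * ?f (map snd (x # X)) j)
  = (\<Sum>j<length X. \<Sum>i<Suc j. ?f (map snd (x # X)) i * ?f (map snd (x # X)) (Suc j))"
  unfolding list.size(4) add_0_right add_Suc_right One_nat_def sum.lessThan_Suc_shift[of _ "length X"] by simp
 also have "... = (\<Sum>j<length X. ?f (map snd (x # X)) 0 * ?f (map snd X) j + (\<Sum>i<j. ?f (map snd X) i * ?f (map snd X) j))"
  by (intro sum.cong refl, subst sum.lessThan_Suc_shift) simp
 also have "... = (deg A (snd x) + 1) * (\<Sum>j<length X. ?f (map snd X) j) + (\<Sum>j<length X. \<Sum>i<j. ?f (map snd X) i * ?f (map snd X) j)"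
  by (simp add: sum.distrib sum_distrib_left algebra_simps)
 finally have "rev_exp A (map snd (x # X)) = rev_exp A (map snd X) + (deg A (snd x) + 1) * (\<Sum>j<length X. deg A (map snd X ! j) + 1) + 1"
  unfolding rev_exp_def by simp
 moreover have "even (\<Sum>j<length X. deg A (map snd X ! j) + 1) = even (bd X)"
  using even_bd_take[of X A "length X"] Cons.prems by simp
 ultimately show ?case using Cons by (auto simp: parity)
qed (simp add: rev_exp_def)

lemma brace_op_simps [simp]:
 "gr (brace_op A) = gr A" "scal (brace_op A) = scal A" "diff (brace_op A) = diff A" "mul (brace_op A) = op_mul A"
 "unt (brace_op A) = unt A"
 by (auto simp: brace_op_def)

lemma dga_op_simps [simp]:
 "gr (dga_op A) = gr A" "scal (dga_op A) = scal A" "diff (dga_op A) = diff A" "mul (dga_op A) = op_mul A"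
 "unt (dga_op A) = unt A"
 by (auto simp: dga_op_def)

lemma same_pieces:
 assumes "gr B = gr A"
 shows "letters B = letters A" "homog B = homog A" "deg B = deg A"
 using assms by (auto simp: letters_def homog_def deg_def fun_eq_iff)

lemmas brace_op_pieces [simp] = same_pieces[OF brace_op_simps(1)]
lemmas dga_op_pieces [simp] = same_pieces[OF dga_op_simps(1)]

lemma brace_op_degrees [simp]:
 "dsum (brace_op A) = dsum A" "bdeg (brace_op A) = bdeg A" "rev_exp (brace_op A) = rev_exp A" "label (brace_op A) = label A"
 by (auto simp: dsum_def bdeg_def rev_exp_def label_def fun_eq_iff)

lemma lin1_same [simp]: "lin1 (brace_op A) = lin1 A" "lin1 (dga_op M) = lin1 M" "mlin (brace_op A) = mlin A"
 by (auto simp: lin1_def mlin_def fun_eq_iff)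

lemma bd_rev [simp]: "bd (rev X) = bd X"
 by (induction X) auto

locale brace_alg_op = brace_alg A
 for A :: "('k::field, 'a::ab_group_add, 'r) brace_alg_scheme" +
 assumes dgaO: "dga (brace_op A)"
begin

abbreviation "A' \<equiv> brace_op A"

lemma rev_mem: "X \<in> L ==> rev X \<in> L"
 by (simp add: in_lists_conv_set)

lemma brc_op:
 assumes x: "x \<in> letters A" and Y: "Y \<in> L"
 shows "brc A' (snd x) (map snd Y) = sg (rexp Y) (brc A (snd x) (map snd (rev Y)))"
proof (cases "0 \<in> snd ` set Y")
 case True
 then have "brc A (snd x) (map snd (rev Y)) = 0"
  using brace_zero_right[OF gA gA multi snd_letters[OF x] rev_mem[OF Y]] by simp
 then show ?thesis by (simp add: brace_op_def rev_map scal_sg[OF gA])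
next
 case False
 then have "\<forall>y\<in>set Y. fst y = deg A (snd y)" using letters_label_or_zero[OF gA Y] by blast
 then have "even (rev_exp A (map snd Y)) = even (rexp Y)" by (rule rev_exp_rexp)
 then have "sg (rev_exp A (map snd Y)) (brc A (snd x) (map snd (rev Y))) = sg (rexp Y) (brc A (snd x) (map snd (rev Y)))"
  by (rule sg_cong)
 then show ?thesis by (simp add: brace_op_def rev_map scal_sg[OF gA])
qed

lemma lbr_op:
 assumes t: "vector_space t" and g: "lin1 A t g" and x: "x \<in> letters A" and Y: "Y \<in> L"
 shows "g (lbr (brc A') x Y) = sg (rexp Y) (g (bl x (rev Y)))"
 using lin1_sg_arg[OF gA t g snd_letters[OF bl_letters[OF x rev_mem[OF Y]]], of "rexp Y"]
 by (simp add: lbr_def brc_op[OF x Y])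

lemma lmul_op:
 assumes t: "vector_space t" and g: "lin1 A t g" and x: "x \<in> letters A" and y: "y \<in> letters A"
 shows "g (lmul A' x y) = sg (fst x * fst y) (g (lmul A y x))"
 using lin1_sg_arg[OF gA t g snd_letters[OF lmul_letters[OF y x]], of "fst x * fst y"]
 by (simp add: lmul_def op_mul_letters[OF dgaA snd_letters snd_letters, OF x y] add.commute)

lemma multilinear_op: "brace_multilinear A' A' (brc A')"
 unfolding brace_multilinear_def brace_op_simps brace_op_pieces brace_op_degrees
proof (intro conjI ballI allI)
 have brc': "brc A' x xs = sg (rev_exp A xs) (brc A x (rev xs))" for x xs by (simp add: brace_op_def scal_sg[OF gA])
 fix m xs assume m: "m \<in> homog A" and xs: "xs \<in> lists (homog A)"
 have rxs: "rev xs \<in> lists (homog A)" using xs by (simp add: in_lists_conv_set)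
 have "bdeg A (rev xs) = bdeg A xs" by (simp add: bdeg_def rev_map[symmetric])
 then show "brc A' m xs \<in> gr A (deg A m + bdeg A xs)"
  using multi m rxs unfolding brace_multilinear_def brc' by (metis graded_sg[OF gA])
next
 fix i xs assume xs: "xs \<in> lists (homog A)"
 then have "rev xs \<in> lists (homog A)" by (simp add: in_lists_conv_set)
 then have "lin_on (scal A) (scal A) (gr A i) (%m. brc A m (rev xs))" using multi unfolding brace_multilinear_def by blast
 then show "lin_on (scal A) (scal A) (gr A i) (%m. brc A' m xs)"
  unfolding lin_on_def by (simp add: brace_op_def scal_sg[OF gA] scale_sg[OF graded_vector_space[OF gA]])
next
 fix m xs ys i assume m: "m \<in> homog A" and xs: "xs \<in> lists (homog A)" and ys: "ys \<in> lists (homog A)"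
 let ?l = "map (label A)"
 have l: "?l xs \<in> L" "?l ys \<in> L" using xs ys labels_in_lists[OF gA] by auto
 have lm: "label A m \<in> letters A" using label_in_letters[OF gA m] .
 have "brc A' m (xs @ x # ys) = sg (rexp (?l xs @ (i, x) # ?l ys)) (brc A m (rev ys @ x # rev xs))" if "x \<in> gr A i" for x
  using brc_op[OF lm, of "?l xs @ (i, x) # ?l ys"] l that by (simp add: label_def comp_def rev_map)
 moreover have "rexp (?l xs @ (i, x) # ?l ys) = rexp (?l xs @ (i, 0) # ?l ys)" if "x \<in> gr A i" for x by (rule rexp_cong) simp
 ultimately have *: "brc A' m (xs @ x # ys) = sg (rexp (?l xs @ (i, 0 :: 'a) # ?l ys)) (brc A m (rev ys @ x # rev xs))" if "x \<in> gr A i" for x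
  by (metis that)
 have "lin_on (scal A) (scal A) (gr A i) (%x. brc A m (rev ys @ x # rev xs))"
  using multi m xs ys unfolding brace_multilinear_def by (simp add: in_lists_conv_set)
 then show "lin_on (scal A) (scal A) (gr A i) (%x. brc A' m (xs @ x # ys))"
  unfolding lin_on_def using graded_add[OF gA, of _ i] graded_scale[OF gA, of _ i]
  by (simp add: * scale_sg[OF graded_vector_space[OF gA]])
qed

sublocale O: brace_ops "brace_op A"
proof
 show "brc A' x [] = x" if "x \<in> homog A'" for x
  using brc_op[OF label_in_letters[OF gA], of x "[]"] that brc_Nil[of x] by (simp add: label_def)
qed (fact dgaO multilinear_op)+

text \<open>Reversal is an algebra isomorphism of bar constructions.\<close>

lemma ws_op:
 assumes t: "vector_space t"
 shows "mlin A t \<phi> ==> X \<in> L ==> Y \<in> L ==>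
  weave_sum (brc A') X Y (%W. sg (rexp W) (\<phi> (rev W))) = sg (rexp X + rexp Y) (ws (rev X) (rev Y) \<phi>)"
proof (induction X arbitrary: Y \<phi> rule: list.induct)
 case Nil
 then show ?case by simp
next
 case (Cons x X)
 have x: "x \<in> letters A" and X: "X \<in> L" using Cons.prems(2) by auto
 have step: "sg ((fst x - 1) * bd U + bd X * (bd U + bd U'))
   (weave_sum (brc A') X V' (%W. sg (rexp (U @ lbr (brc A') x U' # W)) (\<phi> (rev (U @ lbr (brc A') x U' # W)))))
  = sg (rexp (x # X) + rexp Y + (fst x - 1) * bd V') (ws (rev X) (rev V') (%P. \<phi> (P @ bl x (rev U') # rev U)))"
  if Y': "Y = U @ U' @ V'" for U U' V'
 proof -
  have U: "U \<in> L" "U' \<in> L" "V' \<in> L" using Y' Cons.prems(3) by auto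
  have "weave_sum (brc A') X V' (%W. sg (rexp (U @ lbr (brc A') x U' # W)) (\<phi> (rev (U @ lbr (brc A') x U' # W))))
   = weave_sum (brc A') X V' (%W. sg (rexp U + bd U * (bd X + bd V') + (fst x - 1 + bd U') * (bd U + bd X + bd V') + 1 + rexp U')
     (sg (rexp W) (\<phi> (rev W @ bl x (rev U') # rev U))))"
  proof (rule O.ws_cong)
   show "X \<in> O.L" "V' \<in> O.L" using X U by auto
   fix W assume "W \<in> O.L" and bd: "bd W = bd X + bd V'"
   then have W: "W \<in> L" by simp
   have "lin1 A t (%z. \<phi> (rev W @ z # rev U))" by (rule mlin_lists[OF Cons.prems(1) rev_mem[OF W] rev_mem[OF U(1)]])
   from lbr_op[OF t this x U(2)]
   show "sg (rexp (U @ lbr (brc A') x U' # W)) (\<phi> (rev (U @ lbr (brc A') x U' # W)))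
    = sg (rexp U + bd U * (bd X + bd V') + (fst x - 1 + bd U') * (bd U + bd X + bd V') + 1 + rexp U')
     (sg (rexp W) (\<phi> (rev W @ bl x (rev U') # rev U)))"
    by simp (intro sg_cong, auto simp: rexp_append parity bd)
  qed
  also have "... = sg (rexp U + bd U * (bd X + bd V') + (fst x - 1 + bd U') * (bd U + bd X + bd V') + 1 + rexp U')
    (sg (rexp X + rexp V') (ws (rev X) (rev V') (%P. \<phi> (P @ bl x (rev U') # rev U))))"
   unfolding weave_sum_sg
   by (subst Cons.IH[of "%P. \<phi> (P @ bl x (rev U') # rev U)" V'])
    (use X U x Cons.prems(1) in \<open>auto intro!: mlin_append_right bl_letters rev_mem simp del: letters_iff\<close>)
  finally show ?thesis unfolding Y' by simp (intro sg_cong, auto simp: rexp_append parity)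
 qed
 have "weave_sum (brc A') (x # X) Y (%W. sg (rexp W) (\<phi> (rev W)))
  = cut_sum Y (%U V. cut_sum V (%U' V'.
    sg (rexp (x # X) + rexp Y + (fst x - 1) * bd V') (ws (rev X) (rev V') (%P. \<phi> (P @ bl x (rev U') # rev U)))))"
  unfolding weave_sum_Cons by (intro cut_sum_cong step) simp
 also have "... = sg (rexp (x # X) + rexp Y) (ws (rev X @ [x]) (rev Y) \<phi>)"
  unfolding weave_sum_append_Cons cut_sum_rev cut_sum_coassoc[symmetric]
  by (simp add: cut_sum_sg[symmetric] add.commute add.left_commute)
 finally show ?case by simp
qed

lemma bar_term_op:
 assumes t: "vector_space t" and g: "lin1 A t g" and B: "B \<in> L"
 shows "bar_term A' B g = sg (rexp B + 1) (bar_term A (rev B) g)"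
proof -
 consider "B = []" | x where "B = [x]" | x y where "B = [x, y]" | "length B \<ge> 3"
  by (cases B; cases "tl B"; cases "tl (tl B)") auto
 then show ?thesis
 proof cases
  case (3 x y)
  then show ?thesis using B lmul_op[OF t g, of x y] by (simp del: letters_iff) (intro sg_cong, auto simp: parity)
 next
  case 4
  then show ?thesis by (simp add: bar_term_long)
 qed (auto simp: sg_def ldiff_def)
qed

text \<open>A summand of the differential is determined by the new letter, and \<open>bar_term_op\<close> compares these.\<close>

lemma diff_sum_op:
 assumes t: "vector_space t" and \<phi>: "mlin A t \<phi>" and X: "X \<in> L"
 shows "diff_sum A' X (%W. sg (rexp W) (\<phi> (rev W))) = sg (rexp X) (diff_sum A (rev X) \<phi>)"
proof -
 have "diff_sum A' X (%W. sg (rexp W) (\<phi> (rev W))) = cut_sum X (%U V. cut_sum V (%B V'.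
   sg (rexp X + bd V') (bar_term A (rev B) (%z. \<phi> (rev V' @ z # rev U)))))"
  unfolding diff_sum_cut
 proof (intro cut_sum_cong)
  fix U V B V' assume XU: "X = U @ V" "V = B @ V'"
  have U: "U \<in> L" "B \<in> L" "V' \<in> L" using XU X by auto
  have "lin1 A t (%z. \<phi> (rev V' @ z # rev U))" by (rule mlin_lists[OF \<phi> rev_mem[OF U(3)] rev_mem[OF U(1)]])
  note bt = bar_term_op[OF t this U(2)]
  have "bar_term A' B (%z. sg (rexp (U @ z # V')) (\<phi> (rev (U @ z # V'))))
   = bar_term A' B (%z. sg (rexp U + rexp V' + bd U * bd V' + 1 + (bd B + 1) * (bd U + bd V')) (\<phi> (rev V' @ z # rev U)))"
   by (rule O.bar_term_cong) (use U in \<open>auto intro!: sg_cong simp: rexp_append parity\<close>)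
  then show "sg (bd U) (bar_term A' B (%z. sg (rexp (U @ z # V')) (\<phi> (rev (U @ z # V')))))
   = sg (rexp X + bd V') (bar_term A (rev B) (%z. \<phi> (rev V' @ z # rev U)))"
   unfolding XU by (simp add: bar_term_sg bt) (intro sg_cong, auto simp: rexp_append parity)
 qed
 also have "... = sg (rexp X) (diff_sum A (rev X) \<phi>)"
  unfolding diff_sum_cut cut_sum_rev cut_sum_coassoc[symmetric] bd_rev cut_sum_sg[symmetric] rev_rev_ident sg_simps(3) ..
 finally show ?thesis .
qed

lemma op_brace_tail: "brace_tail A' A' id (brc A')"
proof (rule brace_tail.intro[OF O.brace_ops_axioms brace_tail_axioms.intro])
 have sA: "lin1 A (scal A) snd" by (rule lin1_snd)
 note t = graded_vector_space[OF gA]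
 have b: "brc A (snd m) (map snd X) = snd (bl m X)" "brc A' (snd m) (map snd X) = snd (lbr (brc A') m X)" for m X
  by (simp_all add: lbr_def)
 have ml: "mlin A (scal A) (%W. snd (bl m W))" if "m \<in> letters A" for m by (rule mlin_bm[OF sA that])
 note op = lbr_op[OF t sA]
 show "dga A'" by (rule dgaO)
 show "brace_multilinear A' A' (brc A')" by (rule multilinear_op)
 show "graded_map A' A' 0 id" by (auto simp: graded_map_def lin_on_def)
 show "brc A' m [] = m" if "m \<in> homog A'" for m by (rule O.brc_Nil[OF that])
 {
  fix m X Y assume "m \<in> letters A'" "X \<in> lists (letters A')" "Y \<in> lists (letters A')"
  then have m: "m \<in> letters A" and X: "X \<in> L" and Y: "Y \<in> L" by auto
  have "brc A' (brc A' (snd m) (map snd X)) (map snd Y) = snd (lbr (brc A') (lbr (brc A') m X) Y)" by (simp add: lbr_def)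
  also have "... = sg (rexp Y) (snd (bl (lbr (brc A') m X) (rev Y)))"
   using op[OF _ Y] O.bl_letters[of m X] m X by simp
  also have "... = sg (rexp Y) (sg (rexp X) (snd (bl (bl m (rev X)) (rev Y))))"
   using lbr_op[OF t lin1_bm[OF sA rev_mem[OF Y]] m X] by simp
  also have "... = sg (rexp X + rexp Y) (ws (rev X) (rev Y) (%W. snd (bl m W)))"
   by (simp add: bm_bm[OF t sA m rev_mem[OF X] rev_mem[OF Y]] add.commute)
  also have "... = weave_sum (brc A') X Y (%W. sg (rexp W) (snd (bl m (rev W))))"
   by (rule ws_op[OF t ml[OF m] X Y, symmetric])
  also have "... = weave_sum (brc A') X Y (%W. brc A' (snd m) (map snd W))"
   by (rule O.ws_cong) (use X Y m op in \<open>auto simp: b simp del: letters_iff\<close>)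
  finally show "brc A' (brc A' (snd m) (map snd X)) (map snd Y) = weave_sum (brc A') X Y (%W. brc A' (snd m) (map snd W))" .
 }
 {
  fix m m' Y assume "m \<in> letters A'" "m' \<in> letters A'" "Y \<in> lists (letters A')"
  then have m: "m \<in> letters A" "m' \<in> letters A" and Y: "Y \<in> L" by auto
  have "brc A' (mul A' (snd m) (snd m')) (map snd Y) = snd (lbr (brc A') (lmul A' m m') Y)" by (simp add: lbr_def lmul_def)
  also have "... = sg (rexp Y) (snd (bl (lmul A' m m') (rev Y)))"
   using op[OF _ Y] O.lmul_letters[of m m'] m by simp
  also have "... = sg (rexp Y) (sg (fst m * fst m') (snd (bl (lmul A m' m) (rev Y))))"
   using lmul_op[OF t lin1_bm[OF sA rev_mem[OF Y]] m] by simp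
  also have "... = cut_sum Y (%U V. sg (rexp Y + fst m * fst m' + fst m * bd V) (snd (lmul A (bl m' (rev V)) (bl m (rev U)))))"
   unfolding bm_lmul[OF t sA m(2,1) rev_mem[OF Y]] by (simp add: cut_sum_rev cut_sum_sg[symmetric] add.assoc)
  also have "... = cut_sum Y (%U V. sg (fst m' * bd U) (mul A' (brc A' (snd m) (map snd U)) (brc A' (snd m') (map snd V))))"
  proof (rule cut_sum_cong)
   fix U V assume UV: "Y = U @ V"
   then have l: "U \<in> L" "V \<in> L" using Y by auto
   have 1: "bl m (rev U) \<in> letters A" "bl m' (rev V) \<in> letters A" "lbr (brc A') m U \<in> letters A" "lbr (brc A') m' V \<in> letters A"
    using m l bl_letters rev_mem O.bl_letters by auto
   have "mul A' (brc A' (snd m) (map snd U)) (brc A' (snd m') (map snd V)) = snd (lmul A' (lbr (brc A') m U) (lbr (brc A') m' V))"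
    by (simp add: lbr_def lmul_def)
   also have "... = sg ((fst m + bd U) * (fst m' + bd V)) (snd (lmul A (lbr (brc A') m' V) (lbr (brc A') m U)))"
    using lmul_op[OF t sA 1(3,4)] by simp
   also have "snd (lmul A (lbr (brc A') m' V) (lbr (brc A') m U)) = sg (rexp V) (snd (lmul A (bl m' (rev V)) (lbr (brc A') m U)))"
    by (rule lbr_op[OF t lin1_lmul_left[OF sA 1(3)] m(2) l(2)])
   also have "snd (lmul A (bl m' (rev V)) (lbr (brc A') m U)) = sg (rexp U) (snd (lmul A (bl m' (rev V)) (bl m (rev U))))"
    by (rule lbr_op[OF t lin1_lmul_right[OF sA 1(2)] m(1) l(1)])
   finally show "sg (rexp Y + fst m * fst m' + fst m * bd V) (snd (lmul A (bl m' (rev V)) (bl m (rev U))))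
    = sg (fst m' * bd U) (mul A' (brc A' (snd m) (map snd U)) (brc A' (snd m') (map snd V)))"
    unfolding UV by simp (intro sg_cong, auto simp: rexp_append parity)
  qed
  finally show "brc A' (mul A' (snd m) (snd m')) (map snd Y)
   = cut_sum Y (%U V. sg (fst m' * bd U) (mul A' (brc A' (snd m) (map snd U)) (brc A' (snd m') (map snd V))))" .
 }
 {
  fix m Y assume "m \<in> letters A'" "Y \<in> lists (letters A')" and ne: "Y \<noteq> []"
  then have m: "m \<in> letters A" and Y: "Y \<in> L" by auto
  obtain y Y1 where Y1: "Y = y # Y1" using ne by (cases Y) auto
  obtain z Y2 where Y2: "Y = Y2 @ [z]" using ne by (cases Y rule: rev_cases) auto
  have l: "y \<in> letters A" "Y1 \<in> L" "z \<in> letters A" "Y2 \<in> L"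
   using Y[unfolded Y1] Y[unfolded Y2] by (simp_all del: letters_iff)
  have dm: "ldiff A m \<in> letters A" by (rule ldiff_letters[OF m])
  have 1: "brc A' (diff A (snd m)) (map snd Y) = sg (rexp Y) (snd (bl (ldiff A m) (rev Y)))"
   using op[OF dm Y] by (simp add: lbr_def ldiff_def)
  have "diff_sum A' Y (%W. brc A' (snd m) (map snd W)) = diff_sum A' Y (%W. sg (rexp W) (snd (bl m (rev W))))"
   by (rule O.diff_sum_cong) (use Y m op in \<open>auto simp: b simp del: letters_iff\<close>)
  then have 2: "diff_sum A' Y (%W. brc A' (snd m) (map snd W)) = sg (rexp Y) (diff_sum A (rev Y) (%W. snd (bl m W)))"
   using diff_sum_op[OF t ml[OF m] Y] by simp
  have 3: "mul A' (snd y) (brc A' (snd m) (map snd Y1)) = sg (fst y * (fst m + bd Y1) + rexp Y1) (snd (lmul A (bl m (rev Y1)) y))"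
  proof -
   have "lbr (brc A') m Y1 \<in> letters A" using O.bl_letters[of m Y1] m l by simp
   from lmul_op[OF t sA l(1) this] lbr_op[OF t lin1_lmul_left[OF sA l(1)] m l(2)]
   show ?thesis by (simp add: lmul_def lbr_def)
  qed
  have 4: "mul A' (brc A' (snd m) (map snd Y2)) (snd z) = sg (fst z * (fst m + bd Y2) + rexp Y2) (snd (lmul A z (bl m (rev Y2))))"
  proof -
   have "lbr (brc A') m Y2 \<in> letters A" using O.bl_letters[of m Y2] m l by simp
   from lmul_op[OF t sA this l(3)] lbr_op[OF t lin1_lmul_right[OF sA l(3)] m l(4)]
   show ?thesis by (simp add: lmul_def lbr_def mult.commute)
  qed
  have "diff A' (brc A' (snd m) (map snd Y)) = snd (ldiff A (lbr (brc A') m Y))" by (simp add: lbr_def ldiff_def)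
  also have "... = sg (rexp Y) (snd (ldiff A (bl m (rev Y))))" by (rule lbr_op[OF t lin1_ldiff[OF sA] m Y])
  also have "... = sg (rexp Y) (snd (bl (ldiff A m) (rev Y)) + sg (fst m) (diff_sum A (rev Y) (%W. snd (bl m W)))
   - sg ((fst z - 1) * fst m) (snd (lmul A z (bl m (rev Y2))))
   + sg (fst m + bd Y1) (snd (lmul A (bl m (rev Y1)) y)))"
  proof -
   have "hd (rev Y) = z" "tl (rev Y) = rev Y2" "rev Y \<noteq> []" unfolding Y2 by simp_all
   moreover have "last (rev Y) = y" "butlast (rev Y) = rev Y1" unfolding Y1 by simp_all
   ultimately show ?thesis using ldiff_bm[OF t sA m rev_mem[OF Y]] by simp
  qed
  finally have main: "diff A' (brc A' (snd m) (map snd Y)) = ..." .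
  have s1: "sg (rexp Y) (sg ((fst z - 1) * fst m) v) = - sg (fst m + bd Y2) (sg (fst z * (fst m + bd Y2) + rexp Y2) v)" for v :: 'a
   unfolding Y2 by (auto simp: sg_def rexp_append parity)
  have s2: "sg (rexp Y) (sg (fst m + bd Y1) v) = - sg ((fst y - 1) * fst m) (sg (fst y * (fst m + bd Y1) + rexp Y1) v)" for v :: 'a
   unfolding Y1 by (auto simp: sg_def parity)
  have h1: "hd Y = y" "tl Y = Y1" by (simp_all add: Y1)
  have h2: "last Y = z" "butlast Y = Y2" by (simp_all add: Y2)
  note h = h1 h2
  show "diff A' (brc A' (snd m) (map snd Y)) = brc A' (diff A' (snd m)) (map snd Y)
    + sg (fst m) (diff_sum A' Y (%W. brc A' (snd m) (map snd W)))
    - sg ((fst (hd Y) - 1) * fst m) (mul A' (id (snd (hd Y))) (brc A' (snd m) (map snd (tl Y))))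
    + sg (fst m + bd (butlast Y)) (mul A' (brc A' (snd m) (map snd (butlast Y))) (id (snd (last Y))))"
   unfolding main h id_apply 3 4 2 using s1 s2 1 by (simp add: algebra_simps)
 }
qed

lemma brace_alg_op: "brace_alg A'"
 using op_brace_tail by (simp add: brace_alg_def)

end

section \<open>The one-sided bar complex is a dg algebra\<close>

text \<open>
 The graphs that define maps on tensors are indexed by homogeneous elements, the formulas used here by
 letters. Multilinear functions do not distinguish between a letter and the letter with the same
 underlying element and its canonical degree.
\<close>

lemma image_relabel:
 assumes "!!d. d \<in> D ==> l d \<in> G" "!!g. g \<in> G ==> s g \<in> D \<and> f (l (s g)) = f g"
 shows "(%d. f (l d)) ` D = f ` G"
proof
 show "(%d. f (l d)) ` D \<subseteq> f ` G" using assms(1) by auto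
 show "f ` G \<subseteq> (%d. f (l d)) ` D"
 proof
  fix y assume "y \<in> f ` G"
  then obtain g where g: "g \<in> G" "y = f g" by blast
  then show "y \<in> (%d. f (l d)) ` D" using assms(2)[OF g(1)] by (metis image_eqI)
 qed
qed

lemma graph_image2:
 assumes "!!x y. x \<in> D ==> y \<in> E ==> f (l (x, y)) = F x y"
 shows "{F x y | x y. x \<in> D \<and> y \<in> E} = (%d. f (l d)) ` (D \<times> E)"
proof -
 have "{F x y | x y. x \<in> D \<and> y \<in> E} = (%(x, y). F x y) ` (D \<times> E)" by auto
 also have "... = (%d. f (l d)) ` (D \<times> E)" by (rule image_cong) (use assms in auto)
 finally show ?thesis .
qed

lemma graph_image4:
 assumes "!!x y z w. x \<in> D ==> y \<in> E ==> z \<in> D' ==> w \<in> E' ==> f (l ((x, y), (z, w))) = F x y z w"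
 shows "{F x y z w | x y z w. x \<in> D \<and> y \<in> E \<and> z \<in> D' \<and> w \<in> E'} = (%d. f (l d)) ` ((D \<times> E) \<times> (D' \<times> E'))"
proof -
 have "{F x y z w | x y z w. x \<in> D \<and> y \<in> E \<and> z \<in> D' \<and> w \<in> E'}
  = (%((x, y), (z, w)). F x y z w) ` ((D \<times> E) \<times> (D' \<times> E'))"
 proof (intro subset_antisym subsetI)
  fix u assume "u \<in> {F x y z w | x y z w. x \<in> D \<and> y \<in> E \<and> z \<in> D' \<and> w \<in> E'}"
  then obtain x y z w where "u = F x y z w" "x \<in> D" "y \<in> E" "z \<in> D'" "w \<in> E'" by blast
  then show "u \<in> (%((x, y), (z, w)). F x y z w) ` ((D \<times> E) \<times> (D' \<times> E'))"
   by (intro image_eqI[of _ _ "((x, y), (z, w))"]) auto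
 next
  fix u assume "u \<in> (%((x, y), (z, w)). F x y z w) ` ((D \<times> E) \<times> (D' \<times> E'))"
  then obtain x y z w where "u = F x y z w" "x \<in> D" "y \<in> E" "z \<in> D'" "w \<in> E'" by auto
  then show "u \<in> {F x y z w | x y z w. x \<in> D \<and> y \<in> E \<and> z \<in> D' \<and> w \<in> E'}" by blast
 qed
 also have "... = (%d. f (l d)) ` ((D \<times> E) \<times> (D' \<times> E'))" by (rule image_cong) (use assms in auto)
 finally show ?thesis .
qed

lemma bar_dga_simps [simp]: "scal (bar_dga A) = fscal" "unt (bar_dga A) = wd A []"
 by (simp_all add: bar_dga_def wd_def)

lemma label_simps [simp]: "fst (label V x) = deg V x" "snd (label V x) = x" "snd \<circ> label V = id"
 by (simp_all add: label_def fun_eq_iff)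

lemma bd_label: "bd (map (label A) xs) = bdeg A xs"
 by (simp add: bdeg_def bd_def comp_def)

lemma word_label: "word A xs = wd A (map (label A) xs)"
 by (simp add: wd_def)

lemma bar_diff_word_label: "bar_diff_word A xs = diff_sum A (map (label A) xs) (wd A)"
 using diff_sum_indexed[of "map (label A) xs" A "word A"]
 by (simp add: bar_diff_word_def wd_def[abs_def] fscal_sg)

context brace_ops
begin

abbreviation "T \<equiv> bar_dga A"

lemma relabel_word:
 assumes X: "X \<in> L"
 shows "map (label A) (map snd X) = map (label A \<circ> snd) X" "map snd X \<in> lists (homog A)"
 using map_snd_lists[OF gA] X by auto

lemmas mlin_word = mlin_wd[OF graded_vector_space[OF gA]]
lemmas gT = graded_bar[OF gA]

lemma bar_mul:
 obtains mT where "!!v. flin (mT v)" "!!w. flin (%v. mT v w)"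
  "!!X Y. X \<in> L ==> Y \<in> L ==> mT (wd A X) (wd A Y) = ws X Y (wd A)"
  "!!u v. u \<in> homog T ==> v \<in> homog T ==> mul T u v = mT u v"
proof -
 note f = vector_space_fscal
 let ?S = "{(word A xs, word A ys,
     \<Sum>ks\<in>insertions (length xs) (length ys).
      fscal (ksign (weave_exp A xs ks ys)) (word A (weave (brc A) 0 xs ks ys))) | xs ys.
      xs \<in> lists (homog A) \<and> ys \<in> lists (homog A)}"
 let ?f = "%(X, Y). (wd A X, wd A Y, ws X Y (wd A))"
 let ?l = "%(xs, ys). (map (label A) xs, map (label A) ys)"
 have lab: "ws (map (label A \<circ> snd) X) (map (label A \<circ> snd) Y) (wd A) = ws X Y (wd A)" if "X \<in> L" "Y \<in> L" for X Y
 proof -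
  have "map (label A \<circ> snd) Y \<in> L" using that(2) relabel_word[OF that(2)] labels_in_lists[OF gA] by metis
  then show ?thesis
   using mlin_label[OF gA mlin_ws_left[OF f mlin_word] f that(1)] mlin_label[OF gA mlin_ws_right[OF f mlin_word that(1)] f that(2)] by metis
 qed
 have wlab: "wd A (map (label A \<circ> snd) X) = wd A X" if "X \<in> L" for X by (rule mlin_label[OF gA mlin_word f that])
 have "?S = (%d. ?f (?l d)) ` (lists (homog A) \<times> lists (homog A))"
 proof -
  have "?f (?l (xs, ys)) = (word A xs, word A ys,
     \<Sum>ks\<in>insertions (length xs) (length ys).
      fscal (ksign (weave_exp A xs ks ys)) (word A (weave (brc A) 0 xs ks ys)))" for xs ys
   using weave_sum_insertions[of "map (label A) xs" A "map (label A) ys" "word A" "brc A"]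
   by (simp add: wd_def[abs_def] fscal_sg)
  then show ?thesis by (rule graph_image2[where f = ?f and l = ?l])
 qed
 also have "... = ?f ` (L \<times> L)"
  by (rule image_relabel[where s = "%(X, Y). (map snd X, map snd Y)"])
   (simp_all add: case_prod_unfold mem_Times_iff labels_in_lists[OF gA] relabel_word(2) lab wlab del: letters_iff)
 finally have S: "?S = (%(X, Y). (wd A X, wd A Y, ws X Y (wd A))) ` (L \<times> L)" .
 have ne: "L \<noteq> {}" by blast
 from bilin_ext_exists[OF f f f _ _ S ne] obtain mT where mT: "!!v. flin (mT v)" "!!w. flin (%v. mT v w)"
  "!!X Y. X \<in> L ==> Y \<in> L ==> mT (wd A X) (wd A Y) = ws X Y (wd A)"
  "!!u v. u \<in> module.span fscal (wd A ` L) ==> v \<in> module.span fscal (wd A ` L) ==> bilin_ext fscal fscal fscal ?S u v = mT u v"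
  using extends_word[OF gA f mlin_ws_left[OF f mlin_word]] extends_word[OF gA f mlin_ws_right[OF f mlin_word]] by blast
 show ?thesis
 proof (rule that[OF mT(1-3)])
  fix u v assume uv: "u \<in> homog T" "v \<in> homog T"
  have h: "u \<in> module.span fscal (wd A ` L)" "v \<in> module.span fscal (wd A ` L)"
   using gens_homog[OF gens_word[OF gA] _ uv(1)] gens_homog[OF gens_word[OF gA] _ uv(2)] by (simp_all add: f)
  show "mul T u v = mT u v" using mT(4)[OF h] by (simp add: bar_dga_def)
 qed
qed

lemma bar_mul_wd:
 assumes "X \<in> L" "Y \<in> L"
 shows "mul T (wd A X) (wd A Y) = ws X Y (wd A)"
proof -
 obtain mT where mT: "!!X Y. X \<in> L ==> Y \<in> L ==> mT (wd A X) (wd A Y) = ws X Y (wd A)"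
  "!!u v. u \<in> homog T ==> v \<in> homog T ==> mul T u v = mT u v" by (rule bar_mul) (rule that)
 have "wd A X \<in> homog T" if "X \<in> L" for X
  using gens_base[OF gens_word[OF gA] _ that] by (intro homogI) (simp add: vector_space_fscal)
 then show ?thesis using mT assms by simp
qed

end

locale left_module = brace_module A M "act M" "mbr M"
 for A :: "('k::field, 'a::ab_group_add, 'r) brace_alg_scheme" and M :: "('k, 'a, 'm::ab_group_add, 's) brace_mod_scheme"
begin

definition te :: "(int \<times> 'a) list => int \<times> 'm => (('a, 'k) words, 'm, 'k) tensor" where
 "te X m = tns T M (wd A X) (snd m)"

abbreviation "LB \<equiv> left_bar_dga A M"

lemmas vT = graded_vector_space[OF gT]
lemmas vM = graded_vector_space[OF T.gM]
lemmas f = vector_space_fscal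

lemma bilin_te: "bilin fscal te"
 unfolding bilin_def te_def
 using mlin_linear[OF mlin_word] linear_tns_left[OF vT vM] lin1_tns(2)[OF vT vM] by (auto simp: bar_dga_simps simp del: letters_iff)

lemma extends_te: "vector_space t ==> bilin t \<phi> ==> extends fscal t (L \<times> letters M) (%(X, m). te X m) (%(X, m). \<phi> X m)"
 unfolding te_def
 by (rule extends_tns[OF vT vM _ _ extends_letter[OF T.gM _ bilinD(2)]])
  (auto intro: extends_word[OF gA _ bilinD(1), unfolded bar_dga_simps] simp del: letters_iff)

lemma bilin_lbar_diff:
 assumes t: "vector_space t" and \<phi>: "bilin t \<phi>"
 shows "bilin t (%X m. lbar_diff X m \<phi>)"
proof -
 have "mlin A t (%X. if X = [] then 0 else sg (bd (butlast X)) (\<phi> (butlast X) (lmul M (lH (last X)) m)))" if m: "m \<in> letters M" for m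
  unfolding mlin_def
 proof (intro ballI)
  fix P Q assume P: "P \<in> L" and Q: "Q \<in> L"
  show "lin1 A t (%x. if P @ x # Q = [] then 0 else sg (bd (butlast (P @ x # Q))) (\<phi> (butlast (P @ x # Q)) (lmul M (lH (last (P @ x # Q))) m)))"
  proof (cases "Q = []")
   case True
   have "lin1 A t (%x. \<phi> P (lmul M (lH x) m))" by (rule T.lin1_lh[OF T.lin1_lmulM_left[OF bilinD(2)[OF \<phi> P] m]])
   then show ?thesis using True lin1_const_sg[OF t] by (simp add: butlast_append)
  next
   case False
   have "butlast Q \<in> L" "lmul M (lH (last Q)) m \<in> letters M"
    using Q False by (auto simp: in_lists_conv_set dest: in_set_butlastD intro!: T.lmulM_letters T.lh_letters m simp del: letters_iff)
   then have "lin1 A t (%x. \<phi> (P @ x # butlast Q) (lmul M (lH (last Q)) m))" by (intro mlin_lists[OF bilinD(1)[OF \<phi>]] P)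
   from lin1_sg[OF t this, of "%i. bd P + (i - 1) + bd (butlast Q)"]
   show ?thesis using False by (simp add: butlast_append add.assoc)
  qed
 qed
 moreover have "mlin A t (%X. sg (bd X) (\<phi> X (ldiff M m)))" if m: "m \<in> letters M" for m
  by (rule mlin_bd_sg[OF t bilinD(1)[OF \<phi> T.ldiffM_letters[OF m]], of "%i. i"])
 moreover have "lin1 M t (%m. diff_sum A X (%W. \<phi> W m))" if "X \<in> L" for X
  unfolding diff_sum_def by (rule lin1_ssum[OF t]) (use diffs_mem that bilinD(2)[OF \<phi>] in blast)
 moreover have "lin1 M t (%m. if X = [] then 0 else sg (bd (butlast X)) (\<phi> (butlast X) (lmul M (lH (last X)) m)))" if X: "X \<in> L" for X
 proof (cases "X = []")
  case False
  then have "butlast X \<in> L" "lH (last X) \<in> letters M"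
   using X by (auto simp: in_lists_conv_set dest: in_set_butlastD intro!: T.lh_letters simp del: letters_iff)
  then show ?thesis using False lin1_const_sg[OF t T.lin1_lmulM_right[OF bilinD(2)[OF \<phi>]]] by simp
 qed (simp add: lin1_0[OF t])
 ultimately show ?thesis unfolding bilin_def lbar_diff_def
  by (intro conjI ballI mlin_add[OF t] lin1_add[OF t] mlin_diff_sum[OF t] bilinD(1)[OF \<phi>] lin1_const_sg[OF t] T.lin1_ldiffM bilinD(2)[OF \<phi>]) auto
qed

lemma bilin_lbar_mul:
 assumes t: "vector_space t" and \<phi>: "bilin t \<phi>" and X: "X \<in> L" and m: "m \<in> letters M"
 shows "bilin t (%Y m'. lbar_mul X m Y m' \<phi>)" "bilin t (%Y m'. lbar_mul Y m' X m \<phi>)"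
proof -
 note W = weaves_mem[THEN conjunct1]
 have 1: "lin1 M t (%m'. \<phi> W (lmul M (bM m V) m'))" if "W \<in> L" "V \<in> L" "m \<in> letters M" for W V m
  by (rule T.lin1_lmulM_right[OF bilinD(2)[OF \<phi> that(1)] T.bm_letters[OF that(3,2)]])
 have 2: "lin1 M t (%m'. \<phi> W (lmul M (bM m' V) m))" if "W \<in> L" "V \<in> L" for W V
  by (rule T.lin1_bm[OF T.lin1_lmulM_left[OF bilinD(2)[OF \<phi> that(1)] m] that(2)])
 have 3: "mlin A t (%V. \<phi> W (lmul M (bM m V) m'))" if "W \<in> L" "m' \<in> letters M" for W m'
  by (rule T.mlin_bm[OF T.lin1_lmulM_left[OF bilinD(2)[OF \<phi> that(1)] that(2)] m])
 have 4: "mlin A t (%W. \<phi> W (lmul M (bM m V) m'))" if "V \<in> L" "m \<in> letters M" "m' \<in> letters M" for V m m'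
  by (rule bilinD(1)[OF \<phi> T.lmulM_letters[OF T.bm_letters[OF that(2,1)] that(3)]])
 show "bilin t (%Y m'. lbar_mul X m Y m' \<phi>)" unfolding bilin_def lbar_mul_def
 proof (intro conjI ballI)
  show "mlin A t (%Y. cut_sum Y (%U V. sg (fst m * bd U) (ws X U (%W. \<phi> W (lmul M (bM m V) m')))))" if m': "m' \<in> letters M" for m'
   by (rule mlin_cut_sum[OF t], rule mlin_const_sg[OF t mlin_weave_sum[OF t 3]])
    (use W X m' mlin_bd_sg[OF t mlin_ws_right[OF t 4[OF _ m m'] X], of _ "%i. fst m * i"] in auto)
  show "lin1 M t (%m'. cut_sum Y (%U V. sg (fst m * bd U) (ws X U (%W. \<phi> W (lmul M (bM m V) m')))))" if Y: "Y \<in> L" for Y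
   by (rule lin1_cut_sum[OF t lin1_const_sg[OF t lin1_weave_sum[OF t 1]]]) (use W X Y m in auto)
 qed
 show "bilin t (%Y m'. lbar_mul Y m' X m \<phi>)" unfolding bilin_def lbar_mul_def
 proof (intro conjI ballI)
  show "mlin A t (%Y. cut_sum X (%U V. sg (fst m' * bd U) (ws Y U (%W. \<phi> W (lmul M (bM m' V) m)))))" if m': "m' \<in> letters M" for m'
   by (rule mlin_cut_sum_const[OF t mlin_const_sg[OF t mlin_ws_left[OF t 4]]]) (use X m m' in auto)
  show "lin1 M t (%m'. cut_sum X (%U V. sg (fst m' * bd U) (ws Y U (%W. \<phi> W (lmul M (bM m' V) m)))))" if Y: "Y \<in> L" for Y
  proof (rule lin1_cut_sum[OF t])
   fix U V assume "X = U @ V"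
   then have "lin1 M t (%m'. ws Y U (%W. \<phi> W (lmul M (bM m' V) m)))"
    using W X Y by (intro lin1_weave_sum[OF t 2]) auto
   from lin1_sg[OF t this, of "%i. i * bd U"]
   show "lin1 M t (%m'. sg (fst m' * bd U) (ws Y U (%W. \<phi> W (lmul M (bM m' V) m))))" .
  qed
 qed
qed

lemma bilin_relabel:
 assumes t: "vector_space t" and \<phi>: "bilin t \<phi>" and X: "X \<in> L" and m: "m \<in> letters M"
 shows "\<phi> (map (label A \<circ> snd) X) (label M (snd m)) = \<phi> X m"
proof -
 have "label M (snd m) \<in> letters M" by (rule label_in_letters[OF T.gM homogI[OF snd_letters[OF m]]])
 then have "\<phi> (map (label A \<circ> snd) X) (label M (snd m)) = \<phi> X (label M (snd m))"
  by (rule mlin_label[OF gA bilinD(1)[OF \<phi>] t X])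
 then show ?thesis using lin1_label[OF T.gM bilinD(2)[OF \<phi> X] t m] by simp
qed

lemma gens_LB: "gens LB (L \<times> letters M) (%(X, m). te X m) (%(X, m). bd X + fst m)"
 unfolding te_def
 by (rule gens_cong[OF gens_tensor[OF vT vM gens_word[OF gA] gens_letters[OF T.gM]]]) (simp_all add: left_bar_dga_def)

lemma LB_simps [simp]: "scal LB = fscal" "unt LB = te [] (0, unt M)" "gr LB = gr (tensor_cplx T M)"
 by (simp_all add: left_bar_dga_def te_def wd_def)

lemma homog_LB [simp]: "homog LB = homog (tensor_cplx T M)"
 by (simp add: homog_def)

lemma gLB: "graded LB"
 by (rule graded_cong[OF graded_tensor[OF gT T.gM]]) simp_all

lemma te_gr: "X \<in> L ==> m \<in> letters M ==> te X m \<in> gr LB (bd X + fst m)"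
 using gens_base[OF gens_LB _, of "(X, m)"] by (simp add: f)

lemma labels_LB:
 "xs \<in> lists (homog A) ==> map (label A) xs \<in> L" "m \<in> homog M ==> label M m \<in> letters M"
 using labels_in_lists[OF gA] label_in_letters[OF T.gM] by auto

lemma LB_diff:
 obtains d where "flin d"
  "!!X m. X \<in> L ==> m \<in> letters M ==> d (te X m) = lbar_diff X m te"
  "!!u. u \<in> homog LB ==> diff LB u = d u"
proof -
 let ?S = "{(tns (bar_dga A) M (word A xs) m,
     tns (bar_dga A) M (bar_diff_word A xs) m
     + fscal (ksign (bdeg A xs)) (tns (bar_dga A) M (word A xs) (diff M m))
     + (if xs = [] then 0 else fscal (ksign (bdeg A (butlast xs)))
        (tns (bar_dga A) M (word A (butlast xs)) (mul M (act M (last xs)) m)))) | xs m.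
      xs \<in> lists (homog A) \<and> m \<in> homog M}"
 let ?f = "%(X, m). (te X m, lbar_diff X m te)"
 let ?l = "%(xs, m). (map (label A) xs, label M m)"
 note b = bilin_relabel[OF f bilin_te] bilin_relabel[OF f bilin_lbar_diff[OF f bilin_te]]
 have "?S = (%d. ?f (?l d)) ` (lists (homog A) \<times> homog M)"
 proof -
  have "?f (?l (xs, m)) = (tns (bar_dga A) M (word A xs) m,
     tns (bar_dga A) M (bar_diff_word A xs) m
     + fscal (ksign (bdeg A xs)) (tns (bar_dga A) M (word A xs) (diff M m))
     + (if xs = [] then 0 else fscal (ksign (bdeg A (butlast xs)))
        (tns (bar_dga A) M (word A (butlast xs)) (mul M (act M (last xs)) m))))" for xs m
   using diff_sum_linear[OF linear_tns_left[OF vT vM, of m], of A "map (label A) xs" "wd A"]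
   by (simp add: te_def lbar_diff_def bar_diff_word_label word_label fscal_sg bd_label map_butlast[symmetric]
     ldiff_def lmul_def lhom_def last_map)
  then show ?thesis by (rule graph_image2[where f = ?f and l = ?l])
 qed
 also have "... = ?f ` (L \<times> letters M)"
  by (rule image_relabel[where s = "%(X, m). (map snd X, snd m)"])
   (simp_all add: case_prod_unfold mem_Times_iff labels_LB relabel_word(2) homogI[OF snd_letters] b del: letters_iff)
 finally have S: "?S = (%g. (case g of (X, m) => te X m, case g of (X, m) => lbar_diff X m te)) ` (L \<times> letters M)"
  by (simp add: case_prod_unfold)
 from lin_ext_exists[OF extends_te[OF f bilin_lbar_diff[OF f bilin_te]] S] obtain d where
  d: "flin d"
  "!!g. g \<in> L \<times> letters M ==> d (case g of (X, m) => te X m) = (case g of (X, m) => lbar_diff X m te)"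
  "!!u. u \<in> module.span fscal ((%(X, m). te X m) ` (L \<times> letters M)) ==> lin_ext fscal fscal ?S u = d u" by blast
 show ?thesis
 proof (rule that[OF d(1)])
  show "d (te X m) = lbar_diff X m te" if "X \<in> L" "m \<in> letters M" for X m using d(2)[of "(X, m)"] that by simp
  show "diff LB u = d u" if "u \<in> homog LB" for u
   using d(3)[OF gens_homog[OF gens_LB _ that, simplified, OF f]] by (simp add: left_bar_dga_def)
 qed
qed

lemma LB_mul:
 obtains p where "!!v. flin (p v)" "!!w. flin (%v. p v w)"
  "!!X m Y m'. X \<in> L ==> m \<in> letters M ==> Y \<in> L ==> m' \<in> letters M ==> p (te X m) (te Y m') = lbar_mul X m Y m' te"
  "!!u v. u \<in> homog LB ==> v \<in> homog LB ==> mul LB u v = p u v"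
proof -
 let ?R = "%xs m ys m'. (tns (bar_dga A) M (word A xs) m, tns (bar_dga A) M (word A ys) m',
     \<Sum>i\<le>length ys. fscal (ksign (deg M m * (dsum A (take i ys) + int i)))
      (tns (bar_dga A) M (mul (bar_dga A) (word A xs) (word A (take i ys)))
        (mul M (mbr M m (drop i ys)) m')))"
 let ?S = "{?R xs m ys m' | xs m ys m'.
      xs \<in> lists (homog A) \<and> m \<in> homog M \<and> ys \<in> lists (homog A) \<and> m' \<in> homog M}"
 let ?G = "L \<times> letters M" and ?D = "lists (homog A) \<times> homog M"
 let ?f = "%((X, m), (Y, m')). (te X m, te Y m', lbar_mul X m Y m' te)"
 let ?l = "%((xs, m), (ys, m')). ((map (label A) xs, label M m), (map (label A) ys, label M m'))"
 have b: "lbar_mul (map (label A \<circ> snd) X) (label M (snd m)) (map (label A \<circ> snd) Y) (label M (snd m')) te = lbar_mul X m Y m' te"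
  if g: "X \<in> L" "m \<in> letters M" "Y \<in> L" "m' \<in> letters M" for X m Y m'
 proof -
  have l: "map (label A \<circ> snd) X \<in> L" "label M (snd m) \<in> letters M"
   using labels_LB(1)[OF relabel_word(2)[OF g(1)]] labels_LB(2)[OF homogI[OF snd_letters[OF g(2)]]] relabel_word(1)[OF g(1)] by auto
  have "lbar_mul (map (label A \<circ> snd) X) (label M (snd m)) (map (label A \<circ> snd) Y) (label M (snd m')) te
   = lbar_mul (map (label A \<circ> snd) X) (label M (snd m)) Y m' te"
   by (rule bilin_relabel[OF f bilin_lbar_mul(1)[OF f bilin_te l] g(3,4)])
  also have "... = lbar_mul X m Y m' te"
   by (rule bilin_relabel[OF f bilin_lbar_mul(2)[OF f bilin_te g(3,4)] g(1,2)])
  finally show ?thesis .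
 qed
 have "?S = (%d. ?f (?l d)) ` (?D \<times> ?D)"
 proof -
  have "?f (?l ((xs, m), (ys, m'))) = ?R xs m ys m'" if xs: "xs \<in> lists (homog A)" and ys: "ys \<in> lists (homog A)" for xs m ys m'
  proof -
   let ?X = "map (label A) xs" and ?Y = "map (label A) ys"
   have XY: "?X \<in> L" "?Y \<in> L" using xs ys labels_in_lists[OF gA] by auto
   have "lbar_mul ?X (label M m) ?Y (label M m') te = (\<Sum>i\<le>length ys. sg (deg M m * bd (take i ?Y))
     (ws ?X (take i ?Y) (%W. tns T M (wd A W) (mul M (mbr M m (drop i ys)) m'))))"
    unfolding lbar_mul_def cut_sum_take_drop[symmetric] te_def lmul_def lbr_def snd_conv label_simps drop_map length_map
     map_map list.map_id ..
   also have "... = (\<Sum>i\<le>length ys. fscal (ksign (deg M m * (dsum A (take i ys) + int i)))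
      (tns T M (mul T (word A xs) (word A (take i ys))) (mul M (mbr M m (drop i ys)) m')))"
   proof (rule sum.cong[OF refl])
    fix i assume i: "i \<in> {..length ys}"
    have "take i ?Y \<in> L" using XY(2) lists_letters_simps(3)[of "take i ?Y" "drop i ?Y" A] unfolding append_take_drop_id by blast
    then have "mul T (word A xs) (word A (take i ys)) = ws ?X (take i ?Y) (wd A)"
     using bar_mul_wd[OF XY(1)] by (simp add: word_label take_map)
    then have 1: "tns T M (mul T (word A xs) (word A (take i ys))) v = ws ?X (take i ?Y) (%W. tns T M (wd A W) v)" for v
     using weave_sum_linear[OF linear_tns_left[OF vT vM]] by (simp add: bar_dga_simps)
    have "dsum A (map snd (take i ?Y)) = bd (take i ?Y) + int (length (take i ?Y))"
     by (rule dsum_bd) (auto simp: take_map)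
    then have "dsum A (take i ys) + int i = bd (take i ?Y) + 2 * int i" using i by (simp add: take_map comp_def)
    then show "sg (deg M m * bd (take i ?Y)) (ws ?X (take i ?Y) (%W. tns T M (wd A W) (mul M (mbr M m (drop i ys)) m')))
     = fscal (ksign (deg M m * (dsum A (take i ys) + int i)))
      (tns T M (mul T (word A xs) (word A (take i ys))) (mul M (mbr M m (drop i ys)) m'))"
     unfolding 1 fscal_sg by (intro sg_cong) (simp add: parity)
   qed
   finally show ?thesis by (simp add: te_def word_label)
  qed
  then show ?thesis by (intro graph_image4[where f = ?f and l = ?l])
 qed
 also have "... = ?f ` (?G \<times> ?G)"
  by (rule image_relabel[where s = "%((X, m), (Y, m')). ((map snd X, snd m), (map snd Y, snd m'))"])
   (simp_all add: case_prod_unfold mem_Times_iff labels_LB relabel_word(2) homogI[OF snd_letters] b bilin_relabel[OF f bilin_te] del: letters_iff)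
 finally have S: "?S = (%(g, h). (case g of (X, m) => te X m, case h of (X, m) => te X m,
   case g of (X, m) => case h of (Y, m') => lbar_mul X m Y m' te)) ` (?G \<times> ?G)"
  by (simp add: case_prod_unfold)
 have 1: "extends fscal fscal ?G (%(X, m). te X m) (%g. case g of (X, m) => case h of (Y, m') => lbar_mul X m Y m' te)" if "h \<in> ?G" for h
  using that extends_te[OF f bilin_lbar_mul(2)[OF f bilin_te]] by (cases h) (simp del: letters_iff)
 have 2: "extends fscal fscal ?G (%(X, m). te X m) (%h. case g of (X, m) => case h of (Y, m') => lbar_mul X m Y m' te)" if "g \<in> ?G" for g
  using that extends_te[OF f bilin_lbar_mul(1)[OF f bilin_te]] by (cases g) (simp del: letters_iff)
 have "([], (0, unt M)) \<in> ?G" using dga_unit(1)[OF T.dgaM] by simp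
 then have ne: "?G \<noteq> {}" by blast
 from bilin_ext_exists[OF f f f 1 2 S ne] obtain p where
  p: "!!v. flin (p v)" "!!w. flin (%v. p v w)"
  "!!g h. g \<in> ?G ==> h \<in> ?G ==> p (case g of (X, m) => te X m) (case h of (X, m) => te X m)
   = (case g of (X, m) => case h of (Y, m') => lbar_mul X m Y m' te)"
  "!!u v. u \<in> module.span fscal ((%(X, m). te X m) ` ?G) ==> v \<in> module.span fscal ((%(X, m). te X m) ` ?G) ==>
   bilin_ext fscal fscal fscal ?S u v = p u v" by blast
 show ?thesis
 proof (rule that[OF p(1,2)])
  show "p (te X m) (te Y m') = lbar_mul X m Y m' te" if "X \<in> L" "m \<in> letters M" "Y \<in> L" "m' \<in> letters M" for X m Y m'
   using p(3)[of "(X, m)" "(Y, m')"] that by simp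
  show "mul LB u v = p u v" if uv: "u \<in> homog LB" "v \<in> homog LB" for u v
   using p(4)[OF gens_homog[OF gens_LB _ uv(1), simplified, OF f] gens_homog[OF gens_LB _ uv(2), simplified, OF f]]
   by (simp add: left_bar_dga_def)
 qed
qed

lemma lbar_diff_mem:
 assumes V: "graded V" and X: "X \<in> L" and m: "m \<in> letters M"
  and \<phi>: "!!W w. W \<in> L ==> w \<in> letters M ==> bd W + fst w = bd X + fst m + 1 ==> \<phi> W w \<in> gr V n"
 shows "lbar_diff X m \<phi> \<in> gr V n"
proof -
 have "diff_sum A X (%W. \<phi> W m) \<in> gr V n"
  unfolding diff_sum_def by (rule graded_ssum[OF V]) (use diffs_mem[OF _ X] m in \<open>auto intro!: \<phi> simp del: letters_iff\<close>)
 moreover have "sg (bd X) (\<phi> X (ldiff M m)) \<in> gr V n"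
  by (intro graded_sg[OF V] \<phi> X T.ldiffM_letters m) simp
 moreover have "(if X = [] then 0 else sg (bd (butlast X)) (\<phi> (butlast X) (lmul M (lH (last X)) m))) \<in> gr V n"
 proof (cases X rule: rev_cases)
  case (snoc Y x)
  then show ?thesis using X m by (simp del: letters_iff) (intro graded_sg[OF V] \<phi> T.lmulM_letters T.lh_letters, auto simp del: letters_iff)
 qed (simp add: graded_zero[OF V])
 ultimately show ?thesis unfolding lbar_diff_def using graded_add[OF V] by blast
qed

lemma lbar_mul_mem:
 assumes V: "graded V" and X: "X \<in> L" "Y \<in> L" and m: "m \<in> letters M" "m' \<in> letters M"
  and \<phi>: "!!W w. W \<in> L ==> w \<in> letters M ==> bd W + fst w = bd X + fst m + bd Y + fst m' ==> \<phi> W w \<in> gr V n"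
 shows "lbar_mul X m Y m' \<phi> \<in> gr V n"
 unfolding lbar_mul_def weave_sum_def
proof (intro graded_cut_sum[OF V] graded_sg[OF V] graded_ssum[OF V])
 fix U U' k W assume U: "Y = U @ U'" and W: "(k, W) \<in> set (weaves (brc A) X U)"
 have "W \<in> L" "bd W = bd X + bd U" using weaves_mem[OF W] X U by auto
 then show "\<phi> W (lmul M (bM m U') m') \<in> gr V n"
  using U X m by (intro \<phi> T.lmulM_letters T.bm_letters) auto
qed

lemma lbar_diff_linear: "lin s t F ==> F (lbar_diff X m \<phi>) = lbar_diff X m (%W w. F (\<phi> W w))"
 unfolding lbar_diff_def by (simp add: linear_plus linear_sg diff_sum_linear linear_0)

lemma lbar_mul_linear: "lin s t F ==> F (lbar_mul X m Y m' \<phi>) = lbar_mul X m Y m' (%W w. F (\<phi> W w))"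
 unfolding lbar_mul_def by (simp add: cut_sum_linear linear_sg weave_sum_linear)

lemma lbar_diff_cong:
 assumes "X \<in> L" "m \<in> letters M" "!!W w. W \<in> L ==> w \<in> letters M ==> \<phi> W w = \<psi> W w"
 shows "lbar_diff X m \<phi> = lbar_diff X m \<psi>"
proof -
 have "diff_sum A X (%W. \<phi> W m) = diff_sum A X (%W. \<psi> W m)" by (rule diff_sum_cong) (use assms in auto)
 moreover have "\<phi> X (ldiff M m) = \<psi> X (ldiff M m)" using assms T.ldiffM_letters by blast
 moreover have "\<phi> (butlast X) (lmul M (lH (last X)) m) = \<psi> (butlast X) (lmul M (lH (last X)) m)" if "X \<noteq> []"
  using that assms(1,2) by (intro assms(3) T.lmulM_letters T.lh_letters) (auto simp: in_lists_conv_set dest: in_set_butlastD simp del: letters_iff)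
 ultimately show ?thesis unfolding lbar_diff_def by simp
qed

lemma lbar_mul_cong:
 assumes "X \<in> L" "m \<in> letters M" "Y \<in> L" "m' \<in> letters M" "!!W w. W \<in> L ==> w \<in> letters M ==> \<phi> W w = \<psi> W w"
 shows "lbar_mul X m Y m' \<phi> = lbar_mul X m Y m' \<psi>"
 unfolding lbar_mul_def
 by (intro cut_sum_cong arg_cong[where f = "sg _"] ws_cong assms(5) T.lmulM_letters T.bm_letters) (use assms in auto)

text \<open>
 All axioms are checked on pure tensors, where they are the identities for \<open>lbar_mul\<close> and
 \<open>lbar_diff\<close> with \<open>\<phi> = te\<close>.
\<close>

lemma dga_LB: "dga LB"
proof -
 obtain d where d: "flin d"
  "!!X m. X \<in> L ==> m \<in> letters M ==> d (te X m) = lbar_diff X m te"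
  "!!u. u \<in> homog LB ==> diff LB u = d u" by (rule LB_diff) (rule that)
 obtain p where p: "!!v. flin (p v)" "!!w. flin (%v. p v w)"
  "!!X m Y m'. X \<in> L ==> m \<in> letters M ==> Y \<in> L ==> m' \<in> letters M ==> p (te X m) (te Y m') = lbar_mul X m Y m' te"
  "!!u v. u \<in> homog LB ==> v \<in> homog LB ==> mul LB u v = p u v" by (rule LB_mul) (rule that)
 have u: "(0, unt M) \<in> letters M" using dga_unit(1)[OF T.dgaM] by simp
 show ?thesis
 proof (rule dga_by_generators[OF gLB gens_LB, unfolded LB_simps(1,2), OF d(1,3) p(1,2,4)])
  show "te [] (0, unt M) \<in> gr LB 0" using te_gr[of "[]", OF _ u] by simp
  fix g assume "g \<in> L \<times> letters M"
  then obtain X m where g: "g = (X, m)" "X \<in> L" "m \<in> letters M" by blast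
  show "d (case g of (X, m) => te X m) \<in> gr LB ((case g of (X, m) => bd X + fst m) + 1)"
   unfolding g(1) case_prod_conv d(2)[OF g(2,3)] by (rule lbar_diff_mem[OF gLB g(2,3)]) (metis te_gr)
  have "d (lbar_diff X m te) = lbar_diff X m (%W w. lbar_diff W w te)"
   unfolding lbar_diff_linear[OF d(1)] by (rule lbar_diff_cong[OF g(2,3) d(2)])
  then show "d (d (case g of (X, m) => te X m)) = 0"
   unfolding g(1) case_prod_conv d(2)[OF g(2,3)] using lbar_diff_lbar_diff[OF f bilin_te g(2,3)] by simp
  show "p (te [] (0, unt M)) (case g of (X, m) => te X m) = (case g of (X, m) => te X m)"
   "p (case g of (X, m) => te X m) (te [] (0, unt M)) = (case g of (X, m) => te X m)"
   unfolding g(1) case_prod_conv using p(3)[OF _ u g(2,3), of "[]"] p(3)[OF g(2,3) _ u, of "[]"] lbar_mul_unit[OF f bilin_te g(2,3)] by simp_all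
  fix h assume "h \<in> L \<times> letters M"
  then obtain Y m' where h: "h = (Y, m')" "Y \<in> L" "m' \<in> letters M" by blast
  show "p (case g of (X, m) => te X m) (case h of (X, m) => te X m) \<in> gr LB ((case g of (X, m) => bd X + fst m) + (case h of (X, m) => bd X + fst m))"
   unfolding g(1) h(1) case_prod_conv p(3)[OF g(2,3) h(2,3)]
   by (rule lbar_mul_mem[OF gLB g(2) h(2) g(3) h(3)]) (metis te_gr add.assoc)
  have 1: "d (lbar_mul X m Y m' te) = lbar_mul X m Y m' (%W w. lbar_diff W w te)"
   unfolding lbar_mul_linear[OF d(1)] by (rule lbar_mul_cong[OF g(2,3) h(2,3) d(2)])
  have 2: "p (lbar_diff X m te) (te Y m') = lbar_diff X m (%W w. lbar_mul W w Y m' te)"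
   unfolding lbar_diff_linear[OF p(2)] by (rule lbar_diff_cong[OF g(2,3)]) (rule p(3)[OF _ _ h(2,3)])
  have 3: "p (te X m) (lbar_diff Y m' te) = lbar_diff Y m' (%W w. lbar_mul X m W w te)"
   unfolding lbar_diff_linear[OF p(1)] by (rule lbar_diff_cong[OF h(2,3)]) (rule p(3)[OF g(2,3)])
  show "d (p (case g of (X, m) => te X m) (case h of (X, m) => te X m))
   = p (d (case g of (X, m) => te X m)) (case h of (X, m) => te X m)
    + sg (case g of (X, m) => bd X + fst m) (p (case g of (X, m) => te X m) (d (case h of (X, m) => te X m)))"
   unfolding g(1) h(1) case_prod_conv p(3)[OF g(2,3) h(2,3)] d(2)[OF g(2,3)] d(2)[OF h(2,3)] 1 2 3
   by (rule lbar_leibniz[OF f bilin_te g(2) h(2) g(3) h(3)])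
  fix k assume "k \<in> L \<times> letters M"
  then obtain Z m'' where k: "k = (Z, m'')" "Z \<in> L" "m'' \<in> letters M" by blast
  have 4: "p (lbar_mul X m Y m' te) (te Z m'') = lbar_mul X m Y m' (%W w. lbar_mul W w Z m'' te)"
   unfolding lbar_mul_linear[OF p(2)] by (rule lbar_mul_cong[OF g(2,3) h(2,3)]) (rule p(3)[OF _ _ k(2,3)])
  have 5: "p (te X m) (lbar_mul Y m' Z m'' te) = lbar_mul Y m' Z m'' (%W w. lbar_mul X m W w te)"
   unfolding lbar_mul_linear[OF p(1)] by (rule lbar_mul_cong[OF h(2,3) k(2,3)]) (rule p(3)[OF g(2,3)])
  show "p (p (case g of (X, m) => te X m) (case h of (X, m) => te X m)) (case k of (X, m) => te X m)
   = p (case g of (X, m) => te X m) (p (case h of (X, m) => te X m) (case k of (X, m) => te X m))"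
   unfolding g(1) h(1) k(1) case_prod_conv p(3)[OF g(2,3) h(2,3)] p(3)[OF h(2,3) k(2,3)] 4 5
   by (rule lbar_mul_assoc[OF f bilin_te g(2) h(2) k(2) g(3) h(3) k(3)])
 qed
qed

end

section \<open>The right bar complex\<close>

lemma dga_op_module [simp]: "act (dga_op N) = act N" "mbr (dga_op N) = mbr N"
 by (simp_all add: dga_op_def)

lemma word_op [simp]: "wd (brace_op A) = wd A"
 by (simp add: wd_def[abs_def] word_def[abs_def])

lemma tns_cong: "scal V' = scal V ==> scal W' = scal W ==> tns V' W' = tns V W"
 by (simp add: tns_def[abs_def])

lemma mlin_rev: "mlin A t \<phi> ==> mlin A t (%X. \<phi> (rev X))"
 unfolding mlin_def by (auto simp: in_lists_conv_set simp del: letters_iff)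

lemma linear_agree_on_gens:
 assumes F: "lin s t F" "lin s t F'" and eq: "!!g. g \<in> G ==> F (e g) = F' (e g)"
  and x: "x \<in> module.span s (e ` G)"
 shows "F x = F' x"
 by (rule linear_agree[OF F _ x]) (rule eq)

locale right_module = brace_alg_op A + B: left_module "brace_op A" "dga_op N"
 for A :: "('k::field, 'a::ab_group_add, 'r) brace_alg_scheme" and N :: "('k, 'a, 'n::ab_group_add, 's) brace_mod_scheme"
begin

abbreviation "N' \<equiv> dga_op N"
abbreviation "RB \<equiv> right_bar_dga A N"

lemma gN: "graded N"
 by (rule graded_cong[OF B.T.gM]) simp_all

lemmas vN = graded_vector_space[OF gN]

definition rt :: "int \<times> 'n => (int \<times> 'a) list => ('n, ('a, 'k) words, 'k) tensor" where
 "rt n X = tns N T (snd n) (wd A X)"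

abbreviation "kf n X \<equiv> fst n * bd X + rexp X"

lemma te_op: "B.te X n = tns T N (wd A X) (snd n)"
proof -
 have "tns (bar_dga A') N' = tns T N" by (rule tns_cong) simp_all
 then show ?thesis by (simp add: B.te_def)
qed

lemma vsT: "vector_space (scal T)"
 by (simp add: vector_space_fscal)

lemma bilin_rt:
 shows "n \<in> letters N ==> mlin A fscal (rt n)" "X \<in> L ==> lin1 N fscal (%n. rt n X)"
 unfolding rt_def using mlin_linear[OF mlin_word linear_tns_right[OF vN vsT, unfolded bar_dga_simps]] lin1_tns(1)[OF vN vsT]
 by (simp_all del: letters_iff)

lemma mlin_kf: "vector_space t ==> mlin A t \<phi> ==> mlin A t (%X. sg (kf n X) (\<phi> X))"
 by (rule mlin_sg, assumption+) (metis rexp_cong map_fst_bd)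

lemma bilin_flip: "B.bilin fscal (%X n. sg (kf n X) (rt n (rev X)))"
proof -
 have "lin1 N fscal (%n. sg (kf n X) (rt n (rev X)))" if "X \<in> L" for X
  by (rule lin1_sg[OF vector_space_fscal bilin_rt(2)[OF rev_mem[OF that]], where h = "%i. i * bd X + rexp X"])
 moreover have "mlin A fscal (%X. sg (kf n X) (rt n (rev X)))" if "n \<in> letters N" for n
  by (rule mlin_kf[OF vector_space_fscal mlin_rev[OF bilin_rt(1)[OF that]]])
 ultimately show ?thesis by (simp add: B.bilin_def)
qed

lemma extends_rt:
 assumes t: "vector_space t" and "!!n. n \<in> letters N ==> mlin A t (\<phi> n)" "!!X. X \<in> L ==> lin1 N t (%n. \<phi> n X)"
 shows "extends fscal t (letters N \<times> L) (%(n, X). rt n X) (%(n, X). \<phi> n X)"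
 unfolding rt_def
 by (rule extends_tns[OF vN vsT t extends_letter[OF gN t assms(3)]])
  (auto intro: extends_word[OF gA t assms(2), unfolded bar_dga_simps] simp del: letters_iff)

lemma RB_simps [simp]: "scal RB = fscal" "gr RB = gr (tensor_cplx N T)"
 by (simp_all add: right_bar_dga_def Let_def)

lemma homog_RB [simp]: "homog RB = homog (tensor_cplx N T)"
 by (simp add: homog_def)

lemma gRB: "graded RB"
 by (rule graded_cong[OF graded_tensor[OF gN gT]]) simp_all

lemma gens_RB: "gens RB (letters N \<times> L) (%(n, X). rt n X) (%(n, X). fst n + bd X)"
 unfolding rt_def
 by (rule gens_cong[OF gens_tensor[OF vN vsT gens_letters[OF gN] gens_word[OF gA]]]) simp_all

lemma rt_gr: "n \<in> letters N ==> X \<in> L ==> rt n X \<in> gr RB (fst n + bd X)"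
 using gens_base[OF gens_RB _, of "(n, X)"] by (simp add: B.f)

lemma te_op_gr: "X \<in> L ==> n \<in> letters N ==> B.te X n \<in> gr B.LB (bd X + fst n)"
 using B.te_gr[of X n] by simp

text \<open>The two mutually inverse linear maps that identify the two descriptions.\<close>

definition flips where
 "flips F G \<longleftrightarrow> flin F \<and> flin G \<and>
  (\<forall>X\<in>L. \<forall>n\<in>letters N. F (B.te X n) = sg (kf n X) (rt n (rev X))) \<and>
  (\<forall>X\<in>L. \<forall>n\<in>letters N. G (rt n X) = sg (kf n X) (B.te (rev X) n)) \<and>
  (\<forall>u\<in>homog B.LB. lin_ext fscal fscal (flip_graph A N) u = F u) \<and>
  (\<forall>u\<in>homog RB. lin_ext fscal fscal ((flip_graph A N)\<inverse>) u = G u) \<and>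
  (\<forall>i. \<forall>u\<in>gr B.LB i. F u \<in> gr RB i \<and> G (F u) = u) \<and>
  (\<forall>i. \<forall>u\<in>gr RB i. G u \<in> gr B.LB i \<and> F (G u) = u)"

lemma flip_maps: "\<exists>F G. flips F G"
proof -
 note f = vector_space_fscal
 let ?G = "L \<times> letters N"
 let ?e = "%(X, n). B.te X n" and ?v = "%(X, n). sg (kf n X) (rt n (rev X))"
 let ?l = "%(xs, n). (map (label A) xs, label N n)"
 have tebil: "B.bilin fscal B.te" by (rule B.bilin_te)
 have lab: "B.te (map (label A \<circ> snd) X) (label N (snd n)) = B.te X n"
  "sg (kf (label N (snd n)) (map (label A \<circ> snd) X)) (rt (label N (snd n)) (rev (map (label A \<circ> snd) X))) = sg (kf n X) (rt n (rev X))"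
  if "X \<in> L" "n \<in> letters N" for X n
  using B.bilin_relabel[OF f tebil, of X n] B.bilin_relabel[OF f bilin_flip, of X n] that
   same_pieces(3)[of N' N] by (simp_all add: label_def[abs_def])
 have S: "flip_graph A N = (%g. (?e g, ?v g)) ` ?G"
 proof -
  have "flip_graph A N = (%d. (%g. (?e g, ?v g)) (?l d)) ` (lists (homog A) \<times> homog N)"
   unfolding flip_graph_def
  proof (rule graph_image2[where l = ?l])
   fix xs n
   have "even (rev_exp A (map snd (map (label A) xs))) = even (rexp (map (label A) xs))" by (rule rev_exp_rexp) simp
   then have e: "even (kf (label N n) (map (label A) xs)) = even (deg N n * bdeg A xs + rev_exp A xs)"
    by (simp add: parity bd_label)
   have "tns (bar_dga A') N' = tns T N" by (rule tns_cong) simp_all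
   moreover have "word A' xs = wd A (map (label A) xs)" using word_label[of A' xs] by simp
   ultimately show "(%g. (?e g, ?v g)) (?l (xs, n)) = (tns (bar_dga A') N' (word A' xs) n,
     fscal (ksign (deg N n * bdeg A xs + rev_exp A xs)) (tns N T n (word A (rev xs))))"
    using sg_cong[OF e] by (simp add: te_op rt_def fscal_sg word_label rev_map)
  qed
  also have "... = (%g. (?e g, ?v g)) ` ?G"
   by (rule image_relabel[where s = "%(X, n). (map snd X, snd n)"])
    (simp_all add: case_prod_unfold mem_Times_iff labels_in_lists[OF gA] label_in_letters[OF gN] relabel_word(2)
     homogI[OF snd_letters] lab[unfolded label_simps] del: letters_iff)
  finally show ?thesis .
 qed
 have extF: "extends fscal fscal ?G ?e ?v" using B.extends_te[OF f bilin_flip] by simp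
 obtain F where F: "flin F" "!!g. g \<in> ?G ==> F (?e g) = ?v g"
  "!!u. u \<in> module.span fscal (?e ` ?G) ==> lin_ext fscal fscal (flip_graph A N) u = F u"
  by (rule lin_ext_exists[OF extF S]) (rule that)
 have "extends fscal fscal (letters N \<times> L) (%(n, X). rt n X) (%(n, X). sg (kf n X) (B.te (rev X) n))"
 proof (rule extends_rt[OF f])
  have b: "mlin A fscal (%X. B.te X n)" if "n \<in> letters N" for n using B.bilinD(1)[OF tebil, of n] that by simp
  show "mlin A fscal (%X. sg (kf n X) (B.te (rev X) n))" if "n \<in> letters N" for n
   by (rule mlin_kf[OF f mlin_rev[OF b[OF that]]])
  have "lin1 N fscal (B.te (rev X))" if "X \<in> L" for X using B.bilinD(2)[OF tebil, of "rev X"] rev_mem[OF that] by simp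
  then show "lin1 N fscal (%n. sg (kf n X) (B.te (rev X) n))" if "X \<in> L" for X
   using lin1_sg[OF f, where h = "%i. i * bd X + rexp X"] that by blast
 qed
 then obtain G where G: "flin G" "!!n X. n \<in> letters N ==> X \<in> L ==> G (rt n X) = sg (kf n X) (B.te (rev X) n)"
  unfolding extends_def by fastforce
 have Gv: "G (?v g) = ?e g" if gG: "g \<in> ?G" for g
 proof -
  obtain X n where g: "g = (X, n)" "X \<in> L" "n \<in> letters N" using gG by blast
  have "G (?v g) = sg (kf n X) (sg (kf n (rev X)) (B.te X n))" using g G(2)[OF g(3) rev_mem[OF g(2)]] linear_sg[OF G(1)] by simp
  also have "... = sg 0 (B.te X n)" unfolding sg_simps(3) by (rule sg_cong) (simp add: parity)
  finally show ?thesis using g(1) by simp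
 qed
 have extG: "extends fscal fscal ?G ?v ?e" unfolding extends_def using G(1) Gv by blast
 have S': "(flip_graph A N)\<inverse> = (%g. (?v g, ?e g)) ` ?G" unfolding S by force
 obtain G' where G': "flin G'" "!!g. g \<in> ?G ==> G' (?v g) = ?e g"
  "!!u. u \<in> module.span fscal (?v ` ?G) ==> lin_ext fscal fscal ((flip_graph A N)\<inverse>) u = G' u"
  by (rule lin_ext_exists[OF extG S']) (rule that)
 have v: "?v (rev X, n) = sg (kf n X) (rt n X)" if "X \<in> L" "n \<in> letters N" for X n
  by simp (rule sg_cong, simp add: parity)
 have GG: "G' (rt n X) = G (rt n X)" if "X \<in> L" "n \<in> letters N" for X n
 proof -
  have "sg (kf n X) (G' (rt n X)) = sg (kf n X) (G (rt n X))"
   using G'(2)[of "(rev X, n)"] Gv[of "(rev X, n)"] v[OF that] rev_mem[OF that(1)] that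
   by (simp add: linear_sg[OF G'(1), symmetric] linear_sg[OF G(1), symmetric] del: letters_iff)
  then show ?thesis by (simp add: sg_def split: if_splits)
 qed
 have gL: "gens B.LB ?G ?e (%(X, n). bd X + fst n)" using B.gens_LB by simp
 note agree = linear_agree_on_gens
 have idl: "flin (%x. x)" by (simp add: Vector_Spaces.linear_iff f)
 have sgG: "sg (kf n X) (rt n (rev X)) \<in> gr RB (bd X + fst n)" if "X \<in> L" "n \<in> letters N" for X n
  using graded_sg[OF gRB rt_gr[OF that(2) rev_mem[OF that(1)]]] by (simp add: add.commute)
 have FG: "F (G (rt n X)) = rt n X" if "X \<in> L" "n \<in> letters N" for X n
 proof -
  have "F (G (rt n X)) = sg (kf n X) (sg (kf n (rev X)) (rt n X))"
   using G(2)[OF that(2,1)] F(2)[of "(rev X, n)"] rev_mem[OF that(1)] that by (simp add: linear_sg[OF F(1)] del: letters_iff)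
  also have "... = sg 0 (rt n X)" unfolding sg_simps(3) by (rule sg_cong) (simp add: parity)
  finally show ?thesis by simp
 qed
 have 1: "F (B.te X n) = sg (kf n X) (rt n (rev X))" if "X \<in> L" "n \<in> letters N" for X n using F(2)[of "(X, n)"] that by simp
 have 2: "G (rt n X) = sg (kf n X) (B.te (rev X) n)" if "X \<in> L" "n \<in> letters N" for X n using G(2) that by blast
 have 3: "lin_ext fscal fscal (flip_graph A N) u = F u" if "u \<in> homog B.LB" for u
   using F(3)[OF gens_homog[OF gL _ that, unfolded B.LB_simps, OF f]] .
 have 4: "lin_ext fscal fscal ((flip_graph A N)\<inverse>) u = G u" if u: "u \<in> homog RB" for u
  proof -
   have us: "u \<in> module.span fscal ((%(n, X). rt n X) ` (letters N \<times> L))"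
    using gens_homog[OF gens_RB _ u, unfolded RB_simps, OF f] .
   interpret fs: vector_space "fscal :: 'k => ('n, ('a, 'k) words, 'k) tensor => _" by (rule f)
   have "(%(n, X). rt n X) ` (letters N \<times> L) \<subseteq> fs.span (?v ` ?G)"
   proof clarsimp
    fix i x X assume x: "x \<in> gr N i" and X: "\<forall>y\<in>set X. y \<in> letters A"
    have "?v (rev X, (i, x)) \<in> fs.span (?v ` ?G)" using x X by (intro fs.span_base imageI) (simp add: in_lists_conv_set)
    then have "sg (kf (i, x) X) (rt (i, x) X) \<in> fs.span (?v ` ?G)" using v[of X "(i, x)"] x X by (simp add: in_lists_conv_set)
    then show "rt (i, x) X \<in> fs.span (?v ` ?G)" using fs.span_neg[of "- rt (i, x) X"] by (auto simp: sg_def split: if_splits)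
   qed
   then have "u \<in> fs.span (?v ` ?G)" using us fs.span_minimal[OF _ fs.subspace_span] by blast
   then have "lin_ext fscal fscal ((flip_graph A N)\<inverse>) u = G' u" by (rule G'(3))
   also have "... = G u" by (rule agree[OF G'(1) G(1) _ us]) (use GG in auto)
   finally show ?thesis .
  qed
 have 5: "F u \<in> gr RB i" if "u \<in> gr B.LB i" for u i
  proof (rule gens_maps[OF gL _ gRB _ that])
   show "lin (scal B.LB) (scal RB) F" using F(1) by simp
   fix g assume g: "g \<in> ?G" and i: "(case g of (X, n) => bd X + fst n) = i"
   obtain X n where nX: "g = (X, n)" by (cases g)
   show "F (?e g) \<in> gr RB i" using F(2)[OF g] sgG[of X n] g i nX by (simp del: RB_simps letters_iff)
  qed
 have 6: "G u \<in> gr B.LB i" if "u \<in> gr RB i" for u i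
  proof (rule gens_maps[OF gens_RB _ B.gLB _ that])
   show "lin (scal RB) (scal B.LB) G" using G(1) by simp
   fix g assume g: "g \<in> letters N \<times> L" and i: "(case g of (n, X) => fst n + bd X) = i"
   obtain n X where nX: "g = (n, X)" by (cases g)
   have "B.te (rev X) n \<in> gr B.LB i" using te_op_gr[OF rev_mem, of X n] g i nX by (simp del: B.LB_simps letters_iff add: add.commute)
   then show "G (case g of (n, X) => rt n X) \<in> gr B.LB i" using G(2) graded_sg[OF B.gLB] g nX by (simp del: B.LB_simps letters_iff)
  qed
 have 7: "G (F u) = u" if "u \<in> gr B.LB i" for u i
   by (rule gens_agree[OF gL, unfolded B.LB_simps(1), OF linear_compose[OF F(1) G(1)] idl _ that]) (use F(2) Gv in auto)
 have 8: "F (G u) = u" if "u \<in> gr RB i" for u i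
   by (rule gens_agree[OF gens_RB, unfolded RB_simps(1), OF linear_compose[OF G(1) F(1)] idl _ that]) (use FG in auto)
 show ?thesis unfolding flips_def
  by (intro exI[of _ F] exI[of _ G] conjI ballI allI F(1) G(1) 1 2 3 4 5 6 7 8)
qed

text \<open>Only \<open>dga_op N\<close> is known to be a dg algebra, so products of \<open>N\<close> are expressed by it.\<close>

lemma op_mul_N:
 assumes "x \<in> letters N" "y \<in> letters N"
 shows "mul N (snd y) (snd x) = sg (fst x * fst y) (mul N' (snd x) (snd y))"
proof -
 have l: "x \<in> letters N'" "y \<in> letters N'" using assms by simp_all
 have op: "mul N' (snd x) (snd y) = sg (deg N (snd x) * deg N (snd y)) (mul N (snd y) (snd x))"
  by (simp add: op_mul_def scal_sg[OF gN])
 show ?thesis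
 proof (cases "snd x = 0 \<or> snd y = 0")
  case True
  then have "mul N' (snd x) (snd y) = 0"
   using dga_mul_zero(1)[OF B.T.dgaM snd_letters[OF l(1)]] dga_mul_zero(2)[OF B.T.dgaM snd_letters[OF l(2)]] by auto
  then show ?thesis using op by simp
 next
  case False
  then have "deg N (snd x) = fst x" "deg N (snd y) = fst y"
   using deg_eq[OF gN snd_letters[OF assms(1)]] deg_eq[OF gN snd_letters[OF assms(2)]] by auto
  then show ?thesis unfolding op by simp (simp add: sg_def)
 qed
qed

lemma linear_rt: "lin (scal N) fscal (%v. tns N T v (wd A X))"
 by (rule linear_tns_left[OF vN vsT])

definition rbar_diff :: "int \<times> 'n => (int \<times> 'a) list => (int \<times> 'n => (int \<times> 'a) list => 'z::ab_group_add) => 'z" where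
 "rbar_diff n Y \<phi> = \<phi> (ldiff N n) Y + sg (fst n) (diff_sum A Y (\<phi> n))
   + (case Y of [] => 0 | y # Y' => sg (fst n + 1) (\<phi> (fst n + fst y, mul N (snd n) (act N (snd y))) Y'))"

text \<open>Here \<open>n\<close> absorbs the first part of \<open>Y\<close>, reversed since its braces are those of the opposite algebra.\<close>

definition rbar_mul :: "int \<times> 'n => (int \<times> 'a) list => int \<times> 'n => (int \<times> 'a) list =>
  (int \<times> 'n => (int \<times> 'a) list => 'z::ab_group_add) => 'z" where
 "rbar_mul n X n' Y \<phi> = cut_sum Y (%U V. sg (rexp U + fst n' * (bd U + bd X) + bd U * bd X)
   (ws X V (\<phi> (lmul N' (lbr (mbr N) n (rev U)) n'))))"

lemma RB_diff_formula:
 assumes F: "flin F"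
  "!!X n. X \<in> L ==> n \<in> letters N ==> F (B.te X n) = sg (kf n X) (rt n (rev X))"
  and n: "n \<in> letters N" and Y: "Y \<in> L"
 shows "sg (kf n Y) (F (B.lbar_diff (rev Y) n B.te)) = rbar_diff n Y rt"
proof -
 note f = vector_space_fscal
 have dn: "ldiff N n \<in> letters N" using B.T.ldiffM_letters[of n] n by (simp add: ldiff_def)
 have "F (B.lbar_diff (rev Y) n B.te) = B.lbar_diff (rev Y) n (%W w. F (B.te W w))" by (rule B.lbar_diff_linear[OF F(1)])
 also have "... = B.lbar_diff (rev Y) n (%W w. sg (kf w W) (rt w (rev W)))"
  by (rule B.lbar_diff_cong) (use rev_mem[OF Y] n F(2) in auto)
 also have "... = diff_sum A' (rev Y) (%W. sg (kf n W) (rt n (rev W)))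
   + sg (bd Y) (sg (kf (ldiff N n) Y) (rt (ldiff N n) Y))
   + (case Y of [] => 0 | y # Y' => sg (bd Y') (sg ((fst y + fst n) * bd Y' + rexp Y') (rt (lmul N' (lhom (act N) y) n) Y')))"
 proof -
  have [simp]: "ldiff N' n = ldiff N n" by (simp add: ldiff_def)
  show ?thesis unfolding B.lbar_diff_def
   by (cases Y; simp) (intro arg_cong2[where f = "(+)"] refl sg_cong, auto simp: parity rexp_append)
 qed
 also have "diff_sum A' (rev Y) (%W. sg (kf n W) (rt n (rev W))) = sg (fst n * (bd Y + 1) + rexp Y) (diff_sum A Y (rt n))"
 proof -
  have "diff_sum A' (rev Y) (%W. sg (kf n W) (rt n (rev W)))
   = diff_sum A' (rev Y) (%W. sg (fst n * (bd Y + 1)) (sg (rexp W) (rt n (rev W))))"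
   by (rule O.diff_sum_cong) (use rev_mem[OF Y] in auto)
  also have "... = sg (fst n * (bd Y + 1)) (sg (rexp (rev Y)) (diff_sum A Y (rt n)))"
   unfolding diff_sum_sg diff_sum_op[OF f bilin_rt(1)[OF n] rev_mem[OF Y]] by simp
  also have "... = sg (fst n * (bd Y + 1) + rexp Y) (diff_sum A Y (rt n))" by simp (rule sg_cong, simp add: parity)
  finally show ?thesis .
 qed
 finally have E: "F (B.lbar_diff (rev Y) n B.te) = sg (fst n * (bd Y + 1) + rexp Y) (diff_sum A Y (rt n))
   + sg (bd Y) (sg (kf (ldiff N n) Y) (rt (ldiff N n) Y))
   + (case Y of [] => 0 | y # Y' => sg (bd Y') (sg ((fst y + fst n) * bd Y' + rexp Y') (rt (lmul N' (lhom (act N) y) n) Y')))" .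
 have s1: "sg (kf n Y) (sg (fst n * (bd Y + 1) + rexp Y) v) = sg (fst n) v" for v :: "('n, ('a, 'k) words, 'k) tensor"
  by simp (rule sg_cong, auto simp: parity)
 have s2: "sg (kf n Y) (sg (bd Y) (sg (kf (ldiff N n) Y) v)) = v" for v :: "('n, ('a, 'k) words, 'k) tensor"
  using sg_cong[of "kf n Y + (bd Y + kf (ldiff N n) Y)" 0 v] by (auto simp: parity)
 have s3: "sg (kf n Y) (case Y of [] => 0 | y # Y' => sg (bd Y') (sg ((fst y + fst n) * bd Y' + rexp Y') (rt (lmul N' (lhom (act N) y) n) Y')))
  = (case Y of [] => 0 | y # Y' => sg (fst n + 1) (rt (fst n + fst y, mul N (snd n) (act N (snd y))) Y'))"
 proof (cases Y)
  case (Cons y Y')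
  have ay: "lhom (act N) y \<in> letters N" using B.T.lh_letters[of y] Y Cons by simp
  have "mul N (snd n) (act N (snd y)) = sg (fst y * fst n) (mul N' (act N (snd y)) (snd n))"
   using op_mul_N[OF ay n] by (simp add: lhom_def)
  then have "rt (fst n + fst y, mul N (snd n) (act N (snd y))) Y' = sg (fst y * fst n) (rt (lmul N' (lhom (act N) y) n) Y')"
   using linear_sg[OF linear_rt] by (simp add: rt_def lmul_def lhom_def)
  then show ?thesis unfolding Cons by simp (rule sg_cong, auto simp: parity)
 qed simp
 show ?thesis unfolding E rbar_diff_def sg_simps(4) s1 s2 s3 by (simp add: add.commute)
qed

lemma RB_mul_formula:
 assumes F: "flin F"
  "!!X n. X \<in> L ==> n \<in> letters N ==> F (B.te X n) = sg (kf n X) (rt n (rev X))"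
  and n: "n \<in> letters N" "n' \<in> letters N" and X: "X \<in> L" and Y: "Y \<in> L"
 shows "sg (kf n X + kf n' Y) (F (B.lbar_mul (rev X) n (rev Y) n' B.te)) = rbar_mul n X n' Y rt"
proof -
 note f = vector_space_fscal
 let ?b = "lbr (mbr N) n"
 have "F (B.lbar_mul (rev X) n (rev Y) n' B.te) = B.lbar_mul (rev X) n (rev Y) n' (%W w. F (B.te W w))"
  by (rule B.lbar_mul_linear[OF F(1)])
 also have "... = B.lbar_mul (rev X) n (rev Y) n' (%W w. sg (kf w W) (rt w (rev W)))"
  by (rule B.lbar_mul_cong) (use rev_mem X Y n F(2) in auto)
 also have "... = cut_sum Y (%U V. sg (fst n * bd V) (weave_sum (brc A') (rev X) (rev V)
   (%W. sg (kf (lmul N' (?b (rev U)) n') W) (rt (lmul N' (?b (rev U)) n') (rev W)))))"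
  unfolding B.lbar_mul_def cut_sum_rev by simp
 finally have E: "F (B.lbar_mul (rev X) n (rev Y) n' B.te) = ..." .
 show ?thesis unfolding E rbar_mul_def cut_sum_sg[symmetric]
 proof (rule cut_sum_cong)
  fix U V assume UV: "Y = U @ V"
  then have l: "U \<in> L" "V \<in> L" using Y by auto
  let ?n = "lmul N' (?b (rev U)) n'"
  have m: "?n \<in> letters N"
   using B.T.lmulM_letters[OF B.T.bm_letters, of n "rev U" n'] n rev_mem[OF l(1)] by simp
  have "weave_sum (brc A') (rev X) (rev V) (%W. sg (kf ?n W) (rt ?n (rev W)))
   = weave_sum (brc A') (rev X) (rev V) (%W. sg ((fst n + bd U + fst n') * (bd X + bd V)) (sg (rexp W) (rt ?n (rev W))))"
   by (rule O.ws_cong) (use rev_mem X l in auto)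
  also have "... = sg ((fst n + bd U + fst n') * (bd X + bd V)) (sg (rexp (rev X) + rexp (rev V)) (ws X V (rt ?n)))"
   unfolding weave_sum_sg ws_op[OF f bilin_rt(1)[OF m] rev_mem[OF X] rev_mem[OF l(2)]] by simp
  finally show "sg (kf n X + kf n' Y) (sg (fst n * bd V) (weave_sum (brc A') (rev X) (rev V) (%W. sg (kf ?n W) (rt ?n (rev W)))))
   = sg (rexp U + fst n' * (bd U + bd X) + bd U * bd X) (ws X V (rt ?n))"
   unfolding UV by simp (rule sg_cong, auto simp: parity rexp_append)
 qed
qed

text \<open>
 Differential and product of \<open>R\<close> are transported along the flip, which is bijective, so the dg
 algebra axioms hold for the transported operations.
\<close>

lemma RB_structure:
 obtains d p where "flin d"
  "!!n Y. n \<in> letters N ==> Y \<in> L ==> d (rt n Y) = rbar_diff n Y rt"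
  "!!u. u \<in> homog RB ==> diff RB u = d u"
  "!!v. flin (p v)" "!!w. flin (%v. p v w)"
  "!!n X n' Y. n \<in> letters N ==> X \<in> L ==> n' \<in> letters N ==> Y \<in> L ==> p (rt n X) (rt n' Y) = rbar_mul n X n' Y rt"
  "!!u v. u \<in> homog RB ==> v \<in> homog RB ==> mul RB u v = p u v"
  "unt RB = rt (0, unt N) []" "dga RB"
proof -
 obtain F G where FG': "flips F G" using flip_maps by blast
 have F: "flin F" and G: "flin G"
  and Ft: "!!X n. X \<in> L ==> n \<in> letters N ==> F (B.te X n) = sg (kf n X) (rt n (rev X))"
  and Gt: "!!X n. X \<in> L ==> n \<in> letters N ==> G (rt n X) = sg (kf n X) (B.te (rev X) n)"
  and Fx: "!!u. u \<in> homog B.LB ==> lin_ext fscal fscal (flip_graph A N) u = F u"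
  and Gx: "!!u. u \<in> homog RB ==> lin_ext fscal fscal ((flip_graph A N)\<inverse>) u = G u"
  and Fg: "!!u i. u \<in> gr B.LB i ==> F u \<in> gr RB i" and Gg: "!!u i. u \<in> gr RB i ==> G u \<in> gr B.LB i"
  and GF: "!!u i. u \<in> gr B.LB i ==> G (F u) = u" and FG: "!!u i. u \<in> gr RB i ==> F (G u) = u"
  using FG' unfolding flips_def by blast+
 note F = F Ft Fx Fg and G = G Gt Gx Gg
 obtain d where d: "flin d"
  "!!X m. X \<in> lists (letters A') ==> m \<in> letters N' ==> d (B.te X m) = B.lbar_diff X m B.te"
  "!!u. u \<in> homog B.LB ==> diff B.LB u = d u" by (rule B.LB_diff) (rule that)
 obtain p where p: "!!v. flin (p v)" "!!w. flin (%v. p v w)"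
  "!!X m Y m'. X \<in> lists (letters A') ==> m \<in> letters N' ==> Y \<in> lists (letters A') ==> m' \<in> letters N' ==> p (B.te X m) (B.te Y m') = B.lbar_mul X m Y m' B.te"
  "!!u v. u \<in> homog B.LB ==> v \<in> homog B.LB ==> mul B.LB u v = p u v" by (rule B.LB_mul) (rule that)
 have hG: "G u \<in> homog B.LB" if "u \<in> homog RB" for u
  using that G(4) unfolding homog_def by blast
 note D = B.dga_LB
 have diffR: "diff RB u = F (d (G u))" if u: "u \<in> gr RB i" for u i
 proof -
  have "diff RB u = lin_ext fscal fscal (flip_graph A N) (diff B.LB (G u))"
   using G(3)[OF homogI[OF u]] by (simp add: right_bar_dga_def Let_def)
  then show ?thesis using F(3)[OF homogI[OF dga_diff_gr[OF D G(4)[OF u]]]] d(3)[OF homogI[OF G(4)[OF u]]] by simp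
 qed
 have mulR: "mul RB u v = F (p (G u) (G v))" if u: "u \<in> gr RB i" and v: "v \<in> gr RB j" for u v i j
 proof -
  have "mul RB u v = lin_ext fscal fscal (flip_graph A N) (mul B.LB (G u) (G v))"
   using G(3)[OF homogI[OF u]] G(3)[OF homogI[OF v]] by (simp add: right_bar_dga_def Let_def)
  then show ?thesis
   using F(3)[OF homogI[OF dga_mul_gr[OF D G(4)[OF u] G(4)[OF v]]]] p(4)[OF homogI[OF G(4)[OF u]] homogI[OF G(4)[OF v]]] by simp
 qed
 have u0: "(0, unt N) \<in> letters N" using dga_unit(1)[OF B.T.dgaM] by simp
 have u1: "unt B.LB \<in> gr B.LB 0" by (rule dga_unit(1)[OF D])
 have unitR: "unt RB = F (unt B.LB)"
  using F(3)[OF homogI[OF u1]] by (simp add: right_bar_dga_def Let_def)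
 have fd: "d x \<in> gr B.LB (i + 1)" if "x \<in> gr B.LB i" for x i
  using dga_diff_gr[OF D that] d(3)[OF homogI[OF that]] by simp
 have fp: "p x y \<in> gr B.LB (i + j)" if "x \<in> gr B.LB i" "y \<in> gr B.LB j" for x y i j
  using dga_mul_gr[OF D that] p(4)[OF homogI[OF that(1)] homogI[OF that(2)]] by simp
 have dgaR: "dga RB"
 proof (rule dga_reflect(1)[OF D gRB, where f = G])
  show "graded_map RB B.LB 0 G" by (rule graded_map_linear) (use G(1,4) gRB B.gLB in simp_all)
  show "x = 0" if "x \<in> gr RB i" "G x = 0" for x i using FG[OF that(1)] that(2) linear_0[OF F(1)] by simp
  show "diff RB x \<in> gr RB (i + 1)" if "x \<in> gr RB i" for x i unfolding diffR[OF that] by (rule F(4)[OF fd[OF G(4)[OF that]]])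
  show "G (diff RB x) = diff B.LB (G x)" if "x \<in> gr RB i" for x i
   unfolding diffR[OF that] GF[OF fd[OF G(4)[OF that]]] d(3)[OF homogI[OF G(4)[OF that]]] ..
  show "mul RB x y \<in> gr RB (i + j)" if "x \<in> gr RB i" "y \<in> gr RB j" for x y i j
   unfolding mulR[OF that] by (rule F(4)[OF fp[OF G(4)[OF that(1)] G(4)[OF that(2)]]])
  show "G (mul RB x y) = mul B.LB (G x) (G y)" if "x \<in> gr RB i" "y \<in> gr RB j" for x y i j
   unfolding mulR[OF that] GF[OF fp[OF G(4)[OF that(1)] G(4)[OF that(2)]]]
    p(4)[OF homogI[OF G(4)[OF that(1)]] homogI[OF G(4)[OF that(2)]]] ..
  show "unt RB \<in> gr RB 0" "G (unt RB) = unt B.LB" unfolding unitR by (rule F(4)[OF u1], rule GF[OF u1])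
 qed
 show ?thesis
 proof (rule that[of "%u. F (d (G u))" "%u v. F (p (G u) (G v))"])
  show "flin (%u. F (d (G u)))"
   by (rule linear_compose[OF linear_compose[OF G(1) d(1)] F(1)])
  show "flin (%v. F (p (G u) (G v)))" for u
   by (rule linear_compose[OF linear_compose[OF G(1) p(1)] F(1)])
  show "flin (%u. F (p (G u) (G v)))" for v
   by (rule linear_compose[OF linear_compose[OF G(1) p(2)] F(1)])
  show "diff RB u = F (d (G u))" if "u \<in> homog RB" for u using that diffR unfolding homog_def by blast
  show "mul RB u v = F (p (G u) (G v))" if "u \<in> homog RB" "v \<in> homog RB" for u v
   using that mulR unfolding homog_def by blast
  show "unt RB = rt (0, unt N) []" unfolding unitR using F(2)[of "[]", OF _ u0] by simp
  show "F (d (G (rt n Y))) = rbar_diff n Y rt" if n: "n \<in> letters N" and Y: "Y \<in> L" for n Y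
  proof -
   have "F (d (G (rt n Y))) = sg (kf n Y) (F (B.lbar_diff (rev Y) n B.te))"
    using G(2)[OF Y n] d(2)[of "rev Y" n] rev_mem[OF Y] n by (simp add: linear_sg[OF d(1)] linear_sg[OF F(1)])
   then show ?thesis using RB_diff_formula[OF F(1,2) n Y] by simp
  qed
  show "F (p (G (rt n X)) (G (rt n' Y))) = rbar_mul n X n' Y rt"
   if n: "n \<in> letters N" and X: "X \<in> L" and n': "n' \<in> letters N" and Y: "Y \<in> L" for n X n' Y
  proof -
   have "F (p (G (rt n X)) (G (rt n' Y))) = sg (kf n X + kf n' Y) (F (B.lbar_mul (rev X) n (rev Y) n' B.te))"
    using G(2)[OF X n] G(2)[OF Y n'] p(3)[of "rev X" n "rev Y" n'] rev_mem X Y n n'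
    by (simp add: linear_sg[OF p(1)] linear_sg[OF p(2)] linear_sg[OF F(1)] add.commute add.left_commute)
   then show ?thesis using RB_mul_formula[OF F(1,2) n n' X Y] by simp
  qed
  show "dga RB" by (rule dgaR)
 qed
qed

end

section \<open>Linear maps on two-sided bar complexes\<close>

text \<open>Multilinear functions on \<open>V \<otimes> T(A[1]) \<otimes> W\<close>.\<close>

definition tri :: "('k, 'a::plus, 'r) dgv_scheme => ('k, 'v::plus, 's) dgv_scheme => ('k, 'w::plus, 'q) dgv_scheme =>
  ('k => 'z::plus => 'z) => (int \<times> 'v => (int \<times> 'a) list => int \<times> 'w => 'z) => bool" where
 "tri A V W t \<phi> \<longleftrightarrow> (\<forall>n\<in>letters V. \<forall>m\<in>letters W. mlin A t (%X. \<phi> n X m)) \<and>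
   (\<forall>X\<in>lists (letters A). \<forall>m\<in>letters W. lin1 V t (%n. \<phi> n X m)) \<and>
   (\<forall>n\<in>letters V. \<forall>X\<in>lists (letters A). lin1 W t (\<phi> n X))"

lemma scal_tensor_cplx [simp]: "scal (tensor_cplx V W) = fscal"
 by (simp add: tensor_cplx_def)

lemma tri_relabel:
 assumes A: "graded A" and V: "graded V" and W: "graded W" and t: "vector_space t" and \<phi>: "tri A V W t \<phi>"
  and n: "n \<in> letters V" and X: "X \<in> lists (letters A)" and m: "m \<in> letters W"
 shows "\<phi> (label V (snd n)) (map (label A \<circ> snd) X) (label W (snd m)) = \<phi> n X m"
proof -
 have n': "label V (snd n) \<in> letters V" by (rule label_in_letters[OF V homogI[OF snd_letters[OF n]]])
 have m': "label W (snd m) \<in> letters W" by (rule label_in_letters[OF W homogI[OF snd_letters[OF m]]])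
 have 1: "mlin A t (%X. \<phi> (label V (snd n)) X (label W (snd m)))" using \<phi> n' m' unfolding tri_def by blast
 have 2: "lin1 W t (\<phi> (label V (snd n)) X)" using \<phi> n' X unfolding tri_def by blast
 have 3: "lin1 V t (%n. \<phi> n X m)" using \<phi> m X unfolding tri_def by blast
 show ?thesis using mlin_label[OF A 1 t X] lin1_label[OF W 2 t m] lin1_label[OF V 3 t n] by simp
qed

lemma graph_image3:
 assumes "!!x y z. x \<in> D ==> y \<in> E ==> z \<in> H ==> f (l (x, y, z)) = F x y z"
 shows "{F x y z | x y z. x \<in> D \<and> y \<in> E \<and> z \<in> H} = (%d. f (l d)) ` (D \<times> E \<times> H)"
proof -
 have "{F x y z | x y z. x \<in> D \<and> y \<in> E \<and> z \<in> H} = (%(x, y, z). F x y z) ` (D \<times> E \<times> H)"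
 proof (intro subset_antisym subsetI)
  fix u assume "u \<in> {F x y z | x y z. x \<in> D \<and> y \<in> E \<and> z \<in> H}"
  then obtain x y z where "u = F x y z" "x \<in> D" "y \<in> E" "z \<in> H" by blast
  then show "u \<in> (%(x, y, z). F x y z) ` (D \<times> E \<times> H)"
   by (intro image_eqI[of _ _ "(x, y, z)"]) auto
 next
  fix u assume "u \<in> (%(x, y, z). F x y z) ` (D \<times> E \<times> H)"
  then obtain x y z where "u = F x y z" "x \<in> D" "y \<in> E" "z \<in> H" by auto
  then show "u \<in> {F x y z | x y z. x \<in> D \<and> y \<in> E \<and> z \<in> H}" by blast
 qed
 also have "... = (%d. f (l d)) ` (D \<times> E \<times> H)" by (rule image_cong) (use assms in auto)
 finally show ?thesis .
qed

text \<open>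
 The form in which the maps on two-sided complexes are given: values on homogeneous entries, where
 a multilinear function gives the same values on all letters.
\<close>

lemma lin_ext_tri:
 assumes g: "graded A" "graded V" "graded W" and s: "vector_space s" and t: "vector_space t"
  and ext: "extends s t (letters V \<times> lists (letters A) \<times> letters W) (%(n, X, m). e n X m) (%(n, X, m). \<phi> n X m)"
  and e: "tri A V W s e" and \<phi>: "tri A V W t \<phi>"
  and eq: "!!n xs m. n \<in> homog V ==> xs \<in> lists (homog A) ==> m \<in> homog W ==>
   (e (label V n) (map (label A) xs) (label W m), \<phi> (label V n) (map (label A) xs) (label W m)) = (E n xs m, Q n xs m)"
 obtains F where "lin s t F"
  "!!n X m. n \<in> letters V ==> X \<in> lists (letters A) ==> m \<in> letters W ==> F (e n X m) = \<phi> n X m"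
  "!!u. u \<in> module.span s ((%(n, X, m). e n X m) ` (letters V \<times> lists (letters A) \<times> letters W)) ==>
   lin_ext s t {(E n xs m, Q n xs m) | n xs m. n \<in> homog V \<and> xs \<in> lists (homog A) \<and> m \<in> homog W} u = F u"
proof -
 let ?G = "letters V \<times> lists (letters A) \<times> letters W"
 let ?f = "%(n, X, m). (e n X m, \<phi> n X m)"
 let ?l = "%(n, xs, m). (label V n, map (label A) xs, label W m)"
 have snds: "map snd X \<in> lists (homog A)" if "X \<in> lists (letters A)" for X using that map_snd_lists[OF g(1)] by blast
 have "{(E n xs m, Q n xs m) | n xs m. n \<in> homog V \<and> xs \<in> lists (homog A) \<and> m \<in> homog W}
  = (%d. ?f (?l d)) ` (homog V \<times> lists (homog A) \<times> homog W)"
  by (rule graph_image3[where f = ?f and l = ?l]) (simp only: case_prod_conv eq)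
 also have "... = ?f ` ?G"
  by (rule image_relabel[where s = "%(n, X, m). (snd n, map snd X, snd m)"])
   (simp_all add: case_prod_unfold mem_Times_iff labels_in_lists[OF g(1)] label_in_letters[OF g(2)] label_in_letters[OF g(3)]
    snds homogI[OF snd_letters] tri_relabel[OF g s e] tri_relabel[OF g t \<phi>] del: letters_iff)
 finally have S: "{(E n xs m, Q n xs m) | n xs m. n \<in> homog V \<and> xs \<in> lists (homog A) \<and> m \<in> homog W}
  = (%h. (case h of (n, X, m) => e n X m, case h of (n, X, m) => \<phi> n X m)) ` ?G" by (simp add: case_prod_unfold)
 obtain F where F: "lin s t F"
  "!!h. h \<in> ?G ==> F (case h of (n, X, m) => e n X m) = (case h of (n, X, m) => \<phi> n X m)"
  "!!u. u \<in> module.span s ((%(n, X, m). e n X m) ` ?G) ==>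
   lin_ext s t {(E n xs m, Q n xs m) | n xs m. n \<in> homog V \<and> xs \<in> lists (homog A) \<and> m \<in> homog W} u = F u"
  by (rule lin_ext_exists[OF ext S]) (rule that)
 show ?thesis
 proof (rule that[OF F(1) _ F(3)])
  show "F (e n X m) = \<phi> n X m" if "n \<in> letters V" "X \<in> lists (letters A)" "m \<in> letters W" for n X m
   using F(2)[of "(n, X, m)"] that by simp
 qed
qed

lemma extends_reindex:
 assumes "extends s t G e \<phi>" "!!g. g \<in> G' ==> r g \<in> G \<and> e (r g) = e' g \<and> \<phi> (r g) = \<phi>' g"
 shows "extends s t G' e' \<phi>'"
 using assms unfolding extends_def by metis

lemma lin1_cong:
 assumes V: "graded V" and eq: "!!x. x \<in> letters V ==> g x = g' x" and g': "lin1 V t g'"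
 shows "lin1 V t g"
 using g' graded_add[OF V] graded_scale[OF V] unfolding lin1_def lin_on_def by (simp add: eq)

locale two_sided = left_module A M + right_module A N
 for A :: "('k::field, 'a::ab_group_add, 'r) brace_alg_scheme" and M :: "('k, 'a, 'm::ab_group_add, 's) brace_mod_scheme"
  and N :: "('k, 'a, 'n::ab_group_add, 'q) brace_mod_scheme"
begin

abbreviation "C \<equiv> tensor_cplx T M"
abbreviation "D \<equiv> tensor_cplx T LB"
abbreviation "RL \<equiv> tensor_cplx RB LB"
abbreviation "split \<equiv> bar_split A N M"

lemmas gM = T.gM

lemma vs [simp]: "vector_space fscal"
 by (rule vector_space_fscal)

definition be :: "int \<times> 'n => (int \<times> 'a) list => int \<times> 'm => ('n, 'a, 'm, 'k) bar" where
 "be n X m = tns N C (snd n) (te X m)"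

definition qe where "qe n X Y m = tns RB LB (rt n X) (te Y m)"

definition th where "th n X W Y m = tns RB D (rt n X) (tns T LB (wd A W) (te Y m))"

lemma tri_tns_te:
 assumes V: "graded V" and W: "scal W = fscal"
 shows "tri A V M fscal (%n X m. tns V W (snd n) (te X m))"
proof -
 note vV = graded_vector_space[OF V]
 have vW: "vector_space (scal W)" by (simp add: W)
 have "flin (tns V W v)" for v using linear_tns_right[OF vV vW] by (simp add: W)
 then show ?thesis unfolding tri_def
  using mlin_linear[OF bilinD(1)[OF bilin_te]] lin1_linear[OF bilinD(2)[OF bilin_te]] lin1_tns(1)[OF vV vW] by blast
qed

lemma extends_tns_te:
 assumes V: "graded V" and W: "scal W = fscal" and t: "vector_space t" and \<phi>: "tri A V M t \<phi>"
 shows "extends fscal t (letters V \<times> L \<times> letters M) (%(n, X, m). tns V W (snd n) (te X m)) (%(n, X, m). \<phi> n X m)"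
proof -
 have vW: "vector_space (scal W)" by (simp add: W)
 have 1: "extends (scal V) t (letters V) snd (%n. case h of (X, m) => \<phi> n X m)" if "h \<in> L \<times> letters M" for h
 proof -
  have "lin1 V t (%n. \<phi> n (fst h) (snd h))" using \<phi> that unfolding tri_def by (auto simp: mem_Times_iff simp del: letters_iff)
  from extends_letter[OF V t this] show ?thesis by (simp add: case_prod_unfold)
 qed
 have 2: "extends (scal W) t (L \<times> letters M) (%(X, m). te X m) (%h. case h of (X, m) => \<phi> n X m)" if "n \<in> letters V" for n
 proof -
  have "bilin t (\<phi> n)" using \<phi> that unfolding tri_def bilin_def by blast
  from extends_te[OF t this] show ?thesis by (simp add: W)
 qed
 from extends_tns[OF graded_vector_space[OF V] vW t 1 2] show ?thesis by (simp add: case_prod_unfold)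
qed

lemma tri_be: "tri A N M fscal be"
 using tri_tns_te[OF gN, of C] by (simp add: be_def[abs_def])

lemma qe_lin:
 "X \<in> L ==> lin1 N fscal (%n. qe n X Y m)" "n \<in> letters N ==> mlin A fscal (%X. qe n X Y m)"
 "m \<in> letters M ==> mlin A fscal (%Y. qe n X Y m)" "Y \<in> L ==> lin1 M fscal (%m. qe n X Y m)"
proof -
 have l: "flin (%u. tns RB LB u v)" "flin (tns RB LB u)" for u v
  using linear_tns_left[of RB LB v] linear_tns_right[of RB LB u] by simp_all
 show "X \<in> L ==> lin1 N fscal (%n. qe n X Y m)" unfolding qe_def by (rule lin1_linear[OF bilin_rt(2) l(1)])
 show "n \<in> letters N ==> mlin A fscal (%X. qe n X Y m)" unfolding qe_def by (rule mlin_linear[OF bilin_rt(1) l(1)])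
 show "m \<in> letters M ==> mlin A fscal (%Y. qe n X Y m)" unfolding qe_def by (rule mlin_linear[OF bilinD(1)[OF bilin_te] l(2)])
 show "Y \<in> L ==> lin1 M fscal (%m. qe n X Y m)" unfolding qe_def by (rule lin1_linear[OF bilinD(2)[OF bilin_te] l(2)])
qed

lemma gens_bar: "gens (bar_cplx A N M) (letters N \<times> L \<times> letters M) (%(n, X, m). be n X m) (%(n, X, m). fst n + (bd X + fst m))"
proof -
 have "gens C (L \<times> letters M) (%(X, m). te X m) (%(X, m). bd X + fst m)" by (rule gens_cong[OF gens_LB]) simp_all
 from gens_cong[OF gens_tensor[OF vN _ gens_letters[OF gN] this], of "bar_cplx A N M"]
 show ?thesis by (simp add: bar_cplx_def be_def case_prod_unfold)
qed

lemma gens_RL: "gens RL ((letters N \<times> L) \<times> (L \<times> letters M)) (%((n, X), (Y, m)). qe n X Y m) (%((n, X), (Y, m)). fst n + bd X + (bd Y + fst m))"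
 using gens_tensor[OF _ _ gens_RB gens_LB] by (simp add: qe_def case_prod_unfold)

lemma bar_cplx_simps [simp]: "scal (bar_cplx A N M) = fscal"
 by (simp add: bar_cplx_def)

lemma gr_bar: "gr (bar_cplx A N M) = gr (tensor_cplx N C)"
 by (simp add: bar_cplx_def)

lemma graded_bar_cplx: "graded (bar_cplx A N M)"
proof (rule graded_cong[OF graded_tensor[OF gN]])
 show "graded C" by (rule graded_tensor[OF gT gM])
qed (simp_all add: gr_bar)

lemma be_gr: "n \<in> letters N ==> X \<in> L ==> m \<in> letters M ==> be n X m \<in> gr (bar_cplx A N M) (fst n + (bd X + fst m))"
 using gens_base[OF gens_bar _, of "(n, X, m)"] by simp

text \<open>The right action of \<open>A\<close> on \<open>N\<close>, on letters.\<close>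

definition nact :: "int \<times> 'n => int \<times> 'a => int \<times> 'n" where
 "nact n y = (fst n + fst y, mul N (snd n) (act N (snd y)))"

lemma lh_op_letters: "y \<in> letters A ==> lhom (act N) y \<in> letters N"
 using B.T.lh_letters[of y] by simp

lemma nact_lmul:
 assumes "vector_space t" "lin1 N t g" "n \<in> letters N" "y \<in> letters A"
 shows "g (nact n y) = sg (fst y * fst n) (g (lmul N' (lhom (act N) y) n))"
proof -
 have l: "lmul N' (lhom (act N) y) n \<in> letters N"
  using B.T.lmulM_letters[of "lhom (act N) y" n] lh_op_letters[OF assms(4)] assms(3) by simp
 show ?thesis
  using op_mul_N[OF lh_op_letters[OF assms(4)] assms(3)] lin1_sg_arg[OF gN assms(1,2) snd_letters[OF l], of "fst y * fst n"]
  by (simp add: nact_def lmul_def lhom_def add.commute)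
qed

lemma lin1_nact:
 assumes t: "vector_space t" and g: "lin1 N t g"
 shows "y \<in> letters A ==> lin1 N t (%n. g (nact n y))" "n \<in> letters N ==> lin1 A t (%y. g (nact n y))"
proof -
 assume y: "y \<in> letters A"
 have "lin1 N t (%n. g (lmul N' (lhom (act N) y) n))"
  using B.T.lin1_lmulM_right[of t g "lhom (act N) y"] g lh_op_letters[OF y] by simp
 from lin1_sg[OF t this, where h = "%i. fst y * i"]
 show "lin1 N t (%n. g (nact n y))" by (rule lin1_cong[OF gN, rotated]) (use nact_lmul[OF t g _ y] in blast)
next
 assume n: "n \<in> letters N"
 have "lin1 A t (%y. g (lmul N' (lhom (act N) y) n))"
  using B.T.lin1_lh[OF B.T.lin1_lmulM_left, of t g n] g n by simp
 from lin1_sg[OF t this, where h = "%i. i * fst n"]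
 show "lin1 A t (%y. g (nact n y))" by (rule lin1_cong[OF gA, rotated]) (use nact_lmul[OF t g n] in blast)
qed

lemma nact_letters: "n \<in> letters N ==> y \<in> letters A ==> nact n y \<in> letters N"
 using op_mul_N[OF lh_op_letters, of y n] graded_sg[OF gN] snd_letters[OF B.T.lmulM_letters[of "lhom (act N) y" n]] lh_op_letters[of y]
 by (simp add: nact_def lmul_def lhom_def add.commute del: letters_iff) (simp add: letters_def)

text \<open>The differential of the two-sided complex.\<close>

definition bdiff where
 "bdiff n X m \<phi> = \<phi> (ldiff N n) X m + sg (fst n) (lbar_diff X m (\<phi> n))
   + (case X of [] => 0 | x # X' => sg (fst n + 1) (\<phi> (nact n x) X' m))"

lemma tri_bdiff:
 assumes t: "vector_space t" and \<phi>: "tri A N M t \<phi>"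
 shows "tri A N M t (%n X m. bdiff n X m \<phi>)"
proof -
 have p: "!!n m. n \<in> letters N ==> m \<in> letters M ==> mlin A t (%X. \<phi> n X m)"
  "!!X m. X \<in> L ==> m \<in> letters M ==> lin1 N t (%n. \<phi> n X m)" "!!n X. n \<in> letters N ==> X \<in> L ==> lin1 M t (\<phi> n X)"
  using \<phi> unfolding tri_def by blast+
 have b: "bilin t (\<phi> n)" if "n \<in> letters N" for n using p that by (simp add: bilin_def)
 have dn: "ldiff N n \<in> letters N" if "n \<in> letters N" for n using B.T.ldiffM_letters[of n] that by (simp add: ldiff_def)
 have ld: "lin1 N t (%n. g (ldiff N n))" if "lin1 N t g" for g using B.T.lin1_ldiffM[of t g] that by (simp add: ldiff_def)
 show ?thesis unfolding tri_def
 proof (intro conjI ballI)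
  fix n m assume n: "n \<in> letters N" and m: "m \<in> letters M"
  have "mlin A t (%X. case X of [] => 0 | x # X' => sg (fst n + 1) (\<phi> (nact n x) X' m))"
   unfolding mlin_def
  proof (intro ballI)
   fix P Q assume P: "P \<in> L" and Q: "Q \<in> L"
   show "lin1 A t (%x. case P @ x # Q of [] => 0 | x # X' => sg (fst n + 1) (\<phi> (nact n x) X' m))"
   proof (cases P)
    case Nil
    then show ?thesis using lin1_const_sg[OF t lin1_nact(2)[OF t p(2)[OF Q m] n]] by simp
   next
    case (Cons y P')
    then have "y \<in> letters A" "P' \<in> L" using P by auto
    then show ?thesis using Cons lin1_const_sg[OF t mlin_lists[OF p(1)[OF nact_letters[OF n] m] _ Q]] by simp
   qed
  qed
  then show "mlin A t (%X. bdiff n X m \<phi>)" unfolding bdiff_def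
   using p(1)[OF dn[OF n] m] bilinD(1)[OF bilin_lbar_diff[OF t b[OF n]] m] by (intro mlin_add[OF t] mlin_const_sg[OF t])
 next
  fix X m assume X: "X \<in> L" and m: "m \<in> letters M"
  have "lin1 N t (%n. lbar_diff X m (\<phi> n))"
  proof -
   have 1: "lin1 N t (%n. diff_sum A X (%W. \<phi> n W m))" unfolding diff_sum_def
    by (rule lin1_ssum[OF t]) (use diffs_mem[OF _ X] p(2) m in blast)
   have 2: "lin1 N t (%n. if X = [] then 0 else sg (bd (butlast X)) (\<phi> n (butlast X) (lmul M (lH (last X)) m)))"
   proof (cases "X = []")
    case False
    then have "butlast X \<in> L" "lmul M (lH (last X)) m \<in> letters M"
     using X by (auto simp: in_lists_conv_set dest: in_set_butlastD intro!: T.lmulM_letters T.lh_letters m simp del: letters_iff)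
    then show ?thesis using False lin1_const_sg[OF t p(2)] by simp
   qed (simp add: lin1_0[OF t])
   show ?thesis unfolding lbar_diff_def
    by (intro lin1_add[OF t] 1 2 lin1_const_sg[OF t] p(2) X T.ldiffM_letters m)
  qed
  from lin1_sg[OF t this, where h = "%i. i"]
  have "lin1 N t (%n. sg (fst n) (lbar_diff X m (\<phi> n)))" .
  moreover have "lin1 N t (%n. case X of [] => 0 | x # X' => sg (fst n + 1) (\<phi> (nact n x) X' m))"
  proof (cases X)
   case (Cons x X')
   then have "x \<in> letters A" "X' \<in> L" using X by auto
   from lin1_sg[OF t lin1_nact(1)[OF t p(2)[OF this(2) m] this(1)], where h = "%i. i + 1"] show ?thesis by (simp add: Cons)
  qed (simp add: lin1_0[OF t])
  ultimately show "lin1 N t (%n. bdiff n X m \<phi>)" unfolding bdiff_def by (intro lin1_add[OF t] ld p(2)[OF X m])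
 next
  fix n X assume n: "n \<in> letters N" and X: "X \<in> L"
  have "lin1 M t (%m. case X of [] => 0 | x # X' => sg (fst n + 1) (\<phi> (nact n x) X' m))"
  proof (cases X)
   case (Cons x X')
   then have "x \<in> letters A" "X' \<in> L" using X by auto
   then show ?thesis using lin1_const_sg[OF t p(3)[OF nact_letters[OF n]]] by (simp add: Cons)
  qed (simp add: lin1_0[OF t])
  then show "lin1 M t (%m. bdiff n X m \<phi>)" unfolding bdiff_def
   using p(3)[OF dn[OF n] X] bilinD(2)[OF bilin_lbar_diff[OF t b[OF n]] X] by (intro lin1_add[OF t] lin1_const_sg[OF t])
 qed
qed

lemma homog_bar_span: "u \<in> homog (bar_cplx A N M) ==> u \<in> module.span fscal ((%(n, X, m). be n X m) ` (letters N \<times> L \<times> letters M))"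
 using gens_homog[OF gens_bar, of u] by simp

lemma extends_be: "vector_space t ==> tri A N M t \<phi> ==>
  extends fscal t (letters N \<times> L \<times> letters M) (%(n, X, m). be n X m) (%(n, X, m). \<phi> n X m)"
 unfolding be_def by (rule extends_tns_te[OF gN]) simp_all

lemma bar_diff_map:
 obtains d where "flin d"
  "!!n X m. n \<in> letters N ==> X \<in> L ==> m \<in> letters M ==> d (be n X m) = bdiff n X m be"
  "!!u. u \<in> homog (bar_cplx A N M) ==> diff (bar_cplx A N M) u = d u"
proof -
 let ?Q = "%n xs m. bar_elem A N M (diff N n) (word A xs) m
     + fscal (ksign (deg N n)) (bar_elem A N M n (bar_diff_word A xs) m)
     + fscal (ksign (deg N n + bdeg A xs)) (bar_elem A N M n (word A xs) (diff M m))
     + (if xs = [] then 0 else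
        fscal (ksign (deg N n + 1))
         (bar_elem A N M (mul N n (act N (hd xs))) (word A (tl xs)) m)
        + fscal (ksign (deg N n + bdeg A (butlast xs)))
         (bar_elem A N M n (word A (butlast xs)) (mul M (act M (last xs)) m)))"
 have vC: "vector_space (scal C)" by simp
 have eq: "(be (label N n) (map (label A) xs) (label M m), bdiff (label N n) (map (label A) xs) (label M m) be)
   = (bar_elem A N M n (word A xs) m, ?Q n xs m)" for n xs m
 proof -
  let ?X = "map (label A) xs"
  have 1: "bar_elem A N M v (bar_diff_word A xs) m = diff_sum A ?X (%W. tns N C v (tns T M (wd A W) m))" for v
   unfolding bar_elem_def bar_diff_word_label
   using diff_sum_linear[OF linear_tns_left[OF vT vM, of m], where A = A and X = ?X and \<phi> = "wd A"]
    diff_sum_linear[OF linear_tns_right[OF vN vC, of v], where A = A and X = ?X and \<phi> = "%W. tns T M (wd A W) m"] by simp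
  have "bdiff (label N n) ?X (label M m) be = ?Q n xs m"
  proof (cases "xs = []")
   case True
   then show ?thesis
    by (simp add: bdiff_def lbar_diff_def be_def te_def bar_elem_def ldiff_def word_label fscal_sg bdeg_def bar_diff_word_def linear_0[OF linear_tns_right[OF vN vC]] linear_0[OF linear_tns_left[OF vT vM]])
  next
   case False
   then obtain x xs' where xs: "xs = x # xs'" by (cases xs) auto
   have c: "(case ?X of [] => 0 | x # X' => sg (deg N n + 1) (be (nact (label N n) x) X' (label M m)))
    = sg (deg N n + 1) (bar_elem A N M (mul N n (act N (hd xs))) (word A (tl xs)) m)"
    by (simp add: xs be_def te_def bar_elem_def word_label nact_def)
   have l: "butlast ?X = map (label A) (butlast xs)" "last ?X = label A (last xs)" "bd ?X = bdeg A xs"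
    using False by (simp_all add: map_butlast last_map bd_label)
   have l4: "bd (map (label A) (butlast xs)) = bdeg A (butlast xs)" by (rule bd_label)
   have ne: "?X \<noteq> []" using False by simp
   show ?thesis
    unfolding bdiff_def label_simps(1) c lbar_diff_def l l4 1 fscal_sg if_not_P[OF ne] if_not_P[OF False]
    by (simp add: be_def te_def bar_elem_def ldiff_def lmul_def lhom_def word_label add_ac)
  qed
  then show ?thesis by (simp add: be_def te_def bar_elem_def word_label)
 qed
 obtain F where F: "flin F"
  "!!n X m. n \<in> letters N ==> X \<in> L ==> m \<in> letters M ==> F (be n X m) = bdiff n X m be"
  "!!u. u \<in> module.span fscal ((%(n, X, m). be n X m) ` (letters N \<times> L \<times> letters M)) ==>
   lin_ext fscal fscal {(bar_elem A N M n (word A xs) m, ?Q n xs m) | n xs m. n \<in> homog N \<and> xs \<in> lists (homog A) \<and> m \<in> homog M} u = F u"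
  by (rule lin_ext_tri[OF gA gN gM vs vs extends_be[OF vs tri_bdiff[OF vs tri_be]] tri_be tri_bdiff[OF vs tri_be] eq]) (rule that)
 show ?thesis
  by (rule that[OF F(1,2)]) (use F(3)[OF homog_bar_span] in \<open>simp_all add: bar_cplx_def del: letters_iff\<close>)
qed

definition sp where "sp n X m = cut_sum X (%U V. qe n U V m)"

lemma tri_sp: "tri A N M fscal sp"
 unfolding tri_def sp_def
proof (intro conjI ballI)
 fix n m assume "n \<in> letters N" "m \<in> letters M"
 then show "mlin A fscal (%X. cut_sum X (%U V. qe n U V m))" by (intro mlin_cut_sum[OF vs] qe_lin)
next
 fix X m assume "X \<in> L" "m \<in> letters M"
 then show "lin1 N fscal (%n. cut_sum X (%U V. qe n U V m))" by (intro lin1_cut_sum[OF vs] qe_lin) auto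
next
 fix n X assume "n \<in> letters N" "X \<in> L"
 then show "lin1 M fscal (%m. cut_sum X (%U V. qe n U V m))" by (intro lin1_cut_sum[OF vs] qe_lin) auto
qed

lemma split_map:
 obtains F where "flin F"
  "!!n X m. n \<in> letters N ==> X \<in> L ==> m \<in> letters M ==> F (be n X m) = sp n X m"
  "!!u. u \<in> homog (bar_cplx A N M) ==> split u = F u"
proof -
 let ?Q = "%n xs m. \<Sum>i\<le>length xs. tns RB LB (tns N T n (word A (take i xs))) (tns T M (word A (drop i xs)) m)"
 have eq: "(be (label N n) (map (label A) xs) (label M m), sp (label N n) (map (label A) xs) (label M m))
   = (bar_elem A N M n (word A xs) m, ?Q n xs m)" for n xs m
  unfolding sp_def cut_sum_take_drop[symmetric]
  by (simp add: be_def te_def bar_elem_def word_label qe_def rt_def take_map drop_map)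
 obtain F where F: "flin F"
  "!!n X m. n \<in> letters N ==> X \<in> L ==> m \<in> letters M ==> F (be n X m) = sp n X m"
  "!!u. u \<in> module.span fscal ((%(n, X, m). be n X m) ` (letters N \<times> L \<times> letters M)) ==>
   lin_ext fscal fscal {(bar_elem A N M n (word A xs) m, ?Q n xs m) | n xs m. n \<in> homog N \<and> xs \<in> lists (homog A) \<and> m \<in> homog M} u = F u"
  by (rule lin_ext_tri[OF gA gN gM vs vs extends_be[OF vs tri_sp] tri_be tri_sp eq]) (rule that)
 show ?thesis
  by (rule that[OF F(1,2)]) (use F(3)[OF homog_bar_span] in \<open>simp_all add: bar_split_def del: letters_iff\<close>)
qed

lemma bar_proj_map:
 obtains F where "flin F"
  "!!n m. n \<in> letters N ==> m \<in> letters M ==> F (tns N M (snd n) (snd m)) = be n [] m"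
  "!!u. u \<in> homog (tensor_cplx N M) ==> bar_proj A N M u = F u"
proof -
 let ?G = "letters N \<times> letters M"
 let ?f = "%(n, m). (tns N M (snd n) (snd m), be n [] m)"
 let ?l = "%(n, m). (label N n, label M m)"
 let ?S = "{(tns N M n m, bar_elem A N M n (word A []) m) | n m. n \<in> homog N \<and> m \<in> homog M}"
 have b0: "be (label N (snd n)) [] (label M (snd m)) = be n [] m" for n m by (simp add: be_def te_def)
 have "?S = (%d. ?f (?l d)) ` (homog N \<times> homog M)"
  by (rule graph_image2[where f = ?f and l = ?l]) (simp add: be_def te_def bar_elem_def wd_def)
 also have "... = ?f ` ?G"
  by (rule image_relabel[where s = "%(n, m). (snd n, snd m)"])
   (simp_all add: case_prod_unfold mem_Times_iff label_in_letters[OF gN] label_in_letters[OF gM] homogI[OF snd_letters] b0 del: letters_iff)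
 finally have S: "?S = (%g. (case g of (n, m) => tns N M (snd n) (snd m), case g of (n, m) => be n [] m)) ` ?G" by (simp add: case_prod_unfold)
 have ext: "extends fscal fscal ?G (%(n, m). tns N M (snd n) (snd m)) (%(n, m). be n [] m)"
  by (rule extends_tensor_letters[OF gN gM vs]) (use tri_be in \<open>auto simp: tri_def simp del: letters_iff\<close>)
 obtain F where F: "flin F" "!!g. g \<in> ?G ==> F (case g of (n, m) => tns N M (snd n) (snd m)) = (case g of (n, m) => be n [] m)"
  "!!u. u \<in> module.span fscal ((%(n, m). tns N M (snd n) (snd m)) ` ?G) ==> lin_ext fscal fscal ?S u = F u"
  by (rule lin_ext_exists[OF ext S]) (rule that)
 show ?thesis
 proof (rule that[OF F(1)])
  show "F (tns N M (snd n) (snd m)) = be n [] m" if "n \<in> letters N" "m \<in> letters M" for n m using F(2)[of "(n, m)"] that by simp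
  show "bar_proj A N M u = F u" if "u \<in> homog (tensor_cplx N M)" for u
   using F(3)[OF gens_homog[OF gens_tensor[OF vN vM gens_letters[OF gN] gens_letters[OF gM]] _ that, simplified]] by (simp add: bar_proj_def)
 qed
qed

end

section \<open>The cotensor product\<close>

context two_sided
begin

lemma linear_tns_RD: "flin (%u. tns RB D u v)" "flin (tns RB D u)"
 using linear_tns_left[of RB D v] linear_tns_right[of RB D u] by simp_all

lemma linear_tns_TL: "flin (%u. tns T LB u v)" "flin (tns T LB u)"
 using linear_tns_left[of T LB v] linear_tns_right[of T LB u] by simp_all

lemma extends_RL:
 assumes t: "vector_space t"
  and 1: "!!Y m. Y \<in> L ==> m \<in> letters M ==> (\<forall>n\<in>letters N. mlin A t (%X. \<phi> n X Y m)) \<and> (\<forall>X\<in>L. lin1 N t (%n. \<phi> n X Y m))"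
  and 2: "!!n X. n \<in> letters N ==> X \<in> L ==> bilin t (\<phi> n X)"
 shows "extends fscal t ((letters N \<times> L) \<times> (L \<times> letters M)) (%((n, X), (Y, m)). qe n X Y m) (%((n, X), (Y, m)). \<phi> n X Y m)"
proof -
 have a: "extends (scal RB) t (letters N \<times> L) (%(n, X). rt n X) (%g. (%(n, X). %(Y, m). \<phi> n X Y m) g h)" if "h \<in> L \<times> letters M" for h
  using extends_rt[OF t, of "%n X. \<phi> n X (fst h) (snd h)"] 1[of "fst h" "snd h"] that by (simp add: case_prod_unfold mem_Times_iff del: letters_iff)
 have b: "extends (scal LB) t (L \<times> letters M) (%(Y, m). te Y m) ((%(n, X). %(Y, m). \<phi> n X Y m) g)" if "g \<in> letters N \<times> L" for g
  using extends_te[OF t 2[of "fst g" "snd g"]] that by (simp add: case_prod_unfold mem_Times_iff del: letters_iff)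
 from extends_tns[of RB LB, OF _ _ t a b] show ?thesis by (simp add: qe_def case_prod_unfold)
qed

text \<open>The retraction of the splitting: it kills all terms with a nonempty left word.\<close>

lemma kappa:
 obtains \<kappa> where "flin \<kappa>"
  "!!n X Y m. n \<in> letters N ==> X \<in> L ==> Y \<in> L ==> m \<in> letters M ==> \<kappa> (qe n X Y m) = (if X = [] then be n Y m else 0)"
proof -
 have "extends fscal fscal ((letters N \<times> L) \<times> (L \<times> letters M)) (%((n, X), (Y, m)). qe n X Y m)
   (%((n, X), (Y, m)). if X = [] then be n Y m else 0)"
 proof (rule extends_RL[OF vs])
  have p: "!!n m. n \<in> letters N ==> m \<in> letters M ==> mlin A fscal (%X. be n X m)"
   "!!X m. X \<in> L ==> m \<in> letters M ==> lin1 N fscal (%n. be n X m)" "!!n X. n \<in> letters N ==> X \<in> L ==> lin1 M fscal (be n X)"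
   using tri_be unfolding tri_def by blast+
  have z: "mlin A fscal (%X. if X = [] then c else 0)" for c :: "('n, 'a, 'm, 'k) bar" unfolding mlin_def by (simp add: lin1_0)
  show "(\<forall>n\<in>letters N. mlin A fscal (%X. if X = [] then be n Y m else 0)) \<and> (\<forall>X\<in>L. lin1 N fscal (%n. if X = [] then be n Y m else 0))"
   if "Y \<in> L" "m \<in> letters M" for Y m
  proof (intro conjI ballI z)
   show "lin1 N fscal (%n. if X = [] then be n Y m else 0)" for X using p(2)[OF that] by (cases X) (simp_all add: lin1_0)
  qed
  show "bilin fscal (%Y m. if X = [] then be n Y m else 0)" if "n \<in> letters N" "X \<in> L" for n X
  proof (cases X)
   case Nil
   then show ?thesis using p(1,3)[OF that(1)] by (simp add: bilin_def)
  next
   case (Cons x X')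
   then show ?thesis by (simp add: bilin_def mlin_def lin1_0)
  qed
 qed
 then obtain F where "flin F" and F: "\<forall>g\<in>(letters N \<times> L) \<times> (L \<times> letters M). F ((%((n, X), (Y, m)). qe n X Y m) g)
  = (%((n, X), (Y, m)). if X = [] then be n Y m else 0) g" unfolding extends_def by blast
 then show ?thesis
 proof (intro that[of F])
  fix n X Y m assume "n \<in> letters N" "X \<in> L" "Y \<in> L" "m \<in> letters M"
  then show "F (qe n X Y m) = (if X = [] then be n Y m else 0)"
   using bspec[OF F, of "((n, X), (Y, m))"] by (simp del: letters_iff)
 qed
qed

lemma right_coact_map:
 obtains \<rho> where "flin \<rho>"
  "!!n X Y m. n \<in> letters N ==> X \<in> L ==> Y \<in> L ==> m \<in> letters M ==> \<rho> (qe n X Y m) = cut_sum X (%U V. th n U V Y m)"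
  "!!u. u \<in> homog RL ==> right_coact A N M u = \<rho> u"
proof -
 let ?e = "%n X v. tns RB LB (rt n X) (snd v)"
 let ?\<phi> = "%n X v. cut_sum X (%U V. tns RB D (rt n U) (tns T LB (wd A V) (snd v)))"
 note l = linear_tns_RD and l' = linear_tns_TL
 have l2: "flin (%u. tns RB LB u v)" "flin (tns RB LB u)" for u v
  using linear_tns_left[of RB LB v] linear_tns_right[of RB LB u] by simp_all
 have lv: "lin1 LB fscal snd" using lin1_snd[of LB] by simp
 have e: "tri A N LB fscal ?e" unfolding tri_def
  using mlin_linear[OF bilin_rt(1) l2(1)] lin1_linear[OF bilin_rt(2) l2(1)] lin1_linear[OF lv l2(2)] by blast
 have \<phi>: "tri A N LB fscal ?\<phi>" unfolding tri_def
 proof (intro conjI ballI)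
  fix n v assume n: "n \<in> letters N"
  show "mlin A fscal (%X. ?\<phi> n X v)"
   by (rule mlin_cut_sum[OF vs], rule mlin_linear[OF mlin_linear[OF mlin_word l'(1)] l(2)], rule mlin_linear[OF bilin_rt(1)[OF n] l(1)])
 next
  fix X v assume "X \<in> L"
  then show "lin1 N fscal (%n. ?\<phi> n X v)" by (intro lin1_cut_sum[OF vs] lin1_linear[OF bilin_rt(2) l(1)]) auto
 next
  fix n X
  show "lin1 LB fscal (?\<phi> n X)" by (intro lin1_cut_sum[OF vs] lin1_linear[OF lin1_linear[OF lv l'(2)] l(2)])
 qed
 have ext: "extends fscal fscal (letters N \<times> L \<times> letters LB) (%(n, X, v). ?e n X v) (%(n, X, v). ?\<phi> n X v)"
 proof -
  have p: "!!n v. n \<in> letters N ==> v \<in> letters LB ==> mlin A fscal (%X. ?\<phi> n X v)"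
   "!!X v. X \<in> L ==> v \<in> letters LB ==> lin1 N fscal (%n. ?\<phi> n X v)" "!!n X. n \<in> letters N ==> X \<in> L ==> lin1 LB fscal (?\<phi> n X)"
   using \<phi> unfolding tri_def by blast+
  have a: "extends (scal RB) fscal (letters N \<times> L) (%(n, X). rt n X) (%g. ?\<phi> (fst g) (snd g) v)" if "v \<in> letters LB" for v
   using extends_rt[OF vs, of "%n X. ?\<phi> n X v"] p(1,2)[OF _ that] by (simp add: case_prod_unfold del: letters_iff)
  have b: "extends (scal LB) fscal (letters LB) snd (?\<phi> (fst g) (snd g))" if "g \<in> letters N \<times> L" for g
   using extends_letter[OF gLB vs p(3)] that by (simp add: mem_Times_iff del: letters_iff)
  from extends_tns[of RB LB, OF _ _ vs a b]
  have c: "extends fscal fscal ((letters N \<times> L) \<times> letters LB) (%(g, v). ?e (fst g) (snd g) v) (%(g, v). ?\<phi> (fst g) (snd g) v)"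
   by (simp add: case_prod_unfold)
  show ?thesis by (rule extends_reindex[OF c, where r = "%(n, X, v). ((n, X), v)"]) auto
 qed
 let ?E = "%n xs v. tns RB LB (tns N T n (word A xs)) v"
 let ?Q = "%n xs v. \<Sum>i\<le>length xs. tns RB D (tns N T n (word A (take i xs))) (tns T LB (word A (drop i xs)) v)"
 have eq: "(?e (label N n) (map (label A) xs) (label LB v), ?\<phi> (label N n) (map (label A) xs) (label LB v)) = (?E n xs v, ?Q n xs v)" for n xs v
  unfolding cut_sum_take_drop[symmetric] by (simp add: word_label rt_def take_map drop_map)
 obtain F where F: "flin F"
  "!!n X v. n \<in> letters N ==> X \<in> L ==> v \<in> letters LB ==> F (?e n X v) = ?\<phi> n X v"
  "!!u. u \<in> module.span fscal ((%(n, X, v). ?e n X v) ` (letters N \<times> L \<times> letters LB)) ==>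
   lin_ext fscal fscal {(?E n xs v, ?Q n xs v) | n xs v. n \<in> homog N \<and> xs \<in> lists (homog A) \<and> v \<in> homog LB} u = F u"
  by (rule lin_ext_tri[where e = ?e and \<phi> = ?\<phi> and E = ?E and Q = ?Q, OF gA gN gLB vs vs ext e \<phi> eq]) (rule that)
 have tl: "(bd Y + fst m, te Y m) \<in> letters LB" if "Y \<in> L" "m \<in> letters M" for Y m
  using te_gr[OF that] by (simp only: letters_iff)
 show ?thesis
 proof (rule that[OF F(1)])
  show "F (qe n X Y m) = cut_sum X (%U V. th n U V Y m)" if "n \<in> letters N" "X \<in> L" "Y \<in> L" "m \<in> letters M" for n X Y m
   using F(2)[OF that(1,2) tl[OF that(3,4)]] by (simp add: qe_def th_def)
  show "right_coact A N M u = F u" if u: "u \<in> homog RL" for u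
  proof -
   interpret fs: vector_space "fscal :: 'k => (('n, ('a, 'k) words, 'k) tensor, (('a, 'k) words, 'm, 'k) tensor, 'k) tensor => _" by simp
   have "u \<in> fs.span ((%((n, X), (Y, m)). qe n X Y m) ` ((letters N \<times> L) \<times> (L \<times> letters M)))"
    using gens_homog[OF gens_RL _ u] by simp
   moreover have "(%((n, X), (Y, m)). qe n X Y m) ` ((letters N \<times> L) \<times> (L \<times> letters M)) \<subseteq> (%(n, X, v). ?e n X v) ` (letters N \<times> L \<times> letters LB)"
   proof
    fix w assume "w \<in> (%((n, X), (Y, m)). qe n X Y m) ` ((letters N \<times> L) \<times> (L \<times> letters M))"
    then obtain n X Y m where w: "w = qe n X Y m" "n \<in> letters N" "X \<in> L" "Y \<in> L" "m \<in> letters M" by (elim imageE SigmaE) simp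
    show "w \<in> (%(n, X, v). ?e n X v) ` (letters N \<times> L \<times> letters LB)"
     using w tl[OF w(4,5)] by (intro image_eqI[of _ _ "(n, X, (bd Y + fst m, te Y m))"]) (simp_all add: qe_def del: letters_iff)
   qed
   ultimately have "u \<in> fs.span ((%(n, X, v). ?e n X v) ` (letters N \<times> L \<times> letters LB))" using fs.span_mono by blast
   from F(3)[OF this] show ?thesis unfolding right_coact_def Let_def .
  qed
 qed
qed

lemma left_coact_map:
 obtains \<mu> where "flin \<mu>"
  "!!n X Y m. n \<in> letters N ==> X \<in> L ==> Y \<in> L ==> m \<in> letters M ==> \<mu> (qe n X Y m) = cut_sum Y (%U V. th n X U V m)"
  "!!u. u \<in> homog RL ==> left_coact A N M u = \<mu> u"
proof -
 let ?e = "%r X m. tns RB LB (snd r) (te X m)"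
 let ?\<phi> = "%r X m. cut_sum X (%U V. tns RB D (snd r) (tns T LB (wd A U) (te V m)))"
 note l = linear_tns_RD and l' = linear_tns_TL
 have lv: "lin1 RB fscal snd" using lin1_snd[of RB] by simp
 have e: "tri A RB M fscal ?e" by (rule tri_tns_te[OF gRB]) simp
 have \<phi>: "tri A RB M fscal ?\<phi>" unfolding tri_def
 proof (intro conjI ballI)
  fix r m assume m: "m \<in> letters M"
  show "mlin A fscal (%X. ?\<phi> r X m)"
   by (rule mlin_cut_sum[OF vs], rule mlin_linear[OF mlin_linear[OF bilinD(1)[OF bilin_te m] l'(2)] l(2)],
     rule mlin_linear[OF mlin_linear[OF mlin_word l'(1)] l(2)])
 next
  fix X m
  show "lin1 RB fscal (%r. ?\<phi> r X m)" by (intro lin1_cut_sum[OF vs] lin1_linear[OF lv l(1)])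
 next
  fix r X assume "X \<in> L"
  then show "lin1 M fscal (?\<phi> r X)"
   by (intro lin1_cut_sum[OF vs] lin1_linear[OF lin1_linear[OF bilinD(2)[OF bilin_te] l'(2)] l(2)]) auto
 qed
 let ?E = "%u xs m. tns RB LB u (tns T M (word A xs) m)"
 let ?Q = "%u xs m. \<Sum>i\<le>length xs. tns RB D u (tns T LB (word A (take i xs)) (tns T M (word A (drop i xs)) m))"
 have eq: "(?e (label RB u) (map (label A) xs) (label M m), ?\<phi> (label RB u) (map (label A) xs) (label M m)) = (?E u xs m, ?Q u xs m)" for u xs m
  unfolding cut_sum_take_drop[symmetric] by (simp add: word_label te_def take_map drop_map)
 obtain F where F: "flin F"
  "!!r X m. r \<in> letters RB ==> X \<in> L ==> m \<in> letters M ==> F (?e r X m) = ?\<phi> r X m"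
  "!!u. u \<in> module.span fscal ((%(r, X, m). ?e r X m) ` (letters RB \<times> L \<times> letters M)) ==>
   lin_ext fscal fscal {(?E u xs m, ?Q u xs m) | u xs m. u \<in> homog RB \<and> xs \<in> lists (homog A) \<and> m \<in> homog M} u = F u"
  by (rule lin_ext_tri[where e = ?e and \<phi> = ?\<phi> and E = ?E and Q = ?Q, OF gA gRB gM vs vs extends_tns_te[OF gRB LB_simps(1) vs \<phi>] e \<phi> eq]) (rule that)
 have rl: "(fst n + bd X, rt n X) \<in> letters RB" if "n \<in> letters N" "X \<in> L" for n X
  using rt_gr[OF that] by (simp only: letters_iff)
 show ?thesis
 proof (rule that[OF F(1)])
  show "F (qe n X Y m) = cut_sum Y (%U V. th n X U V m)" if "n \<in> letters N" "X \<in> L" "Y \<in> L" "m \<in> letters M" for n X Y m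
   using F(2)[OF rl[OF that(1,2)] that(3,4)] by (simp add: qe_def th_def)
  show "left_coact A N M u = F u" if u: "u \<in> homog RL" for u
  proof -
   interpret fs: vector_space "fscal :: 'k => (('n, ('a, 'k) words, 'k) tensor, (('a, 'k) words, 'm, 'k) tensor, 'k) tensor => _" by simp
   have "u \<in> fs.span ((%((n, X), (Y, m)). qe n X Y m) ` ((letters N \<times> L) \<times> (L \<times> letters M)))"
    using gens_homog[OF gens_RL _ u] by simp
   moreover have "(%((n, X), (Y, m)). qe n X Y m) ` ((letters N \<times> L) \<times> (L \<times> letters M)) \<subseteq> (%(r, X, m). ?e r X m) ` (letters RB \<times> L \<times> letters M)"
   proof
    fix w assume "w \<in> (%((n, X), (Y, m)). qe n X Y m) ` ((letters N \<times> L) \<times> (L \<times> letters M))"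
    then obtain n X Y m where w: "w = qe n X Y m" "n \<in> letters N" "X \<in> L" "Y \<in> L" "m \<in> letters M" by (elim imageE SigmaE) simp
    show "w \<in> (%(r, X, m). ?e r X m) ` (letters RB \<times> L \<times> letters M)"
     using w rl[OF w(2,3)] by (intro image_eqI[of _ _ "((fst n + bd X, rt n X), Y, m)"]) (simp_all add: qe_def del: letters_iff)
   qed
   ultimately have "u \<in> fs.span ((%(r, X, m). ?e r X m) ` (letters RB \<times> L \<times> letters M))" using fs.span_mono by blast
   from F(3)[OF this] show ?thesis unfolding left_coact_def Let_def .
  qed
 qed
qed

text \<open>The retraction \<open>\<kappa>\<close> on \<open>R \<otimes> T(A[1])\<close>, tensored with \<open>L\<close>.\<close>

lemma theta:
 obtains \<Theta> where "flin \<Theta>"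
  "!!n X W Y m. n \<in> letters N ==> X \<in> L ==> W \<in> L ==> Y \<in> L ==> m \<in> letters M ==> \<Theta> (th n X W Y m) = (if X = [] then qe n W Y m else 0)"
proof -
 let ?H = "L \<times> (L \<times> letters M)"
 let ?\<phi> = "%n X W Y m. if X = [] then qe n W Y m else 0"
 have z: "mlin A fscal (%X. if X = [] then c else 0)" for c :: "(('n, ('a, 'k) words, 'k) tensor, (('a, 'k) words, 'm, 'k) tensor, 'k) tensor"
  unfolding mlin_def by (simp add: lin1_0)
 have z0: "mlin A fscal (%X. 0 :: (('n, ('a, 'k) words, 'k) tensor, (('a, 'k) words, 'm, 'k) tensor, 'k) tensor)"
  unfolding mlin_def by (simp add: lin1_0)
 have a: "extends (scal RB) fscal (letters N \<times> L) (%(n, X). rt n X) (%g. ?\<phi> (fst g) (snd g) (fst h) (fst (snd h)) (snd (snd h)))" if "h \<in> ?H" for h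
 proof -
  have "lin1 N fscal (%n. ?\<phi> n X (fst h) (fst (snd h)) (snd (snd h)))" for X
   using qe_lin(1)[of "fst h" "fst (snd h)" "snd (snd h)"] that by (cases X) (simp_all add: mem_Times_iff lin1_0)
  from extends_rt[where \<phi> = "%n X. ?\<phi> n X (fst h) (fst (snd h)) (snd (snd h))", OF vs z this]
  show ?thesis by (simp add: case_prod_unfold)
 qed
 have b: "extends (scal D) fscal ?H (%(W, g). tns T LB (wd A W) ((%(Y, m). te Y m) g)) (%h. ?\<phi> (fst g) (snd g) (fst h) (fst (snd h)) (snd (snd h)))"
  if g: "g \<in> letters N \<times> L" for g
 proof -
  have c: "extends (scal T) fscal L (wd A) (%W. ?\<phi> (fst g) (snd g) W (fst k) (snd k))" if "k \<in> L \<times> letters M" for k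
  proof -
   have "mlin A fscal (%W. ?\<phi> (fst g) (snd g) W (fst k) (snd k))"
    using qe_lin(2)[of "fst g"] z0 g by (cases "snd g") (simp_all add: mem_Times_iff)
   from extends_word[OF gA vs this] show ?thesis by simp
  qed
  have d: "extends (scal LB) fscal (L \<times> letters M) (%(Y, m). te Y m) (%k. ?\<phi> (fst g) (snd g) W (fst k) (snd k))" if "W \<in> L" for W
  proof -
   have "bilin fscal (%Y m. ?\<phi> (fst g) (snd g) W Y m)"
    unfolding bilin_def using qe_lin(3,4) z0 by (cases "snd g") (simp_all add: lin1_0)
   from extends_te[OF vs this] show ?thesis by (simp add: case_prod_unfold)
  qed
  from extends_tns[of T LB, OF _ _ vs c d] show ?thesis by (simp add: case_prod_unfold)
 qed
 from extends_tns[of RB D, OF _ _ vs a b]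
 have "extends fscal fscal ((letters N \<times> L) \<times> ?H) (%(g, h). th (fst g) (snd g) (fst h) (fst (snd h)) (snd (snd h)))
  (%(g, h). ?\<phi> (fst g) (snd g) (fst h) (fst (snd h)) (snd (snd h)))" by (simp add: th_def case_prod_unfold)
 then obtain F where F: "flin F"
  "!!g h. g \<in> letters N \<times> L ==> h \<in> ?H ==> F (th (fst g) (snd g) (fst h) (fst (snd h)) (snd (snd h))) = ?\<phi> (fst g) (snd g) (fst h) (fst (snd h)) (snd (snd h))"
  unfolding extends_def by fastforce
 show ?thesis
 proof (rule that[OF F(1)])
  fix n X W Y m assume "n \<in> letters N" "X \<in> L" "W \<in> L" "Y \<in> L" "m \<in> letters M"
  then show "F (th n X W Y m) = ?\<phi> n X W Y m" using F(2)[of "(n, X)" "(W, Y, m)"] by simp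
 qed
qed

lemma sp_gr: "n \<in> letters N ==> X \<in> L ==> m \<in> letters M ==> sp n X m \<in> gr RL (fst n + (bd X + fst m))"
 unfolding sp_def
proof (rule graded_cut_sum)
 show "graded RL" by (rule graded_tensor[OF gRB gLB])
 fix U V assume nm: "n \<in> letters N" "m \<in> letters M" and X: "X \<in> L" "X = U @ V"
 then have UV: "U \<in> L" "V \<in> L" by auto
 show "qe n U V m \<in> gr RL (fst n + (bd X + fst m))"
  using tns_gr[OF gRB gLB rt_gr[OF nm(1) UV(1)] te_gr[OF UV(2) nm(2)]] X(2) by (simp add: qe_def add.assoc)
qed

lemma split_gr: "u \<in> gr (bar_cplx A N M) i ==> split u \<in> gr RL i"
proof -
 assume u: "u \<in> gr (bar_cplx A N M) i"
 obtain F where F: "flin F" "!!n X m. n \<in> letters N ==> X \<in> L ==> m \<in> letters M ==> F (be n X m) = sp n X m"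
  "!!u. u \<in> homog (bar_cplx A N M) ==> split u = F u" by (rule split_map) (rule that)
 have "F u \<in> gr RL i"
 proof (rule gens_maps[OF gens_bar _ graded_tensor[OF gRB gLB] _ u])
  show "lin (scal (bar_cplx A N M)) (scal RL) F" using F(1) by simp
  fix g assume g: "g \<in> letters N \<times> L \<times> letters M" "(case g of (n, X, m) => fst n + (bd X + fst m)) = i"
  obtain n X m where nX: "g = (n, X, m)" by (cases g)
  show "F (case g of (n, X, m) => be n X m) \<in> gr RL i"
   using g F(2)[of n X m] sp_gr[of n X m] unfolding nX by (simp del: letters_iff)
 qed
 then show ?thesis using F(3)[OF homogI[OF u]] by simp
qed

text \<open>A cotensor \<open>u\<close> is recovered from both coactions by the retraction that kills the terms with \<open>A\<close>-entries on the left.\<close>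

lemma split_cotensor:
 obtains \<kappa> where "flin \<kappa>"
  "!!u. u \<in> homog (bar_cplx A N M) ==> \<kappa> (split u) = u"
  "!!u. u \<in> homog (bar_cplx A N M) ==> right_coact A N M (split u) = left_coact A N M (split u)"
  "!!u i. u \<in> gr RL i ==> right_coact A N M u = left_coact A N M u ==> \<kappa> u \<in> gr (bar_cplx A N M) i \<and> split (\<kappa> u) = u"
proof -
 obtain \<kappa> where k: "flin \<kappa>"
  "!!n X Y m. n \<in> letters N ==> X \<in> L ==> Y \<in> L ==> m \<in> letters M ==> \<kappa> (qe n X Y m) = (if X = [] then be n Y m else 0)"
  by (rule kappa) (rule that)
 obtain F where F: "flin F" "!!n X m. n \<in> letters N ==> X \<in> L ==> m \<in> letters M ==> F (be n X m) = sp n X m"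
  "!!u. u \<in> homog (bar_cplx A N M) ==> split u = F u" by (rule split_map) (rule that)
 obtain \<rho> where r: "flin \<rho>"
  "!!n X Y m. n \<in> letters N ==> X \<in> L ==> Y \<in> L ==> m \<in> letters M ==> \<rho> (qe n X Y m) = cut_sum X (%U V. th n U V Y m)"
  "!!u. u \<in> homog RL ==> right_coact A N M u = \<rho> u" by (rule right_coact_map) (rule that)
 obtain \<mu> where l: "flin \<mu>"
  "!!n X Y m. n \<in> letters N ==> X \<in> L ==> Y \<in> L ==> m \<in> letters M ==> \<mu> (qe n X Y m) = cut_sum Y (%U V. th n X U V m)"
  "!!u. u \<in> homog RL ==> left_coact A N M u = \<mu> u" by (rule left_coact_map) (rule that)
 obtain \<Theta> where t: "flin \<Theta>"
  "!!n X W Y m. n \<in> letters N ==> X \<in> L ==> W \<in> L ==> Y \<in> L ==> m \<in> letters M ==> \<Theta> (th n X W Y m) = (if X = [] then qe n W Y m else 0)"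
  by (rule theta) (rule that)
 have idl: "flin (%x :: ('n, 'a, 'm, 'k) bar. x)"
  "flin (%x :: (('n, ('a, 'k) words, 'k) tensor, (('a, 'k) words, 'm, 'k) tensor, 'k) tensor. x)"
  by (simp_all add: Vector_Spaces.linear_iff)
 note agree = gens_agree[OF gens_bar, unfolded bar_cplx_simps] and agree' = gens_agree[OF gens_RL, unfolded scal_tensor_cplx]
 have split_cuts: "U \<in> L \<and> V \<in> L" if "X = U @ V" "X \<in> L" for X U V using that by auto
 have kF: "\<kappa> (F (be n X m)) = be n X m" if "n \<in> letters N" "X \<in> L" "m \<in> letters M" for n X m
 proof -
  have "\<kappa> (F (be n X m)) = cut_sum X (%U V. \<kappa> (qe n U V m))" unfolding F(2)[OF that] sp_def by (rule cut_sum_linear[OF k(1)])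
  also have "... = cut_sum X (%U V. if U = [] then be n V m else 0)"
   by (rule cut_sum_cong) (use k(2)[OF that(1) _ _ that(3)] split_cuts that(2) in blast)
  also have "... = be n X m" by (subst cut_sum_first) auto
  finally show ?thesis .
 qed
 have rF: "\<rho> (F (be n X m)) = \<mu> (F (be n X m))" if "n \<in> letters N" "X \<in> L" "m \<in> letters M" for n X m
 proof -
  have "\<rho> (F (be n X m)) = cut_sum X (%U V. \<rho> (qe n U V m))" unfolding F(2)[OF that] sp_def by (rule cut_sum_linear[OF r(1)])
  also have "... = cut_sum X (%U V. cut_sum U (%a b. th n a b V m))"
   by (rule cut_sum_cong) (use r(2)[OF that(1) _ _ that(3)] split_cuts that(2) in blast)
  also have "... = cut_sum X (%a V. cut_sum V (%b c. th n a b c m))" by (rule cut_sum_coassoc)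
  also have "... = cut_sum X (%U V. \<mu> (qe n U V m))"
   by (rule cut_sum_cong, rule sym) (use l(2)[OF that(1) _ _ that(3)] split_cuts that(2) in blast)
  also have "... = \<mu> (F (be n X m))" unfolding F(2)[OF that] sp_def by (rule cut_sum_linear[OF l(1), symmetric])
  finally show ?thesis .
 qed
 have tr: "\<Theta> (\<rho> (qe n X Y m)) = qe n X Y m" if "n \<in> letters N" "X \<in> L" "Y \<in> L" "m \<in> letters M" for n X Y m
 proof -
  have "\<Theta> (\<rho> (qe n X Y m)) = cut_sum X (%U V. \<Theta> (th n U V Y m))" unfolding r(2)[OF that] by (rule cut_sum_linear[OF t(1)])
  also have "... = cut_sum X (%U V. if U = [] then qe n V Y m else 0)"
   by (rule cut_sum_cong) (use t(2)[OF that(1) _ _ that(3,4)] split_cuts that(2) in blast)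
  also have "... = qe n X Y m" by (subst cut_sum_first) auto
  finally show ?thesis .
 qed
 have tl: "\<Theta> (\<mu> (qe n X Y m)) = F (\<kappa> (qe n X Y m))" if "n \<in> letters N" "X \<in> L" "Y \<in> L" "m \<in> letters M" for n X Y m
 proof -
  have "\<Theta> (\<mu> (qe n X Y m)) = cut_sum Y (%U V. \<Theta> (th n X U V m))" unfolding l(2)[OF that] by (rule cut_sum_linear[OF t(1)])
  also have "... = cut_sum Y (%U V. if X = [] then qe n U V m else 0)"
   by (rule cut_sum_cong) (use t(2)[OF that(1,2) _ _ that(4)] split_cuts that(3) in blast)
  also have "... = F (\<kappa> (qe n X Y m))" using F(2)[OF that(1,3,4)] by (simp add: k(2)[OF that] linear_0[OF F(1)] cut_sum_zero sp_def)
  finally show ?thesis .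
 qed
 show ?thesis
 proof (rule that[OF k(1)])
  fix u assume uh: "u \<in> homog (bar_cplx A N M)"
  then obtain i where u: "u \<in> gr (bar_cplx A N M) i" unfolding homog_def by blast
  have "\<kappa> (F u) = u" by (rule agree[OF linear_compose[OF F(1) k(1)] idl(1) _ u]) (elim SigmaE, simp add: kF del: letters_iff)
  then show "\<kappa> (split u) = u" using F(3)[OF uh] by simp
  have "\<rho> (F u) = \<mu> (F u)" by (rule agree[OF linear_compose[OF F(1) r(1)] linear_compose[OF F(1) l(1)] _ u]) (elim SigmaE, simp add: rF del: letters_iff)
  moreover have "F u \<in> homog RL" using split_gr[OF u] F(3)[OF uh] homogI by metis
  ultimately show "right_coact A N M (split u) = left_coact A N M (split u)" using F(3)[OF uh] r(3) l(3) by simp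
 next
  fix u i assume u: "u \<in> gr RL i" and eq: "right_coact A N M u = left_coact A N M u"
  have "\<Theta> (\<rho> u) = u" by (rule agree'[OF linear_compose[OF r(1) t(1)] idl(2) _ u]) (elim SigmaE, simp add: tr del: letters_iff)
  moreover have "\<Theta> (\<mu> u) = F (\<kappa> u)" by (rule agree'[OF linear_compose[OF l(1) t(1)] linear_compose[OF k(1) F(1)] _ u]) (elim SigmaE, simp add: tl del: letters_iff)
  moreover have "\<rho> u = \<mu> u" using eq r(3)[OF homogI[OF u]] l(3)[OF homogI[OF u]] by simp
  ultimately have "F (\<kappa> u) = u" by simp
  moreover have ku: "\<kappa> u \<in> gr (bar_cplx A N M) i"
  proof (rule gens_maps[OF gens_RL _ graded_bar_cplx _ u])
   show "lin (scal RL) (scal (bar_cplx A N M)) \<kappa>" using k(1) by simp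
   fix g assume g: "g \<in> (letters N \<times> L) \<times> (L \<times> letters M)" "(%((n, X), (Y, m)). fst n + bd X + (bd Y + fst m)) g = i"
   obtain n X Y m where nX: "g = ((n, X), (Y, m))" by (cases g) auto
   then have g': "n \<in> letters N" "X \<in> L" "Y \<in> L" "m \<in> letters M" "fst n + bd X + (bd Y + fst m) = i" using g by simp_all
   have "X = [] ==> be n Y m \<in> gr (bar_cplx A N M) i" using be_gr[OF g'(1,3,4)] g'(5) by simp
   then show "\<kappa> ((%((n, X), (Y, m)). qe n X Y m) g) \<in> gr (bar_cplx A N M) i"
    unfolding nX using k(2)[OF g'(1-4)] graded_zero[OF graded_bar_cplx] by simp
  qed
  ultimately show "\<kappa> u \<in> gr (bar_cplx A N M) i \<and> split (\<kappa> u) = u" using F(3)[OF homogI[OF ku]] by simp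
 qed
qed

end

section \<open>The product on the two-sided bar complex\<close>

lemma (in right_module) dga_RB: "dga RB"
 by (rule RB_structure)

lemma (in right_module) unt_RB: "unt RB = rt (0, unt N) []"
 by (rule RB_structure)

lemma (in right_module) rt_homog: "n \<in> letters N ==> X \<in> L ==> rt n X \<in> homog RB"
 by (rule homogI[OF rt_gr])

lemma (in right_module) diff_RB: "n \<in> letters N ==> X \<in> L ==> diff RB (rt n X) = rbar_diff n X rt"
proof (rule RB_structure)
 fix d assume n: "n \<in> letters N" and X: "X \<in> L"
  and 1: "!!n Y. n \<in> letters N ==> Y \<in> L ==> d (rt n Y) = rbar_diff n Y rt" and 2: "!!u. u \<in> homog RB ==> diff RB u = d u"
 show "diff RB (rt n X) = rbar_diff n X rt" using 2[OF rt_homog[OF n X]] 1[OF n X] by simp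
qed

lemma (in right_module) mul_RB:
 "n \<in> letters N ==> X \<in> L ==> n' \<in> letters N ==> Y \<in> L ==> mul RB (rt n X) (rt n' Y) = rbar_mul n X n' Y rt"
proof (rule RB_structure)
 fix p assume n: "n \<in> letters N" and X: "X \<in> L" and n': "n' \<in> letters N" and Y: "Y \<in> L"
  and 1: "!!n X n' Y. n \<in> letters N ==> X \<in> L ==> n' \<in> letters N ==> Y \<in> L ==> p (rt n X) (rt n' Y) = rbar_mul n X n' Y rt"
  and 2: "!!u v. u \<in> homog RB ==> v \<in> homog RB ==> mul RB u v = p u v"
 show "mul RB (rt n X) (rt n' Y) = rbar_mul n X n' Y rt"
  using 2[OF rt_homog[OF n X] rt_homog[OF n' Y]] 1[OF n X n' Y] by simp
qed

lemma (in right_module) rbar_diff_linear: "lin s t F ==> F (rbar_diff n Y \<phi>) = rbar_diff n Y (%a W. F (\<phi> a W))"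
 unfolding rbar_diff_def
 by (auto simp: linear_plus linear_sg linear_0 diff_sum_linear split: list.split simp del: diff_sum_simps)

lemma (in right_module) rbar_mul_linear: "lin s t F ==> F (rbar_mul n X n' Y \<phi>) = rbar_mul n X n' Y (%a W. F (\<phi> a W))"
 unfolding rbar_mul_def by (simp add: cut_sum_linear linear_sg weave_sum_linear)

context two_sided
begin

abbreviation "TD \<equiv> tensor_dga RB LB"
abbreviation "BC \<equiv> bar_cplx A N M"
abbreviation "BT \<equiv> bar_tensor A N M"

lemma te_homog: "X \<in> L ==> m \<in> letters M ==> te X m \<in> homog LB"
 by (rule homogI[OF te_gr])

lemma diff_LB: "X \<in> L ==> m \<in> letters M ==> diff LB (te X m) = lbar_diff X m te"
proof (rule LB_diff)
 fix d assume X: "X \<in> L" and m: "m \<in> letters M"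
  and 1: "!!X m. X \<in> L ==> m \<in> letters M ==> d (te X m) = lbar_diff X m te" and 2: "!!u. u \<in> homog LB ==> diff LB u = d u"
 show "diff LB (te X m) = lbar_diff X m te" using 2[OF te_homog[OF X m]] 1[OF X m] by simp
qed

lemma mul_LB: "X \<in> L ==> m \<in> letters M ==> Y \<in> L ==> m' \<in> letters M ==> mul LB (te X m) (te Y m') = lbar_mul X m Y m' te"
proof (rule LB_mul)
 fix p assume X: "X \<in> L" and m: "m \<in> letters M" and Y: "Y \<in> L" and m': "m' \<in> letters M"
  and 1: "!!X m Y m'. X \<in> L ==> m \<in> letters M ==> Y \<in> L ==> m' \<in> letters M ==> p (te X m) (te Y m') = lbar_mul X m Y m' te"
  and 2: "!!u v. u \<in> homog LB ==> v \<in> homog LB ==> mul LB u v = p u v"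
 show "mul LB (te X m) (te Y m') = lbar_mul X m Y m' te"
  using 2[OF te_homog[OF X m] te_homog[OF Y m']] 1[OF X m Y m'] by simp
qed

lemma tail_term_cut: "tail_term V m (%w. cut_sum U (h w)) = cut_sum U (%a b. tail_term V m (%w. h w a b))"
 unfolding tail_term_def by (auto simp: cut_sum_zero split: list.split)

lemma lbar_diff_cut_sum:
 "lbar_diff X m (%W w. cut_sum W (%U V. \<psi> U V w))
  = cut_sum X (%U V. diff_sum A U (%U'. \<psi> U' V m) + sg (bd U) (lbar_diff V m (\<psi> U)))"
proof -
 have "cut_sum X (%U V. sg (bd U) (tail_term V m (%w. cut_sum U (%a b. \<psi> a b w))))
  = cut_sum X (%U V. cut_sum U (%a b. sg (bd a + bd b) (tail_term V m (\<psi> a b))))"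
  unfolding tail_term_cut cut_sum_sg[symmetric] by (intro cut_sum_cong) simp
 also have "... = cut_sum X (%U V. sg (bd U) (cut_sum V (%a b. sg (bd a) (tail_term b m (\<psi> U a)))))"
  unfolding cut_sum_coassoc cut_sum_sg[symmetric] by simp
 finally show ?thesis unfolding lbar_diff_cut diff_sum_cut_sum by (simp add: cut_sum_add add.assoc)
qed

text \<open>Cutting is a chain map.\<close>

lemma bdiff_cut:
 "bdiff n X m (%n X m. cut_sum X (%U V. \<Phi> n U V m))
  = cut_sum X (%U V. rbar_diff n U (%n' U'. \<Phi> n' U' V m) + sg (fst n + bd U) (lbar_diff V m (\<Phi> n U)))"
proof -
 have "cut_sum X (%U V. case U of [] => 0 | y # U' => sg (fst n + 1) (\<Phi> (nact n y) U' V m))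
  = (case X of [] => 0 | x # X' => sg (fst n + 1) (cut_sum X' (%U V. \<Phi> (nact n x) U V m)))"
  by (cases X) (simp_all add: cut_sum_sg)
 then show ?thesis unfolding bdiff_def lbar_diff_cut_sum rbar_diff_def nact_def[symmetric]
  by (simp add: cut_sum_add cut_sum_sg[symmetric] add_ac)
qed

text \<open>
 The product of two-sided words. A first part of \<open>Y\<close> goes into the reversed brace of \<open>n\<close>, a last
 part into the brace of \<open>m\<close>, and the rest is multiplied with \<open>X\<close>.
\<close>

definition bprod where
 "bprod n X m n' Y m' \<phi> = cut_sum Y (%P R. cut_sum R (%Y' Z.
   sg (bd X * (fst n' + bd P) + fst m * (fst n' + bd P + bd Y') + rexp P + fst n' * bd P)
    (ws X Y' (%W. \<phi> (lmul N' (lbr (mbr N) n (rev P)) n') W (lmul M (bM m Z) m')))))"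

text \<open>Both sides cut \<open>X\<close> into two parts and \<open>Y\<close> into four; coassociativity relates the two ways of doing so.\<close>

lemma cut_product:
 "cut_sum X (%X1 X2. cut_sum Y (%Y1 Y2. sg ((bd X2 + fst m) * (fst n' + bd Y1))
   (rbar_mul n X1 n' Y1 (%a W1. lbar_mul X2 m Y2 m' (%W2 b. \<Phi> a W1 W2 b)))))
  = bprod n X m n' Y m' (%a W b. cut_sum W (%W1 W2. \<Phi> a W1 W2 b))"
proof -
 let ?a = "%P. lmul N' (lbr (mbr N) n (rev P)) n'" and ?b = "%Z. lmul M (bM m Z) m'"
 let ?k = "%X1 X2 P Q S Z. sg ((bd X1 + bd X2) * (fst n' + bd P) + fst m * (fst n' + bd P + (bd Q + bd S)) + rexp P + fst n' * bd P + bd X2 * bd Q)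
   (ws X1 Q (%W1. ws X2 S (%W2. \<Phi> (?a P) W1 W2 (?b Z))))"
 have "cut_sum Y (%Y1 Y2. sg ((bd X2 + fst m) * (fst n' + bd Y1))
   (rbar_mul n X1 n' Y1 (%a W1. lbar_mul X2 m Y2 m' (%W2 b. \<Phi> a W1 W2 b))))
  = cut_sum Y (%P R. cut_sum R (%Y' Z. cut_sum Y' (%Q S. ?k X1 X2 P Q S Z)))" if "X = X1 @ X2" for X1 X2
 proof -
  have "cut_sum Y (%Y1 Y2. sg ((bd X2 + fst m) * (fst n' + bd Y1))
   (rbar_mul n X1 n' Y1 (%a W1. lbar_mul X2 m Y2 m' (%W2 b. \<Phi> a W1 W2 b))))
   = cut_sum Y (%Y1 Y2. cut_sum Y1 (%P Q. cut_sum Y2 (%S Z. ?k X1 X2 P Q S Z)))"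
  proof (rule cut_sum_cong)
   fix Y1 Y2 assume "Y = Y1 @ Y2"
   show "sg ((bd X2 + fst m) * (fst n' + bd Y1)) (rbar_mul n X1 n' Y1 (%a W1. lbar_mul X2 m Y2 m' (%W2 b. \<Phi> a W1 W2 b)))
    = cut_sum Y1 (%P Q. cut_sum Y2 (%S Z. ?k X1 X2 P Q S Z))"
    unfolding rbar_mul_def lbar_mul_def weave_sum_cut_sum weave_sum_sg cut_sum_sg[symmetric] sg_simps(3)
    by (intro cut_sum_cong sg_cong) (auto simp: parity)
  qed
  also have "... = cut_sum Y (%P R. cut_sum R (%Q Y2. cut_sum Y2 (%S Z. ?k X1 X2 P Q S Z)))" by (rule cut_sum_coassoc)
  also have "... = cut_sum Y (%P R. cut_sum R (%Y' Z. cut_sum Y' (%Q S. ?k X1 X2 P Q S Z)))"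
   by (intro cut_sum_cong cut_sum_coassoc[symmetric])
  finally show ?thesis .
 qed
 then have "cut_sum X (%X1 X2. cut_sum Y (%Y1 Y2. sg ((bd X2 + fst m) * (fst n' + bd Y1))
   (rbar_mul n X1 n' Y1 (%a W1. lbar_mul X2 m Y2 m' (%W2 b. \<Phi> a W1 W2 b)))))
  = cut_sum X (%X1 X2. cut_sum Y (%P R. cut_sum R (%Y' Z. cut_sum Y' (%Q S. ?k X1 X2 P Q S Z))))"
  by (rule cut_sum_cong)
 also have "... = cut_sum Y (%P R. cut_sum R (%Y' Z. cut_sum X (%X1 X2. cut_sum Y' (%Q S. ?k X1 X2 P Q S Z))))"
  by (subst cut_sum_swap, rule cut_sum_cong, subst cut_sum_swap, rule refl)
 also have "... = bprod n X m n' Y m' (%a W b. cut_sum W (%W1 W2. \<Phi> a W1 W2 b))"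
  unfolding bprod_def weave_sum_cut cut_sum_sg[symmetric] sg_simps(3)
  by (intro cut_sum_cong sg_cong) (auto simp: parity)
 finally show ?thesis .
qed

lemma bprod_linear: "lin s t F ==> F (bprod n X m n' Y m' \<phi>) = bprod n X m n' Y m' (%a W b. F (\<phi> a W b))"
 unfolding bprod_def by (simp add: cut_sum_linear linear_sg weave_sum_linear)

lemma bprod_mem:
 assumes V: "graded V" and n: "n \<in> letters N" "n' \<in> letters N" and X: "X \<in> L" "Y \<in> L" and m: "m \<in> letters M" "m' \<in> letters M"
  and \<phi>: "!!a W b. a \<in> letters N ==> W \<in> L ==> b \<in> letters M ==>
   fst a + (bd W + fst b) = fst n + (bd X + fst m) + (fst n' + (bd Y + fst m')) ==> \<phi> a W b \<in> gr V i"
 shows "bprod n X m n' Y m' \<phi> \<in> gr V i"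
 unfolding bprod_def weave_sum_def
proof (intro graded_cut_sum[OF V] graded_sg[OF V] graded_ssum[OF V])
 fix P R Y' Z k W assume Y: "Y = P @ R" "R = Y' @ Z" and W: "(k, W) \<in> set (weaves (brc A) X Y')"
 have l: "P \<in> L" "Y' \<in> L" "Z \<in> L" using Y X(2) by auto
 have w: "W \<in> L" "bd W = bd X + bd Y'" using weaves_mem[OF W X(1) l(2)] by auto
 have a: "lmul N' (lbr (mbr N) n (rev P)) n' \<in> letters N"
  using B.T.lmulM_letters[OF B.T.bm_letters, of n "rev P" n'] n rev_mem[OF l(1)] by simp
 have b: "lmul M (bM m Z) m' \<in> letters M" by (intro T.lmulM_letters T.bm_letters m l)
 show "\<phi> (lmul N' (lbr (mbr N) n (rev P)) n') W (lmul M (bM m Z) m') \<in> gr V i"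
  by (rule \<phi>[OF a w(1) b]) (simp add: w(2) Y)
qed

lemma dga_TD: "dga TD"
 by (rule dga_tensor[OF dga_RB dga_LB])

lemma rl_letters: "n \<in> letters N ==> X \<in> L ==> (fst n + bd X, rt n X) \<in> letters RB"
 "X \<in> L ==> m \<in> letters M ==> (bd X + fst m, te X m) \<in> letters LB"
 using rt_gr te_gr by (simp_all only: letters_iff)

lemma l2: "flin (%u. tns RB LB u v)" "flin (tns RB LB u)"
 using linear_tns_left[of RB LB v] linear_tns_right[of RB LB u] by simp_all

lemma TD_diff_sp:
 assumes F: "flin F"
  "!!v w. v \<in> letters RB ==> w \<in> letters LB ==>
   F (tns RB LB (snd v) (snd w)) = tns RB LB (diff RB (snd v)) (snd w) + sg (fst v) (tns RB LB (snd v) (diff LB (snd w)))"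
  and n: "n \<in> letters N" and X: "X \<in> L" and m: "m \<in> letters M"
 shows "F (sp n X m) = bdiff n X m sp"
proof -
 have "F (sp n X m) = cut_sum X (%U V. F (qe n U V m))" unfolding sp_def by (rule cut_sum_linear[OF F(1)])
 also have "... = cut_sum X (%U V. rbar_diff n U (%n' U'. qe n' U' V m) + sg (fst n + bd U) (lbar_diff V m (qe n U)))"
 proof (rule cut_sum_cong)
  fix U V assume "X = U @ V"
  then have l: "U \<in> L" "V \<in> L" using X by auto
  show "F (qe n U V m) = rbar_diff n U (%n' U'. qe n' U' V m) + sg (fst n + bd U) (lbar_diff V m (qe n U))"
   using F(2)[OF rl_letters(1)[OF n l(1)] rl_letters(2)[OF l(2) m]] diff_RB[OF n l(1)] diff_LB[OF l(2) m]
    rbar_diff_linear[OF l2(1)[where v = "te V m"]] lbar_diff_linear[OF l2(2)[where u = "rt n U"]]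
   by (simp add: qe_def[abs_def])
 qed
 also have "... = bdiff n X m sp" unfolding bdiff_cut[symmetric] sp_def[abs_def] ..
 finally show ?thesis .
qed

lemma TD_mul_sp:
 assumes m1: "!!v. flin (p v)" and m2: "!!w. flin (%v. p v w)"
  and p: "!!a b a' b'. a \<in> letters RB ==> b \<in> letters LB ==> a' \<in> letters RB ==> b' \<in> letters LB ==>
   p (tns RB LB (snd a) (snd b)) (tns RB LB (snd a') (snd b'))
   = sg (fst b * fst a') (tns RB LB (mul RB (snd a) (snd a')) (mul LB (snd b) (snd b')))"
  and n: "n \<in> letters N" "n' \<in> letters N" and X: "X \<in> L" "Y \<in> L" and m: "m \<in> letters M" "m' \<in> letters M"
 shows "p (sp n X m) (sp n' Y m') = bprod n X m n' Y m' sp"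
proof -
 have "p (sp n X m) (sp n' Y m') = cut_sum X (%X1 X2. cut_sum Y (%Y1 Y2. p (qe n X1 X2 m) (qe n' Y1 Y2 m')))"
  unfolding sp_def by (simp only: cut_sum_linear[OF m2] cut_sum_linear[OF m1]) (rule cut_sum_swap)
 also have "... = cut_sum X (%X1 X2. cut_sum Y (%Y1 Y2. sg ((bd X2 + fst m) * (fst n' + bd Y1))
   (rbar_mul n X1 n' Y1 (%a W1. lbar_mul X2 m Y2 m' (%W2 b. qe a W1 W2 b)))))"
 proof (intro cut_sum_cong)
  fix X1 X2 Y1 Y2 assume XY: "X = X1 @ X2" "Y = Y1 @ Y2"
  then have l: "X1 \<in> L" "X2 \<in> L" "Y1 \<in> L" "Y2 \<in> L" using X by auto
  have "tns RB LB (rbar_mul n X1 n' Y1 rt) (lbar_mul X2 m Y2 m' te)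
   = rbar_mul n X1 n' Y1 (%a W1. lbar_mul X2 m Y2 m' (%W2 b. qe a W1 W2 b))"
  proof -
   have "tns RB LB (rbar_mul n X1 n' Y1 rt) (lbar_mul X2 m Y2 m' te)
    = rbar_mul n X1 n' Y1 (%a W1. tns RB LB (rt a W1) (lbar_mul X2 m Y2 m' te))" by (rule rbar_mul_linear[OF l2(1)])
   then show ?thesis unfolding lbar_mul_linear[OF l2(2)] qe_def .
  qed
  then show "p (qe n X1 X2 m) (qe n' Y1 Y2 m') = sg ((bd X2 + fst m) * (fst n' + bd Y1))
   (rbar_mul n X1 n' Y1 (%a W1. lbar_mul X2 m Y2 m' (%W2 b. qe a W1 W2 b)))"
   using p[OF rl_letters(1)[OF n(1) l(1)] rl_letters(2)[OF l(2) m(1)] rl_letters(1)[OF n(2) l(3)] rl_letters(2)[OF l(4) m(2)]]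
    mul_RB[OF n(1) l(1) n(2) l(3)] mul_LB[OF l(2) m(1) l(4) m(2)] by (simp add: qe_def)
 qed
 also have "... = bprod n X m n' Y m' sp" unfolding cut_product sp_def[abs_def] ..
 finally show ?thesis .
qed

lemma bdiff_linear: "lin s t F ==> F (bdiff n X m \<phi>) = bdiff n X m (%n X m. F (\<phi> n X m))"
 unfolding bdiff_def by (cases X) (simp_all add: linear_plus linear_sg linear_0 lbar_diff_linear)

lemma bdiff_mem:
 assumes V: "graded V" and n: "n \<in> letters N" and X: "X \<in> L" and m: "m \<in> letters M"
  and \<phi>: "!!a W b. a \<in> letters N ==> W \<in> L ==> b \<in> letters M ==> fst a + (bd W + fst b) = fst n + (bd X + fst m) + 1 ==> \<phi> a W b \<in> gr V i"
 shows "bdiff n X m \<phi> \<in> gr V i"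
proof -
 have dn: "ldiff N n \<in> letters N" using B.T.ldiffM_letters[of n] n by (simp add: ldiff_def)
 have "\<phi> (ldiff N n) X m \<in> gr V i" by (rule \<phi>[OF dn X m]) simp
 moreover have "lbar_diff X m (\<phi> n) \<in> gr V i" by (rule lbar_diff_mem[OF V X m]) (rule \<phi>[OF n], auto)
 moreover have "(case X of [] => 0 | x # X' => sg (fst n + 1) (\<phi> (nact n x) X' m)) \<in> gr V i"
 proof (cases X)
  case (Cons x X')
  then have l: "x \<in> letters A" "X' \<in> L" using X by auto
  have "\<phi> (nact n x) X' m \<in> gr V i" by (rule \<phi>[OF nact_letters[OF n l(1)] l(2) m]) (simp add: Cons nact_def)
  then show ?thesis by (simp add: Cons graded_sg[OF V])
 qed (simp add: graded_zero[OF V])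
 ultimately show ?thesis unfolding bdiff_def using graded_add[OF V] graded_sg[OF V] by blast
qed

lemma BT_simps [simp]: "scal BT = fscal" "gr BT = gr BC" "diff BT = diff BC" "unt BT = be (0, unt N) [] (0, unt M)"
 "mul BT u v = the_inv_into (homog BC) split (mul TD (split u) (split v))"
 by (simp_all add: bar_tensor_def dgv.defs dga.defs bar_cplx_def be_def te_def bar_elem_def wd_def)

lemma homog_BT [simp]: "homog BT = homog BC"
 by (simp add: homog_def)

lemma gBT: "graded BT"
 by (rule graded_cong[OF graded_bar_cplx]) simp_all

lemma sp_Nil: "sp n [] m = qe n [] [] m"
 by (simp add: sp_def)

lemma units: "(0, unt N) \<in> letters N" "(0, unt M) \<in> letters M"
 using dga_unit(1)[OF B.T.dgaM] dga_unit(1)[OF T.dgaM] by simp_all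

text \<open>
 The product of two split elements is the splitting of \<open>bprod\<close> on generators, and hence split for
 all elements, since the image of a graded piece is a subspace.
\<close>

lemma split_structure:
 shows "dga BT" "dga_hom BT TD split" "inj_on split (homog BC)"
  "\<forall>i. bij_betw split (gr BT i) (cotensor A N M i)"
proof -
 obtain F where F: "flin F" "!!n X m. n \<in> letters N ==> X \<in> L ==> m \<in> letters M ==> F (be n X m) = sp n X m"
  "!!u. u \<in> homog BC ==> split u = F u" by (rule split_map) (rule that)
 obtain \<kappa> where k: "flin \<kappa>" "!!u. u \<in> homog BC ==> \<kappa> (split u) = u"
  "!!u. u \<in> homog BC ==> right_coact A N M (split u) = left_coact A N M (split u)"
  "!!u i. u \<in> gr RL i ==> right_coact A N M u = left_coact A N M u ==> \<kappa> u \<in> gr BC i \<and> split (\<kappa> u) = u"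
  by (rule split_cotensor) (rule that)
 obtain d where d: "flin d" "!!n X m. n \<in> letters N ==> X \<in> L ==> m \<in> letters M ==> d (be n X m) = bdiff n X m be"
  "!!u. u \<in> homog BC ==> diff BC u = d u" by (rule bar_diff_map) (rule that)
 have dgs: "dg_space RB" "dg_space LB" using dga_RB dga_LB unfolding dga_def by auto
 obtain e where e: "flin e"
  "!!v w. v \<in> letters RB ==> w \<in> letters LB ==>
   e (tns RB LB (snd v) (snd w)) = tns RB LB (diff RB (snd v)) (snd w) + sg (fst v) (tns RB LB (snd v) (diff LB (snd w)))"
  "!!u. u \<in> homog RL ==> diff RL u = e u" by (rule tensor_diff[OF dgs]) (rule that)
 obtain p where p: "!!v. flin (p v)" "!!w. flin (%v. p v w)"
  "!!a b a' b'. a \<in> letters RB ==> b \<in> letters LB ==> a' \<in> letters RB ==> b' \<in> letters LB ==>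
   p (tns RB LB (snd a) (snd b)) (tns RB LB (snd a') (snd b'))
   = sg (fst b * fst a') (tns RB LB (mul RB (snd a) (snd a')) (mul LB (snd b) (snd b')))"
  "!!u v. u \<in> homog RL ==> v \<in> homog RL ==> mul TD u v = p u v" by (rule tensor_mul[OF dga_RB dga_LB]) (rule that)
 have Fg: "F u \<in> gr RL i" if "u \<in> gr BC i" for u i using split_gr[OF that] F(3)[OF homogI[OF that]] by simp
 show inj: "inj_on split (homog BC)" by (rule inj_on_inverseI[where g = \<kappa>]) (rule k(2))
 show "\<forall>i. bij_betw split (gr BT i) (cotensor A N M i)"
 proof
  fix i
  have s: "gr BC i \<subseteq> homog BC" unfolding homog_def by blast
  have "split ` gr BC i = cotensor A N M i"
  proof (intro subset_antisym subsetI)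
   fix w assume "w \<in> split ` gr BC i"
   then obtain u where u: "w = split u" "u \<in> gr BC i" by blast
   then show "w \<in> cotensor A N M i" using split_gr[OF u(2)] k(3)[OF homogI[OF u(2)]] by (simp add: cotensor_def)
  next
   fix w assume "w \<in> cotensor A N M i"
   then have "w \<in> gr RL i" "right_coact A N M w = left_coact A N M w" by (simp_all add: cotensor_def)
   from k(4)[OF this] show "w \<in> split ` gr BC i" by (intro image_eqI[of _ _ "\<kappa> w"]) auto
  qed
  then show "bij_betw split (gr BT i) (cotensor A N M i)" using inj_on_subset[OF inj s] by (simp add: bij_betw_def)
 qed
 have dgr: "d u \<in> gr BC (i + 1)" if "u \<in> gr BC i" for u i
 proof (rule gens_maps[OF gens_bar _ graded_bar_cplx _ that])
  show "lin (scal BC) (scal BC) d" using d(1) by simp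
  fix g assume g: "g \<in> letters N \<times> L \<times> letters M" "(case g of (n, X, m) => fst n + (bd X + fst m)) = i"
  obtain n X m where nX: "g = (n, X, m)" by (cases g)
  have "bdiff n X m be \<in> gr BC (i + 1)"
  proof (rule bdiff_mem[OF graded_bar_cplx])
   show "be a W b \<in> gr BC (i + 1)" if "a \<in> letters N" "W \<in> L" "b \<in> letters M" "fst a + (bd W + fst b) = fst n + (bd X + fst m) + 1" for a W b
    using be_gr[OF that(1-3)] that(4) g nX by simp
  qed (use g nX in \<open>simp_all del: letters_iff\<close>)
  then show "d (case g of (n, X, m) => be n X m) \<in> gr BC (i + 1)" using d(2)[of n X m] g unfolding nX by (simp del: letters_iff)
 qed
 have chain: "F (d u) = e (F u)" if u: "u \<in> gr BC i" for u i
 proof (rule gens_agree[OF gens_bar, unfolded bar_cplx_simps, OF linear_compose[OF d(1) F(1)] linear_compose[OF F(1) e(1)] _ u])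
  fix g assume "g \<in> letters N \<times> L \<times> letters M"
  then obtain n X m where g: "g = (n, X, m)" "n \<in> letters N" "X \<in> L" "m \<in> letters M" by (elim SigmaE) simp
  have "F (d (be n X m)) = bdiff n X m (%n X m. F (be n X m))" unfolding d(2)[OF g(2-4)] by (rule bdiff_linear[OF F(1)])
  also have "... = bdiff n X m sp"
  proof -
   have dn: "ldiff N n \<in> letters N" using B.T.ldiffM_letters[of n] g(2) by (simp add: ldiff_def)
   have "lbar_diff X m (%X m. F (be n X m)) = lbar_diff X m (sp n)" by (rule lbar_diff_cong[OF g(3,4) F(2)[OF g(2)]])
   moreover have "F (be (ldiff N n) X m) = sp (ldiff N n) X m" by (rule F(2)[OF dn g(3,4)])
   moreover have "F (be (nact n x) X' m) = sp (nact n x) X' m" if "X = x # X'" for x X'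
    using that g F(2)[OF nact_letters] by simp
   ultimately show ?thesis unfolding bdiff_def by (cases X) simp_all
  qed
  also have "... = e (F (be n X m))" unfolding F(2)[OF g(2-4)] by (rule TD_diff_sp[OF e(1,2) g(2-4), symmetric])
  finally show "F (d (case g of (n, X, m) => be n X m)) = e (F (case g of (n, X, m) => be n X m))" unfolding g(1) by simp
 qed
 have closed: "\<exists>w\<in>gr BC (i + j). split w = mul TD (split u) (split v)" if u: "u \<in> gr BC i" and v: "v \<in> gr BC j" for u v i j
 proof -
  let ?S = "F ` gr BC (i + j)"
  interpret vp: vector_space_pair "fscal :: 'k => ('n, 'a, 'm, 'k) bar => _"
   "fscal :: 'k => (('n, ('a, 'k) words, 'k) tensor, (('a, 'k) words, 'm, 'k) tensor, 'k) tensor => _"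
   by (simp add: vector_space_pair_def)
  have sub: "module.subspace fscal ?S"
   using vp.linear_subspace_image[OF F(1)] graded_subspace[OF graded_bar_cplx] by simp
  have gg: "p (F (be n X m)) (F (be n' Y m')) \<in> F ` gr BC (fst n + (bd X + fst m) + (fst n' + (bd Y + fst m')))"
   if g: "n \<in> letters N" "X \<in> L" "m \<in> letters M" "n' \<in> letters N" "Y \<in> L" "m' \<in> letters M" for n X m n' Y m'
  proof -
   let ?w = "bprod n X m n' Y m' be"
   have "?w \<in> gr BC (fst n + (bd X + fst m) + (fst n' + (bd Y + fst m')))"
    by (rule bprod_mem[OF graded_bar_cplx g(1,4,2,5,3,6)]) (metis be_gr)
   moreover have "F ?w = p (F (be n X m)) (F (be n' Y m'))"
   proof -
    have "F ?w = bprod n X m n' Y m' (%a W b. F (be a W b))" by (rule bprod_linear[OF F(1)])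
    also have "... = bprod n X m n' Y m' sp" unfolding bprod_def
    proof (intro cut_sum_cong arg_cong[where f = "sg _"] ws_cong F(2))
     fix P R Y' Z assume Y: "Y = P @ R" "R = Y' @ Z"
     then have l: "P \<in> L" "Y' \<in> L" "Z \<in> L" using g(5) by auto
     show "lmul N' (lbr (mbr N) n (rev P)) n' \<in> letters N"
      using B.T.lmulM_letters[OF B.T.bm_letters, of n "rev P" n'] g rev_mem[OF l(1)] by simp
     show "lmul M (bM m Z) m' \<in> letters M" by (intro T.lmulM_letters T.bm_letters g l)
     show "X \<in> L" "Y' \<in> L" by (rule g l)+
    qed
    also have "... = p (F (be n X m)) (F (be n' Y m'))"
     unfolding F(2)[OF g(1-3)] F(2)[OF g(4-6)] by (rule TD_mul_sp[OF p(1-3) g(1,4,2,5,3,6), symmetric])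
    finally show ?thesis .
   qed
   ultimately show ?thesis by (metis image_eqI)
  qed
  note spn = gens_bar[unfolded gens_def, rule_format, unfolded bar_cplx_simps]
  have step: "p (F (be n X m)) (F v) \<in> ?S" if g: "n \<in> letters N" "X \<in> L" "m \<in> letters M" "fst n + (bd X + fst m) = i" for n X m
  proof (rule linear_maps_span[OF linear_compose[OF F(1) p(1)] sub _ v[unfolded spn]])
   fix x assume "x \<in> {(%(n, X, m). be n X m) h | h. h \<in> letters N \<times> L \<times> letters M \<and> (%(n, X, m). fst n + (bd X + fst m)) h = j}"
   then obtain h where h: "x = (%(n, X, m). be n X m) h" "h \<in> letters N \<times> L \<times> letters M" "(%(n, X, m). fst n + (bd X + fst m)) h = j" by blast
   obtain n' Y m' where h': "h = (n', Y, m')" by (cases h)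
   show "p (F (be n X m)) (F x) \<in> ?S" using gg[OF g(1-3), of n' Y m'] h g(4) unfolding h' by (simp del: letters_iff)
  qed
  have "p (F u) (F v) \<in> ?S"
  proof (rule linear_maps_span[OF linear_compose[OF F(1) p(2)] sub _ u[unfolded spn]])
   fix x assume "x \<in> {(%(n, X, m). be n X m) h | h. h \<in> letters N \<times> L \<times> letters M \<and> (%(n, X, m). fst n + (bd X + fst m)) h = i}"
   then obtain h where h: "x = (%(n, X, m). be n X m) h" "h \<in> letters N \<times> L \<times> letters M" "(%(n, X, m). fst n + (bd X + fst m)) h = i" by blast
   obtain n' Y m' where h': "h = (n', Y, m')" by (cases h)
   show "p (F x) (F v) \<in> ?S" using step[of n' Y m'] h unfolding h' by (simp del: letters_iff)
  qed
  then obtain w where w: "w \<in> gr BC (i + j)" "p (F u) (F v) = F w" by blast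
  have "mul TD (split u) (split v) = p (F u) (F v)"
   using p(4)[OF homogI[OF Fg[OF u]] homogI[OF Fg[OF v]]] F(3)[OF homogI[OF u]] F(3)[OF homogI[OF v]] by simp
  then show ?thesis using w F(3)[OF homogI[OF w(1)]] by metis
 qed
 have mulBT: "mul BT u v \<in> gr BC (i + j) \<and> split (mul BT u v) = mul TD (split u) (split v)"
  if u: "u \<in> gr BC i" and v: "v \<in> gr BC j" for u v i j
 proof -
  obtain w where w: "w \<in> gr BC (i + j)" "split w = mul TD (split u) (split v)" using closed[OF u v] by blast
  have "mul BT u v = w" unfolding BT_simps(5) w(2)[symmetric] by (rule the_inv_into_f_f[OF inj homogI[OF w(1)]])
  then show ?thesis using w by simp
 qed
 have gm: "graded_map BT TD 0 split"
  by (rule graded_map_linear[of _ _ F]) (use F(1,3) Fg gBT in simp_all)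
 note refl = dga_reflect[OF dga_TD gBT gm]
 have r: "x = 0" if "x \<in> gr BT i" "split x = 0" for x i
  using k(2)[OF homogI, of x i] that linear_0[OF k(1)] by simp
 have rd: "diff BT x \<in> gr BT (i + 1)" if "x \<in> gr BT i" for x i
  using dgr[of x i] d(3)[OF homogI, of x i] that by simp
 have rf: "split (diff BT x) = diff TD (split x)" if "x \<in> gr BT i" for x i
 proof -
  have x: "x \<in> gr BC i" using that by simp
  have "split (diff BT x) = F (d x)" using d(3)[OF homogI[OF x]] F(3)[OF homogI[OF dgr[OF x]]] by simp
  also have "... = diff TD (split x)" using chain[OF x] e(3)[OF homogI[OF Fg[OF x]]] F(3)[OF homogI[OF x]] by simp
  finally show ?thesis .
 qed
 have rm: "mul BT x y \<in> gr BT (i + j)" "split (mul BT x y) = mul TD (split x) (split y)" if "x \<in> gr BT i" "y \<in> gr BT j" for x y i j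
  using mulBT[of x i y j] that unfolding BT_simps(2) by blast+
 have ru: "unt BT \<in> gr BT 0" "split (unt BT) = unt TD"
 proof -
  have b: "be (0, unt N) [] (0, unt M) \<in> gr BC 0" using be_gr[OF units(1) _ units(2), of "[]"] by simp
  then show "unt BT \<in> gr BT 0" by simp
  show "split (unt BT) = unt TD"
   using F(3)[OF homogI[OF b]] F(2)[OF units(1) _ units(2), of "[]"] by (simp add: sp_Nil qe_def unt_RB)
 qed
 show "dga BT" by (rule refl(1)[OF r rd rf rm ru])
 show "dga_hom BT TD split" by (rule refl(2)[OF r rd rf rm ru])
qed

text \<open>Multiplicativity is checked after the injective map \<open>bar_split\<close>.\<close>

lemma bar_proj_hom: "dga_hom (tensor_dga N' M) BT (bar_proj A N M)"
proof -
 obtain q where q: "flin q" "!!n m. n \<in> letters N ==> m \<in> letters M ==> q (tns N M (snd n) (snd m)) = be n [] m"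
  "!!u. u \<in> homog (tensor_cplx N M) ==> bar_proj A N M u = q u" by (rule bar_proj_map) (rule that)
 obtain F where F: "flin F" "!!n X m. n \<in> letters N ==> X \<in> L ==> m \<in> letters M ==> F (be n X m) = sp n X m"
  "!!u. u \<in> homog BC ==> split u = F u" by (rule split_map) (rule that)
 obtain d where d: "flin d" "!!n X m. n \<in> letters N ==> X \<in> L ==> m \<in> letters M ==> d (be n X m) = bdiff n X m be"
  "!!u. u \<in> homog BC ==> diff BC u = d u" by (rule bar_diff_map) (rule that)
 obtain p where p: "!!v. flin (p v)" "!!w. flin (%v. p v w)"
  "!!a b a' b'. a \<in> letters RB ==> b \<in> letters LB ==> a' \<in> letters RB ==> b' \<in> letters LB ==>
   p (tns RB LB (snd a) (snd b)) (tns RB LB (snd a') (snd b'))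
   = sg (fst b * fst a') (tns RB LB (mul RB (snd a) (snd a')) (mul LB (snd b) (snd b')))"
  "!!u v. u \<in> homog RL ==> v \<in> homog RL ==> mul TD u v = p u v" by (rule tensor_mul[OF dga_RB dga_LB]) (rule that)
 note N'd = B.T.dgaM and Md = T.dgaM
 have dgs: "dg_space N'" "dg_space M" using N'd Md unfolding dga_def by auto
 have tn: "tns N' M = tns N M" by (rule tns_cong) simp_all
 let ?E = "tensor_cplx N' M" and ?G = "letters N \<times> letters M"
 obtain e where e: "flin e"
  "!!v w. v \<in> letters N' ==> w \<in> letters M ==>
   e (tns N' M (snd v) (snd w)) = tns N' M (diff N' (snd v)) (snd w) + sg (fst v) (tns N' M (snd v) (diff M (snd w)))"
  "!!u. u \<in> homog ?E ==> diff ?E u = e u" by (rule tensor_diff[OF dgs]) (rule that)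
 obtain m0 where m0: "!!v. flin (m0 v)" "!!w. flin (%v. m0 v w)"
  "!!a b a' b'. a \<in> letters N' ==> b \<in> letters M ==> a' \<in> letters N' ==> b' \<in> letters M ==>
   m0 (tns N' M (snd a) (snd b)) (tns N' M (snd a') (snd b'))
   = sg (fst b * fst a') (tns N' M (mul N' (snd a) (snd a')) (mul M (snd b) (snd b')))"
  "!!u v. u \<in> homog ?E ==> v \<in> homog ?E ==> mul (tensor_dga N' M) u v = m0 u v" by (rule tensor_mul[OF N'd Md]) (rule that)
 have gE: "gens ?E ?G (%(n, m). tns N M (snd n) (snd m)) (%(n, m). fst n + fst m)"
  using gens_tensor[of N' M, OF _ _ gens_letters gens_letters] gN gM vN vM by (simp add: tn dga_graded[OF N'd])
 have grE: "gr ?E = gr (tensor_cplx N M)" by (simp add: tensor_cplx_def tn)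
 have hE: "homog ?E = homog (tensor_cplx N M)" by (simp add: homog_def grE)
 note qq = q(3)[folded hE]
 have qg: "q u \<in> gr BC i" if "u \<in> gr ?E i" for u i
 proof (rule gens_maps[OF gE _ graded_bar_cplx _ that])
  show "lin (scal ?E) (scal BC) q" using q(1) by simp
  fix g assume g: "g \<in> ?G" "(case g of (n, m) => fst n + fst m) = i"
  obtain n m where nm: "g = (n, m)" by (cases g)
  show "q (case g of (n, m) => tns N M (snd n) (snd m)) \<in> gr BC i"
   using g q(2)[of n m] be_gr[of n "[]" m] unfolding nm by (simp del: letters_iff)
 qed
 note agree = gens_agree[OF gE, unfolded scal_tensor_cplx]
 have chain: "q (e u) = d (q u)" if u: "u \<in> gr ?E i" for u i
 proof (rule agree[OF linear_compose[OF e(1) q(1)] linear_compose[OF q(1) d(1)] _ u])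
  fix g assume "g \<in> ?G"
  then obtain n m where g: "g = (n, m)" "n \<in> letters N" "m \<in> letters M" by blast
  have dn: "ldiff N n \<in> letters N" using B.T.ldiffM_letters[of n] g(2) by (simp add: ldiff_def)
  have "e (tns N M (snd n) (snd m)) = tns N M (snd (ldiff N n)) (snd m) + sg (fst n) (tns N M (snd n) (snd (ldiff M m)))"
   using e(2)[of n m] g by (simp add: tn ldiff_def)
  then have "q (e (tns N M (snd n) (snd m))) = be (ldiff N n) [] m + sg (fst n) (be n [] (ldiff M m))"
   using q(2)[OF dn g(3)] q(2)[OF g(2) T.ldiffM_letters[OF g(3)]] by (simp add: linear_plus[OF q(1)] linear_sg[OF q(1)])
  also have "... = d (q (tns N M (snd n) (snd m)))" using q(2)[OF g(2,3)] d(2)[OF g(2) _ g(3), of "[]"] by (simp add: bdiff_def lbar_diff_simps)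
  finally show "q (e (case g of (n, m) => tns N M (snd n) (snd m))) = d (q (case g of (n, m) => tns N M (snd n) (snd m)))" unfolding g(1) by simp
 qed
 have gg: "F (q (m0 (tns N M (snd n) (snd m)) (tns N M (snd n') (snd m')))) = p (F (q (tns N M (snd n) (snd m)))) (F (q (tns N M (snd n') (snd m'))))"
  if g: "n \<in> letters N" "m \<in> letters M" "n' \<in> letters N" "m' \<in> letters M" for n m n' m'
 proof -
  have a: "lmul N' n n' \<in> letters N" "lmul M m m' \<in> letters M"
   using B.T.lmulM_letters[of n n'] T.lmulM_letters g by simp_all
  have "m0 (tns N M (snd n) (snd m)) (tns N M (snd n') (snd m')) = sg (fst m * fst n') (tns N M (snd (lmul N' n n')) (snd (lmul M m m')))"
   using m0(3)[of n m n' m'] g by (simp add: tn lmul_def)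
  then have "F (q (m0 (tns N M (snd n) (snd m)) (tns N M (snd n') (snd m')))) = sg (fst m * fst n') (sp (lmul N' n n') [] (lmul M m m'))"
   using q(2)[OF a] F(2)[OF a(1) _ a(2), of "[]"] by (simp add: linear_sg[OF q(1)] linear_sg[OF F(1)])
  moreover have "bprod n [] m n' [] m' sp = sg (fst m * fst n') (sp (lmul N' n n') [] (lmul M m m'))"
   using B.T.bm_Nil[of n] T.bm_Nil[OF g(2)] g(1) by (simp add: bprod_def)
  ultimately show ?thesis
   using TD_mul_sp[OF p(1-3) g(1,3) _ _ g(2,4), of "[]" "[]"] q(2)[OF g(1,2)] q(2)[OF g(3,4)] F(2)[OF g(1) _ g(2), of "[]"] F(2)[OF g(3) _ g(4), of "[]"] by simp
 qed
 have mult: "F (q (m0 u v)) = p (F (q u)) (F (q v))" if u: "u \<in> gr ?E i" and v: "v \<in> gr ?E j" for u v i j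
 proof -
  have 1: "F (q (m0 (tns N M (snd n) (snd m)) v)) = p (F (q (tns N M (snd n) (snd m)))) (F (q v))" if "n \<in> letters N" "m \<in> letters M" for n m
   by (rule agree[OF linear_compose[OF linear_compose[OF m0(1) q(1)] F(1)] linear_compose[OF linear_compose[OF q(1) F(1)] p(1)] _ v])
    (elim SigmaE, simp add: gg[OF that] del: letters_iff)
  show ?thesis
   by (rule agree[OF linear_compose[OF linear_compose[OF m0(2) q(1)] F(1)] linear_compose[OF linear_compose[OF q(1) F(1)] p(2)] _ u])
    (elim SigmaE, simp add: 1 del: letters_iff)
 qed
 have Fg: "F u \<in> gr RL i" if "u \<in> gr BC i" for u i using split_gr[OF that] F(3)[OF homogI[OF that]] by simp
 note hom = split_structure(2)[unfolded dga_hom_def]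
 show ?thesis unfolding dga_hom_def tensor_dga_simps homog_tensor_dga
 proof (intro conjI ballI)
  show "dga (tensor_dga N' M)" by (rule dga_tensor[OF N'd Md])
  show "dga BT" by (rule split_structure(1))
  show "graded_map (tensor_dga N' M) BT 0 (bar_proj A N M)"
   by (rule graded_map_linear[of _ _ q]) (use q(1) qq qg graded_tensor_dga[OF dga_graded[OF N'd] gM] in simp_all)
  have u: "tns N M (unt N) (unt M) \<in> homog ?E"
   using tns_gr[OF gN gM snd_letters[OF units(1)] snd_letters[OF units(2)]] unfolding hE by (intro homogI) simp
  show "bar_proj A N M (tns N' M (unt N') (unt M)) = unt BT"
   using qq[OF u] q(2)[OF units] by (simp add: tn)
 next
  fix x assume x: "x \<in> homog ?E"
  then obtain i where i: "x \<in> gr ?E i" unfolding homog_def by blast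
  have dx: "diff ?E x \<in> homog ?E" using dga_diff_gr[OF dga_tensor[OF N'd Md], of x i] i by (intro homogI) simp
  show "bar_proj A N M (diff ?E x) = diff BT (bar_proj A N M x)"
   using qq[OF dx] qq[OF x] e(3)[OF x] chain[OF i] d(3)[OF homogI[OF qg[OF i]]] by simp
  fix y assume y: "y \<in> homog ?E"
  then obtain j where j: "y \<in> gr ?E j" unfolding homog_def by blast
  have xy: "mul (tensor_dga N' M) x y \<in> gr ?E (i + j)" using dga_mul_gr[OF dga_tensor[OF N'd Md], of x i y j] i j by simp
  have qx: "q x \<in> gr BC i" "q y \<in> gr BC j" by (rule qg[OF i], rule qg[OF j])
  have mBT: "mul BT (q x) (q y) \<in> homog BC" using dga_mul_gr[OF split_structure(1), of "q x" i "q y" j] qx by (intro homogI) simp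
  have "split (mul BT (q x) (q y)) = mul TD (split (q x)) (split (q y))"
   using hom homogI[OF qx(1)] homogI[OF qx(2)] unfolding homog_BT by blast
  also have "... = p (F (q x)) (F (q y))"
   using p(4)[OF homogI[OF Fg[OF qx(1)]] homogI[OF Fg[OF qx(2)]]] F(3)[OF homogI[OF qx(1)]] F(3)[OF homogI[OF qx(2)]] by simp
  also have "... = split (q (mul (tensor_dga N' M) x y))"
   using mult[OF i j] F(3)[OF homogI[OF qg[OF xy]]] m0(4)[OF x y] by simp
  finally have "q (mul (tensor_dga N' M) x y) = mul BT (q x) (q y)"
   using inj_onD[OF split_structure(3)] homogI[OF qg[OF xy]] mBT by metis
  then show "bar_proj A N M (mul (tensor_dga N' M) x y) = mul BT (bar_proj A N M x) (bar_proj A N M y)"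
   using qq[OF x] qq[OF y] qq[OF homogI[OF xy]] by simp
 qed
qed

end

theorem theorem3p10:
  fixes A :: "('k::field_char_0, 'a::ab_group_add) brace_alg"
    and M :: "('k, 'a, 'm::ab_group_add) brace_mod"
    and N :: "('k, 'a, 'n::ab_group_add) brace_mod"
  assumes "brace_algebra A"
    and "left_brace_module A M"
    and "right_brace_module A N"
  shows "dga (bar_tensor A N M) \<and>
         dga_hom (bar_tensor A N M) (tensor_dga (right_bar_dga A N) (left_bar_dga A M)) (bar_split A N M) \<and>
         (\<forall>i. bij_betw (bar_split A N M) (gr (bar_tensor A N M) i) (cotensor A N M i)) \<and>
         dga_hom (tensor_dga (dga_op N) M) (bar_tensor A N M) (bar_proj A N M)"
proof -
  interpret brace_alg A by (rule brace_algebra_letters[OF assms(1)])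
  have N: "left_brace_module (brace_op A) (dga_op N)" using assms(3) unfolding right_brace_module_def .
  have O: "dga (brace_op A)" using N unfolding left_brace_module_def dga_hom_def by blast
  interpret brace_alg_op A by (unfold_locales) (rule O)
  have 1: "left_module A M"
    unfolding left_module_def by (rule brace_module_letters[OF brace_alg_axioms assms(2)])
  have 2: "left_module (brace_op A) (dga_op N)"
    unfolding left_module_def by (rule brace_module_letters[OF brace_alg_op N])
  have "two_sided A M N" unfolding two_sided_def right_module_def
    by (intro conjI 1 2 brace_alg_op_axioms)
  then interpret two_sided A M N .
  show ?thesis using split_structure bar_proj_hom by blast
qed

end
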